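(* Let $\mathfrak g$ be a simple Lie algebra, $\mathfrak h\subset\mathfrak g$ a reductive algebraic subalgebra, $\mathfrak m=\mathfrak h^\perp$ its orthogonal complement with respect to the Killing form (so $\mathfrak g=\mathfrak h\oplus\mathfrak m$), and $\mathcal C_{\mathfrak h}\in\mathcal U(\mathfrak h)$ the associated Casimir element. Let $\mathfrak m_{1/2}$ be the $\mathcal C_{\mathfrak h}$-eigenspace in $\mathfrak m$ with eigenvalue $1/2$, and suppose that $\mathfrak m_{1/2}\ne0$. Then $\mathfrak m_{1/2}=\mathfrak m$, and thereby the decomposition $\mathfrak g=\mathfrak h\oplus\mathfrak m$ is a $\mathbb Z_2$-grading, i.e. $[\mathfrak m,\mathfrak m]\subset\mathfrak h$.
   Context: The ground field is algebraically closed of characteristic $0$. $\mathfrak g$ is the Lie algebra of a simple algebraic group $G$; a reductive algebraic subalgebra is the Lie algebra of a reductive algebraic subgroup of $G$. For such $\mathfrak h$ the restriction $\Phi|_{\mathfrak h}$ of the Killing form $\Phi$ of $\mathfrak g$ is non-degenerate, and $\mathfrak m=\mathfrak h^\perp$ is an $\mathfrak h$-module complementary to $\mathfrak h$. The Casimir element is $\mathcal C_{\mathfrak h}=\sum_i e'_ie_i\in\mathcal U(\mathfrak h)$, where $\{e_i\},\{e'_i\}$ are bases of $\mathfrak h$ dual with respect to $\Phi|_{\mathfrak h}$; it acts on $\mathfrak m$ via the adjoint action. *)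

theory Defs
  imports
    "HOL-Analysis.Analysis"
    "HOL-Library.Poly_Mapping"
    "HOL-Algebra.QuotRing"
begin

section \<open>Linear algebraic groups\<close>

text \<open>
  Affine algebraic groups over \<open>'k\<close> are taken as Zariski closed subgroups of
  \<open>GL\<^sub>n('k)\<close>, \<open>n = CARD('n)\<close>.  The variables of a polynomial function on matrices are
  the pairs \<open>(i, j)\<close> of indices.
\<close>

definition mpoly_eval ::
  "('k::zero \<Rightarrow> 'r::comm_ring_1) \<Rightarrow> ('v \<Rightarrow> 'r) \<Rightarrow> (('v \<Rightarrow>\<^sub>0 nat) \<Rightarrow>\<^sub>0 'k) \<Rightarrow> 'r" where
  "mpoly_eval c x p =
     (\<Sum>m\<in>Poly_Mapping.keys p. c (Poly_Mapping.lookup p m) *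
        (\<Prod>v\<in>Poly_Mapping.keys m. x v ^ Poly_Mapping.lookup m v))"

definition mat_eval ::
  "((('n \<times> 'n) \<Rightarrow>\<^sub>0 nat) \<Rightarrow>\<^sub>0 'k::field) \<Rightarrow> 'k^'n^'n \<Rightarrow> 'k" where
  "mat_eval p A = mpoly_eval (\<lambda>c. c) (\<lambda>(i, j). A $ i $ j) p"

text \<open>The principal open sets are a basis of the Zariski topology.\<close>

definition zariski :: "('k::field^'n^'n) topology" where
  "zariski = topology_generated_by {{A. mat_eval p A \<noteq> 0} | p. True}"

definition GL_mat :: "('k::field^'n^'n) monoid" where
  "GL_mat = \<lparr>carrier = {A. invertible A}, mult = (**), one = mat 1\<rparr>"

definition algebraic_group :: "('k::field^'n^'n) set \<Rightarrow> bool" where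
  "algebraic_group G \<longleftrightarrow>
     subgroup G GL_mat \<and> closedin (subtopology zariski (carrier GL_mat)) G"

text \<open>
  \<open>X\<close> is tangent to \<open>G\<close> at \<open>1\<close> iff every polynomial \<open>p\<close> vanishing on \<open>G\<close> satisfies
  \<open>p (1 + t X) \<equiv> 0\<close> modulo \<open>t\<^sup>2\<close>; below, \<open>t\<close> is the variable of \<open>'k poly\<close>.
\<close>

definition Lie_of :: "('k::field^'n^'n) set \<Rightarrow> ('k^'n^'n) set" where
  "Lie_of G = {X. \<forall>p. (\<forall>A\<in>G. mat_eval p A = 0) \<longrightarrow>
     coeff (mpoly_eval (\<lambda>c. [:c:]) (\<lambda>(i, j). [:mat 1 $ i $ j, X $ i $ j:]) p) 1 = 0}"

definition simple_algebraic_group :: "('k::field^'n^'n) set \<Rightarrow> bool" where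
  "simple_algebraic_group G \<longleftrightarrow>
     algebraic_group G \<and> connectedin zariski G \<and>
     (\<exists>A\<in>G. \<exists>B\<in>G. A ** B \<noteq> B ** A) \<and>
     (\<forall>N. algebraic_group N \<and> connectedin zariski N \<and> N \<lhd> (GL_mat\<lparr>carrier := G\<rparr>)
        \<longrightarrow> N = {mat 1} \<or> N = G)"

text \<open>The power \<open>^\<close> on \<open>'k^'n^'n\<close> is taken entrywise, hence the iterated product.\<close>

definition unipotent_matrix :: "'k::field^'n^'n \<Rightarrow> bool" where
  "unipotent_matrix A \<longleftrightarrow> (\<exists>r. (((**) (A - mat 1)) ^^ r) (mat 1) = 0)"

text \<open>
  The unipotent radical is the largest closed connected normal unipotent subgroup, so a
  group is reductive iff all such subgroups are trivial.  A reductive group need not be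
  connected.
\<close>

definition reductive_group :: "('k::field^'n^'n) set \<Rightarrow> bool" where
  "reductive_group H \<longleftrightarrow>
     algebraic_group H \<and>
     (\<forall>N. algebraic_group N \<and> connectedin zariski N \<and> N \<lhd> (GL_mat\<lparr>carrier := H\<rparr>) \<and>
        (\<forall>A\<in>N. unipotent_matrix A) \<longrightarrow> N = {mat 1})"


section \<open>Matrix Lie algebras\<close>

definition mscale :: "'k::field \<Rightarrow> 'k^'n^'n \<Rightarrow> 'k^'n^'n" (infixr \<open>*\<^sub>M\<close> 75) where
  "c *\<^sub>M A = (\<chi> i j. c * A $ i $ j)"

global_interpretation mat_vs: vector_space "mscale :: 'k::field \<Rightarrow> 'k^'n^'n \<Rightarrow> 'k^'n^'n"
  by unfold_locales (auto simp: mscale_def vec_eq_iff algebra_simps)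

definition lie :: "'k::field^'n^'n \<Rightarrow> 'k^'n^'n \<Rightarrow> 'k^'n^'n" where
  "lie A B = A ** B - B ** A"

definition lie_subalgebra :: "('k::field^'n^'n) set \<Rightarrow> bool" where
  "lie_subalgebra L \<longleftrightarrow> mat_vs.subspace L \<and> (\<forall>x\<in>L. \<forall>y\<in>L. lie x y \<in> L)"

definition lie_ideal :: "('k::field^'n^'n) set \<Rightarrow> ('k^'n^'n) set \<Rightarrow> bool" where
  "lie_ideal I L \<longleftrightarrow> mat_vs.subspace I \<and> I \<subseteq> L \<and> (\<forall>x\<in>L. \<forall>y\<in>I. lie x y \<in> I)"

definition simple_lie_algebra :: "('k::field^'n^'n) set \<Rightarrow> bool" where
  "simple_lie_algebra L \<longleftrightarrow>
     lie_subalgebra L \<and> (\<exists>x\<in>L. \<exists>y\<in>L. lie x y \<noteq> 0) \<and>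
     (\<forall>I. lie_ideal I L \<longrightarrow> I = {0} \<or> I = L)"

definition reductive_algebraic_subalgebra ::
  "('k::field^'n^'n) set \<Rightarrow> ('k^'n^'n) set \<Rightarrow> bool" where
  "reductive_algebraic_subalgebra G \<hh> \<longleftrightarrow>
     lie_subalgebra \<hh> \<and> \<hh> \<subseteq> Lie_of G \<and>
     (\<exists>H. reductive_group H \<and> H \<subseteq> G \<and> \<hh> = Lie_of H)"

text \<open>
  Trace of a linear endomorphism of a subspace \<open>V\<close> (only its values on \<open>V\<close> matter);
  it does not depend on the basis.
\<close>

definition trace_on :: "('k::field^'n^'n) set \<Rightarrow> ('k^'n^'n \<Rightarrow> 'k^'n^'n) \<Rightarrow> 'k" where
  "trace_on V f =
     (let B = (SOME B. mat_vs.independent B \<and> mat_vs.span B = V)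
      in \<Sum>b\<in>B. mat_vs.representation B (f b) b)"

definition killing :: "('k::field^'n^'n) set \<Rightarrow> 'k^'n^'n \<Rightarrow> 'k^'n^'n \<Rightarrow> 'k" where
  "killing L x y = trace_on L (\<lambda>z. lie x (lie y z))"

definition killing_complement ::
  "('k::field^'n^'n) set \<Rightarrow> ('k^'n^'n) set \<Rightarrow> ('k^'n^'n) set" where
  "killing_complement L \<hh> = {x\<in>L. \<forall>y\<in>\<hh>. killing L x y = 0}"

definition basis_of :: "('k::field^'n^'n) set \<Rightarrow> nat \<Rightarrow> (nat \<Rightarrow> 'k^'n^'n) \<Rightarrow> bool" where
  "basis_of V d e \<longleftrightarrow>
     inj_on e {..<d} \<and> mat_vs.independent (e ` {..<d}) \<and> mat_vs.span (e ` {..<d}) = V"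

definition dual_bases ::
  "('k::field^'n^'n \<Rightarrow> 'k^'n^'n \<Rightarrow> 'k) \<Rightarrow> ('k^'n^'n) set \<Rightarrow> nat \<Rightarrow>
     (nat \<Rightarrow> 'k^'n^'n) \<Rightarrow> (nat \<Rightarrow> 'k^'n^'n) \<Rightarrow> bool" where
  "dual_bases \<Phi> V d e e' \<longleftrightarrow>
     basis_of V d e \<and> basis_of V d e' \<and>
     (\<forall>i<d. \<forall>j<d. \<Phi> (e i) (e' j) = (if i = j then 1 else 0))"

definition eigenspace_on ::
  "('k::field^'n^'n) set \<Rightarrow> ('k^'n^'n \<Rightarrow> 'k^'n^'n) \<Rightarrow> 'k \<Rightarrow> ('k^'n^'n) set" where
  "eigenspace_on V f c = {x\<in>V. f x = c *\<^sub>M x}"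

definition Z2_grading ::
  "('k::field^'n^'n) set \<Rightarrow> ('k^'n^'n) set \<Rightarrow> ('k^'n^'n) set \<Rightarrow> bool" where
  "Z2_grading L L0 L1 \<longleftrightarrow>
     mat_vs.subspace L0 \<and> mat_vs.subspace L1 \<and>
     L = {x + y | x y. x \<in> L0 \<and> y \<in> L1} \<and> L0 \<inter> L1 = {0} \<and>
     (\<forall>x\<in>L0. \<forall>y\<in>L0. lie x y \<in> L0) \<and>
     (\<forall>x\<in>L0. \<forall>y\<in>L1. lie x y \<in> L1) \<and>
     (\<forall>x\<in>L1. \<forall>y\<in>L1. lie x y \<in> L0)"


section \<open>The universal enveloping algebra\<close>

text \<open>
  With concatenation of words as addition of exponents, \<open>'a list \<Rightarrow>\<^sub>0 'k\<close> is the free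
  associative \<open>'k\<close>-algebra on the set of letters \<open>'a\<close>.
\<close>

instantiation list :: (type) monoid_add
begin
definition zero_list_def: "0 = []"
definition plus_list_def: "xs + ys = xs @ ys"
instance by standard (auto simp: zero_list_def plus_list_def)
end

definition letter :: "'a \<Rightarrow> ('a list \<Rightarrow>\<^sub>0 'k::field)" where
  "letter x = Poly_Mapping.single [x] 1"

definition free_algebra :: "'a set \<Rightarrow> ('a list \<Rightarrow>\<^sub>0 'k::field) ring" where
  "free_algebra S = \<lparr>carrier = {p. Poly_Mapping.keys p \<subseteq> lists S},
     mult = (*), one = 1, zero = 0, add = (+)\<rparr>"

text \<open>
  The first two families of relations turn the free algebra on the set \<open>\<hh>\<close> into the tensor
  algebra of the vector space \<open>\<hh>\<close>.
\<close>

definition env_relations :: "('k::field^'n^'n) set \<Rightarrow> ((('k^'n^'n) list) \<Rightarrow>\<^sub>0 'k) set" where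
  "env_relations \<hh> =
     {letter (x + y) - letter x - letter y | x y. x \<in> \<hh> \<and> y \<in> \<hh>} \<union>
     {letter (c *\<^sub>M x) - Poly_Mapping.single [] c * letter x | c x. x \<in> \<hh>} \<union>
     {letter x * letter y - letter y * letter x - letter (lie x y) | x y. x \<in> \<hh> \<and> y \<in> \<hh>}"

definition env_ideal :: "('k::field^'n^'n) set \<Rightarrow> ((('k^'n^'n) list) \<Rightarrow>\<^sub>0 'k) set" where
  "env_ideal \<hh> = genideal (free_algebra \<hh>) (env_relations \<hh>)"

definition env_algebra ::
  "('k::field^'n^'n) set \<Rightarrow> ((('k^'n^'n) list) \<Rightarrow>\<^sub>0 'k) set ring" where
  "env_algebra \<hh> = free_algebra \<hh> Quot env_ideal \<hh>"

definition env_inj ::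
  "('k::field^'n^'n) set \<Rightarrow> 'k^'n^'n \<Rightarrow> ((('k^'n^'n) list) \<Rightarrow>\<^sub>0 'k) set" where
  "env_inj \<hh> x = a_r_coset (free_algebra \<hh>) (env_ideal \<hh>) (letter x)"

definition casimir ::
  "('k::field^'n^'n) set \<Rightarrow> nat \<Rightarrow> (nat \<Rightarrow> 'k^'n^'n) \<Rightarrow> (nat \<Rightarrow> 'k^'n^'n) \<Rightarrow>
     ((('k^'n^'n) list) \<Rightarrow>\<^sub>0 'k) set" where
  "casimir \<hh> d e e' =
     finsum (env_algebra \<hh>)
       (\<lambda>i. env_inj \<hh> (e' i) \<otimes>\<^bsub>env_algebra \<hh>\<^esub> env_inj \<hh> (e i)) {..<d}"

text \<open>
  Adjoint action: a word \<open>[x\<^sub>1, \<dots>, x\<^sub>r]\<close> sends \<open>z\<close> to \<open>[x\<^sub>1, [\<dots>, [x\<^sub>r, z] \<dots>]]\<close>, and an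
  element of the enveloping algebra acts through any of its representatives in the free
  algebra (well-defined by \<open>env_act_class\<close> below).
\<close>

definition free_act ::
  "((('k::field^'n^'n) list) \<Rightarrow>\<^sub>0 'k) \<Rightarrow> 'k^'n^'n \<Rightarrow> 'k^'n^'n" where
  "free_act p z =
     (\<Sum>w\<in>Poly_Mapping.keys p. Poly_Mapping.lookup p w *\<^sub>M foldr lie w z)"

definition env_act ::
  "((('k::field^'n^'n) list) \<Rightarrow>\<^sub>0 'k) set \<Rightarrow> 'k^'n^'n \<Rightarrow> 'k^'n^'n" where
  "env_act u z = free_act (SOME p. p \<in> u) z"


text \<open>The enveloping algebra is a ring, it acts, and the Casimir element acts as expected.\<close>

lemma ring_free_algebra: "ring (free_algebra S :: ('a list \<Rightarrow>\<^sub>0 'k::field) ring)"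
proof (rule ringI)
  let ?R = "free_algebra S :: ('a list \<Rightarrow>\<^sub>0 'k::field) ring"
  have add: "p + q \<in> carrier ?R" if "p \<in> carrier ?R" "q \<in> carrier ?R" for p q
    using that Poly_Mapping.keys_add[of p q] by (auto simp: free_algebra_def)
  have mult: "p * q \<in> carrier ?R" if "p \<in> carrier ?R" "q \<in> carrier ?R" for p q
    using that Poly_Mapping.keys_mult[of p q]
    by (fastforce simp: free_algebra_def plus_list_def)
  show "abelian_group ?R"
  proof (rule abelian_groupI)
    fix p assume "p \<in> carrier ?R"
    then have "- p \<in> carrier ?R" by (simp add: free_algebra_def)
    then show "\<exists>y\<in>carrier ?R. y \<oplus>\<^bsub>?R\<^esub> p = \<zero>\<^bsub>?R\<^esub>"
      by (intro bexI[of _ "- p"]) (simp_all add: free_algebra_def)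
  qed (use add in \<open>auto simp: free_algebra_def algebra_simps\<close>)
  show "Group.monoid ?R"
    by (rule Group.monoidI) (use mult in \<open>auto simp: free_algebra_def algebra_simps zero_list_def\<close>)
qed (auto simp: free_algebra_def algebra_simps)

lemma free_act_sum_superset:
  assumes "finite A" "Poly_Mapping.keys p \<subseteq> A"
  shows "free_act p z = (\<Sum>w\<in>A. Poly_Mapping.lookup p w *\<^sub>M foldr lie w z)"
  unfolding free_act_def
  by (rule sum.mono_neutral_left) (use assms in \<open>auto simp: in_keys_iff\<close>)

lemma free_act_add: "free_act (p + q) z = free_act p z + free_act q z"
proof -
  let ?A = "Poly_Mapping.keys p \<union> Poly_Mapping.keys q"
  have "Poly_Mapping.keys (p + q) \<subseteq> ?A" by (rule Poly_Mapping.keys_add)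
  then show ?thesis
    by (simp add: free_act_sum_superset[of ?A] lookup_add mat_vs.scale_left_distrib sum.distrib)
qed

lemma free_act_0 [simp]: "free_act 0 z = 0"
  by (simp add: free_act_def)

lemma free_act_minus: "free_act (p - q) z = free_act p z - free_act q z"
  using free_act_add[of "p - q" q z] by simp

lemma free_act_sum: "free_act (sum f A) z = (\<Sum>i\<in>A. free_act (f i) z)"
  by (induction A rule: infinite_finite_induct) (auto simp: free_act_add)

lemma free_act_single: "free_act (Poly_Mapping.single w c) z = c *\<^sub>M foldr lie w z"
  by (cases "c = 0") (auto simp: free_act_def)

lemma matrix_add_distribs:
  fixes A B C :: "'k::field^'n^'n"
  shows "A ** (B + C) = A ** B + A ** C" "(B + C) ** A = B ** A + C ** A"
    and "A ** (B - C) = A ** B - A ** C" "(B - C) ** A = B ** A - C ** A"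
  by (simp_all add: vec_eq_iff matrix_matrix_mult_def sum.distrib sum_subtractf algebra_simps)

lemma foldr_lie_add: "foldr lie w (a + b) = foldr lie w a + foldr lie w b"
  by (induction w)
     (auto simp: lie_def matrix_add_distribs)

lemma lie_scale: "lie x (c *\<^sub>M a) = c *\<^sub>M lie x a" "lie (c *\<^sub>M x) a = c *\<^sub>M lie x a"
  by (auto simp: lie_def mscale_def vec_eq_iff matrix_matrix_mult_def
      sum_distrib_left algebra_simps)

lemma foldr_lie_scale: "foldr lie w (c *\<^sub>M a) = c *\<^sub>M foldr lie w a"
  by (induction w) (auto simp: lie_scale)

lemma foldr_lie_sum: "foldr lie w (sum f A) = (\<Sum>i\<in>A. foldr lie w (f i))"
proof (induction A rule: infinite_finite_induct)
  case (insert x F)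
  then show ?case by (simp add: foldr_lie_add)
qed (use foldr_lie_scale[of w 0] in \<open>auto simp: mat_vs.scale_zero_left\<close>)

lemma sum_monomials:
  "p = (\<Sum>w\<in>Poly_Mapping.keys p. Poly_Mapping.single w (Poly_Mapping.lookup p w))"
  by (rule poly_mapping_eqI)
     (auto simp: lookup_sum lookup_single when_def in_keys_iff sum.delta')

lemma free_act_mult: "free_act (p * q) z = free_act p (free_act q z)"
proof -
  let ?P = "Poly_Mapping.keys p" and ?Q = "Poly_Mapping.keys q"
  have "p * q = (\<Sum>u\<in>?P. Poly_Mapping.single u (Poly_Mapping.lookup p u)) *
                (\<Sum>v\<in>?Q. Poly_Mapping.single v (Poly_Mapping.lookup q v))"
    using sum_monomials[of p] sum_monomials[of q] by simp
  also have "\<dots> = (\<Sum>u\<in>?P. \<Sum>v\<in>?Q.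
      Poly_Mapping.single (u @ v) (Poly_Mapping.lookup p u * Poly_Mapping.lookup q v))"
    by (simp add: sum_product mult_single plus_list_def)
  finally show ?thesis
    by (simp add: free_act_sum free_act_single free_act_def[of p] free_act_def[of q]
        foldr_lie_sum foldr_lie_scale mat_vs.scale_sum_right mat_vs.scale_scale)
qed

lemma free_act_letter [simp]: "free_act (letter x) z = lie x z"
  by (simp add: letter_def free_act_single mat_vs.scale_one)

lemma free_act_linear:
  "free_act p (a + b) = free_act p a + free_act p b" "free_act p 0 = 0"
proof -
  show *: "free_act p (a + b) = free_act p a + free_act p b" for a b
    by (simp add: free_act_def foldr_lie_add mat_vs.scale_right_distrib sum.distrib)
  show "free_act p 0 = 0" using *[of 0 0] by simp
qed

lemma lie_jacobi: "lie x (lie y z) - lie y (lie x z) - lie (lie x y) z = 0"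
  by (simp add: lie_def matrix_add_distribs matrix_mul_assoc)

lemma env_relations_subset:
  assumes "lie_subalgebra \<hh>"
  shows "env_relations \<hh> \<subseteq> carrier (free_algebra \<hh>)"
proof -
  interpret ring "free_algebra \<hh>" by (rule ring_free_algebra)
  have letter: "letter x \<in> carrier (free_algebra \<hh>)" if "x \<in> \<hh>" for x
    using that by (auto simp: letter_def free_algebra_def)
  have const: "Poly_Mapping.single [] c \<in> carrier (free_algebra \<hh>)" for c
    by (auto simp: free_algebra_def)
  have diff: "p - q \<in> carrier (free_algebra \<hh>)"
    if "p \<in> carrier (free_algebra \<hh>)" "q \<in> carrier (free_algebra \<hh>)" for p q
    using that Poly_Mapping.keys_diff[of p q] by (auto simp: free_algebra_def)
  have mult: "p * q \<in> carrier (free_algebra \<hh>)"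
    if "p \<in> carrier (free_algebra \<hh>)" "q \<in> carrier (free_algebra \<hh>)" for p q
    using m_closed[OF that] by (simp add: free_algebra_def)
  from assms show ?thesis
    by (auto simp: env_relations_def lie_subalgebra_def
        intro!: diff mult letter const mat_vs.subspace_add mat_vs.subspace_scale)
qed

lemma ideal_env_ideal:
  assumes "lie_subalgebra \<hh>"
  shows "ideal (env_ideal \<hh>) (free_algebra \<hh>)"
  unfolding env_ideal_def
  by (rule ring.genideal_ideal[OF ring_free_algebra env_relations_subset[OF assms]])

lemma ring_env_algebra: "lie_subalgebra \<hh> \<Longrightarrow> ring (env_algebra \<hh>)"
  unfolding env_algebra_def by (rule ideal.quotient_is_ring[OF ideal_env_ideal])

lemma free_act_env_ideal:
  fixes \<hh> :: "('k::field^'n^'n) set"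
  assumes "lie_subalgebra \<hh>" "p \<in> env_ideal \<hh>"
  shows "free_act p z = 0"
proof -
  let ?R = "free_algebra \<hh> :: (('k^'n^'n) list \<Rightarrow>\<^sub>0 'k) ring"
  interpret ring ?R by (rule ring_free_algebra)
  let ?K = "{p \<in> carrier ?R. \<forall>z. free_act p z = 0}"
  have inv: "\<ominus>\<^bsub>?R\<^esub> p = - p" if "p \<in> carrier ?R" for p
    by (rule minus_equality) (use that in \<open>auto simp: free_algebra_def\<close>)
  have "ideal ?K ?R"
  proof (rule idealI[OF ring_free_algebra])
    show "subgroup ?K (add_monoid ?R)"
    proof (rule add.subgroupI)
      show "?K \<noteq> {}" by (auto simp: free_algebra_def intro!: exI[of _ 0])
      show "\<ominus>\<^bsub>?R\<^esub> p \<in> ?K" if "p \<in> ?K" for p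
        using that a_inv_closed[of p] free_act_minus[of 0 p]
        by (auto simp: inv)
    next
      fix p q assume "p \<in> ?K" "q \<in> ?K"
      then show "p \<oplus>\<^bsub>?R\<^esub> q \<in> ?K"
        using a_closed[of p q] by (auto simp: free_algebra_def free_act_add)
    qed auto
  next
    fix a p assume "a \<in> ?K" "p \<in> carrier ?R"
    then show "p \<otimes>\<^bsub>?R\<^esub> a \<in> ?K" "a \<otimes>\<^bsub>?R\<^esub> p \<in> ?K"
      using m_closed[of p a] m_closed[of a p]
      by (auto simp: free_algebra_def free_act_mult free_act_linear)
  qed
  moreover have "env_relations \<hh> \<subseteq> ?K"
  proof
    fix r assume r: "r \<in> env_relations \<hh>"
    have "free_act r z = 0" for z
      using r lie_jacobi
      by (auto simp: env_relations_def free_act_minus free_act_mult free_act_single lie_scale)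
         (auto simp: lie_def matrix_add_distribs)
    with r env_relations_subset[OF assms(1)] show "r \<in> ?K" by auto
  qed
  ultimately have "env_ideal \<hh> \<subseteq> ?K"
    unfolding env_ideal_def by (rule genideal_minimal)
  with assms(2) show ?thesis by auto
qed

lemma env_act_class:
  assumes "lie_subalgebra \<hh>" "p \<in> carrier (free_algebra \<hh>)"
  shows "env_act (a_r_coset (free_algebra \<hh>) (env_ideal \<hh>) p) z = free_act p z"
proof -
  let ?R = "free_algebra \<hh>" and ?u = "a_r_coset (free_algebra \<hh>) (env_ideal \<hh>) p"
  interpret ideal "env_ideal \<hh>" ?R by (rule ideal_env_ideal[OF assms(1)])
  have "p \<in> ?u" by (rule a_rcos_self[OF assms(2)])
  then have "(SOME q. q \<in> ?u) \<in> ?u" by (rule someI)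
  then obtain h where h: "h \<in> env_ideal \<hh>" "(SOME q. q \<in> ?u) = h + p"
    by (auto simp: a_r_coset_def' free_algebra_def)
  then show ?thesis
    by (simp add: env_act_def free_act_add free_act_env_ideal[OF assms(1)])
qed

lemma casimir_act:
  fixes \<hh> :: "('k::field^'n^'n) set"
  assumes "lie_subalgebra \<hh>" "\<And>i. i < d \<Longrightarrow> e i \<in> \<hh>" "\<And>i. i < d \<Longrightarrow> e' i \<in> \<hh>"
  shows "env_act (casimir \<hh> d e e') z = (\<Sum>i<d. lie (e' i) (lie (e i) z))"
proof -
  let ?R = "free_algebra \<hh> :: (('k^'n^'n) list \<Rightarrow>\<^sub>0 'k) ring" and ?U = "env_algebra \<hh>"
  let ?c = "a_r_coset (free_algebra \<hh>) (env_ideal \<hh>)"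
  interpret ideal "env_ideal \<hh>" ?R by (rule ideal_env_ideal[OF assms(1)])
  interpret U: ring ?U by (rule ring_env_algebra[OF assms(1)])
  have letter: "letter x \<in> carrier ?R" if "x \<in> \<hh>" for x
    using that by (auto simp: letter_def free_algebra_def)
  have prod: "letter (e' i) * letter (e i) \<in> carrier ?R" if "i < d" for i
    using m_closed[OF letter[OF assms(3)] letter[OF assms(2)], OF that that]
    by (simp add: free_algebra_def)
  have c: "?c p \<in> carrier ?U" if "p \<in> carrier ?R" for p
    using that by (auto simp: env_algebra_def FactRing_def A_RCOSETS_def')
  have mult: "env_inj \<hh> (e' i) \<otimes>\<^bsub>?U\<^esub> env_inj \<hh> (e i) = ?c (letter (e' i) * letter (e i))"
    if "i < d" for i
    using rcoset_mult_add[OF letter[OF assms(3)] letter[OF assms(2)], OF that that]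
    by (simp add: env_inj_def env_algebra_def FactRing_def) (simp add: free_algebra_def)
  have sum: "casimir \<hh> n e e' = ?c (\<Sum>i<n. letter (e' i) * letter (e i)) \<and>
      (\<Sum>i<n. letter (e' i) * letter (e i)) \<in> carrier ?R" if "n \<le> d" for n
    using that
  proof (induction n)
    case 0
    have "?c \<zero>\<^bsub>?R\<^esub> = env_ideal \<hh>"
      by (auto simp: a_r_coset_def' free_algebra_def)
    then show ?case
      using zero_closed by (simp add: casimir_def) (simp add: free_algebra_def env_algebra_def FactRing_def)
  next
    case (Suc n)
    let ?s = "\<Sum>i<n. letter (e' i) * letter (e i)" and ?t = "letter (e' n) * letter (e n)"
    have s: "?s \<in> carrier ?R" and t: "?t \<in> carrier ?R" using Suc prod by auto
    have "casimir \<hh> (Suc n) e e' = ?c ?t \<oplus>\<^bsub>?U\<^esub> casimir \<hh> n e e'"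
      unfolding casimir_def lessThan_Suc using Suc.prems mult prod c
      by (subst U.finsum_insert) auto
    also have "\<dots> = ?c ?t \<oplus>\<^bsub>?U\<^esub> ?c ?s" using Suc by simp
    also have "\<dots> = ?c (?t + ?s)"
      using a_rcos_sum[OF t s] by (simp add: env_algebra_def FactRing_def) (simp add: free_algebra_def)
    finally show ?case using a_closed[OF t s]
      by (simp add: add.commute) (simp add: free_algebra_def add.commute)
  qed
  show ?thesis
    using sum[of d] by (simp add: env_act_class[OF assms(1)] free_act_sum free_act_mult)
qed

end

theory Submission
  imports Defs "HOL-Library.Function_Algebras"
begin

text \<open>
  Write \<open>L\<close> for \<open>\<hh>\<close>, \<open>\<Phi>\<close> for the Killing form of \<open>\<gg>\<close>, \<open>C\<close> for the Casimir operator of \<open>L\<close>, \<open>N\<close> for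
  \<open>\<mm>_half\<close>, \<open>M\<close> for the orthogonal complement of \<open>N\<close> in \<open>\<mm>\<close>, and \<open>K\<close>, \<open>K'\<close> for the trace forms of
  \<open>L\<close> on \<open>N\<close> and \<open>M\<close>.  It is to be shown that \<open>M = 0\<close> and \<open>[N, N] \<subseteq> L\<close>.

  The eigenvalue \<open>1/2\<close> is the one for which the operator \<open>T = 1 - C\<close> on \<open>so(N)\<close> has the form
  \<open>T F = 2 \<Sum> e\<^sub>i F e'\<^sub>i\<close> (\<open>T_apply\<close>).  Hence the trace of \<open>T\<^sup>2\<close> on \<open>so(N)\<close> can be expressed through
  \<open>K\<close> and \<open>K'\<close> (\<open>trace_TT\<close>).  Let \<open>\<theta> : so(N) \<rightarrow> L\<close> be adjoint to the action \<open>\<iota> : L \<rightarrow> so(N)\<close>; its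
  image \<open>L1\<close> is the orthogonal complement of the annihilator of \<open>N\<close>.  Subtracting the trace of
  \<open>(1 - C)\<^sup>2\<close> on \<open>L1\<close> leaves, on the kernel \<open>Z\<close> of \<open>\<theta>\<close>,
  \<open>tr T\<^sup>2 = - 3 tr (K' K) - tr (K'\<^sup>2 on L1)\<close> (\<open>trace_TT_Z\<close>).  The left side is a sum of squares of
  rational numbers, both traces on the right are nonnegative rational numbers, so everything
  vanishes: \<open>T = 0\<close> on \<open>Z\<close>, and \<open>L1\<close> kills \<open>M\<close>.  It follows that \<open>T F\<close> is the action of \<open>\<theta> F\<close> for all
  \<open>F\<close> in \<open>so(N)\<close> (\<open>T_eq_iota_theta\<close>), and for \<open>F = x \<and> y\<close> this says that the \<open>L\<close>-components of the
  brackets of \<open>N\<close> satisfy the Bianchi identity (\<open>bianchi_N\<close>).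

  Let \<open>\<omega> x y\<close> be the \<open>\<mm>\<close>-component of \<open>[x, y]\<close>.  The Jacobi identity computes \<open>C (\<omega> x y)\<close>, and the
  Bianchi identity turns the result into \<open>- C (\<omega> x y)\<close> (\<open>C_om_0\<close>).  So \<open>C\<close> kills \<open>\<omega> x y\<close>, which gives
  first \<open>[N, M] = 0\<close> and then \<open>[N, N] \<subseteq> L1\<close>.  Therefore \<open>L1 + N\<close> is a nonzero ideal of \<open>\<gg>\<close>, that is, all
  of \<open>\<gg>\<close>, and \<open>M = 0\<close> (\<open>half_exhausts\<close>).

  Rationality and positivity come from the algebraicity of \<open>\<hh>\<close>, without a compact real form.  The Lie
  algebra of an algebraic group contains with \<open>x\<close> its replicas (\<open>replica_exists\<close>): an additive
  function \<open>f : 'k \<rightarrow> \<rat>\<close> applied to the eigenvalues of \<open>x\<close> yields elements of \<open>\<hh>\<close> with rational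
  eigenvalues in the adjoint representation, on which trace forms are positive.  A maximal
  \<open>\<Phi>\<close>-orthogonal family of commuting such elements is its own centraliser in \<open>\<hh>\<close> (\<open>centralizer\<close>), so \<open>\<hh>\<close>
  has a root decomposition with rational roots (\<open>torus_data_exists\<close>).  For modules with rational
  weights, the action of \<open>C\<close> on weights of maximal length yields a Reynolds operator
  (\<open>reynolds\<close>), hence complete reducibility and rational eigenvalues of \<open>C\<close>.
\<close>

section \<open>Traces of operators on subspaces\<close>

text \<open>Modules occur below as subspaces of spaces of matrices and of spaces of functions between
  them; linearity, dimension and trace are therefore all relative to a subspace.\<close>

locale linear_space = vector_space scale
  for scale :: "'k::field \<Rightarrow> 'v::ab_group_add \<Rightarrow> 'v" (infixr "\<cdot>" 75)

definition lin_on ::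
  "('k::field \<Rightarrow> 'a::ab_group_add \<Rightarrow> 'a) \<Rightarrow> 'a set \<Rightarrow> ('k \<Rightarrow> 'b::ab_group_add \<Rightarrow> 'b) \<Rightarrow> ('a \<Rightarrow> 'b) \<Rightarrow> bool" where
  "lin_on s V t f \<longleftrightarrow>
     (\<forall>x\<in>V. \<forall>y\<in>V. f (x + y) = f x + f y) \<and> (\<forall>c. \<forall>x\<in>V. f (s c x) = t c (f x))"

lemma lin_onD:
  assumes "lin_on s V t f"
  shows "x \<in> V \<Longrightarrow> y \<in> V \<Longrightarrow> f (x + y) = f x + f y" "x \<in> V \<Longrightarrow> f (s c x) = t c (f x)"
  using assms by (auto simp: lin_on_def)

lemma lin_on_subset: "lin_on s V t f \<Longrightarrow> W \<subseteq> V \<Longrightarrow> lin_on s W t f"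
  unfolding lin_on_def by blast

lemma lin_on_comp:
  "lin_on s V t f \<Longrightarrow> lin_on t W u g \<Longrightarrow> f ` V \<subseteq> W \<Longrightarrow> lin_on s V u (\<lambda>x. g (f x))"
  unfolding lin_on_def by (simp add: image_subset_iff)

context linear_space
begin

lemma lin_on_zero: "subspace V \<Longrightarrow> lin_on scale V t f \<Longrightarrow> f 0 = 0"
  using lin_onD(1)[of scale V t f 0 0] subspace_0 by fastforce

lemma lin_on_sum:
  assumes "subspace V" "lin_on scale V t f" "\<And>i. i \<in> I \<Longrightarrow> x i \<in> V"
  shows "f (\<Sum>i\<in>I. x i) = (\<Sum>i\<in>I. f (x i))"
  using assms(3)
proof (induction I rule: infinite_finite_induct)
  case (insert i I)
  then have "(\<Sum>i\<in>I. x i) \<in> V" by (intro subspace_sum[OF assms(1)]) auto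
  with insert show ?case by (simp add: lin_onD(1)[OF assms(2)])
qed (auto simp: lin_on_zero[OF assms(1,2)])

lemma lin_on_diff:
  assumes "subspace V" "lin_on scale V t f" "x \<in> V" "y \<in> V"
  shows "f (x - y) = f x - f y"
proof -
  have "f (x - y + y) = f (x - y) + f y"
    by (rule lin_onD(1)[OF assms(2)]) (use assms subspace_diff in auto)
  then show ?thesis by simp
qed

lemma subspace_eigen:
  assumes "subspace V" "lin_on scale V scale f"
  shows "subspace {v \<in> V. f v = c \<cdot> v}"
  using assms
  by (auto intro!: subspaceI simp: lin_on_zero subspace_0 subspace_add subspace_scale lin_onD
      scale_right_distrib scale_left_commute)

lemma subspace_lin_image:
  assumes "subspace V" "lin_on scale V scale f"
  shows "subspace (f ` V)"
proof (rule subspaceI)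
  show "0 \<in> f ` V"
    by (rule image_eqI[of _ _ 0]) (simp_all add: lin_on_zero[OF assms] subspace_0[OF assms(1)])
  fix x y assume "x \<in> f ` V" "y \<in> f ` V"
  then obtain u v where "u \<in> V" "v \<in> V" "x = f u" "y = f v" by blast
  then show "x + y \<in> f ` V"
    by (intro image_eqI[of _ _ "u + v"]) (simp_all add: lin_onD(1)[OF assms(2)] subspace_add[OF assms(1)])
next
  fix c x assume "x \<in> f ` V"
  then obtain u where "u \<in> V" "x = f u" by blast
  then show "c \<cdot> x \<in> f ` V"
    by (intro image_eqI[of _ _ "c \<cdot> u"]) (simp_all add: lin_onD(2)[OF assms(2)] subspace_scale[OF assms(1)])
qed

definition fin_dim :: "'v set \<Rightarrow> bool" where
  "fin_dim V \<longleftrightarrow> (\<exists>B. finite B \<and> span B = V)"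

text \<open>The formula of \<open>trace_on\<close>, over an arbitrary vector space.\<close>

definition tr :: "'v set \<Rightarrow> ('v \<Rightarrow> 'v) \<Rightarrow> 'k" where
  "tr V f = (let B = (SOME B. independent B \<and> span B = V)
      in \<Sum>b\<in>B. representation B (f b) b)"

text \<open>A spanning family with coordinate functionals.  The \<open>b i\<close> may be linearly dependent, which
  allows the family \<open>f\<^sub>a \<and> f'\<^sub>b\<close> for \<open>so(N)\<close>.\<close>

definition frame :: "'v set \<Rightarrow> 'i set \<Rightarrow> ('i \<Rightarrow> 'v) \<Rightarrow> ('i \<Rightarrow> 'v \<Rightarrow> 'k) \<Rightarrow> bool" where
  "frame V I b \<phi> \<longleftrightarrow> finite I \<and> (\<forall>i\<in>I. b i \<in> V \<and> lin_on scale V (*) (\<phi> i)) \<and>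
     (\<forall>v\<in>V. v = (\<Sum>i\<in>I. \<phi> i v \<cdot> b i))"

lemma fin_dim_subspace: "fin_dim V \<Longrightarrow> subspace V"
  by (auto simp: fin_dim_def)

lemma basis_within:
  assumes "fin_dim V" "span P = V"
  obtains B where "B \<subseteq> P" "finite B" "independent B" "span B = V"
proof -
  obtain B where B: "B \<subseteq> P" "independent B" "P \<subseteq> span B"
    using maximal_independent_subset by blast
  have sp: "span B = V" using B assms(2)
    by (metis span_mono span_span subset_antisym)
  obtain F where "finite F" "span F = V" using assms(1) by (auto simp: fin_dim_def)
  with B sp have "finite B" using independent_span_bound[of F B] span_superset by blast
  with B sp that show ?thesis by blast
qed

lemma fin_dim_sub:
  assumes "fin_dim V" "subspace W" "W \<subseteq> V"
  shows "fin_dim W"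
proof -
  obtain B where B: "B \<subseteq> W" "independent B" "W \<subseteq> span B"
    using maximal_independent_subset by blast
  obtain F where "finite F" "span F = V" using assms(1) by (auto simp: fin_dim_def)
  with B assms(3) have "finite B" using independent_span_bound[of F B] by auto
  moreover have "span B = W" using B assms(2) by (metis span_subspace)
  ultimately show ?thesis by (auto simp: fin_dim_def)
qed

lemma frame_basis:
  assumes "finite B" "independent B" "span B = V"
  shows "frame V B (\<lambda>b. b) (\<lambda>b v. representation B v b)"
  unfolding frame_def lin_on_def
  using assms by (auto simp: span_base representation_add representation_scale sum_representation_eq)

lemma fin_dim_frame: "fin_dim V \<Longrightarrow> \<exists>B. frame V B (\<lambda>b. b) (\<lambda>b v. representation B v b)"
  using basis_within[of V V] frame_basis fin_dim_subspace by (metis span_eq_iff)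

lemma frame_fin_dim:
  assumes "frame V I b \<phi>" "subspace V" shows "fin_dim V"
proof -
  have "span (b ` I) = V"
  proof
    show "span (b ` I) \<subseteq> V" using assms by (intro span_minimal) (auto simp: frame_def)
    show "V \<subseteq> span (b ` I)"
    proof
      fix v assume "v \<in> V"
      then have "v = (\<Sum>i\<in>I. \<phi> i v \<cdot> b i)" using assms by (auto simp: frame_def)
      also have "\<dots> \<in> span (b ` I)" by (intro span_sum span_scale span_base) auto
      finally show "v \<in> span (b ` I)" .
    qed
  qed
  with assms show ?thesis by (auto simp: fin_dim_def frame_def)
qed

end

lemma frame_coordinate:
  assumes s: "linear_space s" and t: "linear_space t"
    and V: "module.subspace s V" and W: "module.subspace t W" and c: "linear_space.frame t W J c \<psi>"
    and g: "lin_on t W s g" "g ` W \<subseteq> V" and \<phi>: "lin_on s V (*) \<phi>" and w: "w \<in> W"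
  shows "\<phi> (g w) = (\<Sum>j\<in>J. \<psi> j w * \<phi> (g (c j)))"
proof -
  interpret s: linear_space s by fact
  interpret t: linear_space t by fact
  have cW: "c j \<in> W" if "j \<in> J" for j using c that by (auto simp: t.frame_def)
  have gV: "g (t a (c j)) \<in> V" if "j \<in> J" for a j using g(2) t.subspace_scale[OF W cW[OF that]] by blast
  have "w = (\<Sum>j\<in>J. t (\<psi> j w) (c j))" using c w unfolding t.frame_def by blast
  then have "\<phi> (g w) = \<phi> (g (\<Sum>j\<in>J. t (\<psi> j w) (c j)))" by simp
  also have "\<dots> = \<phi> (\<Sum>j\<in>J. g (t (\<psi> j w) (c j)))"
    using cW by (subst t.lin_on_sum[OF W g(1)]) (auto intro: t.subspace_scale[OF W])
  also have "\<dots> = (\<Sum>j\<in>J. \<phi> (g (t (\<psi> j w) (c j))))" by (rule s.lin_on_sum[OF V \<phi> gV])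
  also have "\<dots> = (\<Sum>j\<in>J. \<psi> j w * \<phi> (g (c j)))"
    using cW g(2) by (intro sum.cong refl) (simp add: lin_onD(2)[OF g(1)] lin_onD(2)[OF \<phi>] image_subset_iff)
  finally show ?thesis .
qed

text \<open>Expanding \<open>f (b i)\<close> in one frame and \<open>g (c j)\<close> in the other turns both sides into the same
  double sum.  For \<open>f = id\<close> this says that the trace can be computed in every frame.\<close>

lemma trace_frames_commute:
  assumes s: "linear_space s" and t: "linear_space t"
    and V: "module.subspace s V" and W: "module.subspace t W"
    and b: "linear_space.frame s V I b \<phi>" and c: "linear_space.frame t W J c \<psi>"
    and f: "lin_on s V t f" "f ` V \<subseteq> W" and g: "lin_on t W s g" "g ` W \<subseteq> V"
  shows "(\<Sum>i\<in>I. \<phi> i (g (f (b i)))) = (\<Sum>j\<in>J. \<psi> j (f (g (c j))))"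
proof -
  have bV: "b i \<in> V" "lin_on s V (*) (\<phi> i)" if "i \<in> I" for i
    using b that by (auto simp: linear_space.frame_def[OF s])
  have cW: "c j \<in> W" "lin_on t W (*) (\<psi> j)" if "j \<in> J" for j
    using c that by (auto simp: linear_space.frame_def[OF t])
  have 1: "\<phi> i (g (f (b i))) = (\<Sum>j\<in>J. \<psi> j (f (b i)) * \<phi> i (g (c j)))" if "i \<in> I" for i
    by (rule frame_coordinate[OF s t V W c g bV(2)[OF that]]) (use f(2) bV(1)[OF that] in blast)
  have 2: "\<psi> j (f (g (c j))) = (\<Sum>i\<in>I. \<phi> i (g (c j)) * \<psi> j (f (b i)))" if "j \<in> J" for j
    by (rule frame_coordinate[OF t s W V b f cW(2)[OF that]]) (use g(2) cW(1)[OF that] in blast)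
  show ?thesis by (simp add: 1 2 sum.swap[of _ I] mult.commute)
qed

context linear_space
begin

lemma tr_frame:
  assumes V: "subspace V" and b: "frame V I b \<phi>" and f: "lin_on scale V scale f" "f ` V \<subseteq> V"
  shows "tr V f = (\<Sum>i\<in>I. \<phi> i (f (b i)))"
proof -
  define B where "B = (SOME B. independent B \<and> span B = V)"
  have fd: "fin_dim V" by (rule frame_fin_dim[OF b V])
  obtain B' where "independent B'" "span B' = V"
    using basis_within[OF fd] V by (metis span_eq_iff)
  then have "\<exists>B. independent B \<and> span B = V" by blast
  then have B: "independent B" "span B = V" unfolding B_def by (metis (mono_tags, lifting) someI_ex)+
  then have "finite B" using independent_span_bound fd unfolding fin_dim_def
    by (metis span_superset)
  note fr = frame_basis[OF this B]
  have id: "lin_on scale V scale (\<lambda>x. x)" by (simp add: lin_on_def)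
  have "(\<Sum>i\<in>I. \<phi> i (f (b i))) = (\<Sum>b\<in>B. representation B (f b) b)"
    using trace_frames_commute[OF linear_space_axioms linear_space_axioms V V b fr f id] by simp
  then show ?thesis unfolding tr_def Let_def B_def[symmetric] by simp
qed

lemma frame_in: "frame V I b \<phi> \<Longrightarrow> i \<in> I \<Longrightarrow> b i \<in> V"
  by (simp add: frame_def)

lemma tr_add:
  assumes "fin_dim V" "lin_on scale V scale f" "f ` V \<subseteq> V" "lin_on scale V scale g" "g ` V \<subseteq> V"
  shows "tr V (\<lambda>x. f x + g x) = tr V f + tr V g"
proof -
  obtain B where B: "frame V B (\<lambda>b. b) (\<lambda>b v. representation B v b)"
    using fin_dim_frame[OF assms(1)] by blast
  note V = fin_dim_subspace[OF assms(1)]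
  have fg: "lin_on scale V scale (\<lambda>x. f x + g x)" "(\<lambda>x. f x + g x) ` V \<subseteq> V"
    using assms V by (auto simp: lin_on_def scale_right_distrib intro: subspace_add)
  have "representation B (f b + g b) b = representation B (f b) b + representation B (g b) b" if "b \<in> B" for b
    by (rule lin_onD(1)[where s = scale and V = V and t = "(*)"])
       (use B that assms in \<open>auto simp: frame_def\<close>)
  then show ?thesis
    by (simp add: tr_frame[OF V B] fg assms sum.distrib)
qed

lemma tr_scale:
  assumes "fin_dim V" "lin_on scale V scale f" "f ` V \<subseteq> V"
  shows "tr V (\<lambda>x. c \<cdot> f x) = c * tr V f"
proof -
  obtain B where B: "frame V B (\<lambda>b. b) (\<lambda>b v. representation B v b)"
    using fin_dim_frame[OF assms(1)] by blast
  note V = fin_dim_subspace[OF assms(1)]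
  have fg: "lin_on scale V scale (\<lambda>x. c \<cdot> f x)" "(\<lambda>x. c \<cdot> f x) ` V \<subseteq> V"
    using assms V by (auto simp: lin_on_def scale_right_distrib mult.commute intro: subspace_scale)
  have "representation B (c \<cdot> f b) b = c * representation B (f b) b" if "b \<in> B" for b
    by (rule lin_onD(2)[where s = scale and V = V and t = "(*)"])
       (use B that assms in \<open>auto simp: frame_def\<close>)
  then show ?thesis
    by (simp add: tr_frame[OF V B] fg assms sum_distrib_left)
qed

lemma tr_cong:
  assumes "fin_dim V" "lin_on scale V scale f" "f ` V \<subseteq> V" "\<And>x. x \<in> V \<Longrightarrow> f x = g x"
  shows "tr V f = tr V g"
proof -
  obtain B where B: "frame V B (\<lambda>b. b) (\<lambda>b v. representation B v b)"
    using fin_dim_frame[OF assms(1)] by blast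
  note V = fin_dim_subspace[OF assms(1)]
  have "lin_on scale V scale g" "g ` V \<subseteq> V"
    using assms V by (auto simp: lin_on_def subspace_add subspace_scale)
  with assms frame_in[OF B] show ?thesis by (simp add: tr_frame[OF V B])
qed

lemma tr_eigenbasis:
  assumes "finite B" "independent B" "span B = V" "lin_on scale V scale f"
    and eig: "\<And>b. b \<in> B \<Longrightarrow> f b = c b \<cdot> b"
  shows "tr V f = (\<Sum>b\<in>B. c b)"
proof -
  have V: "subspace V" using assms by auto
  have fV: "f ` V \<subseteq> V"
  proof
    fix y assume "y \<in> f ` V"
    then obtain v where v: "v \<in> V" "y = f v" by auto
    have "f v = f (\<Sum>b\<in>B. representation B v b \<cdot> b)"
      using frame_basis[OF assms(1-3)] v by (simp add: frame_def)
    also have "\<dots> = (\<Sum>b\<in>B. f (representation B v b \<cdot> b))"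
      by (rule lin_on_sum[OF V assms(4)]) (use assms span_base V subspace_scale in blast)
    also have "\<dots> = (\<Sum>b\<in>B. representation B v b \<cdot> (c b \<cdot> b))"
      by (intro sum.cong refl) (use assms span_base lin_onD(2)[OF assms(4)] in \<open>metis eig\<close>)
    also have "\<dots> \<in> V" using assms span_base
      by (intro subspace_sum[OF V] subspace_scale[OF V]) auto
    finally show "y \<in> V" using v by simp
  qed
  have "tr V f = (\<Sum>b\<in>B. representation B (f b) b)"
    by (rule tr_frame[OF V frame_basis[OF assms(1-3)] assms(4) fV])
  also have "\<dots> = (\<Sum>b\<in>B. c b)"
    by (intro sum.cong refl)
       (simp add: eig representation_scale[OF assms(2) span_base] representation_basis[OF assms(2)])
  finally show ?thesis .
qed

end

lemma tr_commute:
  assumes s: "linear_space s" and t: "linear_space t"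
    and V: "linear_space.fin_dim s V" and W: "linear_space.fin_dim t W"
    and f: "lin_on s V t f" "f ` V \<subseteq> W" and g: "lin_on t W s g" "g ` W \<subseteq> V"
  shows "linear_space.tr s V (\<lambda>x. g (f x)) = linear_space.tr t W (\<lambda>y. f (g y))"
proof -
  interpret s: linear_space s by fact
  interpret t: linear_space t by fact
  obtain B where B: "s.frame V B (\<lambda>b. b) (\<lambda>b v. s.representation B v b)"
    using s.fin_dim_frame[OF V] by blast
  obtain C where C: "t.frame W C (\<lambda>b. b) (\<lambda>b v. t.representation C v b)"
    using t.fin_dim_frame[OF W] by blast
  note sub = s.fin_dim_subspace[OF V] t.fin_dim_subspace[OF W]
  have gf: "lin_on s V s (\<lambda>x. g (f x))" "(\<lambda>x. g (f x)) ` V \<subseteq> V"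
    using lin_on_comp[OF f(1) g(1) f(2)] f g by auto
  have fg: "lin_on t W t (\<lambda>x. f (g x))" "(\<lambda>x. f (g x)) ` W \<subseteq> W"
    using lin_on_comp[OF g(1) f(1) g(2)] f g by auto
  show ?thesis
    unfolding s.tr_frame[OF sub(1) B gf] t.tr_frame[OF sub(2) C fg]
    by (rule trace_frames_commute[OF s t sub B C f g])
qed

section \<open>Generalised eigenvectors\<close>

context linear_space
begin

abbreviation shift :: "('v \<Rightarrow> 'v) \<Rightarrow> 'k \<Rightarrow> 'v \<Rightarrow> 'v" where
  "shift T c \<equiv> (\<lambda>w. T w - c \<cdot> w)"

definition geig :: "('v \<Rightarrow> 'v) \<Rightarrow> 'k \<Rightarrow> 'v \<Rightarrow> bool" where
  "geig T c v \<longleftrightarrow> (\<exists>n. (shift T c ^^ n) v = 0)"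

lemma shift_lin:
  assumes "subspace V" "lin_on scale V scale T" "T ` V \<subseteq> V"
  shows "lin_on scale V scale (shift T c)" "shift T c ` V \<subseteq> V"
  using assms by (auto simp: lin_on_def algebra_simps subspace_diff subspace_scale)

lemma funpow_lin:
  assumes "subspace V" "lin_on scale V scale T" "T ` V \<subseteq> V"
  shows "lin_on scale V scale (T ^^ n)" "(T ^^ n) ` V \<subseteq> V"
proof -
  have "lin_on scale V scale (T ^^ n) \<and> (T ^^ n) ` V \<subseteq> V"
    using assms by (induction n) (auto simp: lin_on_def image_subset_iff)
  then show "lin_on scale V scale (T ^^ n)" "(T ^^ n) ` V \<subseteq> V" by auto
qed

text \<open>\<open>(c - d) v = (T - d) v - (T - c) v\<close> lets one invert \<open>T - d\<close> on generalised \<open>c\<close>-eigenvectors.\<close>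

lemma geig_in_subspace:
  assumes V: "subspace V" "lin_on scale V scale T" "T ` V \<subseteq> V"
    and W: "subspace W" "W \<subseteq> V" "T ` W \<subseteq> W" and "c \<noteq> d"
    and "v \<in> V" "(shift T c ^^ n) v = 0" "shift T d v \<in> W"
  shows "v \<in> W"
  using assms(8-)
proof (induction n arbitrary: v)
  case 0
  then show ?case using W by (simp add: subspace_0)
next
  case (Suc n)
  let ?w = "shift T c v"
  have w: "?w \<in> V" using shift_lin(2)[OF V] Suc.prems(1) by auto
  have "shift T d ?w = shift T c (shift T d v)"
    using Suc.prems V
    by (simp add: lin_on_diff[OF V(1,2)] subspace_scale lin_onD(2)[OF V(2)] image_subset_iff algebra_simps)
  also have "\<dots> \<in> W" using shift_lin(2)[OF W(1) lin_on_subset[OF V(2) W(2)] W(3)] Suc.prems by auto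
  finally have "shift T d ?w \<in> W" .
  moreover have "(shift T c ^^ n) ?w = 0"
    using Suc.prems(2) by (metis comp_apply funpow_Suc_right)
  ultimately have "?w \<in> W" by (intro Suc.IH[OF w])
  moreover have "(c - d) \<cdot> v = shift T d v - ?w" by (simp add: algebra_simps)
  ultimately have "(c - d) \<cdot> v \<in> W" using Suc.prems(3) W(1) subspace_diff by metis
  then have "inverse (c - d) \<cdot> ((c - d) \<cdot> v) \<in> W" using W subspace_scale by blast
  then show ?case using \<open>c \<noteq> d\<close> by simp
qed

lemma geig_zero: "geig T c 0"
  unfolding geig_def by (rule exI[of _ 0]) simp

lemma geig_funpow_shift:
  assumes V: "subspace V" "lin_on scale V scale T" "T ` V \<subseteq> V" and "v \<in> V" "geig T c v"
  shows "geig T c (shift T d v)"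
proof -
  obtain n where n: "(shift T c ^^ n) v = 0" using assms by (auto simp: geig_def)
  have "(shift T c ^^ n) (shift T d v) = shift T d ((shift T c ^^ n) v)" for n
  proof (induction n)
    case (Suc n)
    have u: "(shift T c ^^ n) v \<in> V"
      using funpow_lin(2)[OF V(1) shift_lin[OF V]] \<open>v \<in> V\<close> by blast
    show ?case using V u
      by (simp add: Suc lin_on_diff[OF V(1,2)] subspace_scale lin_onD(2)[OF V(2)] image_subset_iff algebra_simps)
  qed simp
  with n have "(shift T c ^^ n) (shift T d v) = 0"
    by (simp add: lin_on_zero[OF V(1,2)])
  then show ?thesis by (auto simp: geig_def)
qed

text \<open>A power of \<open>T - d\<close> kills the component with eigenvalue \<open>d\<close> and, by \<open>geig_in_subspace\<close>, does not
  hide that another component is outside \<open>W\<close>.  So one component can be removed at a time.\<close>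

lemma geig_components:
  assumes V: "subspace V" "lin_on scale V scale T" "T ` V \<subseteq> V"
    and W: "subspace W" "W \<subseteq> V" "T ` W \<subseteq> W"
    and "finite S" "\<And>c. c \<in> S \<Longrightarrow> v c \<in> V" "\<And>c. c \<in> S \<Longrightarrow> geig T c (v c)" "(\<Sum>c\<in>S. v c) \<in> W"
  shows "\<forall>c\<in>S. v c \<in> W"
  using assms(7-)
proof (induction S arbitrary: v rule: finite_induct)
  case (insert d S)
  obtain n where n: "(shift T d ^^ n) (v d) = 0" using insert.prems by (auto simp: geig_def)
  let ?P = "shift T d ^^ n"
  have P: "lin_on scale V scale ?P" "?P ` V \<subseteq> V"
    by (rule funpow_lin[OF V(1) shift_lin[OF V]])+
  have PW: "?P ` W \<subseteq> W"
    by (rule funpow_lin[OF W(1) shift_lin[OF W(1) lin_on_subset[OF V(2) W(2)] W(3)]])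
  have "?P (\<Sum>c\<in>insert d S. v c) = (\<Sum>c\<in>insert d S. ?P (v c))"
    by (rule lin_on_sum[OF V(1) P(1)]) (use insert.prems in auto)
  also have "\<dots> = (\<Sum>c\<in>S. ?P (v c))" using insert n by simp
  finally have "(\<Sum>c\<in>S. ?P (v c)) \<in> W" using insert.prems(3) PW by (metis image_subset_iff)
  moreover have "geig T c (?P (v c)) \<and> ?P (v c) \<in> V" if "c \<in> S" for c
  proof (induction n)
    let ?P' = "\<lambda>n. (shift T d ^^ n) (v c)"
    case (Suc n)
    then have "geig T c (shift T d (?P' n))" "shift T d (?P' n) \<in> V"
      using geig_funpow_shift[OF V] shift_lin(2)[OF V] by blast+
    then show ?case by simp
  qed (use insert.prems that in auto)
  ultimately have PS: "\<forall>c\<in>S. ?P (v c) \<in> W" by (intro insert.IH) blast+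
  have vS: "v c \<in> W" if c: "c \<in> S" for c
  proof -
    have cd: "c \<noteq> d" using c insert.hyps by auto
    have descend: "x \<in> W" if "x \<in> V" "geig T c x" "(shift T d ^^ n) x \<in> W" for x n
      using that
    proof (induction n arbitrary: x)
      case (Suc n)
      have "(shift T d ^^ n) (shift T d x) \<in> W"
        using Suc.prems(3) by (metis comp_apply funpow_Suc_right)
      moreover have "shift T d x \<in> V" using shift_lin(2)[OF V] Suc.prems(1) by blast
      moreover have "geig T c (shift T d x)" by (rule geig_funpow_shift[OF V Suc.prems(1,2)])
      ultimately have "shift T d x \<in> W" by (rule Suc.IH[rotated -1])
      moreover obtain m where "(shift T c ^^ m) x = 0" using Suc.prems(2) unfolding geig_def by blast
      ultimately show ?case by (intro geig_in_subspace[OF V W cd Suc.prems(1)])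
    qed simp
    show ?thesis
      by (rule descend[OF insert.prems(1,2)]) (use PS c in auto)
  qed
  have "v d = (\<Sum>c\<in>insert d S. v c) - (\<Sum>c\<in>S. v c)" using insert.hyps by simp
  also have "\<dots> \<in> W" using insert.prems(3) vS by (rule subspace_diff[OF W(1) _ subspace_sum[OF W(1)]])
  finally show ?case using vS by auto
qed auto

lemma geig_shift_preimage:
  assumes V: "subspace V" "lin_on scale V scale T" "T ` V \<subseteq> V" and "c \<noteq> d"
    and "v \<in> V" "geig T c v"
  shows "\<exists>u\<in>V. geig T c u \<and> shift T d u = v"
proof -
  obtain n where "(shift T c ^^ n) v = 0" using assms by (auto simp: geig_def)
  with \<open>v \<in> V\<close> show ?thesis
  proof (induction n arbitrary: v)
    case 0
    then show ?case using V by (intro bexI[of _ 0]) (auto simp: geig_zero lin_on_zero subspace_0)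
  next
    case (Suc n)
    let ?w = "shift T c v"
    have w: "?w \<in> V" using shift_lin(2)[OF V] Suc.prems(1) by auto
    moreover have "(shift T c ^^ n) ?w = 0"
      using Suc.prems(2) by (metis comp_apply funpow_Suc_right)
    ultimately obtain u where u: "u \<in> V" "geig T c u" "shift T d u = ?w"
      using Suc.IH[of ?w] by blast
    define x where "x = inverse (c - d) \<cdot> (v - u)"
    have "shift T d (v - u) = (c - d) \<cdot> v"
      using V Suc.prems u by (simp add: lin_on_diff[OF V(1,2)] algebra_simps)
    moreover have "shift T d x = inverse (c - d) \<cdot> shift T d (v - u)"
      unfolding x_def using V Suc.prems u by (intro lin_onD(2)[OF shift_lin(1)[OF V]] subspace_diff)
    ultimately have "shift T d x = v" using \<open>c \<noteq> d\<close> by simp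
    moreover have "x \<in> V" using V Suc.prems u unfolding x_def by (simp add: subspace_diff subspace_scale)
    moreover have "geig T c x"
    proof -
      obtain m where m: "(shift T c ^^ m) u = 0" using u by (auto simp: geig_def)
      have P: "lin_on scale V scale (shift T c ^^ n)" for n
        by (rule funpow_lin(1)[OF V(1) shift_lin[OF V]])
      have kill: "(shift T c ^^ (a + b)) y = 0" if "y \<in> V" "(shift T c ^^ b) y = 0" for a b y
        using that lin_on_zero[OF V(1) P] by (simp add: funpow_add)
      have "(shift T c ^^ (m + Suc n)) v = 0" "(shift T c ^^ (m + Suc n)) u = 0"
        using kill[OF Suc.prems(1,2), of m] kill[OF u(1) m, of "Suc n"] by (auto simp: add.commute)
      moreover have "(shift T c ^^ (m + Suc n)) x = inverse (c - d) \<cdot>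
          ((shift T c ^^ (m + Suc n)) v - (shift T c ^^ (m + Suc n)) u)"
        unfolding x_def lin_on_diff[OF V(1) P Suc.prems(1) u(1), symmetric]
        by (rule lin_onD(2)[OF P subspace_diff[OF V(1) Suc.prems(1) u(1)]])
      ultimately have "(shift T c ^^ (m + Suc n)) x = 0"
        by (simp only: diff_0_right scale_zero_right)
      then show ?thesis unfolding geig_def by (rule exI)
    qed
    ultimately show ?case by blast
  qed
qed

text \<open>The factors are peeled off one at a time: by \<open>geig_shift_preimage\<close>, \<open>T - d\<close> can be inverted on
  generalised eigenvectors of all other eigenvalues.\<close>

lemma geig_decomposition:
  assumes V: "subspace V" "lin_on scale V scale T" "T ` V \<subseteq> V"
    and "v \<in> V" "foldr (\<lambda>c w. shift T c w) cs v = 0"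
  shows "\<exists>w. (\<forall>c\<in>set cs. w c \<in> V \<and> geig T c (w c)) \<and> v = (\<Sum>c\<in>set cs. w c)"
proof -
  have "\<exists>w. (\<forall>c\<in>set cs. w c \<in> V \<and> geig T c (w c)) \<and> v = (\<Sum>c\<in>set cs. w c)"
    if "v \<in> V" "foldr (\<lambda>c w. shift T c w) (rev cs) v = 0" for v cs
    using that
  proof (induction cs arbitrary: v)
    case (Cons d cs)
    have "shift T d v \<in> V" using shift_lin(2)[OF V] Cons.prems by auto
    then obtain w where w: "\<forall>c\<in>set cs. w c \<in> V \<and> geig T c (w c)" "shift T d v = (\<Sum>c\<in>set cs. w c)"
      using Cons.IH[of "shift T d v"] Cons.prems(2) by (auto simp del: fun_upd_apply)
    have "\<exists>u. u \<in> V \<and> geig T c u \<and> shift T d u = w c" if "c \<in> set cs - {d}" for c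
    proof -
      have "c \<noteq> d" "w c \<in> V" "geig T c (w c)" using w that by auto
      from geig_shift_preimage[OF V this] show ?thesis by blast
    qed
    then obtain u where u: "\<And>c. c \<in> set cs - {d} \<Longrightarrow> u c \<in> V \<and> geig T c (u c) \<and> shift T d (u c) = w c"
      by metis
    define u0 where "u0 = v - (\<Sum>c\<in>set cs - {d}. u c)"
    have su: "(\<Sum>c\<in>set cs - {d}. u c) \<in> V" using u V by (intro subspace_sum) auto
    have u0: "u0 \<in> V" unfolding u0_def using su V Cons.prems by (simp add: subspace_diff)
    have "shift T d u0 = shift T d v - shift T d (\<Sum>c\<in>set cs - {d}. u c)"
      unfolding u0_def by (rule lin_on_diff[OF V(1) shift_lin(1)[OF V] Cons.prems(1) su])
    also have "shift T d (\<Sum>c\<in>set cs - {d}. u c) = (\<Sum>c\<in>set cs - {d}. w c)"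
      using u by (subst lin_on_sum[OF V(1) shift_lin(1)[OF V]]) auto
    also have "shift T d v - \<dots> = (if d \<in> set cs then w d else 0)"
      unfolding w(2) by (auto simp: sum_diff1)
    finally have s: "shift T d u0 = (if d \<in> set cs then w d else 0)" .
    have "geig T d (shift T d u0)" unfolding s using w(1) geig_zero by auto
    then have "geig T d u0" unfolding geig_def by (metis comp_apply funpow_Suc_right)
    moreover have "v = (\<Sum>c\<in>set (d # cs). (u(d := u0)) c)"
    proof -
      have "(\<Sum>c\<in>set (d # cs). (u(d := u0)) c) = u0 + (\<Sum>c\<in>set cs - {d}. (u(d := u0)) c)"
        by (simp add: sum.insert_remove)
      also have "(\<Sum>c\<in>set cs - {d}. (u(d := u0)) c) = (\<Sum>c\<in>set cs - {d}. u c)"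
        by (intro sum.cong) auto
      finally show ?thesis by (simp add: u0_def)
    qed
    moreover have "\<forall>c\<in>set (d # cs). (u(d := u0)) c \<in> V \<and> geig T c ((u(d := u0)) c)"
      using u u0 calculation(1) by simp
    ultimately show ?case by (intro exI[of _ "u(d := u0)"] conjI)
  qed simp
  from this[of v "rev cs", unfolded rev_rev_ident set_rev, OF assms(4,5)] show ?thesis .
qed

end

context linear_space
begin

lemma geig_add:
  assumes V: "subspace V" "lin_on scale V scale T" "T ` V \<subseteq> V"
    and "x \<in> V" "y \<in> V" "geig T c x" "geig T c y"
  shows "geig T c (x + y)"
proof -
  have P: "lin_on scale V scale (shift T c ^^ n)" for n
    by (rule funpow_lin(1)[OF V(1) shift_lin[OF V]])
  obtain a b where ab: "(shift T c ^^ a) x = 0" "(shift T c ^^ b) y = 0"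
    using assms(6,7) unfolding geig_def by blast
  have "(shift T c ^^ (b + a)) x = 0" "(shift T c ^^ (a + b)) y = 0"
    using ab lin_on_zero[OF V(1) P] by (simp_all add: funpow_add)
  then have "(shift T c ^^ (a + b)) (x + y) = 0"
    using lin_onD(1)[OF P assms(4,5)] by (simp add: add.commute)
  then show ?thesis unfolding geig_def by (rule exI)
qed

lemma geig_scale:
  assumes V: "subspace V" "lin_on scale V scale T" "T ` V \<subseteq> V"
    and "x \<in> V" "geig T c x"
  shows "geig T c (a \<cdot> x)"
proof -
  have P: "lin_on scale V scale (shift T c ^^ n)" for n
    by (rule funpow_lin(1)[OF V(1) shift_lin[OF V]])
  obtain n where n: "(shift T c ^^ n) x = 0" using assms(5) unfolding geig_def by blast
  then have "(shift T c ^^ n) (a \<cdot> x) = 0" using lin_onD(2)[OF P assms(4)] by simp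
  then show ?thesis unfolding geig_def by (rule exI)
qed

lemma subspace_geig:
  assumes V: "subspace V" "lin_on scale V scale T" "T ` V \<subseteq> V"
  shows "subspace {v \<in> V. geig T c v}"
  using assms
  by (intro subspaceI) (auto simp: geig_zero subspace_0 subspace_add subspace_scale
      intro: geig_add[OF V] geig_scale[OF V])

lemma geig_eigenvector: "T v = c \<cdot> v \<Longrightarrow> geig T c v"
  unfolding geig_def by (rule exI[of _ 1]) simp

text \<open>Define \<open>D\<close> on a basis of generalised eigenvectors; \<open>geig_components\<close> shows that a generalised
  eigenvector involves only basis vectors with the same eigenvalue.\<close>

lemma geig_functional_calculus:
  assumes V: "fin_dim V" "lin_on scale V scale T" "T ` V \<subseteq> V"
    and sp: "V \<subseteq> span {v \<in> V. \<exists>c. geig T c v}"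
  obtains D where "lin_on scale V scale D" "D ` V \<subseteq> V"
    "\<And>c v. v \<in> V \<Longrightarrow> geig T c v \<Longrightarrow> D v = h c \<cdot> v"
proof -
  note sV = fin_dim_subspace[OF V(1)]
  have "span {v \<in> V. \<exists>c. geig T c v} = V"
    using sp span_minimal[of "{v \<in> V. \<exists>c. geig T c v}" V] sV by auto
  then obtain B where B: "B \<subseteq> {v \<in> V. \<exists>c. geig T c v}" "finite B" "independent B" "span B = V"
    by (rule basis_within[OF V(1)])
  have "\<forall>b\<in>B. \<exists>c. geig T c b" using B(1) by auto
  from bchoice[OF this] obtain e where e: "\<And>b. b \<in> B \<Longrightarrow> geig T (e b) b" by blast
  have BV: "b \<in> V" if "b \<in> B" for b using B(1) that by auto
  have ex: "(\<Sum>b\<in>B. representation B v b \<cdot> b) = v" if "v \<in> V" for v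
    using sum_representation_eq[of B v B] B that by auto
  define D where "D v = (\<Sum>b\<in>B. (representation B v b * h (e b)) \<cdot> b)" for v
  show ?thesis
  proof
    show "lin_on scale V scale D"
      unfolding lin_on_def D_def using B
      by (auto simp: representation_add representation_scale distrib_right scale_left_distrib
          sum.distrib scale_sum_right mult.assoc)
    show "D ` V \<subseteq> V"
      unfolding D_def by (intro image_subsetI subspace_sum[OF sV] subspace_scale[OF sV] BV)
  next
    fix c v assume v: "v \<in> V" "geig T c v"
    define w where "w d = (\<Sum>b\<in>{b \<in> B. e b = d}. representation B v b \<cdot> b)" for d
    have wg: "w d \<in> {v \<in> V. geig T d v}" for d
      unfolding w_def using BV e
      by (intro subspace_sum subspace_scale subspace_geig[OF sV V(2,3)]) auto
    let ?u = "\<lambda>d. w d - (if d = c then v else 0)"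
    have ug: "?u d \<in> {v \<in> V. geig T d v}" for d
      using v wg[of d] subspace_diff[OF subspace_geig[OF sV V(2,3), of d]] by auto
    let ?S = "insert c (e ` B)"
    have sw: "(\<Sum>d\<in>?S. w d) = v"
    proof -
      have "(\<Sum>d\<in>?S. w d) = (\<Sum>b\<in>B. representation B v b \<cdot> b)"
        unfolding w_def using B(2) by (intro sum.group) auto
      then show ?thesis using ex[OF v(1)] by simp
    qed
    have "(\<Sum>d\<in>?S. ?u d) \<in> {0}" using sw B(2) by (simp add: sum_subtractf)
    then have "\<forall>d\<in>?S. ?u d \<in> {0}"
      using ug B(2) sV lin_on_zero[OF sV V(2)]
      by (intro geig_components[OF sV V(2,3)]) (auto simp: subspace_0)
    then have w: "w d = (if d = c then v else 0)" if "d \<in> ?S" for d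
      using bspec[OF \<open>\<forall>d\<in>?S. ?u d \<in> {0}\<close> that] by auto
    have "D v = (\<Sum>d\<in>?S. \<Sum>b\<in>{b \<in> B. e b = d}. (representation B v b * h (e b)) \<cdot> b)"
      unfolding D_def using B(2) by (intro sum.group[symmetric]) auto
    also have "\<dots> = (\<Sum>d\<in>?S. h d \<cdot> w d)"
      unfolding w_def by (auto intro!: sum.cong simp: scale_sum_right mult.commute)
    also have "\<dots> = (\<Sum>d\<in>?S. if d = c then h c \<cdot> v else 0)"
      by (intro sum.cong refl) (simp add: w)
    also have "\<dots> = h c \<cdot> v" using B(2) by (simp add: sum.delta)
    finally show "D v = h c \<cdot> v" .
  qed
qed

text \<open>The trace on \<open>T\<^sup>k V\<close> equals the trace on \<open>T\<^sup>k\<^sup>+\<^sup>1 V\<close>, by commuting \<open>T\<close> with the inclusion; the chain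
  ends in \<open>0\<close>.\<close>

lemma tr_nilpotent:
  assumes V: "fin_dim V" "lin_on scale V scale T" "T ` V \<subseteq> V"
    and nil: "\<And>v. v \<in> V \<Longrightarrow> \<exists>n. (T ^^ n) v = 0"
  shows "tr V T = 0"
proof -
  note sV = fin_dim_subspace[OF V(1)]
  obtain B where B: "finite B" "span B = V" using V(1) by (auto simp: fin_dim_def)
  have BV: "B \<subseteq> V" using B span_superset by blast
  note P = funpow_lin[OF sV V(2,3)]
  have up: "(T ^^ (a + n)) v = 0" if "v \<in> V" "(T ^^ n) v = 0" for v n a
    using that lin_on_zero[OF sV P(1)] by (simp add: funpow_add)
  have "\<forall>b\<in>B. \<exists>n. (T ^^ n) b = 0" using nil BV by blast
  from bchoice[OF this] obtain m where m: "\<And>b. b \<in> B \<Longrightarrow> (T ^^ m b) b = 0" by blast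
  define N where "N = sum m B"
  have NB: "(T ^^ N) b = 0" if "b \<in> B" for b
  proof -
    have "m b \<le> N" unfolding N_def using B that by (intro member_le_sum) auto
    then show ?thesis using up[of b "m b" "N - m b"] m[OF that] BV that by auto
  qed
  have N: "(T ^^ N) v = 0" if "v \<in> V" for v
  proof -
    have "v \<in> span B" using that B by simp
    then have "v \<in> V \<and> (T ^^ N) v = 0"
    proof (induction rule: span_induct_alt)
      case base
      then show ?case using sV lin_on_zero[OF sV P(1)] by (auto simp: subspace_0)
    next
      case (step c x y)
      then have "x \<in> V" using BV by auto
      then show ?case using step NB[of x] sV
        by (simp add: lin_onD[OF P(1)] subspace_add subspace_scale)
    qed
    then show ?thesis by simp
  qed
  define W where "W k = (T ^^ k) ` V" for k
  have WV: "W k \<subseteq> V" for k unfolding W_def using P(2) by blast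
  have sW: "subspace (W k)" for k unfolding W_def by (rule subspace_lin_image[OF sV P(1)])
  have fW: "fin_dim (W k)" for k by (rule fin_dim_sub[OF V(1) sW WV])
  have TW: "T ` W k = W (Suc k)" for k unfolding W_def by (simp add: image_image)
  have sub: "W (Suc k) \<subseteq> W k" for k
    unfolding W_def using V(3) by (metis comp_apply funpow_Suc_right image_comp image_mono)
  have step: "tr (W k) T = tr (W (Suc k)) T" for k
    by (rule tr_commute[OF linear_space_axioms linear_space_axioms fW fW, where g = "\<lambda>x. x"])
       (use TW sub lin_on_subset[OF V(2) WV] in \<open>auto simp: lin_on_def\<close>)
  have "tr V T = tr (W 0) T" by (simp add: W_def)
  also have "\<dots> = tr (W k) T" for k by (induction k) (simp, metis step)
  finally have "tr V T = tr (W N) T" .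
  also have "W N = {0}" using N unfolding W_def using sV subspace_0 by force
  also have "tr {0} T = 0"
  proof -
    have fr: "frame {0} ({} :: 'v set) (\<lambda>b. b) (\<lambda>b v. 0)" by (simp add: frame_def)
    have "tr {0} T = (\<Sum>i\<in>({} :: 'v set). 0)"
      using lin_on_zero[OF sV V(2)]
      by (intro tr_frame[OF _ fr]) (auto simp: lin_on_def)
    then show ?thesis by simp
  qed
  finally show ?thesis .
qed

lemma span_Union_subspaces:
  assumes "\<And>c. subspace (E c)" "v \<in> span (\<Union>c\<in>C. E c)"
  shows "\<exists>S w. finite S \<and> S \<subseteq> C \<and> (\<forall>c. w c \<in> E c) \<and> v = (\<Sum>c\<in>S. w c)"
  using assms(2)
proof (induction rule: span_induct_alt)
  case base
  show ?case using assms(1) subspace_0 by (intro exI[of _ "{}"] exI[of _ "\<lambda>_. 0"]) auto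
next
  case (step a x y)
  then obtain S w where S: "finite S" "S \<subseteq> C" "\<And>c. w c \<in> E c" "y = (\<Sum>c\<in>S. w c)" by blast
  obtain d where d: "d \<in> C" "x \<in> E d" using step by auto
  define w' where "w' c = (if c \<in> S then w c else 0) + (if c = d then a \<cdot> x else 0)" for c
  have "a \<cdot> x + y = (\<Sum>c\<in>insert d S. w' c)"
  proof -
    have "(\<Sum>c\<in>insert d S. w' c) =
        (\<Sum>c\<in>insert d S. if c \<in> S then w c else 0) + (\<Sum>c\<in>insert d S. if c = d then a \<cdot> x else 0)"
      by (simp only: w'_def sum.distrib)
    also have "(\<Sum>c\<in>insert d S. if c \<in> S then w c else 0) = (\<Sum>c\<in>S. w c)"
      using S(1) by (intro sum.mono_neutral_cong_right) auto
    also have "(\<Sum>c\<in>insert d S. if c = d then a \<cdot> x else 0) = a \<cdot> x"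
      using S(1) by (subst sum.delta) auto
    finally show ?thesis using S(4) by (simp add: add.commute)
  qed
  moreover have "\<forall>c. w' c \<in> E c"
    using S(3) d(2) assms(1) unfolding w'_def
    by (auto intro!: subspace_add[OF assms(1)] subspace_scale[OF assms(1)] subspace_0[OF assms(1)])
  ultimately show ?case using S d by (intro exI[of _ "insert d S"] exI[of _ w']) auto
qed

lemma eigenvectors_span_subspace:
  assumes V: "subspace V" "lin_on scale V scale T" "T ` V \<subseteq> V"
    and sp: "V \<subseteq> span {v \<in> V. \<exists>c\<in>C. T v = c \<cdot> v}"
    and W: "subspace W" "W \<subseteq> V" "T ` W \<subseteq> W"
  shows "W \<subseteq> span {v \<in> W. \<exists>c\<in>C. T v = c \<cdot> v}"
proof
  fix x assume x: "x \<in> W"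
  let ?E = "\<lambda>c. {v \<in> V. T v = c \<cdot> v}"
  have "{v \<in> V. \<exists>c\<in>C. T v = c \<cdot> v} = (\<Union>c\<in>C. ?E c)" by auto
  then have "x \<in> span (\<Union>c\<in>C. ?E c)" using x W sp by auto
  from span_Union_subspaces[OF subspace_eigen[OF V(1,2)] this]
  obtain S w where S: "finite S" "S \<subseteq> C" "\<And>c. w c \<in> ?E c" "x = (\<Sum>c\<in>S. w c)" by blast
  have "\<forall>c\<in>S. w c \<in> W"
    using S x geig_eigenvector by (intro geig_components[OF V W]) auto
  then have "w c \<in> span {v \<in> W. \<exists>c\<in>C. T v = c \<cdot> v}" if "c \<in> S" for c
    using S that by (intro span_base) auto
  then show "x \<in> span {v \<in> W. \<exists>c\<in>C. T v = c \<cdot> v}"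
    unfolding S(4) by (rule span_sum)
qed

text \<open>By induction on the number of operators: a joint eigenspace of the first \<open>k\<close> is stable under the
  next one, which is diagonalisable there by \<open>eigenvectors_span_subspace\<close>.\<close>

lemma joint_eigenvectors_span:
  fixes T :: "nat \<Rightarrow> 'v \<Rightarrow> 'v"
  assumes V: "subspace V" "\<And>l. l < r \<Longrightarrow> lin_on scale V scale (T l)" "\<And>l. l < r \<Longrightarrow> T l ` V \<subseteq> V"
    and comm: "\<And>l m v. l < r \<Longrightarrow> m < r \<Longrightarrow> v \<in> V \<Longrightarrow> T l (T m v) = T m (T l v)"
    and sp: "\<And>l. l < r \<Longrightarrow> V \<subseteq> span {v \<in> V. \<exists>c\<in>C. T l v = c \<cdot> v}"
  shows "V \<subseteq> span {v \<in> V. \<exists>\<mu>. \<forall>l<r. \<mu> l \<in> C \<and> T l v = \<mu> l \<cdot> v}"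
proof -
  have "V \<subseteq> span {v \<in> V. \<exists>\<mu>. \<forall>l<k. \<mu> l \<in> C \<and> T l v = \<mu> l \<cdot> v}" if "k \<le> r" for k
    using that
  proof (induction k)
    case 0
    then show ?case using span_superset by auto
  next
    case (Suc k)
    then have k: "k < r" by simp
    let ?G = "{v \<in> V. \<exists>\<mu>. \<forall>l<Suc k. \<mu> l \<in> C \<and> T l v = \<mu> l \<cdot> v}"
    have "v \<in> span ?G" if v: "v \<in> V" "\<forall>l<k. \<mu> l \<in> C \<and> T l v = \<mu> l \<cdot> v" for v \<mu>
    proof -
      define W where "W = {v \<in> V. \<forall>l<k. T l v = \<mu> l \<cdot> v}"
      have W: "subspace W"
      proof -
        have "subspace {v \<in> V. T l v = \<mu> l \<cdot> v}" if "l < k" for l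
          using subspace_eigen[OF V(1) V(2)] that k by simp
        then have "subspace (V \<inter> (\<Inter>l\<in>{..<k}. {v \<in> V. T l v = \<mu> l \<cdot> v}))"
          by (intro subspace_inter V(1) subspace_Int) auto
        also have "V \<inter> (\<Inter>l\<in>{..<k}. {v \<in> V. T l v = \<mu> l \<cdot> v}) = W"
          by (auto simp: W_def)
        finally show ?thesis .
      qed
      have TW: "T k ` W \<subseteq> W"
      proof
        fix y assume "y \<in> T k ` W"
        then obtain w where w: "w \<in> V" "\<And>l. l < k \<Longrightarrow> T l w = \<mu> l \<cdot> w" "y = T k w" by (auto simp: W_def)
        have "T l (T k w) = \<mu> l \<cdot> T k w" if "l < k" for l
          using comm[of l k w] that k w lin_onD(2)[OF V(2)[OF k]] by simp
        then show "y \<in> W" using w V(3)[OF k] by (auto simp: W_def)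
      qed
      have "W \<subseteq> span {v \<in> W. \<exists>c\<in>C. T k v = c \<cdot> v}"
        by (rule eigenvectors_span_subspace[OF V(1) V(2)[OF k] V(3)[OF k] sp[OF k] W _ TW])
           (auto simp: W_def)
      also have "\<dots> \<subseteq> span ?G"
      proof (rule span_mono, rule subsetI)
        fix u assume "u \<in> {v \<in> W. \<exists>c\<in>C. T k v = c \<cdot> v}"
        then obtain c where u: "u \<in> W" "c \<in> C" "T k u = c \<cdot> u" by auto
        then have "\<forall>l<Suc k. (\<mu>(k := c)) l \<in> C \<and> T l u = (\<mu>(k := c)) l \<cdot> u"
          using v by (auto simp: W_def less_Suc_eq)
        moreover have "u \<in> V" using u by (simp add: W_def)
        ultimately show "u \<in> ?G" by blast
      qed
      finally show ?thesis using v by (auto simp: W_def)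
    qed
    then have "{v \<in> V. \<exists>\<mu>. \<forall>l<k. \<mu> l \<in> C \<and> T l v = \<mu> l \<cdot> v} \<subseteq> span ?G" by blast
    then have "span {v \<in> V. \<exists>\<mu>. \<forall>l<k. \<mu> l \<in> C \<and> T l v = \<mu> l \<cdot> v} \<subseteq> span ?G"
      by (rule span_minimal) simp
    then show ?case using Suc by auto
  qed
  then show ?thesis by simp
qed

text \<open>\<open>p(T) v\<close>, evaluated by Horner's rule.\<close>

definition papply :: "('v \<Rightarrow> 'v) \<Rightarrow> 'k poly \<Rightarrow> 'v \<Rightarrow> 'v" where
  "papply T p v = fold_coeffs (\<lambda>a w. a \<cdot> v + T w) p 0"

lemma papply_pCons:
  assumes V: "subspace V" "lin_on scale V scale T"
  shows "papply T (pCons a p) v = a \<cdot> v + T (papply T p v)"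
  using lin_on_zero[OF V]
  by (cases "p = 0 \<and> a = 0") (auto simp: papply_def)

lemma papply_0 [simp]: "papply T 0 v = 0"
  by (simp add: papply_def)

lemma papply_in:
  assumes V: "subspace V" "lin_on scale V scale T" "T ` V \<subseteq> V" "v \<in> V"
  shows "papply T p v \<in> V"
  using V by (induction p) (auto simp: papply_pCons[OF V(1,2)] subspace_0 intro!: subspace_add subspace_scale)

lemma papply_add:
  assumes V: "subspace V" "lin_on scale V scale T" "T ` V \<subseteq> V" "v \<in> V"
  shows "papply T (p + q) v = papply T p v + papply T q v"
proof (induction p arbitrary: q)
  case (pCons a p)
  show ?case
  proof (cases q)
    case (pCons b r)
    then show ?thesis
      using pCons.IH papply_in[OF V]
      by (simp add: papply_pCons[OF V(1,2)] lin_onD(1)[OF V(2)] scale_left_distrib)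
  qed
qed simp

lemma papply_smult:
  assumes V: "subspace V" "lin_on scale V scale T" "T ` V \<subseteq> V" "v \<in> V"
  shows "papply T (smult c p) v = c \<cdot> papply T p v"
  using papply_in[OF V]
  by (induction p) (simp_all add: papply_pCons[OF V(1,2)] lin_onD(2)[OF V(2)] scale_right_distrib)

lemma papply_linear_factor:
  assumes V: "subspace V" "lin_on scale V scale T" "T ` V \<subseteq> V" "v \<in> V"
  shows "papply T ([:-c, 1:] * p) v = shift T c (papply T p v)"
proof -
  have "[:-c, 1:] * p = smult (-c) p + pCons 0 p" by simp
  then show ?thesis
    by (simp only: papply_add[OF V] papply_smult[OF V] papply_pCons[OF V(1,2)]) simp
qed

text \<open>The vectors \<open>T\<^sup>i v\<close> are linearly dependent.\<close>

lemma exists_annihilating_poly: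
  assumes V: "fin_dim V" "lin_on scale V scale T" "T ` V \<subseteq> V" and v: "v \<in> V"
  shows "\<exists>p. p \<noteq> 0 \<and> papply T p v = 0"
proof -
  note sV = fin_dim_subspace[OF V(1)]
  note V' = sV V(2,3) v
  obtain B where B: "finite B" "span B = V" using V(1) by (auto simp: fin_dim_def)
  let ?S = "\<lambda>n. (\<lambda>i. (T ^^ i) v) ` {..<n}"
  have pw: "(T ^^ n) v \<in> V" for n using funpow_lin(2)[OF sV V(2,3)] v by blast
  have "\<exists>n. (T ^^ n) v \<in> span (?S n)"
  proof (rule ccontr)
    assume "\<not> ?thesis"
    then have n: "(T ^^ n) v \<notin> span (?S n)" for n by blast
    have "independent (?S n) \<and> card (?S n) = n" for n
    proof (induction n)
      case (Suc n)
      have "?S (Suc n) = insert ((T ^^ n) v) (?S n)" by (simp add: lessThan_Suc)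
      moreover have "(T ^^ n) v \<notin> ?S n"
        by (rule contrapos_nn[OF n[of n]]) (rule span_base)
      ultimately have "independent (?S (Suc n))" "card (?S (Suc n)) = Suc n"
        using Suc independent_insertI[OF n[of n]] by simp_all
      then show ?case by blast
    qed (simp add: independent_empty)
    moreover have "?S n \<subseteq> span B" for n using pw B by auto
    ultimately have "n \<le> card B" for n using independent_span_bound[OF B(1), of "?S n"] by metis
    then show False using not_less_eq_eq by blast
  qed
  then obtain n where n: "(T ^^ n) v \<in> span (?S n)" by blast
  have mono: "papply T (monom 1 k) v = (T ^^ k) v" for k
    by (induction k) (simp_all add: monom_0 monom_Suc papply_pCons[OF sV V(2)] lin_on_zero[OF sV V(2)])
  have "\<exists>p. degree p < Suc n \<and> coeff p n = 0 \<and> papply T p v = w" if "w \<in> span (?S n)" for w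
    using that
  proof (induction rule: span_induct_alt)
    case base
    show ?case by (rule exI[of _ 0]) simp
  next
    case (step c x y)
    then obtain p i where p: "degree p < Suc n" "coeff p n = 0" "papply T p v = y" and i: "i < n" "x = (T ^^ i) v"
      by auto
    have "degree (smult c (monom 1 i) + p) < Suc n"
      using p i by (intro degree_add_less) (auto simp: degree_monom_eq intro: le_less_trans[OF degree_smult_le])
    then show ?case using p i
      by (intro exI[of _ "smult c (monom 1 i) + p"])
         (simp add: papply_add[OF V'] papply_smult[OF V'] mono)
  qed
  from this[OF n] obtain p where p: "coeff p n = 0" "papply T p v = (T ^^ n) v" by blast
  have "papply T (monom 1 n + smult (-1) p) v = 0"
    by (simp only: papply_add[OF V'] papply_smult[OF V'] mono p) simp
  moreover have "coeff (monom 1 n + smult (-1) p) n \<noteq> 0" using p by simp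
  then have "monom 1 n + smult (-1) p \<noteq> 0" by (metis coeff_0)
  ultimately show ?thesis by blast
qed

text \<open>Divide an annihilating polynomial of \<open>v\<close> by a power of the variable until its constant term is
  nonzero; then it expresses \<open>v\<close> as a value of \<open>F\<close>.\<close>

lemma injective_endo_surjective:
  assumes V: "fin_dim V" "lin_on scale V scale F" "F ` V \<subseteq> V"
    and inj: "\<And>x. x \<in> V \<Longrightarrow> F x = 0 \<Longrightarrow> x = 0" and v: "v \<in> V"
  shows "\<exists>w\<in>V. F w = v"
proof -
  note sub = fin_dim_subspace[OF V(1)]
  obtain p where "p \<noteq> 0" "papply F p v = 0"
    using exists_annihilating_poly[OF V v] by blast
  then show ?thesis
  proof (induction p)
    case (pCons a p)
    have in_V: "papply F p v \<in> V" by (rule papply_in[OF sub V(2,3) v])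
    have eq: "a \<cdot> v + F (papply F p v) = 0"
      using pCons.prems(2) papply_pCons[OF sub V(2)] by simp
    show ?case
    proof (cases "a = 0")
      case True
      then have "F (papply F p v) = 0" using eq by simp
      then show ?thesis using inj[OF in_V] pCons True by auto
    next
      case False
      have "F ((- inverse a) \<cdot> papply F p v) = (- inverse a) \<cdot> F (papply F p v)"
        by (rule lin_onD(2)[OF V(2) in_V])
      also have "F (papply F p v) = - (a \<cdot> v)" using eq by (simp add: eq_neg_iff_add_eq_0 add.commute)
      finally have "F ((- inverse a) \<cdot> papply F p v) = v" using False by simp
      then show ?thesis using subspace_scale[OF sub in_V] by blast
    qed
  qed simp
qed

lemma papply_linear_factors:
  assumes V: "subspace V" "lin_on scale V scale T" "T ` V \<subseteq> V" "v \<in> V"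
  shows "papply T (prod_list (map (\<lambda>c. [:-c, 1:]) cs)) v = foldr (\<lambda>c w. shift T c w) cs v"
proof (induction cs)
  case Nil
  then show ?case
    using lin_on_zero[OF V(1,2)] by (simp add: one_pCons papply_pCons[OF V(1,2)])
next
  case (Cons c cs)
  then show ?case by (simp only: list.map prod_list.Cons papply_linear_factor[OF V] foldr.simps comp_apply)
qed

end

lemma geig_span_alg_closed:
  fixes s :: "'k::alg_closed_field \<Rightarrow> 'v::ab_group_add \<Rightarrow> 'v"
  assumes "linear_space s"
    and V: "linear_space.fin_dim s V" "lin_on s V s T" "T ` V \<subseteq> V"
  shows "V \<subseteq> module.span s {v \<in> V. \<exists>c. linear_space.geig s T c v}"
proof
  interpret linear_space s by fact
  fix v assume v: "v \<in> V"
  note V' = fin_dim_subspace[OF V(1)] V(2,3)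
  obtain p where p: "p \<noteq> 0" "papply T p v = 0" using exists_annihilating_poly[OF V v] by blast
  obtain A where A: "p = smult (lead_coeff p) (\<Prod>x\<in>#A. [:-x, 1:])"
    using alg_closed_imp_factorization[OF p(1)] by blast
  obtain cs where cs: "mset cs = A" using ex_mset by blast
  define c where "c = lead_coeff p"
  have "(\<Prod>x\<in>#A. [:-x, 1:]) = prod_list (map (\<lambda>a. [:-a, 1:]) cs)"
    unfolding cs[symmetric] by (metis mset_map prod_mset_prod_list)
  then have c: "c \<noteq> 0" "p = smult c (prod_list (map (\<lambda>a. [:-a, 1:]) cs))"
    using A p(1) by (simp_all add: c_def)
  have "s c (foldr (\<lambda>c w. shift T c w) cs v) = 0"
    using p(2) unfolding c(2) papply_smult[OF V' v] papply_linear_factors[OF V' v] .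
  then have "foldr (\<lambda>c w. shift T c w) cs v = 0" using c(1) by simp
  from geig_decomposition[OF V' v this] obtain w where
    w: "\<And>c. c \<in> set cs \<Longrightarrow> w c \<in> V \<and> geig T c (w c)" "v = (\<Sum>c\<in>set cs. w c)" by blast
  show "v \<in> span {v \<in> V. \<exists>c. geig T c v}"
    unfolding w(2) by (intro span_sum span_base) (use w(1) in blast)
qed

text \<open>The functionals separate points of the field.  They carry relations between eigenvalues to
  relations between rational numbers, where sums of squares can be used.\<close>

lemma exists_rational_functional:
  fixes \<delta> :: "'k::field_char_0"
  assumes "\<delta> \<noteq> 0"
  obtains f :: "'k \<Rightarrow> rat" where "\<And>x y. f (x + y) = f x + f y" "\<And>q x. f (of_rat q * x) = q * f x" "f \<delta> \<noteq> 0"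
proof -
  let ?s = "\<lambda>(q::rat) (x::'k). of_rat q * x"
  have 1: "vector_space ?s"
    by unfold_locales (auto simp: algebra_simps of_rat_add of_rat_mult)
  have 2: "vector_space ((*) :: rat \<Rightarrow> rat \<Rightarrow> rat)"
    by unfold_locales (auto simp: algebra_simps)
  interpret p: vector_space_pair ?s "(*) :: rat \<Rightarrow> rat \<Rightarrow> rat"
    using 1 2 by (simp add: vector_space_pair_def)
  have "p.vs1.independent {\<delta>}" using assms by simp
  from p.linear_independent_extend[OF this, of "\<lambda>_. 1"]
  obtain g where g: "Vector_Spaces.linear ?s (*) g" "g \<delta> = 1" by auto
  interpret g: Vector_Spaces.linear ?s "(*)" g by fact
  show ?thesis by (rule that[of g]) (use g g.add g.scale in auto)
qed

section \<open>Polynomial functions and the Lie algebra of a matrix group\<close>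

definition fscale :: "('k::field \<Rightarrow> 'b::ab_group_add \<Rightarrow> 'b) \<Rightarrow> 'k \<Rightarrow> ('a \<Rightarrow> 'b) \<Rightarrow> 'a \<Rightarrow> 'b" where
  "fscale s c F = (\<lambda>x. s c (F x))"

lemma linear_space_fscale: "linear_space s \<Longrightarrow> linear_space (fscale s)"
proof -
  assume "linear_space s"
  then interpret linear_space s .
  show ?thesis
    by unfold_locales (auto simp: fscale_def fun_eq_iff scale_right_distrib scale_left_distrib)
qed

lemma linear_space_mult: "linear_space ((*) :: 'k::field \<Rightarrow> 'k \<Rightarrow> 'k)"
  by unfold_locales (auto simp: algebra_simps)

lemma linear_space_vec: "linear_space ((*s) :: 'k::field \<Rightarrow> 'k^'n \<Rightarrow> 'k^'n)"
  by unfold_locales (auto simp: vec_eq_iff algebra_simps)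

global_interpretation ml: linear_space "mscale :: 'k::field \<Rightarrow> 'k^'n^'n \<Rightarrow> 'k^'n^'n"
  by unfold_locales

text \<open>The Leibniz rule makes eigenvalues additive: induct on the sum of the two nilpotency
  exponents.\<close>

lemma geig_product:
  assumes "linear_space s1" "linear_space s2" "linear_space s3"
    and V3: "module.subspace s3 V3" "lin_on s3 V3 s3 T3" "T3 ` V3 \<subseteq> V3"
    and V1: "\<And>x. x \<in> V1 \<Longrightarrow> T1 x - s1 c x \<in> V1" and V2: "\<And>y. y \<in> V2 \<Longrightarrow> T2 y - s2 d y \<in> V2"
    and \<beta>: "\<And>x y. x \<in> V1 \<Longrightarrow> y \<in> V2 \<Longrightarrow> \<beta> x y \<in> V3" "\<And>y. \<beta> 0 y = 0" "\<And>x. \<beta> x 0 = 0"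
    and leib: "\<And>x y. x \<in> V1 \<Longrightarrow> y \<in> V2 \<Longrightarrow>
       T3 (\<beta> x y) - s3 (c + d) (\<beta> x y) = \<beta> (T1 x - s1 c x) y + \<beta> x (T2 y - s2 d y)"
    and xy: "x \<in> V1" "y \<in> V2" "linear_space.geig s1 T1 c x" "linear_space.geig s2 T2 d y"
  shows "linear_space.geig s3 T3 (c + d) (\<beta> x y)"
proof -
  interpret s1: linear_space s1 by fact
  interpret s2: linear_space s2 by fact
  interpret s3: linear_space s3 by fact
  obtain a b where ab: "(s1.shift T1 c ^^ a) x = 0" "(s2.shift T2 d ^^ b) y = 0"
    using xy(3,4) unfolding s1.geig_def s2.geig_def by blast
  have "s3.geig T3 (c + d) (\<beta> x y)"
    if "x \<in> V1" "y \<in> V2" "(s1.shift T1 c ^^ a) x = 0" "(s2.shift T2 d ^^ b) y = 0" "a + b = n"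
    for n a b x y
    using that
  proof (induction n arbitrary: a b x y)
    case 0
    then show ?case by (simp add: \<beta> s3.geig_zero)
  next
    case (Suc n)
    show ?case
    proof (cases "a = 0 \<or> b = 0")
      case True
      then show ?thesis using Suc.prems by (auto simp: \<beta> s3.geig_zero)
    next
      case False
      then obtain a' b' where a': "a = Suc a'" "b = Suc b'" by (metis not0_implies_Suc)
      let ?x = "T1 x - s1 c x" and ?y = "T2 y - s2 d y"
      have x: "?x \<in> V1" "(s1.shift T1 c ^^ a') ?x = 0"
        using Suc.prems(3) V1[OF Suc.prems(1)] unfolding a' by (simp_all add: funpow_Suc_right del: funpow.simps)
      have y: "?y \<in> V2" "(s2.shift T2 d ^^ b') ?y = 0"
        using Suc.prems(4) V2[OF Suc.prems(2)] unfolding a' by (simp_all add: funpow_Suc_right del: funpow.simps)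
      have "s3.geig T3 (c + d) (\<beta> ?x y)"
        by (rule Suc.IH[OF x(1) Suc.prems(2) x(2) Suc.prems(4)]) (use Suc.prems(5) a' in simp)
      moreover have "s3.geig T3 (c + d) (\<beta> x ?y)"
        by (rule Suc.IH[OF Suc.prems(1) y(1) Suc.prems(3) y(2)]) (use Suc.prems(5) a' in simp)
      ultimately have "s3.geig T3 (c + d) (s3.shift T3 (c + d) (\<beta> x y))"
        unfolding leib[OF Suc.prems(1,2)]
        by (intro s3.geig_add[OF V3] \<beta>(1) x y Suc.prems)
      then show ?thesis unfolding s3.geig_def by (metis comp_apply funpow_Suc_right)
    qed
  qed
  from this[OF xy(1,2) ab refl] show ?thesis .
qed

text \<open>The functions \<open>mat_eval p\<close> (\<open>pfun_eq_range\<close>), in a form that lets derivations be computed by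
  induction.\<close>

inductive_set pfun :: "('k::field^'n^'n \<Rightarrow> 'k) set" where
  const: "(\<lambda>_. c) \<in> pfun"
| coord: "(\<lambda>A. A $ i $ j) \<in> pfun"
| add: "F \<in> pfun \<Longrightarrow> G \<in> pfun \<Longrightarrow> (\<lambda>A. F A + G A) \<in> pfun"
| mult: "F \<in> pfun \<Longrightarrow> G \<in> pfun \<Longrightarrow> (\<lambda>A. F A * G A) \<in> pfun"

lemma mpoly_eval_superset:
  assumes "finite S" "Poly_Mapping.keys p \<subseteq> S" "c 0 = 0"
  shows "mpoly_eval c x p = (\<Sum>m\<in>S. c (Poly_Mapping.lookup p m) *
        (\<Prod>v\<in>Poly_Mapping.keys m. x v ^ Poly_Mapping.lookup m v))"
  unfolding mpoly_eval_def
  by (rule sum.mono_neutral_left) (use assms in \<open>auto simp: in_keys_iff\<close>)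

lemma mpoly_eval_add:
  fixes p q :: "('v \<Rightarrow>\<^sub>0 nat) \<Rightarrow>\<^sub>0 'k::comm_ring_1"
  shows "mpoly_eval (\<lambda>c. c) x (p + q) = mpoly_eval (\<lambda>c. c) x p + mpoly_eval (\<lambda>c. c) x q"
proof -
  let ?S = "Poly_Mapping.keys p \<union> Poly_Mapping.keys q"
  have "Poly_Mapping.keys (p + q) \<subseteq> ?S" by (rule Poly_Mapping.keys_add)
  then show ?thesis
    by (simp add: mpoly_eval_superset[of ?S] lookup_add distrib_right sum.distrib)
qed

lemma mpoly_eval_single:
  "mpoly_eval (\<lambda>c. c) x (Poly_Mapping.single m c) = c * (\<Prod>v\<in>Poly_Mapping.keys m. x v ^ Poly_Mapping.lookup m v)"
  by (cases "c = 0") (auto simp: mpoly_eval_def)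

lemma monomial_eval_add:
  fixes m m' :: "'v \<Rightarrow>\<^sub>0 nat" and x :: "'v \<Rightarrow> 'k::comm_ring_1"
  shows "(\<Prod>v\<in>Poly_Mapping.keys (m + m'). x v ^ Poly_Mapping.lookup (m + m') v) =
    (\<Prod>v\<in>Poly_Mapping.keys m. x v ^ Poly_Mapping.lookup m v) *
    (\<Prod>v\<in>Poly_Mapping.keys m'. x v ^ Poly_Mapping.lookup m' v)"
proof -
  let ?S = "Poly_Mapping.keys m \<union> Poly_Mapping.keys m'"
  have e: "(\<Prod>v\<in>Poly_Mapping.keys n. x v ^ Poly_Mapping.lookup n v) = (\<Prod>v\<in>?S. x v ^ Poly_Mapping.lookup n v)"
    if "Poly_Mapping.keys n \<subseteq> ?S" for n
    by (rule prod.mono_neutral_left) (use that in \<open>auto simp: in_keys_iff\<close>)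
  show ?thesis
    by (subst e[OF Poly_Mapping.keys_add])
       (simp add: e[of m] e[of m'] lookup_add power_add prod.distrib)
qed

lemma mpoly_eval_sum:
  fixes f :: "'i \<Rightarrow> ('v \<Rightarrow>\<^sub>0 nat) \<Rightarrow>\<^sub>0 'k::comm_ring_1"
  shows "mpoly_eval (\<lambda>c. c) x (sum f A) = (\<Sum>i\<in>A. mpoly_eval (\<lambda>c. c) x (f i))"
  by (induction A rule: infinite_finite_induct) (auto simp: mpoly_eval_add mpoly_eval_def[of _ _ 0])

lemma mpoly_eval_mult:
  fixes p q :: "('v \<Rightarrow>\<^sub>0 nat) \<Rightarrow>\<^sub>0 'k::comm_ring_1"
  shows "mpoly_eval (\<lambda>c. c) x (p * q) = mpoly_eval (\<lambda>c. c) x p * mpoly_eval (\<lambda>c. c) x q"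
proof -
  let ?P = "Poly_Mapping.keys p" and ?Q = "Poly_Mapping.keys q"
  have "p * q = (\<Sum>u\<in>?P. Poly_Mapping.single u (Poly_Mapping.lookup p u)) *
                (\<Sum>v\<in>?Q. Poly_Mapping.single v (Poly_Mapping.lookup q v))"
    using sum_monomials[of p] sum_monomials[of q] by simp
  also have "\<dots> = (\<Sum>u\<in>?P. \<Sum>v\<in>?Q.
      Poly_Mapping.single (u + v) (Poly_Mapping.lookup p u * Poly_Mapping.lookup q v))"
    by (simp add: sum_product mult_single)
  finally show ?thesis
    by (simp add: mpoly_eval_sum mpoly_eval_single monomial_eval_add mpoly_eval_def[of _ _ p]
        mpoly_eval_def[of _ _ q] sum_product mult_ac)
qed

lemma pfun_sum: "(\<And>i. i \<in> I \<Longrightarrow> F i \<in> pfun) \<Longrightarrow> (\<lambda>A. \<Sum>i\<in>I. F i A) \<in> pfun"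
  by (induction I rule: infinite_finite_induct) (auto intro: pfun.intros)

lemma pfun_power: "F \<in> pfun \<Longrightarrow> (\<lambda>A. F A ^ n) \<in> pfun"
  by (induction n) (auto intro: pfun.intros)

lemma pfun_prod: "(\<And>i. i \<in> I \<Longrightarrow> F i \<in> pfun) \<Longrightarrow> (\<lambda>A. \<Prod>i\<in>I. F i A) \<in> pfun"
  by (induction I rule: infinite_finite_induct) (auto intro: pfun.intros)

lemma pfun_eq_range: "pfun = range mat_eval"
proof
  show "range mat_eval \<subseteq> pfun"
    unfolding mat_eval_def mpoly_eval_def
    by (auto intro!: pfun_sum pfun_prod pfun_power pfun.intros)
  show "pfun \<subseteq> range mat_eval"
  proof
    fix F :: "'k::field^'n^'n \<Rightarrow> 'k" assume "F \<in> pfun"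
    then show "F \<in> range mat_eval"
    proof induction
      case (const c)
      show ?case
        by (intro image_eqI[of _ _ "Poly_Mapping.single 0 c"]) (auto simp: mat_eval_def mpoly_eval_single)
    next
      case (coord i j)
      show ?case
        by (intro image_eqI[of _ _ "Poly_Mapping.single (Poly_Mapping.single (i, j) 1) 1"])
           (auto simp: mat_eval_def mpoly_eval_single)
    next
      case (add F G)
      then obtain p q where "F = mat_eval p" "G = mat_eval q" by auto
      then show ?case
        by (intro image_eqI[of _ _ "p + q"]) (auto simp: mat_eval_def mpoly_eval_add)
    next
      case (mult F G)
      then obtain p q where "F = mat_eval p" "G = mat_eval q" by auto
      then show ?case
        by (intro image_eqI[of _ _ "p * q"]) (auto simp: mat_eval_def mpoly_eval_mult)
    qed
  qed
qed

text \<open>The derivative of \<open>F\<close> at \<open>A\<close> in direction \<open>Z\<close>: the linear coefficient of the polynomial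
  \<open>F (A + s Z)\<close> in \<open>s\<close>, which is unique because the field is infinite.\<close>

definition ddir :: "('k::field_char_0^'n^'n \<Rightarrow> 'k) \<Rightarrow> 'k^'n^'n \<Rightarrow> 'k^'n^'n \<Rightarrow> 'k" where
  "ddir F A Z = coeff (THE q. \<forall>s. poly q s = F (A + s *\<^sub>M Z)) 1"

lemma ddir_eqI:
  assumes "\<And>s. poly q s = F (A + s *\<^sub>M Z)"
  shows "ddir F A Z = coeff q 1"
proof -
  have "(THE q. \<forall>s. poly q s = F (A + s *\<^sub>M Z)) = q"
    by (rule the_equality) (use assms in \<open>auto simp: poly_eq_poly_eq_iff[symmetric] fun_eq_iff\<close>)
  then show ?thesis by (simp add: ddir_def)
qed

lemma mat_eval_line:
  "poly (mpoly_eval (\<lambda>c. [:c:]) (\<lambda>(i, j). [:A $ i $ j, Z $ i $ j:]) p) s = mat_eval p (A + s *\<^sub>M Z)"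
  by (simp add: mat_eval_def mpoly_eval_def poly_sum poly_prod poly_power case_prod_unfold mscale_def)

lemma pfun_line: "F \<in> pfun \<Longrightarrow> \<exists>q. \<forall>s. poly q s = F (A + s *\<^sub>M Z)"
  unfolding pfun_eq_range using mat_eval_line by blast

lemma Lie_of_iff:
  "X \<in> Lie_of G \<longleftrightarrow> (\<forall>F\<in>pfun. (\<forall>A\<in>G. F A = 0) \<longrightarrow> ddir F (mat 1) X = 0)"
proof -
  have "ddir (mat_eval p) (mat 1) X =
      coeff (mpoly_eval (\<lambda>c. [:c:]) (\<lambda>(i, j). [:mat 1 $ i $ j, X $ i $ j:]) p) 1" for p
    by (rule ddir_eqI[OF mat_eval_line])
  then show ?thesis by (simp add: Lie_of_def pfun_eq_range)
qed

lemma ddir_const: "ddir (\<lambda>_. c) A Z = 0"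
  by (subst ddir_eqI[of "[:c:]"]) auto

lemma ddir_coord: "ddir (\<lambda>A. A $ i $ j) A Z = Z $ i $ j"
  by (subst ddir_eqI[of "[:A $ i $ j, Z $ i $ j:]"]) (auto simp: mscale_def)

lemma ddir_add:
  assumes "F \<in> pfun" "G \<in> pfun"
  shows "ddir (\<lambda>A. F A + G A) A Z = ddir F A Z + ddir G A Z"
proof -
  obtain p q where p: "\<And>s. poly p s = F (A + s *\<^sub>M Z)" and q: "\<And>s. poly q s = G (A + s *\<^sub>M Z)"
    using pfun_line assms by metis
  have "ddir (\<lambda>A. F A + G A) A Z = coeff (p + q) 1"
    by (rule ddir_eqI) (simp add: p q)
  then show ?thesis by (simp add: ddir_eqI[OF p] ddir_eqI[OF q])
qed

lemma ddir_mult: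
  assumes "F \<in> pfun" "G \<in> pfun"
  shows "ddir (\<lambda>A. F A * G A) A Z = ddir F A Z * G A + F A * ddir G A Z"
proof -
  obtain p q where p: "\<And>s. poly p s = F (A + s *\<^sub>M Z)" and q: "\<And>s. poly q s = G (A + s *\<^sub>M Z)"
    using pfun_line assms by metis
  have "ddir (\<lambda>A. F A * G A) A Z = coeff (p * q) 1"
    by (rule ddir_eqI) (simp add: p q)
  also have "\<dots> = coeff p 1 * coeff q 0 + coeff p 0 * coeff q 1"
    by (simp add: coeff_mult numeral_eq_Suc)
  also have "coeff p 0 = F A" using p[of 0] by (simp add: poly_0_coeff_0)
  also have "coeff q 0 = G A" using q[of 0] by (simp add: poly_0_coeff_0)
  finally show ?thesis by (simp add: ddir_eqI[OF p] ddir_eqI[OF q] algebra_simps)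
qed

text \<open>The left-invariant vector field on matrices with value \<open>X\<close> at \<open>1\<close>.\<close>

definition ldrv :: "'k::field_char_0^'n^'n \<Rightarrow> ('k^'n^'n \<Rightarrow> 'k) \<Rightarrow> 'k^'n^'n \<Rightarrow> 'k" where
  "ldrv X F = (\<lambda>A. ddir F A (A ** X))"

lemma ldrv_pfun: "F \<in> pfun \<Longrightarrow> ldrv X F \<in> pfun"
proof (induction rule: pfun.induct)
  case (const c)
  then show ?case by (simp add: ldrv_def ddir_const pfun.const)
next
  case (coord i j)
  show ?case unfolding ldrv_def ddir_coord matrix_matrix_mult_def
    by (auto intro!: pfun_sum pfun.intros)
next
  case (add F G)
  then show ?case using pfun.add[OF add.IH] by (simp add: ldrv_def ddir_add)
next
  case (mult F G)
  have "(\<lambda>A. ldrv X F A * G A + F A * ldrv X G A) \<in> pfun"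
    by (intro pfun.intros mult)
  with mult show ?case by (simp add: ldrv_def ddir_mult)
qed

abbreviation kscale :: "'k::field \<Rightarrow> ('a \<Rightarrow> 'k) \<Rightarrow> 'a \<Rightarrow> 'k" where
  "kscale \<equiv> fscale (*)"

lemma linear_space_kscale: "linear_space (kscale :: 'k::field \<Rightarrow> ('a \<Rightarrow> 'k) \<Rightarrow> _)"
  by (rule linear_space_fscale[OF linear_space_mult])

lemma subspace_pfun: "module.subspace kscale (pfun :: ('k::field^'n^'n \<Rightarrow> 'k) set)"
proof -
  interpret linear_space "kscale :: 'k \<Rightarrow> ('k^'n^'n \<Rightarrow> 'k) \<Rightarrow> _" by (rule linear_space_kscale)
  show "subspace (pfun :: ('k^'n^'n \<Rightarrow> 'k) set)"
    using pfun.const[of 0] pfun.add pfun.mult[OF pfun.const]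
    by (intro subspaceI) (auto simp: fscale_def plus_fun_def zero_fun_def)
qed

lemma ldrv_lin:
  fixes X :: "'k::field_char_0^'n^'n"
  shows "lin_on kscale pfun kscale (ldrv X)"
  unfolding lin_on_def
proof (intro conjI ballI allI)
  fix F G :: "'k^'n^'n \<Rightarrow> 'k" assume "F \<in> pfun" "G \<in> pfun"
  then show "ldrv X (F + G) = ldrv X F + ldrv X G"
    by (simp add: ldrv_def plus_fun_def ddir_add)
next
  fix c and F :: "'k^'n^'n \<Rightarrow> 'k" assume "F \<in> pfun"
  then show "ldrv X (kscale c F) = kscale c (ldrv X F)"
    by (simp add: ldrv_def fscale_def ddir_const ddir_mult[OF pfun.const] fun_eq_iff)
qed

lemma pfun_translate: "F \<in> pfun \<Longrightarrow> (\<lambda>B. F (A ** B)) \<in> pfun"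
proof (induction rule: pfun.induct)
  case (coord i j)
  show ?case unfolding matrix_matrix_mult_def by (auto intro!: pfun_sum pfun.intros)
qed (auto intro: pfun.intros)

lemma mult_mscale: "A ** (c *\<^sub>M B) = c *\<^sub>M (A ** B)" "(c *\<^sub>M B) ** A = c *\<^sub>M (B ** A)"
  by (auto simp: mscale_def vec_eq_iff matrix_matrix_mult_def sum_distrib_left algebra_simps)

text \<open>Translation by \<open>A \<in> H\<close> preserves the vanishing ideal of \<open>H\<close> and carries tangency at \<open>1\<close> to
  tangency at \<open>A\<close>.\<close>

lemma ldrv_vanishing_ideal:
  fixes X :: "'k::field_char_0^'n^'n"
  assumes X: "X \<in> Lie_of H" and H: "\<And>A B. A \<in> H \<Longrightarrow> B \<in> H \<Longrightarrow> A ** B \<in> H"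
    and F: "F \<in> pfun" "\<And>A. A \<in> H \<Longrightarrow> F A = 0" and A: "A \<in> H"
  shows "ldrv X F A = 0"
proof -
  let ?G = "\<lambda>B. F (A ** B)"
  obtain q where q: "\<And>s. poly q s = F (A + s *\<^sub>M (A ** X))" using pfun_line[OF F(1)] by metis
  have "ddir ?G (mat 1) X = coeff q 1"
    by (rule ddir_eqI) (simp add: q matrix_add_distribs mult_mscale)
  also have "\<dots> = ldrv X F A" by (simp add: ldrv_def ddir_eqI[OF q])
  finally have "ldrv X F A = ddir ?G (mat 1) X" ..
  also have "\<forall>B\<in>H. ?G B = 0" using F(2) H A by simp
  then have "ddir ?G (mat 1) X = 0"
    using X[unfolded Lie_of_iff, THEN bspec, OF pfun_translate[OF F(1)]] by simp
  finally show ?thesis .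
qed

section \<open>Replicas\<close>

lemma fin_dim_vec: "linear_space.fin_dim ((*s) :: 'k::field \<Rightarrow> 'k^'n \<Rightarrow> _) UNIV"
proof -
  interpret linear_space "(*s) :: 'k \<Rightarrow> 'k^'n \<Rightarrow> _" by (rule linear_space_vec)
  show ?thesis unfolding fin_dim_def
    using finite_cart_basis span_cart_basis by blast
qed

lemma mscale_vec: "(c *\<^sub>M A) *v w = c *s (A *v w)"
  by (simp add: mscale_def vec_eq_iff matrix_vector_mult_def sum_distrib_left mult.assoc)

lemma lie_vec: "lie A B *v w = A *v (B *v w) - B *v (A *v w)"
  by (simp add: lie_def matrix_vector_mult_diff_rdistrib matrix_vector_mul_assoc)

text \<open>\<open>Y\<close> acts on the generalised eigenspace of \<open>X\<close> for \<open>c\<close> by \<open>f c\<close>.  Since \<open>f\<close> is additive and the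
  coordinates generate all polynomial functions, the vector field of \<open>Y\<close> acts in the same way on the
  generalised eigenspaces of the vector field of \<open>X\<close> in polynomial functions.  The vanishing ideal of
  \<open>H\<close> is stable under the field of \<open>X\<close>, so it contains the generalised eigencomponents of its
  elements and is stable under the field of \<open>Y\<close> too.\<close>

lemma replica_exists:
  fixes X :: "'k::{alg_closed_field, field_char_0}^'n^'n" and f :: "'k \<Rightarrow> 'k"
  assumes f: "\<And>x y. f (x + y) = f x + f y"
  obtains Y where
    "\<And>H. X \<in> Lie_of H \<Longrightarrow> mat 1 \<in> H \<Longrightarrow> (\<And>A B. A \<in> H \<Longrightarrow> B \<in> H \<Longrightarrow> A ** B \<in> H) \<Longrightarrow> Y \<in> Lie_of H"
    "\<And>\<delta> Z. ml.geig (lie X) \<delta> Z \<Longrightarrow> lie Y Z = f \<delta> *\<^sub>M Z"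
proof -
  have f0: "f 0 = 0" using f[of 0 0] by simp
  interpret v: linear_space "(*s) :: 'k \<Rightarrow> 'k^'n \<Rightarrow> _" by (rule linear_space_vec)
  interpret p: linear_space "kscale :: 'k \<Rightarrow> ('k^'n^'n \<Rightarrow> 'k) \<Rightarrow> _" by (rule linear_space_kscale)
  let ?T = "\<lambda>w. X *v w"
  have T: "lin_on (*s) UNIV (*s) ?T" "?T ` UNIV \<subseteq> UNIV"
    by (auto simp: lin_on_def matrix_vector_right_distrib vector_scalar_commute)
  note sp = geig_span_alg_closed[OF linear_space_vec fin_dim_vec T]
  obtain D where D: "lin_on (*s) UNIV (*s) D" "\<And>c w. v.geig ?T c w \<Longrightarrow> D w = f c *s w"
    using v.geig_functional_calculus[OF fin_dim_vec T sp, of f] by (metis UNIV_I)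
  define Y where "Y = (\<chi> i j. D (axis j 1) $ i)"
  have Y: "Y *v w = D w" for w
  proof -
    have "D w = D (\<Sum>j\<in>UNIV. w $ j *s axis j 1)" by (simp add: basis_expansion)
    also have "\<dots> = (\<Sum>j\<in>UNIV. D (w $ j *s axis j 1))" by (rule v.lin_on_sum[OF _ D(1)]) auto
    also have "\<dots> = (\<Sum>j\<in>UNIV. w $ j *s D (axis j 1))" by (simp add: lin_onD(2)[OF D(1)])
    finally show ?thesis
      by (simp add: Y_def vec_eq_iff matrix_vector_mult_def mult.commute)
  qed
  have Yg: "Y *v w = f c *s w" if "v.geig ?T c w" for c w
    using D(2)[OF that] by (simp add: Y)
  let ?W = "{w. \<exists>c. v.geig ?T c w}"
  have spW: "w \<in> vec.span ?W" for w using sp by auto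
  show ?thesis
  proof (rule that[of Y])
    fix \<delta> Z assume Z: "ml.geig (lie X) \<delta> Z"
    have "lie Y Z *v w = (f \<delta> *\<^sub>M Z) *v w" for w
      using spW[of w]
    proof (induction rule: vec.span_induct_alt)
      case base
      then show ?case by simp
    next
      case (step a w u)
      then obtain c where w: "v.geig ?T c w" by auto
      have "v.geig ?T (\<delta> + c) (Z *v w)"
        by (rule geig_product[where ?V1.0 = UNIV and ?V2.0 = UNIV and ?V3.0 = UNIV and ?T1.0 = "lie X" and
             ?s1.0 = mscale and ?s2.0 = "(*s)" and ?T2.0 = ?T and \<beta> = "\<lambda>Z w. Z *v w"])
           (use T Z w ml.linear_space_axioms v.linear_space_axioms in
             \<open>auto simp: lie_vec mscale_vec matrix_vector_mult_diff_rdistrib vector_scalar_commute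
                matrix_vector_mult_diff_distrib vec.scale_left_distrib\<close>)
      then have "lie Y Z *v w = (f \<delta> *\<^sub>M Z) *v w"
        by (simp add: lie_vec mscale_vec Yg[OF w] Yg f vector_scalar_commute vec.scale_left_distrib)
      then show ?case using step
        by (simp add: matrix_vector_right_distrib vector_scalar_commute)
    qed
    then show "lie Y Z = f \<delta> *\<^sub>M Z" by (simp add: matrix_eq)
  next
    fix H :: "('k^'n^'n) set"
    assume H: "X \<in> Lie_of H" "mat 1 \<in> H" "\<And>A B. A \<in> H \<Longrightarrow> B \<in> H \<Longrightarrow> A ** B \<in> H"
    define Q where "Q c = {F \<in> pfun. p.geig (ldrv X) c F \<and> ldrv Y F = kscale (f c) F}" for c
    have XP: "p.subspace pfun" "lin_on kscale pfun kscale (ldrv X)" "ldrv X ` pfun \<subseteq> pfun"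
      using subspace_pfun ldrv_lin ldrv_pfun by auto
    have sQ: "p.subspace (Q c)" for c
    proof -
      have "Q c = {F \<in> pfun. p.geig (ldrv X) c F} \<inter> {F \<in> pfun. ldrv Y F = kscale (f c) F}"
        by (auto simp: Q_def)
      then show ?thesis
        using p.subspace_inter[OF p.subspace_geig[OF XP] p.subspace_eigen[OF subspace_pfun ldrv_lin]] by simp
    qed
    let ?Q = "\<Union>c. Q c"
    have QI: "F \<in> p.span ?Q" if "F \<in> Q c" for F c
      by (rule p.span_base) (use that in blast)
    have multQ: "(\<lambda>A. F A * G A) \<in> p.span ?Q" if F: "F \<in> Q c" and G: "G \<in> Q d" for F G c d
    proof (rule QI)
      have FG: "F \<in> pfun" "G \<in> pfun" "p.geig (ldrv X) c F" "p.geig (ldrv X) d G"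
        "ldrv Y F = kscale (f c) F" "ldrv Y G = kscale (f d) G"
        using F G by (auto simp: Q_def)
      have stab: "ldrv X F - kscale c F \<in> pfun" if "F \<in> pfun" for F :: "'k^'n^'n \<Rightarrow> 'k" and c
        using that by (intro p.subspace_diff p.subspace_scale subspace_pfun ldrv_pfun)
      have "p.geig (ldrv X) (c + d) (\<lambda>A. F A * G A)"
      proof (rule geig_product[where ?V1.0 = pfun and ?V2.0 = pfun and ?V3.0 = pfun
            and ?s1.0 = kscale and ?s2.0 = kscale and ?T1.0 = "ldrv X" and ?T2.0 = "ldrv X"
            and \<beta> = "\<lambda>F G A. F A * G A"])

        fix F G :: "'k^'n^'n \<Rightarrow> 'k" assume "F \<in> pfun" "G \<in> pfun"
        then show "ldrv X (\<lambda>A. F A * G A) - kscale (c + d) (\<lambda>A. F A * G A) =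
            (\<lambda>A. (ldrv X F - kscale c F) A * G A) + (\<lambda>A. F A * (ldrv X G - kscale d G) A)"
          by (simp add: ldrv_def ddir_mult fscale_def fun_eq_iff algebra_simps)
      qed (use FG XP linear_space_kscale pfun.mult stab in \<open>auto simp: zero_fun_def\<close>)
      moreover have "ldrv Y (\<lambda>A. F A * G A) = kscale (f (c + d)) (\<lambda>A. F A * G A)"
        using FG(5,6) by (simp add: ldrv_def ddir_mult[OF FG(1,2)] fscale_def fun_eq_iff f algebra_simps)
      ultimately show "(\<lambda>A. F A * G A) \<in> Q (c + d)"
        using FG by (simp add: Q_def pfun.mult)
    qed
    have multQ': "(\<lambda>A. F A * G A) \<in> p.span ?Q" if F: "F \<in> p.span ?Q" and G: "G \<in> Q d" for F G d
      using F
    proof (induction rule: p.span_induct_alt)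
      case base
      show ?case using p.span_zero by (simp add: zero_fun_def)
    next
      case (step a F F')
      then obtain c where "F \<in> Q c" by blast
      have "(\<lambda>A. (kscale a F + F') A * G A) = kscale a (\<lambda>A. F A * G A) + (\<lambda>A. F' A * G A)"
        by (simp add: fscale_def fun_eq_iff algebra_simps)
      then show ?case
        using multQ[OF \<open>F \<in> Q c\<close> G] step(2) by (simp only: p.span_add p.span_scale)
    qed
    have multspan: "(\<lambda>A. F A * G A) \<in> p.span ?Q" if F: "F \<in> p.span ?Q" and G: "G \<in> p.span ?Q" for F G
      using G
    proof (induction rule: p.span_induct_alt)
      case base
      show ?case using p.span_zero by (simp add: zero_fun_def)
    next
      case (step a G G')
      then obtain c where "G \<in> Q c" by blast
      have "(\<lambda>A. F A * (kscale a G + G') A) = kscale a (\<lambda>A. F A * G A) + (\<lambda>A. F A * G' A)"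
        by (simp add: fscale_def fun_eq_iff algebra_simps)
      then show ?case
        using multQ'[OF F \<open>G \<in> Q c\<close>] step(2) by (simp only: p.span_add p.span_scale)
    qed
    have coordQ: "(\<lambda>A. (A *v w) $ i) \<in> p.span ?Q" for w i
      using spW[of w]
    proof (induction rule: vec.span_induct_alt)
      case base
      show ?case using p.span_zero by (simp add: zero_fun_def)
    next
      case (step a w u)
      then obtain c where w: "v.geig ?T c w" by auto
      let ?L = "\<lambda>w A. (A *v w) $ i"
      have L: "?L w \<in> pfun" for w unfolding matrix_vector_mult_def
        by (auto intro!: pfun_sum pfun.intros)
      have DL: "ldrv Z (?L w) = ?L (Z *v w)" for Z w
      proof
        fix A
        have "poly [:(A *v w) $ i, ((A ** Z) *v w) $ i:] s = ((A + s *\<^sub>M (A ** Z)) *v w) $ i" for s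
          by (simp add: matrix_vector_mult_add_rdistrib mscale_vec)
        from ddir_eqI[OF this] show "ldrv Z (?L w) A = ?L (Z *v w) A"
          by (simp add: ldrv_def matrix_vector_mul_assoc)
      qed
      have Ll: "?L (x - c *s y) = ?L x - kscale c (?L y)" "?L (c *s x) = kscale c (?L x)" "?L 0 = 0" for x y c
        by (simp_all add: fscale_def fun_eq_iff matrix_vector_mult_diff_distrib vector_scalar_commute)
      have "(p.shift (ldrv X) c ^^ n) (?L w) = ?L ((v.shift ?T c ^^ n) w)" for n
        by (induction n) (simp_all only: funpow.simps comp_apply id_apply DL Ll)
      moreover obtain n where "(v.shift ?T c ^^ n) w = 0" using w unfolding v.geig_def by blast
      ultimately have "(p.shift (ldrv X) c ^^ n) (?L w) = 0" by (simp only: Ll(3))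
      then have "p.geig (ldrv X) c (?L w)" unfolding p.geig_def by (rule exI)
      then have "?L w \<in> Q c"
        using L by (simp add: Q_def DL Yg[OF w] Ll)
      moreover have "?L (a *s w + u) = kscale a (?L w) + ?L u"
        by (simp add: fscale_def fun_eq_iff matrix_vector_right_distrib vector_scalar_commute)
      ultimately show ?case using step(2) QI by (simp only: p.span_add p.span_scale)
    qed
    have all: "F \<in> p.span ?Q" if "F \<in> pfun" for F
      using that
    proof induction
      case (const c)
      have "p.geig (ldrv X) 0 (\<lambda>_. c)"
        by (rule p.geig_eigenvector) (simp add: ldrv_def ddir_const fscale_def)
      then show ?case
        by (intro QI[of _ 0]) (simp add: Q_def pfun.const ldrv_def ddir_const fscale_def f0)
    next
      case (coord i j)
      have "(\<lambda>A. A $ i $ j) = (\<lambda>A :: 'k^'n^'n. (A *v axis j 1) $ i)"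
        by (simp add: fun_eq_iff matrix_vector_mul_component inner_axis matrix_vector_mult_def axis_def if_distrib cong: if_cong)
      then show ?case using coordQ by simp
    next
      case (add F G)
      then show ?case using p.span_add by (simp add: plus_fun_def)
    next
      case (mult F G)
      then show ?case by (intro multspan)
    qed
    define I where "I = {F \<in> pfun. \<forall>A\<in>H. F A = 0}"
    have I: "p.subspace I"
      using p.subspace_0[OF subspace_pfun] p.subspace_add[OF subspace_pfun] p.subspace_scale[OF subspace_pfun]
      by (intro p.subspaceI) (auto simp: I_def fscale_def)
    have XI: "ldrv X ` I \<subseteq> I"
      using ldrv_vanishing_ideal[OF H(1,3)] ldrv_pfun by (auto simp: I_def)
    show "Y \<in> Lie_of H"
      unfolding Lie_of_iff
    proof (intro ballI impI)
      fix F :: "'k^'n^'n \<Rightarrow> 'k" assume F: "F \<in> pfun" "\<forall>A\<in>H. F A = 0"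
      obtain S w where S: "finite S" "\<And>c. w c \<in> Q c" "F = (\<Sum>c\<in>S. w c)"
        using p.span_Union_subspaces[OF sQ all[OF F(1)]] by blast
      have wp: "w c \<in> pfun" "p.geig (ldrv X) c (w c)" "ldrv Y (w c) = kscale (f c) (w c)" for c
        using S(2)[of c] by (auto simp: Q_def)
      have wI: "\<forall>c\<in>S. w c \<in> I"
        by (rule p.geig_components[OF XP I _ XI S(1)]) (use wp F S(3) in \<open>auto simp: I_def\<close>)
      have "ldrv Y F = (\<Sum>c\<in>S. ldrv Y (w c))"
        unfolding S(3) by (rule p.lin_on_sum[OF subspace_pfun ldrv_lin]) (rule wp)
      also have "\<dots> = (\<Sum>c\<in>S. kscale (f c) (w c))" by (simp add: wp)
      also have "\<dots> \<in> I" by (intro p.subspace_sum[OF I] p.subspace_scale[OF I]) (use wI in blast)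
      finally have "ldrv Y F (mat 1) = 0" using H(2) by (simp add: I_def)
      then show "ddir F (mat 1) Y = 0" by (simp add: ldrv_def)
    qed
  qed
qed

section \<open>Representations and Casimir operators\<close>

definition lie_rep ::
  "('k::field^'n^'n) set \<Rightarrow> ('k \<Rightarrow> 'v::ab_group_add \<Rightarrow> 'v) \<Rightarrow> 'v set \<Rightarrow> ('k^'n^'n \<Rightarrow> 'v \<Rightarrow> 'v) \<Rightarrow> bool" where
  "lie_rep L s V act \<longleftrightarrow> linear_space s \<and> module.subspace s V \<and>
     (\<forall>u\<in>L. lin_on s V s (act u) \<and> act u ` V \<subseteq> V) \<and>
     (\<forall>v\<in>V. \<forall>u\<in>L. \<forall>w\<in>L. act (u + w) v = act u v + act w v \<and>
        act (lie u w) v = act u (act w v) - act w (act u v)) \<and>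
     (\<forall>v\<in>V. \<forall>u\<in>L. \<forall>c. act (c *\<^sub>M u) v = s c (act u v))"

text \<open>Dual bases, described by the two expansions that they provide.\<close>

definition dual_pair ::
  "('k::field^'n^'n \<Rightarrow> 'k^'n^'n \<Rightarrow> 'k) \<Rightarrow> ('k^'n^'n) set \<Rightarrow> nat \<Rightarrow>
     (nat \<Rightarrow> 'k^'n^'n) \<Rightarrow> (nat \<Rightarrow> 'k^'n^'n) \<Rightarrow> bool" where
  "dual_pair \<Phi> V d e e' \<longleftrightarrow> (\<forall>i<d. e i \<in> V \<and> e' i \<in> V) \<and>
     (\<forall>u\<in>V. u = (\<Sum>i<d. \<Phi> u (e' i) *\<^sub>M e i) \<and> u = (\<Sum>i<d. \<Phi> u (e i) *\<^sub>M e' i))"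

definition invariant_form ::
  "('k::field^'n^'n) set \<Rightarrow> ('k^'n^'n \<Rightarrow> 'k^'n^'n \<Rightarrow> 'k) \<Rightarrow> bool" where
  "invariant_form L \<Phi> \<longleftrightarrow>
     (\<forall>x\<in>L. \<forall>y\<in>L. \<Phi> x y = \<Phi> y x \<and> (\<forall>z\<in>L. \<Phi> (x + y) z = \<Phi> x z + \<Phi> y z \<and>
        \<Phi> (lie x y) z = \<Phi> x (lie y z)) \<and> (\<forall>c. \<Phi> (c *\<^sub>M x) y = c * \<Phi> x y))"

definition cas :: "nat \<Rightarrow> (nat \<Rightarrow> 'm) \<Rightarrow> (nat \<Rightarrow> 'm) \<Rightarrow> ('m \<Rightarrow> 'v \<Rightarrow> 'v) \<Rightarrow> 'v \<Rightarrow> 'v::ab_group_add" where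
  "cas d e e' act v = (\<Sum>i<d. act (e' i) (act (e i) v))"

lemma dual_pair_swap: "dual_pair \<Phi> V d e e' \<Longrightarrow> dual_pair \<Phi> V d e' e"
  unfolding dual_pair_def by blast

lemma dual_pairD:
  assumes "dual_pair \<Phi> V d e e'"
  shows "i < d \<Longrightarrow> e i \<in> V" "i < d \<Longrightarrow> e' i \<in> V"
    "u \<in> V \<Longrightarrow> (\<Sum>i<d. \<Phi> u (e' i) *\<^sub>M e i) = u" "u \<in> V \<Longrightarrow> (\<Sum>i<d. \<Phi> u (e i) *\<^sub>M e' i) = u"
  using assms unfolding dual_pair_def by force+

lemma invariant_formD:
  assumes "invariant_form L \<Phi>"
  shows "x \<in> L \<Longrightarrow> y \<in> L \<Longrightarrow> \<Phi> x y = \<Phi> y x"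
    "x \<in> L \<Longrightarrow> y \<in> L \<Longrightarrow> z \<in> L \<Longrightarrow> \<Phi> (x + y) z = \<Phi> x z + \<Phi> y z"
    "x \<in> L \<Longrightarrow> y \<in> L \<Longrightarrow> \<Phi> (c *\<^sub>M x) y = c * \<Phi> x y"
    "x \<in> L \<Longrightarrow> y \<in> L \<Longrightarrow> z \<in> L \<Longrightarrow> \<Phi> (lie x y) z = \<Phi> x (lie y z)"
  using assms unfolding invariant_form_def by blast+

text \<open>The tensor \<open>\<Sum> e\<^sub>i \<otimes> e'\<^sub>i\<close> represents the form on \<open>V\<close>, hence is independent of the dual pair.\<close>

lemma dual_pair_tensor:
  assumes \<Phi>: "invariant_form L \<Phi>" and e: "dual_pair \<Phi> V d e e'" and g: "dual_pair \<Phi> V d' g g'"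
    and V: "mat_vs.subspace V" and t: "linear_space t" and VL: "V \<subseteq> L"
    and \<beta>: "\<And>w. w \<in> V \<Longrightarrow> lin_on mscale V t (\<lambda>u. \<beta> u w)" "\<And>u. u \<in> V \<Longrightarrow> lin_on mscale V t (\<beta> u)"
  shows "(\<Sum>i<d. \<beta> (e i) (e' i)) = (\<Sum>j<d'. \<beta> (g j) (g' j))"
proof -
  interpret t: linear_space t by fact
  have eV: "e i \<in> V" "e' i \<in> V" if "i < d" for i using dual_pairD[OF e] that by auto
  have gV: "g i \<in> V" "g' i \<in> V" if "i < d'" for i using dual_pairD[OF g] that by auto
  have "(\<Sum>i<d. \<beta> (e i) (e' i)) = (\<Sum>i<d. \<Sum>j<d'. t (\<Phi> (e i) (g' j)) (\<beta> (g j) (e' i)))"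
  proof (intro sum.cong refl)
    fix i assume "i \<in> {..<d}"
    then have i: "e i \<in> V" "e' i \<in> V" using eV by auto
    have "\<beta> (e i) (e' i) = \<beta> (\<Sum>j<d'. \<Phi> (e i) (g' j) *\<^sub>M g j) (e' i)"
      using dual_pairD(3)[OF g i(1)] by simp
    also have "\<dots> = (\<Sum>j<d'. \<beta> (\<Phi> (e i) (g' j) *\<^sub>M g j) (e' i))"
      by (rule ml.lin_on_sum[OF V \<beta>(1)[OF i(2)]]) (use gV mat_vs.subspace_scale[OF V] in auto)
    also have "\<dots> = (\<Sum>j<d'. t (\<Phi> (e i) (g' j)) (\<beta> (g j) (e' i)))"
      by (intro sum.cong refl lin_onD(2)[OF \<beta>(1)[OF i(2)]] gV) simp
    finally show "\<beta> (e i) (e' i) = (\<Sum>j<d'. t (\<Phi> (e i) (g' j)) (\<beta> (g j) (e' i)))" .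
  qed
  also have "\<dots> = (\<Sum>j<d'. \<Sum>i<d. t (\<Phi> (g' j) (e i)) (\<beta> (g j) (e' i)))"
  proof -
    have "\<Phi> (e i) (g' j) = \<Phi> (g' j) (e i)" if "i < d" "j < d'" for i j
      by (rule invariant_formD(1)[OF \<Phi>]) (use eV gV VL that in blast)+
    then show ?thesis by (subst sum.swap) (intro sum.cong refl arg_cong2[where f = t], auto)
  qed
  also have "\<dots> = (\<Sum>j<d'. \<beta> (g j) (g' j))"
  proof (intro sum.cong refl)
    fix j assume "j \<in> {..<d'}"
    then have j: "g j \<in> V" "g' j \<in> V" using gV by auto
    have "\<beta> (g j) (g' j) = \<beta> (g j) (\<Sum>i<d. \<Phi> (g' j) (e i) *\<^sub>M e' i)"
      using dual_pairD(4)[OF e j(2)] by simp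
    also have "\<dots> = (\<Sum>i<d. \<beta> (g j) (\<Phi> (g' j) (e i) *\<^sub>M e' i))"
      by (rule ml.lin_on_sum[OF V \<beta>(2)[OF j(1)]]) (use eV mat_vs.subspace_scale[OF V] in auto)
    also have "\<dots> = (\<Sum>i<d. t (\<Phi> (g' j) (e i)) (\<beta> (g j) (e' i)))"
      by (intro sum.cong refl lin_onD(2)[OF \<beta>(2)[OF j(1)]] eV) simp
    finally show "(\<Sum>i<d. t (\<Phi> (g' j) (e i)) (\<beta> (g j) (e' i))) = \<beta> (g j) (g' j)" ..
  qed
  finally show ?thesis .
qed

lemma lie_anti: "lie y x = - lie x y"
  by (simp add: lie_def)

lemma lie_add: "lie (x + y) z = lie x z + lie y z" "lie z (x + y) = lie z x + lie z y"
  by (simp_all add: lie_def matrix_add_distribs)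

lemma lie_diff: "lie (x - y) z = lie x z - lie y z" "lie z (x - y) = lie z x - lie z y"
  by (simp_all add: lie_def matrix_add_distribs)

lemma lie_zero [simp]: "lie 0 z = 0" "lie z 0 = 0" "lie z z = 0"
  by (simp_all add: lie_def)

lemma lie_sum: "lie (sum f A) z = (\<Sum>i\<in>A. lie (f i) z)" "lie z (sum f A) = (\<Sum>i\<in>A. lie z (f i))"
  by (induction A rule: infinite_finite_induct) (auto simp: lie_add)

lemma lie_neg: "lie (- x) z = - lie x z" "lie z (- x) = - lie z x"
  using lie_diff[of 0 x z] lie_diff[of z 0 x] by (simp_all add: lie_diff)

lemma lie_lie: "lie (lie x y) z = lie x (lie y z) - lie y (lie x z)"
  using lie_jacobi[of x y z] by simp

lemma lin_on_lie: "lin_on mscale V mscale (lie x)"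
  by (simp add: lin_on_def lie_add lie_scale)

lemma lie_subalgebraD:
  assumes "lie_subalgebra L"
  shows "mat_vs.subspace L" "x \<in> L \<Longrightarrow> y \<in> L \<Longrightarrow> lie x y \<in> L"
  using assms by (auto simp: lie_subalgebra_def)

lemma lie_kills_span:
  assumes "\<And>b. b \<in> B \<Longrightarrow> lie u b = 0" "x \<in> mat_vs.span B"
  shows "lie u x = 0"
  using assms(2) by (induction rule: mat_vs.span_induct_alt) (simp_all add: lie_add lie_scale assms(1))

lemma lie_rep_adjoint:
  assumes "mat_vs.subspace V" "\<And>u v. u \<in> L \<Longrightarrow> v \<in> V \<Longrightarrow> lie u v \<in> V"
  shows "lie_rep L mscale V lie"
  unfolding lie_rep_def
  using assms by (auto simp: ml.linear_space_axioms lin_on_lie lie_add lie_lie lie_scale)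

context
  fixes L :: "('k::field^'n^'n) set" and s :: "'k \<Rightarrow> 'v::ab_group_add \<Rightarrow> 'v" and V act
  assumes rep: "lie_rep L s V act"
begin

interpretation linear_space s using rep by (simp add: lie_rep_def)

lemma rep_subspace: "subspace V" using rep by (simp add: lie_rep_def)

lemma rep_lin: "u \<in> L \<Longrightarrow> lin_on s V s (act u)" using rep by (simp add: lie_rep_def)

lemma rep_in: "u \<in> L \<Longrightarrow> v \<in> V \<Longrightarrow> act u v \<in> V" using rep by (auto simp: lie_rep_def)

lemma rep_add: "u \<in> L \<Longrightarrow> v \<in> V \<Longrightarrow> w \<in> V \<Longrightarrow> act u (v + w) = act u v + act u w"
  using rep_lin lin_onD(1) by blast

lemma rep_scale: "u \<in> L \<Longrightarrow> v \<in> V \<Longrightarrow> act u (s c v) = s c (act u v)"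
  using rep_lin lin_onD(2) by blast

lemma rep_diff: "u \<in> L \<Longrightarrow> v \<in> V \<Longrightarrow> w \<in> V \<Longrightarrow> act u (v - w) = act u v - act u w"
  by (rule lin_on_diff[OF rep_subspace rep_lin])

lemma rep_zero: "u \<in> L \<Longrightarrow> act u 0 = 0"
  by (rule lin_on_zero[OF rep_subspace rep_lin])

lemma rep_sum: "u \<in> L \<Longrightarrow> (\<And>i. i \<in> A \<Longrightarrow> f i \<in> V) \<Longrightarrow> act u (\<Sum>i\<in>A. f i) = (\<Sum>i\<in>A. act u (f i))"
  by (rule lin_on_sum[OF rep_subspace rep_lin])

lemma rep_add_left: "u \<in> L \<Longrightarrow> w \<in> L \<Longrightarrow> v \<in> V \<Longrightarrow> act (u + w) v = act u v + act w v"
  using rep by (simp add: lie_rep_def)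

lemma rep_scale_left: "u \<in> L \<Longrightarrow> v \<in> V \<Longrightarrow> act (c *\<^sub>M u) v = s c (act u v)"
  using rep by (simp add: lie_rep_def)

lemma rep_lie: "u \<in> L \<Longrightarrow> w \<in> L \<Longrightarrow> v \<in> V \<Longrightarrow> act (lie u w) v = act u (act w v) - act w (act u v)"
  using rep by (simp add: lie_rep_def)

lemma rep_sub:
  assumes "subspace W" "W \<subseteq> V" "\<And>u w. u \<in> L \<Longrightarrow> w \<in> W \<Longrightarrow> act u w \<in> W"
  shows "lie_rep L s W act"
  using rep assms unfolding lie_rep_def
  by (auto intro: lin_on_subset)

lemma rep_lin_left: "v \<in> V \<Longrightarrow> lin_on mscale L s (\<lambda>u. act u v)"
  by (simp add: lin_on_def rep_add_left rep_scale_left)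

end

context
  fixes L :: "('k::field^'n^'n) set" and s :: "'k \<Rightarrow> 'v::ab_group_add \<Rightarrow> 'v" and V act
  assumes rep: "lie_rep L s V act" and L: "lie_subalgebra L"
begin

interpretation linear_space s using rep by (simp add: lie_rep_def)

lemma rep_sum_left:
  "v \<in> V \<Longrightarrow> (\<And>i. i \<in> A \<Longrightarrow> f i \<in> L) \<Longrightarrow> act (\<Sum>i\<in>A. f i) v = (\<Sum>i\<in>A. act (f i) v)"
  by (rule ml.lin_on_sum[OF lie_subalgebraD(1)[OF L] rep_lin_left[OF rep]])

lemma rep_zero_left: "v \<in> V \<Longrightarrow> act 0 v = 0"
  by (rule ml.lin_on_zero[OF lie_subalgebraD(1)[OF L] rep_lin_left[OF rep]])

lemma cas_lin:
  assumes "\<And>i. i < d \<Longrightarrow> e i \<in> L \<and> e' i \<in> L"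
  shows "lin_on s V s (cas d e e' act)" "v \<in> V \<Longrightarrow> cas d e e' act v \<in> V"
  using assms
  by (auto simp: lin_on_def cas_def rep_add[OF rep] rep_scale[OF rep] rep_in[OF rep] sum.distrib scale_sum_right
      intro!: subspace_sum[OF rep_subspace[OF rep]])

lemma cas_independent:
  assumes \<Phi>: "invariant_form L \<Phi>" and e: "dual_pair \<Phi> L d e e'" and g: "dual_pair \<Phi> L d' g g'"
    and v: "v \<in> V"
  shows "cas d e e' act v = cas d' g g' act v"
  unfolding cas_def
proof (rule dual_pair_tensor[OF \<Phi> e g _ linear_space_axioms order_refl, where \<beta> = "\<lambda>u w. act w (act u v)"])
  show "mat_vs.subspace L" by (rule lie_subalgebraD(1)[OF L])
  show "lin_on mscale L s (\<lambda>u. act w (act u v))" if "w \<in> L" for w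
    using lin_on_comp[OF rep_lin_left[OF rep v] rep_lin[OF rep that]] rep_in[OF rep _ v] by blast
  show "lin_on mscale L s (\<lambda>w. act w (act u v))" if "u \<in> L" for u
    by (rule rep_lin_left[OF rep rep_in[OF rep that v]])
qed

text \<open>By invariance of the form, \<open>\<Sum> [u, e'\<^sub>i] \<otimes> e\<^sub>i + e'\<^sub>i \<otimes> [u, e\<^sub>i] = 0\<close>.\<close>

lemma cas_commutes:
  assumes \<Phi>: "invariant_form L \<Phi>" and e: "dual_pair \<Phi> L d e e'" and u: "u \<in> L" and v: "v \<in> V"
  shows "act u (cas d e e' act v) = cas d e e' act (act u v)"
proof -
  note LL = lie_subalgebraD(1)[OF L] and LLL = lie_subalgebraD(2)[OF L]
  have eL: "e i \<in> L" "e' i \<in> L" if "i < d" for i using dual_pairD[OF e] that by auto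
  let ?c = "\<lambda>i j. \<Phi> (lie u (e i)) (e' j)"
  have A: "act (lie u (e i)) w = (\<Sum>j<d. s (?c i j) (act (e j) w))" if "i < d" "w \<in> V" for i w
  proof -
    have "act (lie u (e i)) w = act (\<Sum>j<d. ?c i j *\<^sub>M e j) w"
      using dual_pairD(3)[OF e LLL[OF u eL(1)[OF that(1)]]] by simp
    also have "\<dots> = (\<Sum>j<d. s (?c i j) (act (e j) w))"
      using eL that mat_vs.subspace_scale[OF LL]
      by (subst rep_sum_left) (auto simp: rep_scale_left[OF rep])
    finally show ?thesis .
  qed
  have B: "act (lie u (e' j)) w = (\<Sum>i<d. s (- ?c i j) (act (e' i) w))" if j: "j < d" and w: "w \<in> V" for j w
  proof -
    have c: "\<Phi> (lie u (e' j)) (e i) = - ?c i j" if "i < d" for i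
    proof -
      have "\<Phi> (lie u (e' j)) (e i) = \<Phi> (- 1 *\<^sub>M lie (e' j) u) (e i)"
        by (simp add: lie_anti[of "e' j" u])
      also have "\<dots> = - \<Phi> (lie (e' j) u) (e i)"
        using eL LLL u j that by (subst invariant_formD(3)[OF \<Phi>]) auto
      also have "\<dots> = - \<Phi> (e' j) (lie u (e i))" using eL LLL u j that by (simp add: invariant_formD(4)[OF \<Phi>])
      also have "\<dots> = - ?c i j" using eL LLL u j that invariant_formD(1)[OF \<Phi>] by auto
      finally show ?thesis .
    qed
    have "act (lie u (e' j)) w = act (\<Sum>i<d. \<Phi> (lie u (e' j)) (e i) *\<^sub>M e' i) w"
      using dual_pairD(4)[OF e LLL[OF u eL(2)[OF j]]] by simp
    also have "\<dots> = (\<Sum>i<d. s (\<Phi> (lie u (e' j)) (e i)) (act (e' i) w))"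
      using eL j w mat_vs.subspace_scale[OF LL]
      by (subst rep_sum_left) (auto simp: rep_scale_left[OF rep])
    finally show ?thesis by (simp add: c)
  qed
  have "act u (cas d e e' act v) - cas d e e' act (act u v) =
      (\<Sum>i<d. act u (act (e' i) (act (e i) v)) - act (e' i) (act (e i) (act u v)))"
    unfolding cas_def using eL u v by (subst rep_sum[OF rep]) (auto simp: rep_in[OF rep] sum_subtractf)
  also have "\<dots> = (\<Sum>i<d. act (lie u (e' i)) (act (e i) v) + act (e' i) (act (lie u (e i)) v))"
    using eL u v by (intro sum.cong refl) (simp add: rep_lie[OF rep] rep_in[OF rep] rep_diff[OF rep])
  also have "\<dots> = (\<Sum>j<d. act (lie u (e' j)) (act (e j) v)) + (\<Sum>i<d. act (e' i) (act (lie u (e i)) v))"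
    by (rule sum.distrib)
  also have "(\<Sum>j<d. act (lie u (e' j)) (act (e j) v)) =
      (\<Sum>j<d. \<Sum>i<d. s (- ?c i j) (act (e' i) (act (e j) v)))"
    using eL v by (intro sum.cong refl) (simp add: B rep_in[OF rep])
  also have "\<dots> = - (\<Sum>i<d. \<Sum>j<d. s (?c i j) (act (e' i) (act (e j) v)))"
    by (subst sum.swap) (simp add: sum_negf)
  also have "(\<Sum>i<d. act (e' i) (act (lie u (e i)) v)) =
      (\<Sum>i<d. \<Sum>j<d. s (?c i j) (act (e' i) (act (e j) v)))"
    using eL v by (intro sum.cong refl)
      (simp add: A, subst rep_sum[OF rep], auto simp: rep_scale[OF rep] rep_in[OF rep] intro!: subspace_scale[OF rep_subspace[OF rep]])
  finally show ?thesis by simp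
qed

end

section \<open>Root decompositions with rational roots\<close>

text \<open>The \<open>H i\<close> are an orthogonal basis of a torus, the \<open>X a\<close> a basis of the sum of the root spaces and
  the \<open>Y a\<close> the dual basis; so the \<open>X a\<close> already cover positive and negative roots.\<close>

locale torus_data =
  fixes L :: "('k::field_char_0^'n^'n) set" and \<Phi> :: "'k^'n^'n \<Rightarrow> 'k^'n^'n \<Rightarrow> 'k"
    and r s :: nat and H X Y :: "nat \<Rightarrow> 'k^'n^'n" and q :: "nat \<Rightarrow> rat" and \<alpha> :: "nat \<Rightarrow> nat \<Rightarrow> rat"
  assumes lie_subalgebra: "lie_subalgebra L"
    and inv: "invariant_form L \<Phi>"
    and H_in: "i < r \<Longrightarrow> H i \<in> L" and X_in: "a < s \<Longrightarrow> X a \<in> L" and Y_in: "a < s \<Longrightarrow> Y a \<in> L"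
    and expand: "u \<in> L \<Longrightarrow>
      u = (\<Sum>i<r. (\<Phi> u (H i) / of_rat (q i)) *\<^sub>M H i) + (\<Sum>a<s. \<Phi> u (Y a) *\<^sub>M X a)"
    and expand': "u \<in> L \<Longrightarrow>
      u = (\<Sum>i<r. (\<Phi> u (H i) / of_rat (q i)) *\<^sub>M H i) + (\<Sum>a<s. \<Phi> u (X a) *\<^sub>M Y a)"
    and q_pos: "i < r \<Longrightarrow> q i > 0"
    and HH: "i < r \<Longrightarrow> j < r \<Longrightarrow> lie (H i) (H j) = 0"
    and HX: "i < r \<Longrightarrow> a < s \<Longrightarrow> lie (H i) (X a) = of_rat (\<alpha> a i) *\<^sub>M X a"
    and HY: "i < r \<Longrightarrow> a < s \<Longrightarrow> lie (H i) (Y a) = of_rat (- \<alpha> a i) *\<^sub>M Y a"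
    and \<Phi>HX: "i < r \<Longrightarrow> a < s \<Longrightarrow> \<Phi> (H i) (X a) = 0" and \<Phi>HY: "i < r \<Longrightarrow> a < s \<Longrightarrow> \<Phi> (H i) (Y a) = 0"
    and \<Phi>XY: "a < s \<Longrightarrow> b < s \<Longrightarrow> \<Phi> (X a) (Y b) = (if a = b then 1 else 0)"
    and \<Phi>HH: "i < r \<Longrightarrow> j < r \<Longrightarrow> \<Phi> (H i) (H j) = (if i = j then of_rat (q i) else 0)"
    and \<alpha>_nonzero: "a < s \<Longrightarrow> \<exists>i<r. \<alpha> a i \<noteq> 0"
begin

definition e :: "nat \<Rightarrow> 'k^'n^'n" where
  "e i = (if i < r then H i else X (i - r))"

definition e' :: "nat \<Rightarrow> 'k^'n^'n" where
  "e' i = (if i < r then (1 / of_rat (q i)) *\<^sub>M H i else Y (i - r))"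

lemma subspace_L: "mat_vs.subspace L" by (rule lie_subalgebraD(1)[OF lie_subalgebra])

lemmas L_scale = mat_vs.subspace_scale[OF subspace_L] and L_sum = mat_vs.subspace_sum[OF subspace_L]

lemma sum_e: "(\<Sum>i<r + s. F i) = (\<Sum>i<r. F i) + (\<Sum>a<s. F (r + a))"
  for F :: "nat \<Rightarrow> 'b::comm_monoid_add"
proof -
  have "{..<r + s} = {..<r} \<union> (+) r ` {..<s}"
  proof (intro subset_antisym subsetI)
    fix i assume "i \<in> {..<r + s}"
    then show "i \<in> {..<r} \<union> (+) r ` {..<s}"
      by (cases "i < r") (auto intro!: image_eqI[of _ _ "i - r"])
  qed auto
  then have "(\<Sum>i<r + s. F i) = (\<Sum>i<r. F i) + (\<Sum>i\<in>(+) r ` {..<s}. F i)"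
    by (simp only:) (rule sum.union_disjoint, auto)
  then show ?thesis by (simp add: sum.reindex)
qed

lemma e_simps: "i < r \<Longrightarrow> e i = H i" "e (r + a) = X a"
  "i < r \<Longrightarrow> e' i = (1 / of_rat (q i)) *\<^sub>M H i" "e' (r + a) = Y a"
  by (auto simp: e_def e'_def)

lemma dual_e: "dual_pair \<Phi> L (r + s) e e'"
  unfolding dual_pair_def
proof (intro conjI allI impI ballI)
  fix i assume "i < r + s"
  then show "e i \<in> L" "e' i \<in> L"
    using H_in X_in Y_in L_scale by (auto simp: e_def e'_def)
next
  fix u assume u: "u \<in> L"
  have "\<Phi> u ((1 / of_rat (q i)) *\<^sub>M H i) = \<Phi> u (H i) / of_rat (q i)" if "i < r" for i
    using invariant_formD(1,3)[OF inv] H_in[OF that] u L_scale by simp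
  then show "u = (\<Sum>i<r + s. \<Phi> u (e' i) *\<^sub>M e i)" "u = (\<Sum>i<r + s. \<Phi> u (e i) *\<^sub>M e' i)"
    using expand[OF u] expand'[OF u] by (simp_all add: sum_e e_simps)
qed

text \<open>The element of the torus that represents the root \<open>\<alpha> a\<close> with respect to \<open>\<Phi>\<close>.\<close>

definition coroot :: "nat \<Rightarrow> 'k^'n^'n" where
  "coroot a = (\<Sum>i<r. of_rat (\<alpha> a i / q i) *\<^sub>M H i)"

lemma coroot_in: "coroot a \<in> L"
  unfolding coroot_def using H_in by (intro mat_vs.subspace_sum mat_vs.subspace_scale subspace_L) auto

text \<open>The bracket has weight \<open>0\<close>, so it is determined by its products with the \<open>H i\<close>.\<close>

lemma XY_same_root:
  assumes a: "a < s" "b < s" "\<And>i. i < r \<Longrightarrow> \<alpha> a i = \<alpha> b i"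
  shows "lie (X a) (Y b) = (if a = b then coroot a else 0)"
proof -
  let ?u = "lie (X a) (Y b)"
  note XL = X_in[OF a(1)] and YL = Y_in[OF a(2)]
  have u: "?u \<in> L" by (rule lie_subalgebraD(2)[OF lie_subalgebra XL YL])
  have Hu: "lie (H i) ?u = 0" if i: "i < r" for i
    using lie_lie[of "H i" "X a" "Y b"] HX[OF i a(1)] HY[OF i a(2)] a(3)[OF i]
    by (simp add: lie_scale lie_neg of_rat_minus)
  have root: "\<Phi> ?u (Y c) = 0" if c: "c < s" for c
  proof -
    obtain l where l: "l < r" "\<alpha> c l \<noteq> 0" using \<alpha>_nonzero[OF c] by blast
    note HL = H_in[OF l(1)] and YcL = Y_in[OF c]
    have "of_rat (- \<alpha> c l) * \<Phi> ?u (Y c) = \<Phi> (of_rat (- \<alpha> c l) *\<^sub>M Y c) ?u"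
      using invariant_formD(1,3)[OF inv YcL u] by simp
    also have "\<dots> = \<Phi> (lie (H l) (Y c)) ?u" by (simp only: HY[OF l(1) c])
    also have "\<dots> = \<Phi> ?u (lie (H l) (Y c))"
      by (rule invariant_formD(1)[OF inv lie_subalgebraD(2)[OF lie_subalgebra HL YcL] u])
    also have "\<dots> = \<Phi> (lie ?u (H l)) (Y c)" by (rule invariant_formD(4)[OF inv u HL YcL, symmetric])
    also have "lie ?u (H l) = 0 *\<^sub>M H l" using Hu[OF l(1)] lie_anti[of "H l" ?u] by simp
    also have "\<Phi> (0 *\<^sub>M H l) (Y c) = 0" using invariant_formD(3)[OF inv HL YcL, of 0] by simp
    finally show ?thesis using l(2) by simp
  qed
  have tor: "\<Phi> ?u (H i) = (if a = b then of_rat (\<alpha> a i) else 0)" if i: "i < r" for i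
  proof -
    note HL = H_in[OF i]
    have "\<Phi> ?u (H i) = \<Phi> (H i) ?u" by (rule invariant_formD(1)[OF inv u HL])
    also have "\<dots> = \<Phi> (lie (H i) (X a)) (Y b)" by (rule invariant_formD(4)[OF inv HL XL YL, symmetric])
    also have "\<dots> = of_rat (\<alpha> a i) * \<Phi> (X a) (Y b)"
      unfolding HX[OF i a(1)] by (rule invariant_formD(3)[OF inv XL YL])
    finally show ?thesis by (simp add: \<Phi>XY a)
  qed
  have "?u = (\<Sum>i<r. (\<Phi> ?u (H i) / of_rat (q i)) *\<^sub>M H i) + (\<Sum>c<s. \<Phi> ?u (Y c) *\<^sub>M X c)"
    by (rule expand[OF u])
  also have "\<dots> = (\<Sum>i<r. (if a = b then of_rat (\<alpha> a i / q i) else 0) *\<^sub>M H i)"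
    by (simp add: root tor of_rat_divide if_distrib[of "\<lambda>x. x / _"] cong: if_cong)
  finally show ?thesis by (simp add: coroot_def)
qed

lemma XY: "a < s \<Longrightarrow> lie (X a) (Y a) = (\<Sum>i<r. of_rat (\<alpha> a i / q i) *\<^sub>M H i)"
  using XY_same_root[of a a] by (simp add: coroot_def)

abbreviation C :: "('k^'n^'n \<Rightarrow> 'v \<Rightarrow> 'v) \<Rightarrow> 'v \<Rightarrow> 'v::ab_group_add" where
  "C act \<equiv> cas (r + s) e e' act"

text \<open>The form dual to \<open>\<Phi>\<close> on weights; it is positive definite because the \<open>q i\<close> are positive.\<close>

definition ip :: "(nat \<Rightarrow> rat) \<Rightarrow> (nat \<Rightarrow> rat) \<Rightarrow> rat" where
  "ip l m = (\<Sum>i<r. l i * m i / q i)"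

lemma ip_pos: "\<exists>i<r. l i \<noteq> 0 \<Longrightarrow> ip l l > 0"
proof -
  assume "\<exists>i<r. l i \<noteq> 0"
  then obtain i where i: "i < r" "l i \<noteq> 0" by blast
  have "0 < l i * l i / q i" using i q_pos[of i] by (intro divide_pos_pos) (auto simp: zero_less_mult_iff)
  moreover have "0 \<le> l j * l j / q j" if "j \<in> {..<r}" for j
    using q_pos[of j] that by (intro divide_nonneg_nonneg) auto
  ultimately show ?thesis unfolding ip_def using i by (intro sum_pos2[of "{..<r}" i]) auto
qed

definition wsp :: "('k \<Rightarrow> 'v \<Rightarrow> 'v) \<Rightarrow> 'v set \<Rightarrow> ('k^'n^'n \<Rightarrow> 'v \<Rightarrow> 'v) \<Rightarrow> (nat \<Rightarrow> rat) \<Rightarrow> 'v set" where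
  "wsp sc V act l = {v \<in> V. \<forall>i<r. act (H i) v = sc (of_rat (l i)) v}"

definition weights :: "(nat \<Rightarrow> rat) set" where
  "weights = {l. \<forall>i\<ge>r. l i = 0}"

text \<open>Modules of finite dimension with rational weights.  This class is stable under submodules
  (\<open>wmod_sub\<close>) and endomorphisms (\<open>wmod_endo\<close>).\<close>

definition wmod :: "('k \<Rightarrow> 'v::ab_group_add \<Rightarrow> 'v) \<Rightarrow> 'v set \<Rightarrow> ('k^'n^'n \<Rightarrow> 'v \<Rightarrow> 'v) \<Rightarrow> bool" where
  "wmod sc V act \<longleftrightarrow> lie_rep L sc V act \<and>
     (\<exists>P. finite P \<and> P \<subseteq> (\<Union>l. wsp sc V act l) \<and> module.span sc P = V)"

end

context torus_data
begin

context
  fixes sc :: "'k \<Rightarrow> 'v::ab_group_add \<Rightarrow> 'v" and V act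
  assumes rep: "lie_rep L sc V act"
begin

interpretation linear_space sc using rep by (simp add: lie_rep_def)

lemma wsp_subspace: "subspace (wsp sc V act l)"
proof -
  have "wsp sc V act l = V \<inter> (\<Inter>i\<in>{..<r}. {v \<in> V. act (H i) v = sc (of_rat (l i)) v})"
    by (auto simp: wsp_def)
  then show ?thesis
    using subspace_eigen[OF rep_subspace[OF rep] rep_lin[OF rep H_in]]
    by (auto intro!: subspace_inter subspace_Int rep_subspace[OF rep])
qed

text \<open>Only the coordinates below \<open>r\<close> of a weight matter, and weights in \<open>weights\<close> vanish beyond \<open>r\<close>, so
  distinct ones are separated by some \<open>H k\<close>; the coordinates are treated one after the other.\<close>

lemma wsp_independent:
  assumes "finite T" "T \<subseteq> weights" "\<And>l. l \<in> T \<Longrightarrow> v l \<in> wsp sc V act l" "(\<Sum>l\<in>T. v l) = 0" "l0 \<in> T"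
  shows "v l0 = 0"
proof -
  note sV = rep_subspace[OF rep]
  have vV: "v l \<in> V" if "l \<in> T" for l using assms(3)[OF that] by (simp add: wsp_def)
  have "(\<Sum>l | l \<in> T \<and> (\<forall>i<k. l i = l0 i). v l) = 0" if "k \<le> r" for k
    using that
  proof (induction k)
    case 0
    then show ?case using assms by simp
  next
    case (Suc k)
    let ?T = "{l \<in> T. \<forall>i<k. l i = l0 i}"
    have kr: "k < r" using Suc by simp
    define w where "w c = (\<Sum>l | l \<in> ?T \<and> of_rat (l k) = c. v l)" for c :: 'k
    have fT: "finite ?T" using assms by simp
    let ?S = "(\<lambda>l. of_rat (l k) :: 'k) ` ?T"
    have sw: "(\<Sum>c\<in>?S. w c) = 0"
      unfolding w_def using Suc fT by (subst sum.group) auto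
    have wV: "w c \<in> V" for c unfolding w_def using vV by (intro subspace_sum[OF sV]) auto
    have we: "act (H k) (w c) = sc c (w c)" for c
    proof -
      have "act (H k) (w c) = (\<Sum>l | l \<in> ?T \<and> of_rat (l k) = c. act (H k) (v l))"
        unfolding w_def by (rule rep_sum[OF rep H_in[OF kr]]) (use vV in auto)
      also have "\<dots> = (\<Sum>l | l \<in> ?T \<and> of_rat (l k) = c. sc c (v l))"
        using assms(3) kr by (intro sum.cong refl) (auto simp: wsp_def)
      finally show ?thesis by (simp add: w_def scale_sum_right)
    qed
    have "\<forall>c\<in>?S. w c \<in> {0}"
      by (rule geig_components[OF sV rep_lin[OF rep H_in[OF kr]] _ subspace_single_0])
         (use rep_in[OF rep H_in[OF kr]] sV fT wV we geig_eigenvector sw in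
           \<open>auto simp: subspace_0 rep_zero[OF rep H_in[OF kr]]\<close>)
    then have "w (of_rat (l0 k)) = 0" using assms(5) by auto
    also have "w (of_rat (l0 k)) = (\<Sum>l | l \<in> T \<and> (\<forall>i<Suc k. l i = l0 i). v l)"
      unfolding w_def by (intro sum.cong) (auto simp: less_Suc_eq)
    finally show ?case .
  qed
  from this[of r] have "(\<Sum>l | l \<in> T \<and> (\<forall>i<r. l i = l0 i). v l) = 0" by simp
  also have "{l. l \<in> T \<and> (\<forall>i<r. l i = l0 i)} = {l0}"
  proof -
    have "l = l0" if "l \<in> T" "\<forall>i<r. l i = l0 i" for l
      using that assms(2,5) unfolding weights_def
      by (intro ext) (metis (mono_tags, lifting) linorder_not_less mem_Collect_eq subsetD)
    then show ?thesis using assms(5) by blast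
  qed
  finally show ?thesis by simp
qed

lemma wsp_outside:
  assumes "finite S" "S \<subseteq> weights" "V \<subseteq> span (\<Union>l\<in>S. wsp sc V act l)"
    and "m \<in> weights" "m \<notin> S" "v \<in> wsp sc V act m"
  shows "v = 0"
proof -
  have "v \<in> span (\<Union>l\<in>S. wsp sc V act l)" using assms by (auto simp: wsp_def)
  from span_Union_subspaces[OF wsp_subspace this] obtain T w where
    T: "finite T" "T \<subseteq> S" "\<And>l. w l \<in> wsp sc V act l" "v = (\<Sum>l\<in>T. w l)" by blast
  let ?w = "w(m := - v)"
  have "m \<notin> T" using T assms by auto
  then have "(\<Sum>l\<in>insert m T. ?w l) = - v + (\<Sum>l\<in>T. ?w l)" using T(1) by simp
  also have "(\<Sum>l\<in>T. ?w l) = (\<Sum>l\<in>T. w l)" using \<open>m \<notin> T\<close> by (intro sum.cong) auto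
  finally have "(\<Sum>l\<in>insert m T. ?w l) = 0" using T(4) by simp
  moreover have "?w l \<in> wsp sc V act l" if "l \<in> insert m T" for l
    using T(3) subspace_neg[OF wsp_subspace assms(6)] by simp
  ultimately have "?w m = 0"
    using T(1,2) assms(2,4) by (intro wsp_independent[where T = "insert m T" and v = ?w]) auto
  then show ?thesis by simp
qed

lemma wsp_shift:
  assumes "v \<in> wsp sc V act l" "a < s"
  shows "act (X a) v \<in> wsp sc V act (\<lambda>i. l i + \<alpha> a i)" "act (Y a) v \<in> wsp sc V act (\<lambda>i. l i - \<alpha> a i)"
proof -
  have v: "v \<in> V" "\<And>i. i < r \<Longrightarrow> act (H i) v = sc (of_rat (l i)) v" using assms by (auto simp: wsp_def)
  have "act (H i) (act (X a) v) = sc (of_rat (l i + \<alpha> a i)) (act (X a) v)" if i: "i < r" for i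
  proof -
    have "act (H i) (act (X a) v) = act (lie (H i) (X a)) v + act (X a) (act (H i) v)"
      using rep_lie[OF rep H_in[OF i] X_in[OF assms(2)] v(1)] by simp
    then show ?thesis using i v assms X_in
      by (simp add: HX v rep_scale_left[OF rep] rep_scale[OF rep] of_rat_add scale_left_distrib add.commute)
  qed
  then show "act (X a) v \<in> wsp sc V act (\<lambda>i. l i + \<alpha> a i)"
    using rep_in[OF rep X_in[OF assms(2)] v(1)] by (simp add: wsp_def)
  have "act (H i) (act (Y a) v) = sc (of_rat (l i - \<alpha> a i)) (act (Y a) v)" if i: "i < r" for i
  proof -
    have "act (H i) (act (Y a) v) = act (lie (H i) (Y a)) v + act (Y a) (act (H i) v)"
      using rep_lie[OF rep H_in[OF i] Y_in[OF assms(2)] v(1)] by simp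
    also have "act (lie (H i) (Y a)) v = sc (of_rat (- \<alpha> a i)) (act (Y a) v)"
      by (simp only: HY[OF i assms(2)] rep_scale_left[OF rep Y_in[OF assms(2)] v(1)])
    finally show ?thesis using i v Y_in[OF assms(2)]
      by (simp add: rep_scale[OF rep] of_rat_diff of_rat_minus scale_left_diff_distrib)
  qed
  then show "act (Y a) v \<in> wsp sc V act (\<lambda>i. l i - \<alpha> a i)"
    using rep_in[OF rep Y_in[OF assms(2)] v(1)] by (simp add: wsp_def)
qed

lemma wsp_restrict: "wsp sc V act l = wsp sc V act (\<lambda>i. if i < r then l i else 0)"
  by (auto simp: wsp_def)

lemma C_split:
  assumes "v \<in> V"
  shows "C act v = (\<Sum>i<r. sc (1 / of_rat (q i)) (act (H i) (act (H i) v))) + (\<Sum>a<s. act (Y a) (act (X a) v))"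
  by (simp add: cas_def sum_e e_simps rep_scale_left[OF rep] H_in rep_in[OF rep] assms)

text \<open>Let \<open>v\<close> have a weight \<open>l\<close> of maximal length.  If \<open>ip (\<alpha> a) l \<ge> 0\<close> then \<open>l + \<alpha> a\<close> is longer than \<open>l\<close>, so
  \<open>X a\<close> kills \<open>v\<close>.  Otherwise \<open>l - \<alpha> a\<close> is longer, \<open>Y a\<close> kills \<open>v\<close>, and \<open>Y a X a v = - [X a, Y a] v\<close> is
  known from the coroot.\<close>

lemma C_on_extremal:
  assumes S: "finite S" "S \<subseteq> weights" "V \<subseteq> span (\<Union>l\<in>S. wsp sc V act l)"
    and l: "l \<in> S" "\<And>m. m \<in> S \<Longrightarrow> ip m m \<le> ip l l" and v: "v \<in> wsp sc V act l"
  shows "C act v = sc (of_rat (ip l l + (\<Sum>a<s. max 0 (- ip (\<alpha> a) l)))) v"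
proof -
  have vV: "v \<in> V" and vH: "\<And>i. i < r \<Longrightarrow> act (H i) v = sc (of_rat (l i)) v" using v by (auto simp: wsp_def)
  have kill: "w = 0" if "w \<in> wsp sc V act m" "ip m m > ip l l" for w m
  proof (rule wsp_outside[OF S])
    let ?m = "\<lambda>i. if i < r then m i else 0"
    show "?m \<in> weights" by (simp add: weights_def)
    show "w \<in> wsp sc V act ?m" using that wsp_restrict by blast
    have "ip ?m ?m = ip m m" by (simp add: ip_def)
    then show "?m \<notin> S" using l(2)[of ?m] that by auto
  qed
  have aa: "ip (\<alpha> a) (\<alpha> a) > 0" if "a < s" for a using \<alpha>_nonzero[OF that] by (rule ip_pos)
  (* the sign of the product with the root decides which root vector kills v *)
  have root: "act (Y a) (act (X a) v) = sc (of_rat (max 0 (- ip (\<alpha> a) l))) v" if a: "a < s" for a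
  proof (cases "ip (\<alpha> a) l \<ge> 0")
    case True
    have "ip (\<lambda>i. l i + \<alpha> a i) (\<lambda>i. l i + \<alpha> a i) = ip l l + 2 * ip (\<alpha> a) l + ip (\<alpha> a) (\<alpha> a)"
      by (simp add: ip_def sum.distrib[symmetric] sum_distrib_left add_divide_distrib[symmetric] algebra_simps)
    then have "act (X a) v = 0" using True aa[OF a] by (intro kill[OF wsp_shift(1)[OF v a]]) simp
    then show ?thesis using True Y_in[OF a] by (simp add: rep_zero[OF rep])
  next
    case False
    have "ip (\<lambda>i. l i - \<alpha> a i) (\<lambda>i. l i - \<alpha> a i) = ip l l - 2 * ip (\<alpha> a) l + ip (\<alpha> a) (\<alpha> a)"
      by (simp add: ip_def sum.distrib[symmetric] sum_subtractf[symmetric] sum_distrib_left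
          add_divide_distrib[symmetric] diff_divide_distrib[symmetric] algebra_simps)
    then have Y0: "act (Y a) v = 0" using False aa[OF a] by (intro kill[OF wsp_shift(2)[OF v a]]) simp
    have "act (lie (X a) (Y a)) v = act (X a) (act (Y a) v) - act (Y a) (act (X a) v)"
      by (rule rep_lie[OF rep X_in[OF a] Y_in[OF a] vV])
    then have "act (Y a) (act (X a) v) = - act (lie (X a) (Y a)) v"
      using Y0 X_in[OF a] by (simp add: rep_zero[OF rep])
    also have "act (lie (X a) (Y a)) v = (\<Sum>i<r. sc (of_rat (\<alpha> a i / q i)) (act (H i) v))"
      unfolding XY[OF a] using H_in L_scale vV
      by (subst rep_sum_left[OF rep lie_subalgebra]) (auto simp: rep_scale_left[OF rep])
    also have "\<dots> = (\<Sum>i<r. sc (of_rat (\<alpha> a i * l i / q i)) v)"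
      by (intro sum.cong refl) (simp add: vH of_rat_mult of_rat_divide)
    also have "\<dots> = sc (of_rat (ip (\<alpha> a) l)) v"
      by (simp add: ip_def of_rat_sum scale_sum_left)
    finally show ?thesis using False by (simp add: of_rat_minus)
  qed
  have tor: "sc (1 / of_rat (q i)) (act (H i) (act (H i) v)) = sc (of_rat (l i * l i / q i)) v" if "i < r" for i
    using that vH H_in vV by (simp add: rep_scale[OF rep] of_rat_mult of_rat_divide)
  have "C act v = (\<Sum>i<r. sc (of_rat (l i * l i / q i)) v) + (\<Sum>a<s. sc (of_rat (max 0 (- ip (\<alpha> a) l))) v)"
    unfolding C_split[OF vV] by (intro arg_cong2[of _ _ _ _ "(+)"] sum.cong refl) (auto simp: tor root)
  also have "\<dots> = sc (of_rat (ip l l + (\<Sum>a<s. max 0 (- ip (\<alpha> a) l)))) v"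
    by (simp add: ip_def of_rat_sum of_rat_add scale_sum_left scale_left_distrib)
  finally show ?thesis .
qed

text \<open>A root vector changes the weight by a nonzero root.\<close>

lemma zero_weight_trivial:
  assumes "V \<subseteq> span (wsp sc V act (\<lambda>_. 0))" "u \<in> L" "v \<in> V"
  shows "act u v = 0"
proof -
  have V0: "V \<subseteq> wsp sc V act (\<lambda>_. 0)" using assms(1) wsp_subspace by (metis span_eq_iff)
  have H0: "act (H i) v = 0" if "i < r" for i using V0 assms(3) that by (auto simp: wsp_def)
  have X0: "act (X a) v = 0" if a: "a < s" for a
  proof -
    obtain i where i: "i < r" "\<alpha> a i \<noteq> 0" using \<alpha>_nonzero[OF a] by auto
    have "act (X a) v \<in> V" by (rule rep_in[OF rep X_in[OF a] assms(3)])
    then have "act (H i) (act (X a) v) = 0" using V0 i by (auto simp: wsp_def)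
    moreover have "v \<in> wsp sc V act (\<lambda>_. 0)" using V0 assms(3) by auto
    from wsp_shift(1)[OF this a] have "act (H i) (act (X a) v) = sc (of_rat (\<alpha> a i)) (act (X a) v)"
      using i by (simp add: wsp_def)
    ultimately show ?thesis using i by simp
  qed
  have "act u v = act ((\<Sum>i<r. (\<Phi> u (H i) / of_rat (q i)) *\<^sub>M H i) + (\<Sum>a<s. \<Phi> u (Y a) *\<^sub>M X a)) v"
    using expand[OF assms(2)] by simp
  also have "\<dots> = (\<Sum>i<r. act ((\<Phi> u (H i) / of_rat (q i)) *\<^sub>M H i) v) + (\<Sum>a<s. act (\<Phi> u (Y a) *\<^sub>M X a) v)"
  proof -
    have "(\<Phi> u (H i) / of_rat (q i)) *\<^sub>M H i \<in> L" if "i < r" for i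
      by (rule L_scale[OF H_in[OF that]])
    moreover have "\<Phi> u (Y a) *\<^sub>M X a \<in> L" if "a < s" for a
      by (rule L_scale[OF X_in[OF that]])
    ultimately show ?thesis
      by (subst rep_add_left[OF rep])
         (auto intro!: L_sum arg_cong2[of _ _ _ _ "(+)"]
           rep_sum_left[OF rep lie_subalgebra assms(3)] assms(3))
  qed
  also have "\<dots> = 0"
    using H_in X_in assms by (simp add: rep_scale_left[OF rep] H0 X0)
  finally show ?thesis .
qed

end

end

section \<open>Complete reducibility of modules with rational weights\<close>

context torus_data
begin

lemma C_lin:
  assumes "lie_rep L sc V act"
  shows "lin_on sc V sc (C act)" "v \<in> V \<Longrightarrow> C act v \<in> V"
  using cas_lin[OF assms lie_subalgebra, of "r + s" e e'] dual_pairD(1,2)[OF dual_e] by auto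

lemma C_commutes:
  assumes "lie_rep L sc V act" "u \<in> L" "v \<in> V"
  shows "act u (C act v) = C act (act u v)"
  by (rule cas_commutes[OF assms(1) lie_subalgebra inv dual_e assms(2,3)])

text \<open>\<open>C - c\<close> kills the weight space of a longest weight, where \<open>c\<close> is the scalar of \<open>C_on_extremal\<close>, and
  its image is a module with fewer nonzero weights.  When only the weight \<open>0\<close> is left, \<open>L\<close> acts
  trivially.\<close>

lemma shifts_reach_invariants:
  assumes "lie_rep L sc V act" "finite S" "S \<subseteq> weights"
    "V \<subseteq> module.span sc (\<Union>l\<in>S. wsp sc V act l)"
  shows "\<exists>cs. (\<forall>c\<in>set cs. c > 0) \<and> (\<forall>v\<in>V. \<forall>u\<in>L.
     act u (foldr (\<lambda>c w. C act w - sc (of_rat c) w) cs v) = 0)"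
  using assms
proof (induction "card (S - {\<lambda>_. 0})" arbitrary: V S rule: less_induct)
  case less
  note rep = less.prems(1)
  interpret linear_space sc using rep by (simp add: lie_rep_def)
  note sV = rep_subspace[OF rep]
  show ?case
  proof (cases "S \<subseteq> {\<lambda>_. 0}")
    case True
    then have "V \<subseteq> span (wsp sc V act (\<lambda>_. 0))"
      using less.prems(4) span_mono[of "\<Union>l\<in>S. wsp sc V act l" "wsp sc V act (\<lambda>_. 0)"] by auto
    from zero_weight_trivial[OF rep this] show ?thesis by (intro exI[of _ "[]"]) simp
  next
    case False
    then obtain l1 where l1: "l1 \<in> S" "l1 \<noteq> (\<lambda>_. 0)" by auto
    then obtain i where "l1 i \<noteq> 0" by (meson ext)
    then have "i < r" using l1 less.prems(3) unfolding weights_def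
      by (metis (mono_tags, lifting) linorder_not_less mem_Collect_eq subsetD)
    then have pos1: "ip l1 l1 > 0" using \<open>l1 i \<noteq> 0\<close> by (intro ip_pos) auto
    have "Max ((\<lambda>m. ip m m) ` S) \<in> (\<lambda>m. ip m m) ` S"
      using l1 less.prems(2) by (intro Max_in) auto
    then obtain l where l: "l \<in> S" "ip l l = Max ((\<lambda>m. ip m m) ` S)" by auto
    have lmax: "ip m m \<le> ip l l" if "m \<in> S" for m
      unfolding l(2) using that less.prems(2) by (intro Max_ge) auto
    have "l \<noteq> (\<lambda>_. 0)" using lmax[OF l1(1)] pos1 by (auto simp: ip_def)
    define c where "c = ip l l + (\<Sum>a<s. max 0 (- ip (\<alpha> a) l))"
    have "c > 0" using lmax[OF l1(1)] pos1 unfolding c_def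
      by (intro add_pos_nonneg sum_nonneg) auto
    let ?T = "\<lambda>w. C act w - sc (of_rat c) w"
    have CV: "C act ` V \<subseteq> V" using C_lin(2)[OF rep] by auto
    note T = shift_lin[OF sV C_lin(1)[OF rep] CV, of "of_rat c"]
    have T0: "?T w = 0" if "w \<in> wsp sc V act l" for w
      using C_on_extremal[OF rep less.prems(2,3,4) l(1) lmax that] by (simp add: c_def)
    have actT: "act u (?T v) = ?T (act u v)" if "u \<in> L" "v \<in> V" for u v
    proof -
      have "act u (?T v) = act u (C act v) - act u (sc (of_rat c) v)"
        by (rule rep_diff[OF rep that(1) C_lin(2)[OF rep that(2)] subspace_scale[OF sV that(2)]])
      also have "act u (C act v) = C act (act u v)"
        by (rule C_commutes[OF rep that])
      also have "act u (sc (of_rat c) v) = sc (of_rat c) (act u v)"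
        by (rule rep_scale[OF rep that])
      finally show ?thesis .
    qed
    let ?V = "?T ` V"
    have sV': "subspace ?V" by (rule subspace_lin_image[OF sV T(1)])
    have rep': "lie_rep L sc ?V act"
    proof (rule rep_sub[OF rep sV' T(2)])
      fix u w assume u: "u \<in> L" and "w \<in> ?V"
      then obtain v where "v \<in> V" "w = ?T v" by blast
      then show "act u w \<in> ?V"
        using actT[OF u] rep_in[OF rep u] by (intro image_eqI[of _ _ "act u v"]) simp_all
    qed
    let ?S = "S - {l}"
    have sp: "?V \<subseteq> span (\<Union>l\<in>?S. wsp sc ?V act l)"
    proof
      fix y assume "y \<in> ?V"
      then obtain v where v: "v \<in> V" "y = ?T v" by blast
      then have "v \<in> span (\<Union>l\<in>S. wsp sc V act l)" using less.prems(4) by blast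
      from span_Union_subspaces[OF wsp_subspace[OF rep] this] obtain R w where
        R: "finite R" "R \<subseteq> S" "\<And>l. w l \<in> wsp sc V act l" "v = (\<Sum>l\<in>R. w l)" by blast
      have wV: "w l \<in> V" for l using R(3) by (auto simp: wsp_def)
      have "y = (\<Sum>m\<in>R. ?T (w m))"
        unfolding v(2) R(4) by (rule lin_on_sum[OF sV T(1) wV])
      also have "\<dots> = (\<Sum>m\<in>R - {l}. ?T (w m))"
        by (rule sum.mono_neutral_right) (use R(1) T0[OF R(3)] in auto)
      also have "\<dots> \<in> span (\<Union>l\<in>?S. wsp sc ?V act l)"
      proof (intro span_sum span_base)
        fix m assume m: "m \<in> R - {l}"
        have "act (H i) (?T (w m)) = sc (of_rat (m i)) (?T (w m))" if "i < r" for i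
        proof -
          have "act (H i) (w m) = sc (of_rat (m i)) (w m)" using R(3)[of m] that by (simp add: wsp_def)
          then show ?thesis using actT[OF H_in[OF that] wV[of m]] lin_onD(2)[OF T(1) wV[of m]] by simp
        qed
        then have "?T (w m) \<in> wsp sc ?V act m" using wV[of m] by (auto simp: wsp_def)
        then show "?T (w m) \<in> (\<Union>l\<in>?S. wsp sc ?V act l)" using m R(2) by blast
      qed
      finally show "y \<in> span (\<Union>l\<in>?S. wsp sc ?V act l)" .
    qed
    have "card (?S - {\<lambda>_. 0}) < card (S - {\<lambda>_. 0})"
      using less.prems(2) l(1) \<open>l \<noteq> (\<lambda>_. 0)\<close> by (intro psubset_card_mono) auto
    from less.hyps[OF this rep' _ _ sp] less.prems(2,3) obtain cs where
      cs: "\<forall>c\<in>set cs. c > 0" "\<forall>v\<in>?V. \<forall>u\<in>L. act u (foldr (\<lambda>c w. C act w - sc (of_rat c) w) cs v) = 0"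
      by auto
    then show ?thesis using \<open>c > 0\<close>
      by (intro exI[of _ "cs @ [c]"]) auto
  qed
qed

lemma wmod_rep: "wmod sc V act \<Longrightarrow> lie_rep L sc V act"
  by (simp add: wmod_def)

text \<open>A finite spanning set of weight vectors provides the finite set of weights on which
  \<open>shifts_reach_invariants\<close> inducts.\<close>

lemma wmod_shifts:
  assumes "wmod sc V act"
  obtains cs where "\<And>c. c \<in> set cs \<Longrightarrow> c > 0"
    "\<And>v u. v \<in> V \<Longrightarrow> u \<in> L \<Longrightarrow> act u (foldr (\<lambda>c w. C act w - sc (of_rat c) w) cs v) = 0"
proof -
  note rep = wmod_rep[OF assms]
  interpret linear_space sc using rep by (simp add: lie_rep_def)
  obtain P where P: "finite P" "P \<subseteq> (\<Union>l. wsp sc V act l)" "span P = V"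
    using assms by (auto simp: wmod_def)
  have "\<forall>p\<in>P. \<exists>l. l \<in> weights \<and> p \<in> wsp sc V act l"
  proof
    fix p assume "p \<in> P"
    then obtain l where "p \<in> wsp sc V act l" using P(2) by blast
    then show "\<exists>l. l \<in> weights \<and> p \<in> wsp sc V act l"
      using wsp_restrict[OF rep, of l] by (intro exI[of _ "\<lambda>i. if i < r then l i else 0"]) (auto simp: weights_def)
  qed
  from bchoice[OF this] obtain f where f: "\<And>p. p \<in> P \<Longrightarrow> f p \<in> weights \<and> p \<in> wsp sc V act (f p)" by blast
  have "V \<subseteq> span (\<Union>l\<in>f ` P. wsp sc V act l)"
    unfolding P(3)[symmetric] using f by (intro span_mono) (auto simp: P(3))
  moreover have "f ` P \<subseteq> weights" using f by blast
  ultimately obtain cs where "\<forall>c\<in>set cs. c > 0"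
    "\<forall>v\<in>V. \<forall>u\<in>L. act u (foldr (\<lambda>c w. C act w - sc (of_rat c) w) cs v) = 0"
    using shifts_reach_invariants[OF rep finite_imageI[OF P(1)]] by blast
  then show ?thesis using that by blast
qed

text \<open>\<open>C\<close> maps \<open>v\<close> into \<open>W\<close>, so the product of the operators \<open>C - c\<close> acts on \<open>v\<close> modulo \<open>W\<close> as the product
  of the scalars \<open>- c\<close>, which is nonzero because the \<open>c\<close> are positive; and its values are
  invariant.\<close>

lemma reynolds:
  assumes "wmod sc V act" and v: "v \<in> V"
    and W: "module.subspace sc W" "W \<subseteq> V" "\<And>u w. u \<in> L \<Longrightarrow> w \<in> W \<Longrightarrow> act u w \<in> W"
    and vW: "\<And>u. u \<in> L \<Longrightarrow> act u v \<in> W"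
  shows "\<exists>w\<in>W. \<forall>u\<in>L. act u (v - w) = 0"
proof -
  note rep = wmod_rep[OF assms(1)]
  interpret linear_space sc using rep by (simp add: lie_rep_def)
  note sV = rep_subspace[OF rep]
  obtain cs where cs: "\<And>c. c \<in> set cs \<Longrightarrow> c > 0"
    "\<And>v u. v \<in> V \<Longrightarrow> u \<in> L \<Longrightarrow> act u (foldr (\<lambda>c w. C act w - sc (of_rat c) w) cs v) = 0"
    using wmod_shifts[OF assms(1)] by blast
  have e: "e i \<in> L" "e' i \<in> L" if "i < r + s" for i using dual_pairD(1,2)[OF dual_e that] .
  have Cv: "C act v \<in> W" unfolding cas_def
    by (intro subspace_sum[OF W(1)] W(3) vW) (auto intro: e)
  have CW: "C act w \<in> W" if "w \<in> W" for w unfolding cas_def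
    by (intro subspace_sum[OF W(1)] W(3) that) (auto intro: e)
  have "\<exists>p w. p \<noteq> 0 \<and> w \<in> W \<and> foldr (\<lambda>c w. C act w - sc (of_rat c) w) cs v = sc p v + w"
    using cs(1)
  proof (induction cs)
    case Nil
    then show ?case using subspace_0[OF W(1)] by (intro exI[of _ 1] exI[of _ 0]) auto
  next
    case (Cons c cs)
    then obtain p w where p: "p \<noteq> 0" "w \<in> W" "foldr (\<lambda>c w. C act w - sc (of_rat c) w) cs v = sc p v + w"
      by auto
    have "C act (sc p v + w) - sc (of_rat c) (sc p v + w) =
        sc (- of_rat c * p) v + (sc p (C act v) + C act w - sc (of_rat c) w)"
      using v p(2) W(2) subspace_scale[OF sV]
      by (subst lin_onD(1)[OF C_lin(1)[OF rep]])
         (auto simp: lin_onD(2)[OF C_lin(1)[OF rep]] scale_right_distrib algebra_simps)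
    moreover have "sc p (C act v) + C act w - sc (of_rat c) w \<in> W"
      using Cv CW p(2) by (intro subspace_diff subspace_add subspace_scale W(1))
    moreover have "- of_rat c * p \<noteq> 0" using Cons.prems[of c] p(1) by simp
    ultimately show ?case unfolding foldr.simps comp_apply p(3) by blast
  qed
  then obtain p w where p: "p \<noteq> 0" "w \<in> W"
    "foldr (\<lambda>c w. C act w - sc (of_rat c) w) cs v = sc p v + w" by blast
  have "act u (v - sc (- inverse p) w) = 0" if u: "u \<in> L" for u
  proof -
    have "v - sc (- inverse p) w = sc (inverse p) (sc p v + w)"
      using p(1) by (simp add: scale_right_distrib)
    moreover have "act u (sc p v + w) = 0" using cs(2)[OF v u] p(3) by simp
    moreover have "sc p v + w \<in> V" using v p(2) W(2) by (auto intro: subspace_add[OF sV] subspace_scale[OF sV])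
    ultimately show ?thesis using rep_scale[OF rep u, of "sc p v + w" "inverse p"] by simp
  qed
  moreover have "sc (- inverse p) w \<in> W" by (rule subspace_scale[OF W(1) p(2)])
  ultimately show ?thesis by blast
qed

end

text \<open>Extension by \<open>0\<close> outside \<open>V\<close> makes equality of functions the equality on \<open>V\<close>.\<close>

definition endo :: "('k::field \<Rightarrow> 'v::ab_group_add \<Rightarrow> 'v) \<Rightarrow> 'v set \<Rightarrow> ('v \<Rightarrow> 'v) set" where
  "endo sc V = {F. (\<forall>v. v \<notin> V \<longrightarrow> F v = 0) \<and> lin_on sc V sc F \<and> F ` V \<subseteq> V}"

definition endo_act :: "('m \<Rightarrow> 'v \<Rightarrow> 'v) \<Rightarrow> 'v set \<Rightarrow> 'm \<Rightarrow> ('v \<Rightarrow> 'v) \<Rightarrow> 'v \<Rightarrow> 'v::ab_group_add" where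
  "endo_act act V u F = (\<lambda>v. if v \<in> V then act u (F v) - F (act u v) else 0)"

lemma endoD:
  assumes "F \<in> endo sc V"
  shows "lin_on sc V sc F" "v \<in> V \<Longrightarrow> F v \<in> V" "v \<notin> V \<Longrightarrow> F v = 0"
  using assms by (auto simp: endo_def)

lemma endo_eqI:
  assumes "F \<in> endo sc V" "G \<in> endo sc V" "\<And>v. v \<in> V \<Longrightarrow> F v = G v"
  shows "F = G"
  using assms by (auto simp: endo_def fun_eq_iff) metis

lemma sum_fun_apply: "(\<Sum>i\<in>A. f i) x = (\<Sum>i\<in>A. f i x)" for f :: "'i \<Rightarrow> 'a \<Rightarrow> 'b::comm_monoid_add"
  by (induction A rule: infinite_finite_induct) auto

lemma subspace_endo:
  assumes "linear_space sc" "module.subspace sc V"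
  shows "module.subspace (fscale sc) (endo sc V)"
proof -
  interpret linear_space sc by fact
  interpret f: linear_space "fscale sc" by (rule linear_space_fscale) fact
  show ?thesis
  proof (rule f.subspaceI)
    show "0 \<in> endo sc V" using assms(2) by (auto simp: endo_def lin_on_def subspace_0)
    show "F + G \<in> endo sc V" if "F \<in> endo sc V" "G \<in> endo sc V" for F G
      using that subspace_add[OF assms(2)]
      by (auto simp: endo_def lin_on_def scale_right_distrib image_subset_iff)
    show "fscale sc c F \<in> endo sc V" if "F \<in> endo sc V" for c F
      using that subspace_scale[OF assms(2)]
      by (auto simp: endo_def lin_on_def fscale_def scale_right_distrib mult.commute image_subset_iff)
  qed
qed

lemma lie_rep_endo:
  assumes rep: "lie_rep L sc V act" and L: "lie_subalgebra L"
  shows "lie_rep L (fscale sc) (endo sc V) (endo_act act V)"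
proof -
  interpret linear_space sc using rep by (simp add: lie_rep_def)
  note sV = rep_subspace[OF rep]
  have cl: "endo_act act V u F \<in> endo sc V" if "u \<in> L" "F \<in> endo sc V" for u F
    using that endoD[OF that(2)] sV
    by (auto simp: endo_def endo_act_def lin_on_def rep_in[OF rep] rep_add[OF rep] rep_scale[OF rep]
        subspace_add subspace_scale subspace_diff scale_right_diff_distrib)
  have "endo_act act V u (F + G) = endo_act act V u F + endo_act act V u G"
    "endo_act act V u (fscale sc c F) = fscale sc c (endo_act act V u F)"
    if "u \<in> L" "F \<in> endo sc V" "G \<in> endo sc V" for u F G c
    using that endoD[OF that(2)] endoD[OF that(3)]
    by (auto simp: endo_act_def fscale_def fun_eq_iff rep_add[OF rep] rep_scale[OF rep] scale_right_diff_distrib)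
  moreover have "endo_act act V (u + w) F = endo_act act V u F + endo_act act V w F"
    "endo_act act V (c *\<^sub>M u) F = fscale sc c (endo_act act V u F)"
    "endo_act act V (lie u w) F = endo_act act V u (endo_act act V w F) - endo_act act V w (endo_act act V u F)"
    if "u \<in> L" "w \<in> L" "F \<in> endo sc V" for u w F c
    using that endoD(2)[OF that(3)]
    by (auto simp: endo_act_def fscale_def fun_eq_iff rep_add_left[OF rep] rep_scale_left[OF rep] rep_lie[OF rep]
        rep_in[OF rep] rep_diff[OF rep] scale_right_diff_distrib lin_onD[OF endoD(1)[OF that(3)]]
        lin_on_diff[OF sV endoD(1)[OF that(3)]])
  ultimately show ?thesis
    unfolding lie_rep_def
    using linear_space_fscale[OF linear_space_axioms] subspace_endo[OF linear_space_axioms sV] cl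
    by (auto simp: lin_on_def)
qed

context torus_data
begin

lemma wmod_endo:
  assumes "wmod sc V act"
  shows "wmod (fscale sc) (endo sc V) (endo_act act V)"
proof -
  note rep = wmod_rep[OF assms]
  interpret linear_space sc using rep by (simp add: lie_rep_def)
  interpret f: linear_space "fscale sc" by (rule linear_space_fscale) unfold_locales
  note sV = rep_subspace[OF rep]
  obtain P where P: "finite P" "P \<subseteq> (\<Union>l. wsp sc V act l)" "span P = V"
    using assms by (auto simp: wmod_def)
  then have "fin_dim V" by (auto simp: fin_dim_def)
  from basis_within[OF this P(3)] obtain B where
    B: "B \<subseteq> P" "finite B" "independent B" "span B = V" by blast
  have BV: "b \<in> V" if "b \<in> B" for b using B(4) that span_base by blast
  have "\<forall>b\<in>B. \<exists>l. b \<in> wsp sc V act l" using B(1) P(2) by blast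
  from bchoice[OF this] obtain l where l: "\<And>b. b \<in> B \<Longrightarrow> b \<in> wsp sc V act (l b)" by blast
  define E where "E = (\<lambda>(b, c). \<lambda>v. if v \<in> V then sc (representation B v c) b else 0)"
  have E_in: "E (b, c) \<in> endo sc V" if "b \<in> B" for b c
    using that BV B sV
    by (auto simp: E_def endo_def lin_on_def subspace_add subspace_scale representation_add
        representation_scale scale_left_distrib)
  have repH: "representation B (act (H i) v) c = of_rat (l c i) * representation B v c"
    if "i < r" "v \<in> V" "c \<in> B" for i v c
  proof -
    have "act (H i) v = act (H i) (\<Sum>b\<in>B. sc (representation B v b) b)"
      using sum_representation_eq[of B v B] B that by simp
    also have "\<dots> = (\<Sum>b\<in>B. act (H i) (sc (representation B v b) b))"
      by (rule rep_sum[OF rep H_in[OF that(1)]]) (use BV subspace_scale[OF sV] in auto)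
    also have "\<dots> = (\<Sum>b\<in>B. sc (representation B v b * of_rat (l b i)) b)"
      using l BV that by (intro sum.cong refl) (auto simp: rep_scale[OF rep H_in] wsp_def)
    finally have "representation B (act (H i) v) c =
        representation B (\<Sum>b\<in>B. sc (representation B v b * of_rat (l b i)) b) c" by simp
    also have "\<dots> = (\<Sum>b\<in>B. representation B (sc (representation B v b * of_rat (l b i)) b) c)"
      using B BV by (subst representation_sum) (auto intro!: span_scale)
    also have "\<dots> = (\<Sum>b\<in>B. if b = c then representation B v b * of_rat (l b i) else 0)"
      using B BV
      by (intro sum.cong refl) (simp add: representation_scale[OF B(3) span_base] representation_basis)
    also have "\<dots> = of_rat (l c i) * representation B v c" using that(3) B(2) by (simp add: mult.commute)
    finally show ?thesis .
  qed
  have E_wt: "E (b, c) \<in> wsp (fscale sc) (endo sc V) (endo_act act V) (\<lambda>i. l b i - l c i)"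
    if bc: "b \<in> B" "c \<in> B" for b c
  proof -
    have "endo_act act V (H i) (E (b, c)) = fscale sc (of_rat (l b i - l c i)) (E (b, c))" if i: "i < r" for i
    proof
      fix v
      show "endo_act act V (H i) (E (b, c)) v = fscale sc (of_rat (l b i - l c i)) (E (b, c)) v"
      proof (cases "v \<in> V")
        case True
        have "act (H i) b = sc (of_rat (l b i)) b" using l[OF bc(1)] i by (simp add: wsp_def)
        then show ?thesis
          using True i bc BV rep_in[OF rep H_in[OF i] True]
          by (simp add: endo_act_def E_def fscale_def rep_scale[OF rep H_in[OF i]] repH of_rat_diff
              scale_left_diff_distrib algebra_simps)
      qed (simp add: endo_act_def E_def fscale_def)
    qed
    then show ?thesis using E_in[OF bc(1)] by (simp add: wsp_def)
  qed
  have "f.span (E ` (B \<times> B)) = endo sc V"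
  proof
    show "f.span (E ` (B \<times> B)) \<subseteq> endo sc V"
      using E_in by (intro f.span_minimal subspace_endo[OF linear_space_axioms sV]) auto
    show "endo sc V \<subseteq> f.span (E ` (B \<times> B))"
    proof
      fix F assume F: "F \<in> endo sc V"
      have "F = (\<Sum>p\<in>B \<times> B. fscale sc (representation B (F (snd p)) (fst p)) (E p))" (is "_ = ?G")
      proof (rule endo_eqI[OF F])
        show "?G \<in> endo sc V"
          by (intro f.subspace_sum f.subspace_scale subspace_endo[OF linear_space_axioms sV])
             (use E_in in auto)
        fix v assume v: "v \<in> V"
        have "F v = F (\<Sum>c\<in>B. sc (representation B v c) c)"
          using sum_representation_eq[of B v B] B v by simp
        also have "\<dots> = (\<Sum>c\<in>B. F (sc (representation B v c) c))"
          by (rule lin_on_sum[OF sV endoD(1)[OF F]]) (use BV subspace_scale[OF sV] in auto)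
        also have "\<dots> = (\<Sum>c\<in>B. sc (representation B v c) (F c))"
          by (intro sum.cong refl lin_onD(2)[OF endoD(1)[OF F]] BV)
        also have "\<dots> = (\<Sum>c\<in>B. \<Sum>b\<in>B. sc (representation B (F c) b * representation B v c) b)"
        proof (intro sum.cong refl)
          fix c assume "c \<in> B"
          then have "F c = (\<Sum>b\<in>B. sc (representation B (F c) b) b)"
            using sum_representation_eq[of B "F c" B] B endoD(2)[OF F] BV by simp
          then have "sc (representation B v c) (F c) =
              sc (representation B v c) (\<Sum>b\<in>B. sc (representation B (F c) b) b)" by simp
          then show "sc (representation B v c) (F c) =
              (\<Sum>b\<in>B. sc (representation B (F c) b * representation B v c) b)"
            by (simp add: scale_sum_right mult.commute)
        qed
        also have "\<dots> = (\<Sum>b\<in>B. \<Sum>c\<in>B. sc (representation B (F c) b * representation B v c) b)"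
          by (rule sum.swap)
        also have "\<dots> = ?G v"
          using v by (simp add: sum.cartesian_product case_prod_unfold fscale_def E_def sum_fun_apply)
        finally show "F v = ?G v" .
      qed
      also have "?G \<in> f.span (E ` (B \<times> B))"
        by (intro f.span_sum f.span_scale f.span_base) auto
      finally show "F \<in> f.span (E ` (B \<times> B))" .
    qed
  qed
  moreover have "E ` (B \<times> B) \<subseteq> (\<Union>l. wsp (fscale sc) (endo sc V) (endo_act act V) l)"
    using E_wt by fastforce
  ultimately show ?thesis
    unfolding wmod_def using lie_rep_endo[OF rep lie_subalgebra] B(2)
    by (intro conjI exI[of _ "E ` (B \<times> B)"]) simp_all
qed

text \<open>Apply \<open>reynolds\<close> in the module of endomorphisms to a linear projection \<open>F\<close> onto \<open>W\<close>: each \<open>u \<in> L\<close>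
  moves \<open>F\<close> into the submodule of maps from \<open>V\<close> to \<open>W\<close> that vanish on \<open>W\<close>.\<close>

lemma complete_reducibility:
  assumes "wmod sc V act"
    and W: "module.subspace sc W" "W \<subseteq> V" "\<And>u w. u \<in> L \<Longrightarrow> w \<in> W \<Longrightarrow> act u w \<in> W"
  obtains p where "lin_on sc V sc p" "p ` V \<subseteq> W" "\<And>w. w \<in> W \<Longrightarrow> p w = w"
    "\<And>u v. u \<in> L \<Longrightarrow> v \<in> V \<Longrightarrow> act u (p v) = p (act u v)"
proof -
  note rep = wmod_rep[OF assms(1)]
  interpret linear_space sc using rep by (simp add: lie_rep_def)
  interpret f: linear_space "fscale sc" by (rule linear_space_fscale) unfold_locales
  interpret vp: vector_space_pair sc sc by unfold_locales
  note sV = rep_subspace[OF rep]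
  have id: "Vector_Spaces.linear sc sc (\<lambda>x. x)" by (rule module_hom_ident[unfolded module_hom_iff_linear])
  from vp.linear_exists_left_inverse_on[OF id W(1)] obtain g where
    g: "g ` UNIV \<subseteq> W" "Vector_Spaces.linear sc sc g" "\<And>w. w \<in> W \<Longrightarrow> g w = w" by auto
  interpret g: Vector_Spaces.linear sc sc g by fact
  define F where "F v = (if v \<in> V then g v else 0)" for v
  have F: "F \<in> endo sc V"
    using g W(2) sV by (auto simp: F_def endo_def lin_on_def g.add g.scale subspace_add subspace_scale)
  define K where "K = {F \<in> endo sc V. F ` V \<subseteq> W \<and> (\<forall>w\<in>W. F w = 0)}"
  note sE = subspace_endo[OF linear_space_axioms sV]
  have K: "f.subspace K"
    using f.subspace_0[OF sE] f.subspace_add[OF sE] f.subspace_scale[OF sE]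
      subspace_0[OF W(1)] subspace_add[OF W(1)] subspace_scale[OF W(1)]
    by (intro f.subspaceI) (auto simp: K_def fscale_def image_subset_iff)
  have K_act: "endo_act act V u G \<in> K"
    if u: "u \<in> L" and G: "G \<in> endo sc V" "G ` V \<subseteq> W" "\<And>w. w \<in> W \<Longrightarrow> G w = a w" "a = (\<lambda>_. 0) \<or> a = (\<lambda>w. w)" for u G a
  proof -
    have "endo_act act V u G \<in> endo sc V"
      using rep_in[OF lie_rep_endo[OF rep lie_subalgebra] u G(1)] .
    moreover have "endo_act act V u G ` V \<subseteq> W"
      using G(2) W(3)[OF u] rep_in[OF rep u] subspace_diff[OF W(1)] by (auto simp: endo_act_def image_subset_iff)
    moreover have "endo_act act V u G w = 0" if "w \<in> W" for w
      using that G(3,4) W(2) W(3)[OF u] rep_zero[OF rep u] by (auto simp: endo_act_def)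
    ultimately show ?thesis by (simp add: K_def)
  qed
  have "\<exists>G\<in>K. \<forall>u\<in>L. endo_act act V u (F - G) = 0"
  proof (rule reynolds[OF wmod_endo[OF assms(1)] F K])
    show "K \<subseteq> endo sc V" by (auto simp: K_def)
    show "endo_act act V u G \<in> K" if "u \<in> L" "G \<in> K" for u G
      using that by (intro K_act[of u G "\<lambda>_. 0"]) (auto simp: K_def)
    show "endo_act act V u F \<in> K" if "u \<in> L" for u
      by (rule K_act[of u F "\<lambda>w. w"]) (use that F g W(2) in \<open>auto simp: F_def\<close>)
  qed
  then obtain G where G: "G \<in> K" "\<And>u. u \<in> L \<Longrightarrow> endo_act act V u (F - G) = 0" by blast
  have FG: "F - G \<in> endo sc V"
    using F G(1) by (intro f.subspace_diff subspace_endo[OF linear_space_axioms sV]) (auto simp: K_def)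
  show ?thesis
  proof (rule that[of "F - G"])
    show "lin_on sc V sc (F - G)" by (rule endoD(1)[OF FG])
    show "(F - G) ` V \<subseteq> W"
      using G(1) g(1) subspace_diff[OF W(1)] by (auto simp: K_def F_def image_subset_iff)
    show "(F - G) w = w" if "w \<in> W" for w
      using that G(1) g(3) W(2) by (auto simp: K_def F_def)
    show "act u ((F - G) v) = (F - G) (act u v)" if "u \<in> L" "v \<in> V" for u v
      using fun_cong[OF G(2)[OF that(1)], of v] that(2) by (simp add: endo_act_def)
  qed
qed

text \<open>By \<open>wmod_shifts\<close>, \<open>V\<close> is the sum of generalised eigenspaces of \<open>C\<close> for the rational numbers \<open>c\<close>
  and \<open>0\<close>.  If \<open>(C - c)\<^sup>2 v = 0\<close>, an equivariant projection \<open>p\<close> onto the kernel of \<open>C - c\<close> fixes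
  \<open>(C - c) v\<close>, but it also maps it to \<open>(C - c) (p v) = 0\<close>.\<close>

lemma casimir_eigenvectors_span:
  assumes "wmod sc V act"
  shows "V \<subseteq> module.span sc {v \<in> V. \<exists>c. C act v = sc (of_rat c) v}"
proof
  note rep = wmod_rep[OF assms(1)]
  interpret linear_space sc using rep by (simp add: lie_rep_def)
  note sV = rep_subspace[OF rep]
  have CV: "C act ` V \<subseteq> V" using C_lin(2)[OF rep] by auto
  have eL: "e i \<in> L" "e' i \<in> L" if "i < r + s" for i using dual_pairD(1,2)[OF dual_e that] .
  fix v assume v: "v \<in> V"
  have "\<exists>cs. \<forall>v\<in>V. \<forall>u\<in>L. act u (foldr (\<lambda>c w. C act w - sc (of_rat c) w) cs v) = 0"
  proof (rule wmod_shifts[OF assms(1)])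
    fix cs
    assume "\<And>v u. v \<in> V \<Longrightarrow> u \<in> L \<Longrightarrow> act u (foldr (\<lambda>c w. C act w - sc (of_rat c) w) cs v) = 0"
    then show ?thesis by (intro exI[of _ cs]) simp
  qed
  then obtain cs where
    cs: "\<forall>v\<in>V. \<forall>u\<in>L. act u (foldr (\<lambda>c w. C act w - sc (of_rat c) w) cs v) = 0" ..
  have ss: "shift (C act) c v = 0" if v: "v \<in> V" "shift (C act) c (shift (C act) c v) = 0" for c v
  proof -
    define W where "W = {v \<in> V. C act v = sc c v}"
    have W: "subspace W" unfolding W_def by (rule subspace_eigen[OF sV C_lin(1)[OF rep]])
    have "\<exists>p. lin_on sc V sc p \<and> p ` V \<subseteq> W \<and> (\<forall>w\<in>W. p w = w) \<and>
        (\<forall>u\<in>L. \<forall>v\<in>V. act u (p v) = p (act u v))"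
      by (rule complete_reducibility[OF assms W])
         (auto simp: W_def rep_in[OF rep] C_commutes[OF rep, symmetric] rep_scale[OF rep])
    then obtain p where p: "lin_on sc V sc p" "p ` V \<subseteq> W" "\<And>w. w \<in> W \<Longrightarrow> p w = w"
      "\<And>u v. u \<in> L \<Longrightarrow> v \<in> V \<Longrightarrow> act u (p v) = p (act u v)" by blast
    let ?u = "shift (C act) c v"
    have uV: "?u \<in> V" using shift_lin(2)[OF sV C_lin(1)[OF rep] CV] v(1) by blast
    then have "?u \<in> W" using v(2) by (simp add: W_def)
    then have "?u = p ?u" using p(3) by simp
    also have "\<dots> = p (C act v) - sc c (p v)"
      using v(1) C_lin(2)[OF rep v(1)] subspace_scale[OF sV v(1)]
      by (simp add: lin_on_diff[OF sV p(1)] lin_onD(2)[OF p(1)])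
    also have "p (C act v) = C act (p v)"
    proof -
      have "p (C act v) = (\<Sum>i<r + s. p (act (e' i) (act (e i) v)))"
        unfolding cas_def using v(1) by (intro lin_on_sum[OF sV p(1)] rep_in[OF rep]) (auto intro: eL)
      also have "\<dots> = (\<Sum>i<r + s. act (e' i) (act (e i) (p v)))"
        using v(1) eL by (intro sum.cong refl) (simp add: p(4) rep_in[OF rep])
      finally show ?thesis by (simp add: cas_def)
    qed
    also have "C act (p v) - sc c (p v) = 0" using p(2) v(1) by (auto simp: W_def)
    finally show ?thesis .
  qed
  have kill: "shift (C act) c v = 0" if vg: "v \<in> V" "geig (C act) c v" for c v
  proof -
    obtain n where "(shift (C act) c ^^ n) v = 0" using vg(2) unfolding geig_def by blast
    with vg(1) show ?thesis
    proof (induction n arbitrary: v)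
      case 0
      then show ?case using lin_on_zero[OF sV C_lin(1)[OF rep]] by simp
    next
      case (Suc n)
      have "shift (C act) c v \<in> V" using shift_lin(2)[OF sV C_lin(1)[OF rep] CV] Suc.prems(1) by blast
      moreover have "(shift (C act) c ^^ n) (shift (C act) c v) = 0"
        using Suc.prems(2) by (simp only: funpow_Suc_right comp_apply)
      ultimately have "shift (C act) c (shift (C act) c v) = 0" by (rule Suc.IH)
      then show ?case by (rule ss[OF Suc.prems(1)])
    qed
  qed
  let ?cs = "map of_rat (0 # cs) :: 'k list"
  define w0 where "w0 = foldr (\<lambda>c w. C act w - sc (of_rat c) w) cs v"
  have "act (e' i) (act (e i) w0) = 0" if "i < r + s" for i
    using cs[rule_format, OF v eL(1)[OF that], folded w0_def] rep_zero[OF rep eL(2)[OF that]] by simp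
  then have "C act w0 = 0" by (simp add: cas_def)
  then have "foldr (\<lambda>c w. shift (C act) c w) ?cs v = 0" by (simp add: foldr_map comp_def w0_def)
  from geig_decomposition[OF sV C_lin(1)[OF rep] CV v this] obtain w where
    w: "\<forall>c\<in>set ?cs. w c \<in> V \<and> geig (C act) c (w c)" "v = (\<Sum>c\<in>set ?cs. w c)" by blast
  have "w c \<in> {v \<in> V. \<exists>c. C act v = sc (of_rat c) v}" if c: "c \<in> set ?cs" for c
  proof -
    have wc: "w c \<in> V" "geig (C act) c (w c)" using w(1) c by blast+
    have "C act (w c) = sc c (w c)" using kill[OF wc] by (simp del: list.map)
    moreover have "\<exists>d. c = of_rat d" using c by auto
    ultimately show ?thesis using wc(1) by auto
  qed
  then show "v \<in> span {v \<in> V. \<exists>c. C act v = sc (of_rat c) v}"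
    unfolding w(2) by (intro span_sum span_base)
qed

end

section \<open>Invariant forms and trace forms\<close>

lemma fin_dim_matrices: "mat_vs.subspace V \<Longrightarrow> ml.fin_dim V" for V :: "('k::field^'n^'n) set"
proof -
  define E :: "'n \<times> 'n \<Rightarrow> 'k^'n^'n" where "E = (\<lambda>(i, j). \<chi> a b. if a = i \<and> b = j then 1 else 0)"
  have "A \<in> mat_vs.span (range E)" for A :: "'k^'n^'n"
  proof -
    have "A = (\<Sum>p\<in>UNIV. A $ fst p $ snd p *\<^sub>M E p)"
    proof (unfold vec_eq_iff, intro allI)
      fix a b
      have "(\<Sum>p\<in>UNIV. A $ fst p $ snd p *\<^sub>M E p) $ a $ b =
          (\<Sum>p\<in>UNIV. if p = (a, b) then A $ a $ b else 0)"
        unfolding sum_component by (intro sum.cong refl) (auto simp: E_def mscale_def split: if_splits)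
      then show "A $ a $ b = (\<Sum>p\<in>UNIV. A $ fst p $ snd p *\<^sub>M E p) $ a $ b" by simp
    qed
    also have "\<dots> \<in> mat_vs.span (range E)"
      by (intro mat_vs.span_sum mat_vs.span_scale mat_vs.span_base) auto
    finally show ?thesis .
  qed
  then have "ml.fin_dim (UNIV :: ('k^'n^'n) set)"
    unfolding ml.fin_dim_def by (intro exI[of _ "range E"]) auto
  then show "mat_vs.subspace V \<Longrightarrow> ml.fin_dim V" by (rule ml.fin_dim_sub) auto
qed

definition orth_family :: "('m \<Rightarrow> 'm \<Rightarrow> 'k::field) \<Rightarrow> 'm set \<Rightarrow> nat \<Rightarrow> (nat \<Rightarrow> 'm) \<Rightarrow> bool" where
  "orth_family \<Phi> V k v \<longleftrightarrow> (\<forall>i<k. v i \<in> V \<and> \<Phi> (v i) (v i) \<noteq> 0) \<and>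
     (\<forall>i<k. \<forall>j<k. i \<noteq> j \<longrightarrow> \<Phi> (v i) (v j) = 0)"

lemma form_lin:
  assumes "invariant_form L \<Phi>" "mat_vs.subspace L" "y \<in> L"
  shows "lin_on mscale L (*) (\<lambda>x. \<Phi> x y)" "lin_on mscale L (*) (\<Phi> y)"
proof -
  show 1: "lin_on mscale L (*) (\<lambda>x. \<Phi> x y)"
    unfolding lin_on_def using invariant_formD(2,3)[OF assms(1)] assms(3) by simp
  have e: "\<Phi> y x = \<Phi> x y" if "x \<in> L" for x by (rule invariant_formD(1)[OF assms(1,3) that])
  show "lin_on mscale L (*) (\<Phi> y)"
    using 1 mat_vs.subspace_add[OF assms(2)] mat_vs.subspace_scale[OF assms(2)]
    unfolding lin_on_def by (simp add: e)
qed

lemma form_sum: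
  assumes "invariant_form L \<Phi>" "mat_vs.subspace L" "y \<in> L" "\<And>i. i \<in> I \<Longrightarrow> x i \<in> L"
  shows "\<Phi> (\<Sum>i\<in>I. x i) y = (\<Sum>i\<in>I. \<Phi> (x i) y)" "\<Phi> y (\<Sum>i\<in>I. x i) = (\<Sum>i\<in>I. \<Phi> y (x i))"
  using assms by (auto intro!: ml.lin_on_sum form_lin)

lemma form_diff:
  assumes "invariant_form L \<Phi>" "mat_vs.subspace L" "y \<in> L" "x \<in> L" "x' \<in> L"
  shows "\<Phi> (x - x') y = \<Phi> x y - \<Phi> x' y" "\<Phi> y (x - x') = \<Phi> y x - \<Phi> y x'"
  using assms by (auto intro!: ml.lin_on_diff form_lin)

lemma form_zero:
  assumes "invariant_form L \<Phi>" "mat_vs.subspace L" "y \<in> L"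
  shows "\<Phi> 0 y = 0" "\<Phi> y 0 = 0"
  using assms by (auto intro!: ml.lin_on_zero form_lin)

lemma form_scale:
  assumes "invariant_form L \<Phi>" "mat_vs.subspace L" "x \<in> L" "y \<in> L"
  shows "\<Phi> (c *\<^sub>M x) y = c * \<Phi> x y" "\<Phi> y (c *\<^sub>M x) = c * \<Phi> y x"
  using lin_onD(2)[OF form_lin(1)[OF assms(1,2,4)] assms(3)]
    lin_onD(2)[OF form_lin(2)[OF assms(1,2,4)] assms(3)] by auto

lemma form_add:
  assumes "invariant_form L \<Phi>" "mat_vs.subspace L" "y \<in> L" "x \<in> L" "x' \<in> L"
  shows "\<Phi> (x + x') y = \<Phi> x y + \<Phi> x' y" "\<Phi> y (x + x') = \<Phi> y x + \<Phi> y x'"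
  using lin_onD(1)[OF form_lin(1)[OF assms(1,2,3)] assms(4,5)]
    lin_onD(1)[OF form_lin(2)[OF assms(1,2,3)] assms(4,5)] by auto

lemma form_lie_swap:
  assumes "invariant_form L \<Phi>" "mat_vs.subspace L" "x \<in> L" "y \<in> L" "z \<in> L" "lie y z \<in> L" "lie x y \<in> L" "lie x z \<in> L"
  shows "\<Phi> (lie x y) z = - \<Phi> y (lie x z)"
proof -
  have "lie y x = (- 1) *\<^sub>M lie x y" using lie_anti[of x y] by simp
  then have "\<Phi> (lie y x) z = - \<Phi> (lie x y) z"
    using form_scale(1)[OF assms(1,2,7,5), of "- 1"] by simp
  moreover have "\<Phi> (lie y x) z = \<Phi> y (lie x z)"
    by (rule invariant_formD(4)[OF assms(1,4,3,5)])
  ultimately show ?thesis by simp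
qed

lemma orth_family_span_independent:
  fixes \<Phi> :: "'k::field^'n^'n \<Rightarrow> 'k^'n^'n \<Rightarrow> 'k"
  assumes \<Phi>: "invariant_form L \<Phi>" "mat_vs.subspace L" and V: "V \<subseteq> L" and v: "orth_family \<Phi> V k v"
  shows "inj_on v {..<k}" "mat_vs.independent (v ` {..<k})"
proof -
  have vL: "v i \<in> L" if "i < k" for i using v V that by (auto simp: orth_family_def)
  show inj: "inj_on v {..<k}"
    using v unfolding inj_on_def orth_family_def by (metis lessThan_iff)
  show "mat_vs.independent (v ` {..<k})"
  proof (rule mat_vs.independent_if_scalars_zero)
    fix f x assume f: "(\<Sum>x\<in>v ` {..<k}. f x *\<^sub>M x) = 0" and "x \<in> v ` {..<k}"
    then obtain j where j: "j < k" "x = v j" by auto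
    have "(\<Sum>i<k. f (v i) *\<^sub>M v i) = 0" using f by (simp add: sum.reindex[OF inj])
    then have "0 = \<Phi> (\<Sum>i<k. f (v i) *\<^sub>M v i) (v j)"
      using form_zero(1)[OF \<Phi> vL[OF j(1)]] by simp
    also have "\<dots> = (\<Sum>i<k. \<Phi> (f (v i) *\<^sub>M v i) (v j))"
      by (rule form_sum[OF \<Phi> vL[OF j(1)]]) (use vL mat_vs.subspace_scale[OF \<Phi>(2)] in auto)
    also have "\<dots> = (\<Sum>i<k. if i = j then f (v j) * \<Phi> (v j) (v j) else 0)"
      using v j vL by (intro sum.cong refl) (auto simp: form_scale[OF \<Phi>] orth_family_def)
    finally show "f x = 0" using j v by (auto simp: orth_family_def)
  qed simp
qed

lemma orth_family_bound:
  fixes \<Phi> :: "'k::field^'n^'n \<Rightarrow> 'k^'n^'n \<Rightarrow> 'k"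
  assumes \<Phi>: "invariant_form L \<Phi>" "mat_vs.subspace L"
  obtains b where "\<And>V k v. V \<subseteq> L \<Longrightarrow> orth_family \<Phi> V k v \<Longrightarrow> k \<le> b"
proof -
  obtain B where B: "finite B" "mat_vs.span B = L"
    using fin_dim_matrices[OF \<Phi>(2)] by (auto simp: ml.fin_dim_def)
  have "k \<le> card B" if V: "V \<subseteq> L" and v: "orth_family \<Phi> V k v" for V k v
  proof -
    have "v ` {..<k} \<subseteq> mat_vs.span B" using v V B(2) by (auto simp: orth_family_def)
    then have "card (v ` {..<k}) \<le> card B"
      using mat_vs.independent_span_bound[OF B(1) orth_family_span_independent(2)[OF \<Phi> V v]] by simp
    then show ?thesis by (simp add: card_image[OF orth_family_span_independent(1)[OF \<Phi> V v]])
  qed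
  then show ?thesis using that by blast
qed

text \<open>Take a maximal orthogonal family of non-isotropic vectors.  The form vanishes on the diagonal of
  its orthogonal complement, hence, by polarisation, on the complement, which is therefore \<open>0\<close>.\<close>

lemma dual_pair_exists:
  fixes \<Phi> :: "'k::field_char_0^'n^'n \<Rightarrow> 'k^'n^'n \<Rightarrow> 'k"
  assumes \<Phi>: "invariant_form L \<Phi>" "mat_vs.subspace L" and V: "mat_vs.subspace V" "V \<subseteq> L"
    and nondeg: "\<And>x. x \<in> V \<Longrightarrow> (\<And>y. y \<in> V \<Longrightarrow> \<Phi> x y = 0) \<Longrightarrow> x = 0"
  obtains d e e' where "dual_pair \<Phi> V d e e'"
proof -
  obtain b where b: "\<And>k v. orth_family \<Phi> V k v \<Longrightarrow> k \<le> b"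
    using orth_family_bound[OF \<Phi>] V(2) by metis
  have "orth_family \<Phi> V 0 (\<lambda>_. 0)" by (simp add: orth_family_def)
  then have "\<exists>v. orth_family \<Phi> V 0 v" by blast
  from ex_has_greatest_nat[of "\<lambda>k. \<exists>v. orth_family \<Phi> V k v" 0 "\<lambda>k. k" "Suc b", OF this] b
  obtain k v where v: "orth_family \<Phi> V k v" and kmax: "\<And>k' v'. orth_family \<Phi> V k' v' \<Longrightarrow> k' \<le> k"
    by (metis le_imp_less_Suc)
  have vV: "v i \<in> V" if "i < k" for i using v that by (auto simp: orth_family_def)
  have vL: "v i \<in> L" if "i < k" for i using vV[OF that] V(2) by auto
  let ?q = "\<lambda>i. \<Phi> (v i) (v i)"
  have q: "?q i \<noteq> 0" if "i < k" for i using v that by (auto simp: orth_family_def)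
  let ?p = "\<lambda>x. \<Sum>i<k. (\<Phi> x (v i) / ?q i) *\<^sub>M v i"
  have pV: "?p x \<in> V" for x
    by (intro mat_vs.subspace_sum V(1) mat_vs.subspace_scale) (use vV in auto)
  have orth: "\<Phi> (x - ?p x) (v j) = 0" if x: "x \<in> V" and j: "j < k" for x j
  proof -
    have "\<Phi> (?p x) (v j) = (\<Sum>i<k. \<Phi> ((\<Phi> x (v i) / ?q i) *\<^sub>M v i) (v j))"
      by (rule form_sum[OF \<Phi> vL[OF j]]) (use vL mat_vs.subspace_scale[OF \<Phi>(2)] in auto)
    also have "\<dots> = (\<Sum>i<k. if i = j then \<Phi> x (v j) else 0)"
      using v j vL q by (intro sum.cong refl) (auto simp: form_scale[OF \<Phi>] orth_family_def)
    also have "\<dots> = \<Phi> x (v j)" using j by simp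
    finally show ?thesis using form_diff(1)[OF \<Phi> vL[OF j], of x "?p x"] x pV V(2) by auto
  qed
  define W where "W = {x \<in> V. \<forall>j<k. \<Phi> x (v j) = 0}"
  have W_add: "x + y \<in> W" if "x \<in> W" "y \<in> W" for x y
    using that V mat_vs.subspace_add[OF V(1)] form_add(1)[OF \<Phi> vL] by (auto simp: W_def subset_iff)
  have iso: "\<Phi> x x = 0" if x: "x \<in> W" for x
  proof (rule ccontr)
    assume "\<Phi> x x \<noteq> 0"
    moreover have "\<Phi> (v j) x = 0" if "j < k" for j
      using x that invariant_formD(1)[OF \<Phi>(1) vL[OF that], of x] V(2) by (auto simp: W_def)
    ultimately have "orth_family \<Phi> V (Suc k) (v(k := x))"
      using v x by (auto simp: orth_family_def W_def less_Suc_eq)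
    then show False using kmax by fastforce
  qed
  have W0: "x = 0" if x: "x \<in> W" for x
  proof (rule nondeg)
    show xV: "x \<in> V" using x by (simp add: W_def)
    fix y assume y: "y \<in> V"
    let ?z = "y - ?p y"
    have z: "?z \<in> W" using orth[OF y] y pV mat_vs.subspace_diff[OF V(1)] by (auto simp: W_def)
    have L: "x \<in> L" "?z \<in> L" "?p y \<in> L" using x z pV V(2) by (auto simp: W_def)
    have "\<Phi> (x + ?z) (x + ?z) = 0" by (rule iso[OF W_add[OF x z]])
    then have "\<Phi> x ?z + \<Phi> ?z x = 0"
      using iso[OF x] iso[OF z] L mat_vs.subspace_add[OF \<Phi>(2) L(1,2)] by (simp add: form_add[OF \<Phi>] add.commute)
    then have xz: "\<Phi> x ?z = 0" using invariant_formD(1)[OF \<Phi>(1) L(1,2)] by simp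
    have "\<Phi> x (?p y) = (\<Sum>i<k. \<Phi> x ((\<Phi> y (v i) / ?q i) *\<^sub>M v i))"
      by (rule form_sum[OF \<Phi> L(1)]) (use vL mat_vs.subspace_scale[OF \<Phi>(2)] in auto)
    also have "\<dots> = 0"
      using x vL L(1) by (intro sum.neutral) (auto simp: form_scale[OF \<Phi>] W_def)
    finally show "\<Phi> x y = 0" using xz form_add(2)[OF \<Phi> L(1,2,3)] by simp
  qed
  have ex: "?p x = x" if x: "x \<in> V" for x
    using W0[of "x - ?p x"] orth[OF x] x pV mat_vs.subspace_diff[OF V(1)] by (auto simp: W_def)
  have "dual_pair \<Phi> V k v (\<lambda>i. (1 / ?q i) *\<^sub>M v i)"
    unfolding dual_pair_def
  proof (intro conjI allI impI ballI)
    fix u assume u: "u \<in> V"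
    then have uL: "u \<in> L" using V(2) by auto
    show "u = (\<Sum>i<k. \<Phi> u ((1 / ?q i) *\<^sub>M v i) *\<^sub>M v i)"
      using ex[OF u] uL vL by (simp add: form_scale[OF \<Phi>])
    show "u = (\<Sum>i<k. \<Phi> u (v i) *\<^sub>M (1 / ?q i) *\<^sub>M v i)"
      using ex[OF u] by simp
  qed (use vV mat_vs.subspace_scale[OF V(1)] in auto)
  then show ?thesis by (rule that)
qed

definition tform :: "('k::field^'n^'n) set \<Rightarrow> 'k^'n^'n \<Rightarrow> 'k^'n^'n \<Rightarrow> 'k" where
  "tform V u v = ml.tr V (\<lambda>z. lie u (lie v z))"

lemma killing_tform: "killing V u v = tform V u v"
  by (simp add: killing_def trace_on_def tform_def ml.tr_def)

lemma lin_on_lie2: "lin_on mscale V mscale (\<lambda>z. lie u (lie v z))"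
  by (simp add: lin_on_def lie_add lie_scale)

lemma tform_invariant:
  assumes V: "mat_vs.subspace V" "\<And>u x. u \<in> L \<Longrightarrow> x \<in> V \<Longrightarrow> lie u x \<in> V"
  shows "invariant_form L (tform V)"
proof -
  note fd = fin_dim_matrices[OF V(1)]
  have in2: "(\<lambda>z. lie u (lie v z)) ` V \<subseteq> V" if "u \<in> L" "v \<in> L" for u v
    using V(2) that by auto
  have sym: "tform V x y = tform V y x" if "x \<in> L" "y \<in> L" for x y
    unfolding tform_def
    by (rule tr_commute[OF ml.linear_space_axioms ml.linear_space_axioms fd fd])
       (use V(2) that in \<open>auto intro: lin_on_lie\<close>)
  have inv: "tform V (lie x y) z = tform V x (lie y z)" if xyz: "x \<in> L" "y \<in> L" "z \<in> L" for x y z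
  proof -
    have lin3: "lin_on mscale V mscale (\<lambda>w. lie a (lie b (lie c w)))" for a b c
      by (simp add: lin_on_def lie_add lie_scale)
    have in3: "(\<lambda>w. lie a (lie b (lie c w))) ` V \<subseteq> V" if "a \<in> L" "b \<in> L" "c \<in> L" for a b c
      using V(2) that by auto
    have D: "ml.tr V (\<lambda>w. f w - h w) = ml.tr V f - ml.tr V h"
      if "lin_on mscale V mscale f" "f ` V \<subseteq> V" "lin_on mscale V mscale h" "h ` V \<subseteq> V" for f h
    proof -
      have "lin_on mscale V mscale (\<lambda>w. - 1 *\<^sub>M h w)" "(\<lambda>w. - 1 *\<^sub>M h w) ` V \<subseteq> V"
        using that mat_vs.subspace_neg[OF V(1)] by (auto simp: lin_on_def)
      from ml.tr_add[OF fd that(1,2) this] ml.tr_scale[OF fd that(3,4), of "- 1"]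
      show ?thesis by simp
    qed
    have "tform V (lie x y) z = ml.tr V (\<lambda>w. lie x (lie y (lie z w)) - lie y (lie x (lie z w)))"
      by (simp add: tform_def lie_lie)
    also have "\<dots> = ml.tr V (\<lambda>w. lie x (lie y (lie z w))) - ml.tr V (\<lambda>w. lie y (lie x (lie z w)))"
      by (intro D lin3 in3 xyz)
    also have "ml.tr V (\<lambda>w. lie y (lie x (lie z w))) = ml.tr V (\<lambda>w. lie x (lie z (lie y w)))"
      by (rule tr_commute[OF ml.linear_space_axioms ml.linear_space_axioms fd fd, of "\<lambda>w. lie x (lie z w)" "lie y"])
         (use V(2) xyz in \<open>auto intro: lin_on_lie lin_on_lie2\<close>)
    also have "ml.tr V (\<lambda>w. lie x (lie y (lie z w))) - \<dots> =
        ml.tr V (\<lambda>w. lie x (lie y (lie z w)) - lie x (lie z (lie y w)))"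
      by (rule D[symmetric]) (intro lin3 in3 xyz)+
    also have "\<dots> = tform V x (lie y z)" by (simp add: tform_def lie_lie lie_diff)
    finally show ?thesis .
  qed
  show ?thesis
    unfolding invariant_form_def
  proof (intro ballI conjI allI)
    fix x y assume xy: "x \<in> L" "y \<in> L"
    show "tform V x y = tform V y x" by (rule sym[OF xy])
    show "tform V (c *\<^sub>M x) y = c * tform V x y" for c
      unfolding tform_def lie_scale by (rule ml.tr_scale[OF fd lin_on_lie2 in2[OF xy]])
    fix z assume z: "z \<in> L"
    show "tform V (x + y) z = tform V x z + tform V y z"
      unfolding tform_def lie_add
      by (rule ml.tr_add[OF fd lin_on_lie2 in2[OF xy(1) z] lin_on_lie2 in2[OF xy(2) z]])
    show "tform V (lie x y) z = tform V x (lie y z)" by (rule inv[OF xy z])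
  qed
qed

lemma dual_pair_frame:
  assumes "invariant_form L \<Phi>" "mat_vs.subspace L" "V \<subseteq> L" "dual_pair \<Phi> V d e e'"
  shows "ml.frame V {..<d} e (\<lambda>i v. \<Phi> v (e' i))"
proof -
  have "lin_on mscale V (*) (\<lambda>v. \<Phi> v (e' i))" if "i < d" for i
    using lin_on_subset[OF form_lin(1)[OF assms(1,2)] assms(3)] dual_pairD(2)[OF assms(4) that] assms(3) by blast
  then show ?thesis
    unfolding ml.frame_def using dual_pairD(1)[OF assms(4)] dual_pairD(3)[OF assms(4)] by auto
qed

lemma tr_dual_pair:
  assumes "invariant_form L \<Phi>" "mat_vs.subspace L" "mat_vs.subspace V" "V \<subseteq> L" "dual_pair \<Phi> V d e e'"
    and "lin_on mscale V mscale f" "f ` V \<subseteq> V"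
  shows "ml.tr V f = (\<Sum>i<d. \<Phi> (f (e i)) (e' i))"
  using ml.tr_frame[OF assms(3) dual_pair_frame[OF assms(1,2,4,5)] assms(6,7)] by simp

context torus_data
begin

lemma wmod_weight_basis:
  assumes "wmod sc V act"
  obtains B l where "finite B" "\<not> module.dependent sc B" "module.span sc B = V"
    "\<And>b. b \<in> B \<Longrightarrow> b \<in> wsp sc V act (l b)"
proof -
  note rep = wmod_rep[OF assms]
  interpret linear_space sc using rep by (simp add: lie_rep_def)
  obtain P where P: "finite P" "P \<subseteq> (\<Union>l. wsp sc V act l)" "span P = V"
    using assms by (auto simp: wmod_def)
  then have "fin_dim V" by (auto simp: fin_dim_def)
  from basis_within[OF this P(3)] obtain B where
    B: "B \<subseteq> P" "finite B" "independent B" "span B = V" by blast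
  have "\<forall>b\<in>B. \<exists>l. b \<in> wsp sc V act l" using B(1) P(2) by blast
  from bchoice[OF this] obtain l where "\<forall>b\<in>B. b \<in> wsp sc V act (l b)" ..
  then show ?thesis using that[of B l] B by blast
qed

lemma wmod_fin_dim: "wmod sc V act \<Longrightarrow> linear_space.fin_dim sc V"
  unfolding wmod_def lie_rep_def using linear_space.fin_dim_def by blast

lemma wmod_sub:
  assumes "wmod sc V act" and W: "module.subspace sc W" "W \<subseteq> V" "\<And>u w. u \<in> L \<Longrightarrow> w \<in> W \<Longrightarrow> act u w \<in> W"
  shows "wmod sc W act"
proof -
  note rep = wmod_rep[OF assms(1)]
  note rep' = rep_sub[OF rep W]
  interpret linear_space sc using rep by (simp add: lie_rep_def)
  note sV = rep_subspace[OF rep]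
  obtain P where P: "finite P" "P \<subseteq> (\<Union>l. wsp sc V act l)" "span P = V"
    using assms by (auto simp: wmod_def)
  then have "fin_dim V" by (auto simp: fin_dim_def)
  then have fW: "fin_dim W" by (rule fin_dim_sub[OF _ W(1,2)])
  have eW: "W \<subseteq> span {w \<in> W. \<exists>c\<in>range of_rat. act (H i) w = sc c w}" if i: "i < r" for i
  proof (rule eigenvectors_span_subspace[OF sV rep_lin[OF rep H_in[OF i]]])
    show "act (H i) ` V \<subseteq> V" using rep_in[OF rep H_in[OF i]] by auto
    show "act (H i) ` W \<subseteq> W" using W(3)[OF H_in[OF i]] by auto
    have "P \<subseteq> {v \<in> V. \<exists>c\<in>range of_rat. act (H i) v = sc c v}"
      using P(2) i by (auto simp: wsp_def)
    then show "V \<subseteq> span {v \<in> V. \<exists>c\<in>range of_rat. act (H i) v = sc c v}"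
      using span_mono P(3) by blast
  qed (use W in auto)
  have comm: "act (H i) (act (H j) v) = act (H j) (act (H i) v)" if "i < r" "j < r" "v \<in> W" for i j v
    using rep_lie[OF rep' H_in[OF that(1)] H_in[OF that(2)] that(3)] rep_zero_left[OF rep' lie_subalgebra that(3)]
    by (simp add: HH[OF that(1,2)])
  have "W \<subseteq> span {w \<in> W. \<exists>\<mu>. \<forall>i<r. \<mu> i \<in> range of_rat \<and> act (H i) w = sc (\<mu> i) w}"
    by (rule joint_eigenvectors_span[OF W(1) _ _ comm eW])
       (use rep_lin[OF rep'] rep_in[OF rep'] H_in in auto)
  also have "{w \<in> W. \<exists>\<mu>. \<forall>i<r. \<mu> i \<in> range of_rat \<and> act (H i) w = sc (\<mu> i) w} \<subseteq> (\<Union>l. wsp sc W act l)"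
  proof
    fix w assume "w \<in> {w \<in> W. \<exists>\<mu>. \<forall>i<r. \<mu> i \<in> range of_rat \<and> act (H i) w = sc (\<mu> i) w}"
    then obtain \<mu> where w: "w \<in> W" "\<forall>i<r. \<mu> i \<in> range of_rat \<and> act (H i) w = sc (\<mu> i) w" by blast
    then have "\<forall>i\<in>{..<r}. \<exists>q. \<mu> i = of_rat q" by auto
    from bchoice[OF this] obtain l where "\<forall>i\<in>{..<r}. \<mu> i = of_rat (l i)" ..
    with w have "w \<in> wsp sc W act l" by (auto simp: wsp_def)
    then show "w \<in> (\<Union>l. wsp sc W act l)" by blast
  qed
  finally have W1: "W \<subseteq> span (\<Union>l. wsp sc W act l)" using span_mono by blast
  moreover have "(\<Union>l. wsp sc W act l) \<subseteq> W" by (auto simp: wsp_def)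
  ultimately have "span (\<Union>l. wsp sc W act l) = W" using span_minimal[OF _ W(1)] by blast
  from basis_within[OF fW this] obtain B where "B \<subseteq> (\<Union>l. wsp sc W act l)" "finite B" "span B = W" by blast
  then show ?thesis using rep' by (auto simp: wmod_def)
qed

text \<open>The general element of the torus.\<close>

definition hel :: "(nat \<Rightarrow> 'k) \<Rightarrow> 'k^'n^'n" where
  "hel c = (\<Sum>i<r. c i *\<^sub>M H i)"

lemma hel_in: "hel c \<in> L"
  unfolding hel_def using H_in by (intro mat_vs.subspace_sum mat_vs.subspace_scale subspace_L) auto

lemma hel_weight:
  assumes "b \<in> wsp mscale V lie l"
  shows "lie (hel c) b = (\<Sum>i<r. c i * of_rat (l i)) *\<^sub>M b"
  using assms by (simp add: hel_def lie_sum lie_scale wsp_def mat_vs.scale_sum_left)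

lemma coroot_hel: "coroot a = hel (\<lambda>i. of_rat (\<alpha> a i / q i))"
  by (simp add: coroot_def hel_def)

lemma coroot_weight:
  assumes "b \<in> wsp mscale V lie l"
  shows "lie (coroot a) b = of_rat (ip (\<alpha> a) l) *\<^sub>M b"
  unfolding coroot_hel hel_weight[OF assms]
  by (simp add: ip_def of_rat_sum of_rat_mult of_rat_divide)

lemma X_weight: "a < s \<Longrightarrow> X a \<in> wsp mscale L lie (\<alpha> a)"
  by (simp add: wsp_def X_in HX)

lemma H_hel: "i < r \<Longrightarrow> H i = hel (\<lambda>j. if j = i then 1 else 0)"
  by (simp add: hel_def if_distrib[of "\<lambda>x. x *\<^sub>M _"] cong: if_cong)

lemma tform_hel:
  assumes "finite B" "mat_vs.independent B" "mat_vs.span B = V" "\<And>b. b \<in> B \<Longrightarrow> b \<in> wsp mscale V lie (l b)"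
  shows "tform V (hel c) (hel d) = (\<Sum>b\<in>B. (\<Sum>i<r. c i * of_rat (l b i)) * (\<Sum>i<r. d i * of_rat (l b i)))"
  unfolding tform_def
  by (rule ml.tr_eigenbasis[OF assms(1-3) lin_on_lie2])
     (simp add: hel_weight[OF assms(4)] lie_scale mult.commute)

lemma tform_H:
  assumes "finite B" "mat_vs.independent B" "mat_vs.span B = V" "\<And>b. b \<in> B \<Longrightarrow> b \<in> wsp mscale V lie (l b)"
    and "i < r" "j < r"
  shows "tform V (H i) (H j) = of_rat (\<Sum>b\<in>B. l b i * l b j)"
proof -
  have "tform V (H i) (H j) = (\<Sum>b\<in>B. of_rat (l b i) * of_rat (l b j))"
    unfolding tform_def
    by (rule ml.tr_eigenbasis[OF assms(1-3) lin_on_lie2])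
       (use assms(4-6) in \<open>simp add: wsp_def lie_scale mult.commute\<close>)
  then show ?thesis by (simp add: of_rat_sum of_rat_mult)
qed

lemma tform_coroot:
  assumes "finite B" "mat_vs.independent B" "mat_vs.span B = V" "\<And>b. b \<in> B \<Longrightarrow> b \<in> wsp mscale V lie (l b)"
  shows "tform V (coroot a) (coroot a) = of_rat (\<Sum>b\<in>B. (ip (\<alpha> a) (l b))\<^sup>2)"
proof -
  have "tform V (coroot a) (coroot a) = (\<Sum>b\<in>B. of_rat (ip (\<alpha> a) (l b)) * of_rat (ip (\<alpha> a) (l b)))"
    unfolding tform_def
    by (rule ml.tr_eigenbasis[OF assms(1-3) lin_on_lie2])
       (simp add: coroot_weight[OF assms(4)] lie_scale)
  then show ?thesis by (simp add: of_rat_sum of_rat_mult power2_eq_square)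
qed

lemma ip_root_pos: "a < s \<Longrightarrow> ip (\<alpha> a) (\<alpha> a) > 0"
  by (rule ip_pos[OF \<alpha>_nonzero])

lemma coroot_X: "a < s \<Longrightarrow> lie (coroot a) (X a) = of_rat (ip (\<alpha> a) (\<alpha> a)) *\<^sub>M X a"
  by (rule coroot_weight[OF X_weight])

context
  fixes F assumes F: "invariant_form L F"
begin

lemma form_HX: assumes "i < r" "a < s" shows "F (H i) (X a) = 0" "F (H i) (Y a) = 0"
proof -
  obtain l where l: "l < r" "\<alpha> a l \<noteq> 0" using \<alpha>_nonzero[OF assms(2)] by blast
  note L = H_in[OF assms(1)] H_in[OF l(1)] X_in[OF assms(2)] Y_in[OF assms(2)]
  note z = form_zero(1)[OF F subspace_L]
  have "0 = F (lie (H i) (H l)) (X a)" using HH[OF assms(1) l(1)] z[OF L(3)] by simp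
  also have "\<dots> = F (H i) (lie (H l) (X a))" by (rule invariant_formD(4)[OF F L(1,2,3)])
  also have "\<dots> = of_rat (\<alpha> a l) * F (H i) (X a)"
    unfolding HX[OF l(1) assms(2)] by (rule form_scale(2)[OF F subspace_L L(3,1)])
  finally show "F (H i) (X a) = 0" using l(2) by simp
  have "0 = F (lie (H i) (H l)) (Y a)" using HH[OF assms(1) l(1)] z[OF L(4)] by simp
  also have "\<dots> = F (H i) (lie (H l) (Y a))" by (rule invariant_formD(4)[OF F L(1,2,4)])
  also have "\<dots> = of_rat (- \<alpha> a l) * F (H i) (Y a)"
    unfolding HY[OF l(1) assms(2)] by (rule form_scale(2)[OF F subspace_L L(4,1)])
  finally show "F (H i) (Y a) = 0" using l(2) by simp
qed

text \<open>Different roots are separated by some \<open>H i\<close>; for equal roots move the coroot across the form.\<close>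

lemma form_XY:
  assumes ab: "a < s" "b < s"
  shows "F (X a) (Y b) = (if a = b then F (coroot a) (coroot a) / of_rat (ip (\<alpha> a) (\<alpha> a)) else 0)"
proof (cases "\<forall>i<r. \<alpha> a i = \<alpha> b i")
  case True
  have "of_rat (ip (\<alpha> a) (\<alpha> a)) * F (X a) (Y b) = F (lie (coroot a) (X a)) (Y b)"
    unfolding coroot_X[OF ab(1)] by (rule form_scale(1)[OF F subspace_L X_in[OF ab(1)] Y_in[OF ab(2)], symmetric])
  also have "\<dots> = F (coroot a) (lie (X a) (Y b))"
    by (rule invariant_formD(4)[OF F coroot_in X_in[OF ab(1)] Y_in[OF ab(2)]])
  also have "\<dots> = (if a = b then F (coroot a) (coroot a) else 0)"
    using XY_same_root[OF ab] True form_zero(2)[OF F subspace_L coroot_in] by simp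
  finally show ?thesis using ip_root_pos[OF ab(1)] by (auto simp: field_simps split: if_splits)
next
  case False
  then obtain i where i: "i < r" "\<alpha> a i \<noteq> \<alpha> b i" by blast
  note L = H_in[OF i(1)] X_in[OF ab(1)] Y_in[OF ab(2)]
  note cl = lie_subalgebraD(2)[OF lie_subalgebra]
  have "of_rat (\<alpha> a i) * F (X a) (Y b) = F (lie (H i) (X a)) (Y b)"
    unfolding HX[OF i(1) ab(1)] by (rule form_scale(1)[OF F subspace_L L(2,3), symmetric])
  also have "\<dots> = - F (X a) (lie (H i) (Y b))"
    by (rule form_lie_swap[OF F subspace_L L(1,2,3)]) (intro cl L)+
  also have "\<dots> = - (of_rat (- \<alpha> b i) * F (X a) (Y b))"
    unfolding HY[OF i(1) ab(2)] using form_scale(2)[OF F subspace_L L(3,2)] by simp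
  finally have "(of_rat (\<alpha> a i) - of_rat (\<alpha> b i)) * F (X a) (Y b) = 0"
    by (simp add: of_rat_minus algebra_simps)
  then show ?thesis using i(2) by auto
qed

lemma form_X_eigen:
  assumes a: "a < s" and u: "u \<in> L"
  shows "F u (X a) = F (coroot a) (coroot a) / of_rat (ip (\<alpha> a) (\<alpha> a)) * \<Phi> u (X a)"
    "F u (Y a) = F (coroot a) (coroot a) / of_rat (ip (\<alpha> a) (\<alpha> a)) * \<Phi> u (Y a)"
proof -
  let ?k = "F (coroot a) (coroot a) / of_rat (ip (\<alpha> a) (\<alpha> a))"
  let ?S = "\<Sum>i<r. (\<Phi> u (H i) / of_rat (q i)) *\<^sub>M H i"
  have S: "?S \<in> L" using H_in by (intro L_sum L_scale) auto
  have pair: "F u z = (\<Sum>b<s. \<Phi> u (x' b) * F (x b) z)"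
    if exp: "u = ?S + (\<Sum>b<s. \<Phi> u (x' b) *\<^sub>M x b)" and x: "\<And>b. b < s \<Longrightarrow> x b \<in> L" and z: "z \<in> L"
      and Hz: "\<And>i. i < r \<Longrightarrow> F (H i) z = 0" for x x' z
  proof -
    have X: "(\<Sum>b<s. \<Phi> u (x' b) *\<^sub>M x b) \<in> L" using x by (intro L_sum L_scale) auto
    have "F u z = F ?S z + F (\<Sum>b<s. \<Phi> u (x' b) *\<^sub>M x b) z"
      using form_add(1)[OF F subspace_L z S X] exp by simp
    also have "F ?S z = 0"
      using H_in Hz L_scale by (subst form_sum(1)[OF F subspace_L z]) (auto simp: form_scale[OF F subspace_L _ z])
    also have "F (\<Sum>b<s. \<Phi> u (x' b) *\<^sub>M x b) z = (\<Sum>b<s. \<Phi> u (x' b) * F (x b) z)"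
      using x L_scale by (subst form_sum(1)[OF F subspace_L z]) (auto simp: form_scale[OF F subspace_L _ z])
    finally show ?thesis by simp
  qed
  have "F u (X a) = (\<Sum>b<s. \<Phi> u (X b) * F (Y b) (X a))"
    by (rule pair[OF expand'[OF u] Y_in X_in[OF a] form_HX(1)[OF _ a]])
  also have "\<dots> = (\<Sum>b<s. if b = a then ?k * \<Phi> u (X a) else 0)"
    using invariant_formD(1)[OF F Y_in X_in[OF a]] by (intro sum.cong refl) (auto simp: form_XY[OF a])
  finally show "F u (X a) = ?k * \<Phi> u (X a)" using a by simp
  have "F u (Y a) = (\<Sum>b<s. \<Phi> u (Y b) * F (X b) (Y a))"
    by (rule pair[OF expand[OF u] X_in Y_in[OF a] form_HX(2)[OF _ a]])
  also have "\<dots> = (\<Sum>b<s. if b = a then ?k * \<Phi> u (Y a) else 0)"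
    by (intro sum.cong refl) (auto simp: form_XY[OF _ a])
  finally show "F u (Y a) = ?k * \<Phi> u (Y a)" using a by simp
qed

end

end

section \<open>The eigenvalue one half: notation and the two trace forms\<close>

text \<open>\<open>g = L + N + M\<close> orthogonally for the Killing form \<open>\<Phi>\<close> of \<open>g\<close>, with \<open>N\<close> an eigenspace of \<open>C\<close>.  The
  basis of the torus is adapted to \<open>N\<close>: the first \<open>r1\<close> vectors kill \<open>N\<close>, and no combination that kills
  \<open>N\<close> involves the others.\<close>

locale casimir_half = torus_data L \<Phi> r s H X Y q \<alpha>
  for L :: "('k::field_char_0^'n^'n) set" and \<Phi> r s H X Y q \<alpha> +
  fixes g N M :: "('k^'n^'n) set" and r1 n m :: nat and f f' h h' :: "nat \<Rightarrow> 'k^'n^'n"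
  assumes g_lie: "lie_subalgebra g" and L_g: "L \<subseteq> g" and form: "invariant_form g \<Phi>"
    and \<Phi>_trace: "\<lbrakk>x \<in> g; y \<in> g\<rbrakk> \<Longrightarrow> \<Phi> x y = tform g x y"
    and N: "mat_vs.subspace N" "N \<subseteq> g" "\<lbrakk>u \<in> L; x \<in> N\<rbrakk> \<Longrightarrow> lie u x \<in> N"
    and M: "mat_vs.subspace M" "M \<subseteq> g" "\<lbrakk>u \<in> L; y \<in> M\<rbrakk> \<Longrightarrow> lie u y \<in> M"
    and orth_LN: "\<lbrakk>u \<in> L; x \<in> N\<rbrakk> \<Longrightarrow> \<Phi> u x = 0"
    and orth_LM: "\<lbrakk>u \<in> L; y \<in> M\<rbrakk> \<Longrightarrow> \<Phi> u y = 0"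
    and orth_NM: "\<lbrakk>x \<in> N; y \<in> M\<rbrakk> \<Longrightarrow> \<Phi> x y = 0"
    and decomp: "z \<in> g \<Longrightarrow> \<exists>u\<in>L. \<exists>x\<in>N. \<exists>y\<in>M. z = u + x + y"
    and wmod_g: "wmod mscale g lie"
    and half: "x \<in> N \<Longrightarrow> C lie x = (1 / 2) *\<^sub>M x"
    and torus_kills: "\<lbrakk>i < r1; i < r; x \<in> N\<rbrakk> \<Longrightarrow> lie (H i) x = 0"
    and torus_faithful: "\<lbrakk>\<And>x. x \<in> N \<Longrightarrow> lie (hel c) x = 0; r1 \<le> i; i < r\<rbrakk> \<Longrightarrow> c i = 0"
    and dual_N: "dual_pair \<Phi> N n f f'" and dual_M: "dual_pair \<Phi> M m h h'"
begin

lemmas g_sub = lie_subalgebraD(1)[OF g_lie]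
lemmas g_closed = lie_subalgebraD(2)[OF g_lie]
lemmas L_closed = lie_subalgebraD(2)[OF lie_subalgebra]
lemmas fdN = fin_dim_matrices[OF N(1)]
lemmas form_g = form g_sub

lemma eL: "i < r + s \<Longrightarrow> e i \<in> L" "i < r + s \<Longrightarrow> e' i \<in> L"
  using dual_pairD(1,2)[OF dual_e] by auto

lemma in_g [simp]: "u \<in> L \<Longrightarrow> u \<in> g" "x \<in> N \<Longrightarrow> x \<in> g" "y \<in> M \<Longrightarrow> y \<in> g"
  using L_g N(2) M(2) by auto

lemma fN: "i < n \<Longrightarrow> f i \<in> N" "i < n \<Longrightarrow> f' i \<in> N"
  using dual_pairD(1,2)[OF dual_N] by auto

lemma hM: "i < m \<Longrightarrow> h i \<in> M" "i < m \<Longrightarrow> h' i \<in> M"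
  using dual_pairD(1,2)[OF dual_M] by auto

lemma sym: "x \<in> g \<Longrightarrow> y \<in> g \<Longrightarrow> \<Phi> x y = \<Phi> y x"
  by (rule invariant_formD(1)[OF form])

lemma skew: "x \<in> g \<Longrightarrow> y \<in> g \<Longrightarrow> z \<in> g \<Longrightarrow> \<Phi> (lie x y) z = - \<Phi> y (lie x z)"
  by (rule form_lie_swap[OF form_g]) (auto intro: g_closed)

lemma assoc: "x \<in> g \<Longrightarrow> y \<in> g \<Longrightarrow> z \<in> g \<Longrightarrow> \<Phi> (lie x y) z = \<Phi> x (lie y z)"
  by (rule invariant_formD(4)[OF form])

lemma expand_L: "u \<in> L \<Longrightarrow> (\<Sum>i<r + s. \<Phi> u (e' i) *\<^sub>M e i) = u" "u \<in> L \<Longrightarrow> (\<Sum>i<r + s. \<Phi> u (e i) *\<^sub>M e' i) = u"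
  using dual_pairD(3,4)[OF dual_e] by auto

lemma expand_N: "x \<in> N \<Longrightarrow> (\<Sum>i<n. \<Phi> x (f' i) *\<^sub>M f i) = x" "x \<in> N \<Longrightarrow> (\<Sum>i<n. \<Phi> x (f i) *\<^sub>M f' i) = x"
  using dual_pairD(3,4)[OF dual_N] by auto

lemma expand_M: "y \<in> M \<Longrightarrow> (\<Sum>i<m. \<Phi> y (h' i) *\<^sub>M h i) = y" "y \<in> M \<Longrightarrow> (\<Sum>i<m. \<Phi> y (h i) *\<^sub>M h' i) = y"
  using dual_pairD(3,4)[OF dual_M] by auto

lemma eq_in_L:
  assumes "u \<in> L" "v \<in> L" "\<And>w. w \<in> L \<Longrightarrow> \<Phi> u w = \<Phi> v w"
  shows "u = v"
proof -
  have "(\<Sum>i<r + s. \<Phi> u (e' i) *\<^sub>M e i) = (\<Sum>i<r + s. \<Phi> v (e' i) *\<^sub>M e i)"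
    by (intro sum.cong refl) (simp add: assms(3) eL)
  then show ?thesis by (simp only: expand_L(1)[OF assms(1)] expand_L(1)[OF assms(2)])
qed

lemma form_sum_g:
  assumes "y \<in> g" "\<And>i. i \<in> I \<Longrightarrow> x i \<in> g"
  shows "\<Phi> (\<Sum>i\<in>I. x i) y = (\<Sum>i\<in>I. \<Phi> (x i) y)" "\<Phi> y (\<Sum>i\<in>I. x i) = (\<Sum>i\<in>I. \<Phi> y (x i))"
  using form_sum[OF form_g assms(1), of I x] assms(2) by auto

lemma scale_g: "x \<in> g \<Longrightarrow> y \<in> g \<Longrightarrow> \<Phi> (c *\<^sub>M x) y = c * \<Phi> x y" "x \<in> g \<Longrightarrow> y \<in> g \<Longrightarrow> \<Phi> y (c *\<^sub>M x) = c * \<Phi> y x"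
  using form_scale[OF form_g] by auto

lemmas sub_g = mat_vs.subspace_scale[OF g_sub] and add_g = mat_vs.subspace_add[OF g_sub]
  and diff_g = mat_vs.subspace_diff[OF g_sub] and sum_g = mat_vs.subspace_sum[OF g_sub]

lemma parseval_N:
  assumes "x \<in> N" "y \<in> g"
  shows "(\<Sum>a<n. \<Phi> x (f a) * \<Phi> y (f' a)) = \<Phi> y x"
proof -
  have "\<Phi> y x = \<Phi> y (\<Sum>a<n. \<Phi> x (f a) *\<^sub>M f' a)" using expand_N(2)[OF assms(1)] by simp
  also have "\<dots> = (\<Sum>a<n. \<Phi> y (\<Phi> x (f a) *\<^sub>M f' a))"
    by (rule form_sum_g(2)[OF assms(2)]) (use fN sub_g in auto)
  also have "\<dots> = (\<Sum>a<n. \<Phi> x (f a) * \<Phi> y (f' a))"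
    using assms(2) fN by (intro sum.cong refl) (simp add: scale_g)
  finally show ?thesis ..
qed

lemma tr_N:
  assumes "lin_on mscale N mscale F" "F ` N \<subseteq> N"
  shows "ml.tr N F = (\<Sum>a<n. \<Phi> (F (f a)) (f' a))"
  by (rule tr_dual_pair[OF form_g N(1,2) dual_N assms])

lemma tr_g:
  assumes F: "lin_on mscale g mscale F" "F ` g \<subseteq> g"
  shows "ml.tr g F = (\<Sum>i<r + s. \<Phi> (F (e i)) (e' i)) + (\<Sum>a<n. \<Phi> (F (f a)) (f' a)) + (\<Sum>b<m. \<Phi> (F (h b)) (h' b))"
proof -
  let ?I = "{..<r + s} <+> ({..<n} <+> {..<m})"
  let ?b = "case_sum e (case_sum f h)" and ?b' = "case_sum e' (case_sum f' h')"
  have fr: "ml.frame g ?I ?b (\<lambda>i v. \<Phi> v (?b' i))"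
    unfolding ml.frame_def
  proof (intro conjI ballI)
    fix i assume "i \<in> ?I"
    then have "?b i \<in> g" "?b' i \<in> g" using eL fN hM by (auto split: sum.splits)
    then show "?b i \<in> g" "lin_on mscale g (*) (\<lambda>v. \<Phi> v (?b' i))"
      using form_lin(1)[OF form_g] by auto
  next
    fix v assume "v \<in> g"
    then obtain u x y where v: "u \<in> L" "x \<in> N" "y \<in> M" "v = u + x + y" using decomp by blast
    have ux: "u + x \<in> g" using v add_g by simp
    have a: "\<Phi> v (e' i) = \<Phi> u (e' i)" if "i < r + s" for i
      using v that eL(2)[OF that] orth_LN orth_LM ux
      by (simp add: form_add[OF form_g] sym[of _ "e' i"])
    have b: "\<Phi> v (f' i) = \<Phi> x (f' i)" if "i < n" for i
      using v that fN(2)[OF that] orth_LN orth_NM ux sym[of y "f' i"]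
      by (simp add: form_add[OF form_g])
    have c: "\<Phi> v (h' i) = \<Phi> y (h' i)" if "i < m" for i
      using v that hM(2)[OF that] orth_LM orth_NM ux
      by (simp add: form_add[OF form_g])
    have "(\<Sum>i\<in>?I. \<Phi> v (?b' i) *\<^sub>M ?b i) =
        (\<Sum>i<r + s. \<Phi> v (e' i) *\<^sub>M e i) + ((\<Sum>i<n. \<Phi> v (f' i) *\<^sub>M f i) + (\<Sum>i<m. \<Phi> v (h' i) *\<^sub>M h i))"
      by (simp add: sum.Plus)
    also have "\<dots> = u + (x + y)"
      using expand_L(1)[OF v(1)] expand_N(1)[OF v(2)] expand_M(1)[OF v(3)] by (simp add: a b c)
    finally show "v = (\<Sum>i\<in>?I. \<Phi> v (?b' i) *\<^sub>M ?b i)" using v(4) by (simp add: add.assoc)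
  qed simp
  show ?thesis unfolding ml.tr_frame[OF g_sub fr F] by (simp add: sum.Plus)
qed

abbreviation K where "K \<equiv> tform N"
abbreviation K' where "K' \<equiv> tform M"

lemma K_inv: "invariant_form L K" by (rule tform_invariant[OF N(1,3)])
lemma K'_inv: "invariant_form L K'" by (rule tform_invariant[OF M(1,3)])

lemma K_sum: "u \<in> L \<Longrightarrow> v \<in> L \<Longrightarrow> K u v = (\<Sum>a<n. \<Phi> (lie u (lie v (f a))) (f' a))"
  unfolding tform_def by (rule tr_N[OF lin_on_lie2]) (use N(3) in auto)

lemma K'_sum: "u \<in> L \<Longrightarrow> v \<in> L \<Longrightarrow> K' u v = (\<Sum>b<m. \<Phi> (lie u (lie v (h b))) (h' b))"
  unfolding tform_def by (rule tr_dual_pair[OF form_g M(1,2) dual_M lin_on_lie2]) (use M(3) in auto)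

lemma repL: "lie_rep L mscale L lie"
  by (rule lie_rep_adjoint[OF subspace_L L_closed])

lemma CL_in: "u \<in> L \<Longrightarrow> C lie u \<in> L"
  by (rule C_lin(2)[OF repL])

lemma tensor_swap:
  assumes "linear_space t"
    and "\<And>w. w \<in> L \<Longrightarrow> lin_on mscale L t (\<lambda>u. \<beta> u w)" "\<And>u. u \<in> L \<Longrightarrow> lin_on mscale L t (\<beta> u)"
  shows "(\<Sum>i<r + s. \<beta> (e i) (e' i)) = (\<Sum>i<r + s. \<beta> (e' i) (e i))"
  by (rule dual_pair_tensor[OF inv dual_e dual_pair_swap[OF dual_e] subspace_L assms(1) order_refl assms(2,3)])

lemma lin_form_lie:
  assumes "v \<in> g" "V \<subseteq> g" shows "lin_on mscale V (*) (\<lambda>u. \<Phi> u v)" "lin_on mscale V (*) (\<Phi> v)"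
  using form_lin[OF form_g assms(1)] lin_on_subset[OF _ assms(2)] by blast+

text \<open>The Killing form is the sum of the trace forms on \<open>L\<close>, \<open>N\<close> and \<open>M\<close>, and by invariance the trace form
  on \<open>L\<close> is \<open>\<Phi> (C u) v\<close>.\<close>

lemma form_decomposition:
  assumes u: "u \<in> L" and v: "v \<in> L"
  shows "\<Phi> (C lie u) v + K u v + K' u v = \<Phi> u v"
proof -
  have uv: "u \<in> g" "v \<in> g" using u v by auto
  have "\<Phi> u v = (\<Sum>i<r + s. \<Phi> (lie u (lie v (e i))) (e' i)) + K u v + K' u v"
    unfolding \<Phi>_trace[OF uv] K_sum[OF u v] K'_sum[OF u v] unfolding tform_def[of g]
    by (rule tr_g[OF lin_on_lie2]) (use uv g_closed in auto)
  also have "(\<Sum>i<r + s. \<Phi> (lie u (lie v (e i))) (e' i)) = (\<Sum>i<r + s. - \<Phi> (lie v (e i)) (lie u (e' i)))"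
    using uv eL by (intro sum.cong refl skew) (auto intro: g_closed)
  also have "\<dots> = (\<Sum>i<r + s. - \<Phi> (lie v (e' i)) (lie u (e i)))"
  proof (rule tensor_swap[where \<beta> = "\<lambda>x y. - \<Phi> (lie v x) (lie u y)", OF linear_space_mult])
    fix w assume w: "w \<in> L"
    show "lin_on mscale L (*) (\<lambda>x. - \<Phi> (lie v x) (lie u w))"
      using w u v L_closed by (auto simp: lin_on_def lie_add lie_scale form_add[OF form_g] scale_g)
    show "lin_on mscale L (*) (\<lambda>x. - \<Phi> (lie v w) (lie u x))"
      using w u v L_closed by (auto simp: lin_on_def lie_add lie_scale form_add[OF form_g] scale_g)
  qed
  also have "\<dots> = (\<Sum>i<r + s. \<Phi> (lie (e' i) (lie (e i) u)) v)"
  proof (intro sum.cong refl)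
    fix i assume "i \<in> {..<r + s}"
    then have i: "e i \<in> g" "e' i \<in> g" using eL by auto
    have a: "lie (e' i) v = (- 1) *\<^sub>M lie v (e' i)" "lie (e i) u = (- 1) *\<^sub>M lie u (e i)"
      using lie_anti[of v "e' i"] lie_anti[of u "e i"] by simp_all
    have "\<Phi> (lie (e' i) (lie (e i) u)) v = - \<Phi> (lie (e i) u) (lie (e' i) v)"
      by (intro skew i g_closed uv)
    also have "\<dots> = - \<Phi> (lie (e' i) v) (lie (e i) u)" using sym i uv g_closed by auto
    also have "\<dots> = - \<Phi> (lie v (e' i)) (lie u (e i))"
      unfolding a using i uv g_closed sub_g by (simp only: scale_g) simp
    finally show "- \<Phi> (lie v (e' i)) (lie u (e i)) = \<Phi> (lie (e' i) (lie (e i) u)) v" ..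
  qed
  also have "\<dots> = \<Phi> (C lie u) v"
    unfolding cas_def by (rule form_sum_g(1)[symmetric]) (use uv eL g_closed in auto)
  finally show ?thesis by simp
qed

definition ann :: "'k^'n^'n \<Rightarrow> bool" where "ann u \<longleftrightarrow> (\<forall>x\<in>N. lie u x = 0)"

text \<open>The basis vectors of \<open>L\<close> whose span is orthogonal to the annihilator of \<open>N\<close> (\<open>active_orth\<close>), while
  the others annihilate \<open>N\<close> (\<open>inactive_ann\<close>).\<close>

definition active :: "nat set" where
  "active = {i. i < r + s \<and> (if i < r then r1 \<le> i else \<not> ann (X (i - r)))}"

lemma active_finite: "finite active" and active_subset: "active \<subseteq> {..<r + s}"
  by (auto simp: active_def)

lemma ann_lie: "ann u \<Longrightarrow> v \<in> L \<Longrightarrow> ann (lie u v)"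
  using N(3) by (auto simp: ann_def lie_lie)

lemma ann_lie': "ann u \<Longrightarrow> v \<in> L \<Longrightarrow> ann (lie v u)"
  using N(3) by (auto simp: ann_def lie_lie)

lemma ann_K:
  assumes "ann u" "u \<in> L" "v \<in> L"
  shows "K u v = 0" "K v u = 0"
proof -
  have "ml.tr N (\<lambda>z. lie v (lie u z)) = ml.tr N (\<lambda>z. 0)"
    by (rule ml.tr_cong[OF fdN lin_on_lie2]) (use assms N(3) mat_vs.subspace_0[OF N(1)] in \<open>auto simp: ann_def\<close>)
  also have "\<dots> = 0"
    using ml.tr_scale[OF fdN, of "\<lambda>z. 0" 0] mat_vs.subspace_0[OF N(1)] by (simp add: lin_on_def image_subset_iff)
  finally show "K v u = 0" by (simp add: tform_def)
  then show "K u v = 0" using invariant_formD(1)[OF K_inv assms(2,3)] by simp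
qed

lemma weight_basis:
  assumes "mat_vs.subspace V" "V \<subseteq> g" "\<And>u x. u \<in> L \<Longrightarrow> x \<in> V \<Longrightarrow> lie u x \<in> V"
  shows "\<exists>B l. finite B \<and> mat_vs.independent B \<and> mat_vs.span B = V \<and> (\<forall>b\<in>B. b \<in> wsp mscale V lie (l b))"
proof -
  have "wmod mscale V lie" by (rule wmod_sub[OF wmod_g assms])
  then show ?thesis by (rule wmod_weight_basis) blast
qed

lemmas weight_basis_N = weight_basis[OF N] and weight_basis_M = weight_basis[OF M]

lemma coroot_kills_X:
  assumes a: "a < s" and V: "\<And>x. x \<in> V \<Longrightarrow> lie (coroot a) x = 0" "\<And>u x. u \<in> L \<Longrightarrow> x \<in> V \<Longrightarrow> lie u x \<in> V" and "x \<in> V"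
  shows "lie (X a) x = 0" "lie (Y a) x = 0"
proof -
  have p: "of_rat (ip (\<alpha> a) (\<alpha> a)) \<noteq> (0 :: 'k)" using ip_root_pos[OF a] by simp
  have "lie (lie (coroot a) (X a)) x = 0"
    unfolding lie_lie using V(1) V(2)[OF X_in[OF a]] assms(4) by simp
  then show "lie (X a) x = 0" unfolding coroot_X[OF a] lie_scale using p by simp
  have "lie (coroot a) (Y a) = of_rat (- ip (\<alpha> a) (\<alpha> a)) *\<^sub>M Y a"
  proof -
    have "Y a \<in> wsp mscale L lie (\<lambda>i. - \<alpha> a i)"
      using a by (simp add: wsp_def Y_in HY)
    from coroot_weight[OF this, of a] show ?thesis by (simp add: ip_def sum_negf of_rat_minus)
  qed
  moreover have "lie (lie (coroot a) (Y a)) x = 0"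
    unfolding lie_lie using V(1) V(2)[OF Y_in[OF a]] assms(4) by simp
  ultimately show "lie (Y a) x = 0" using p by (simp add: lie_scale lie_neg of_rat_minus)
qed

lemma sum_of_rat_squares_eq_0:
  assumes "finite B" "of_rat (\<Sum>b\<in>B. (x b)\<^sup>2) = (0 :: 'k)" "b \<in> B"
  shows "x b = 0"
  using assms by (simp add: sum_nonneg_eq_0_iff)

text \<open>The hypothesis says that the squares of the rational eigenvalues of the coroot add up to \<open>0\<close>.\<close>

lemma tform_coroot_0:
  assumes a: "a < s" and z: "tform V (coroot a) (coroot a) = 0"
    and V: "mat_vs.subspace V" "V \<subseteq> g" "\<And>u x. u \<in> L \<Longrightarrow> x \<in> V \<Longrightarrow> lie u x \<in> V" and x: "x \<in> V"
  shows "lie (X a) x = 0" "lie (Y a) x = 0"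
proof -
  obtain B l where B: "finite B" "mat_vs.independent B" "mat_vs.span B = V" "\<And>b. b \<in> B \<Longrightarrow> b \<in> wsp mscale V lie (l b)"
    using weight_basis[OF V] by blast
  have "of_rat (\<Sum>b\<in>B. (ip (\<alpha> a) (l b))\<^sup>2) = (0 :: 'k)"
    by (rule trans[OF tform_coroot[OF B, symmetric] z])
  then have "ip (\<alpha> a) (l b) = 0" if "b \<in> B" for b
    by (rule sum_of_rat_squares_eq_0[OF B(1) _ that])
  then have "lie (coroot a) b = 0" if "b \<in> B" for b using coroot_weight[OF B(4)[OF that]] that by simp
  then have c: "lie (coroot a) x = 0" if "x \<in> V" for x using lie_kills_span[of B] that B(3) by blast
  show "lie (X a) x = 0" "lie (Y a) x = 0"
    using coroot_kills_X[OF a c V(3) x] by auto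
qed

lemma K_coroot_0: "a < s \<Longrightarrow> K (coroot a) (coroot a) = 0 \<Longrightarrow> ann (X a)"
  using tform_coroot_0(1)[OF _ _ N] by (simp add: ann_def)

lemma ann_X_Y:
  assumes a: "a < s" "ann (X a)"
  shows "ann (Y a)"
proof -
  have "ann (coroot a)" using ann_lie[OF a(2) Y_in[OF a(1)]] XY_same_root[OF a(1) a(1)] by simp
  then show ?thesis using coroot_kills_X(2)[OF a(1) _ N(3)] unfolding ann_def by blast
qed

lemma inactive_ann:
  assumes "i < r + s" "i \<notin> active"
  shows "ann (e i)" "ann (e' i)"
proof -
  have "ann (e i) \<and> ann (e' i)"
  proof (cases "i < r")
    case True
    then have "i < r1" using assms by (auto simp: active_def)
    then show ?thesis using torus_kills True by (auto simp: e_simps ann_def lie_scale)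
  next
    case False
    then obtain a where a: "i = r + a" "a < s" using assms(1) by (metis add_less_cancel_left le_Suc_ex not_less)
    then have "ann (X a)" using assms False by (auto simp: active_def)
    then show ?thesis using a ann_X_Y by (simp add: e_simps)
  qed
  then show "ann (e i)" "ann (e' i)" by auto
qed

text \<open>Root components are excluded by \<open>K_coroot_0\<close>.  For the torus component \<open>hel c\<close>, a functional to the
  rational numbers replaces \<open>c\<close> by rational coefficients, on which \<open>K\<close> is a sum of squares.\<close>

lemma radical_ann:
  assumes u: "u \<in> L" and z: "\<And>w. w \<in> L \<Longrightarrow> K u w = 0"
  shows "ann u"
proof -
  define c where "c = (\<lambda>i. \<Phi> u (H i) / of_rat (q i))"
  have exp: "u = hel c + (\<Sum>a<s. \<Phi> u (Y a) *\<^sub>M X a)"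
    using expand[OF u] by (simp add: hel_def c_def)
  have XL: "\<Phi> u (Y a) *\<^sub>M X a \<in> L" if "a < s" for a
    by (rule L_scale[OF X_in[OF that]])
  have SL: "(\<Sum>a<s. \<Phi> u (Y a) *\<^sub>M X a) \<in> L"
    using XL by (intro L_sum) auto
  obtain B l where B: "finite B" "mat_vs.independent B" "mat_vs.span B = N" "\<And>b. b \<in> B \<Longrightarrow> b \<in> wsp mscale N lie (l b)"
    using weight_basis_N by blast
  have X0: "\<Phi> u (Y a) *\<^sub>M lie (X a) x = 0" if a: "a < s" and x: "x \<in> N" for a x
  proof -
    have "K (coroot a) (coroot a) * \<Phi> u (Y a) = 0"
      using form_X_eigen(2)[OF K_inv a u] z[OF Y_in[OF a]] ip_root_pos[OF a] by auto
    then show ?thesis using K_coroot_0[OF a] x by (auto simp: ann_def)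
  qed
  have XS0: "lie (\<Sum>a<s. \<Phi> u (Y a) *\<^sub>M X a) x = 0" if "x \<in> N" for x
    unfolding lie_sum lie_scale by (rule sum.neutral) (use X0[OF _ that] in auto)
  have H0: "K (hel c) (H j) = 0" if j: "j < r" for j
  proof -
    have "0 = K (hel c + (\<Sum>a<s. \<Phi> u (Y a) *\<^sub>M X a)) (H j)" using z[OF H_in[OF j]] exp by simp
    also have "\<dots> = K (hel c) (H j) + K (\<Sum>a<s. \<Phi> u (Y a) *\<^sub>M X a) (H j)"
      by (rule form_add(1)[OF K_inv subspace_L H_in[OF j] hel_in SL])
    also have "K (\<Sum>a<s. \<Phi> u (Y a) *\<^sub>M X a) (H j) = 0"
      using ann_K(1)[OF _ SL H_in[OF j]] XS0 by (simp add: ann_def)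
    finally show ?thesis by simp
  qed
  have ev: "(\<Sum>i<r. c i * of_rat (l b i)) = 0" if b: "b \<in> B" for b
  proof (rule ccontr)
    assume "(\<Sum>i<r. c i * of_rat (l b i)) \<noteq> 0"
    from exists_rational_functional[OF this] obtain F :: "'k \<Rightarrow> rat" where F: "\<And>x y. F (x + y) = F x + F y" "\<And>q x. F (of_rat q * x) = q * F x"
      "F (\<Sum>i<r. c i * of_rat (l b i)) \<noteq> 0"
      by blast
    have F0: "F 0 = 0" using F(2)[of 0 0] by simp
    have Fsum: "F (\<Sum>i\<in>I. x i) = (\<Sum>i\<in>I. F (x i))" for I :: "'j set" and x
      by (induction I rule: infinite_finite_induct) (auto simp: F(1) F0)
    have Fc: "F (x * of_rat p) = F x * p" for x p
      using F(2)[of p x] by (simp add: mult.commute)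
    have Fl: "F (\<Sum>i<r. c i * of_rat (l b i)) = (\<Sum>i<r. F (c i) * l b i)" for b
      by (simp only: Fsum Fc)
    have KH: "K (hel c) (H j) = (\<Sum>b\<in>B. (\<Sum>i<r. c i * of_rat (l b i)) * of_rat (l b j))" if "j < r" for j
    proof -
      have "K (hel c) (H j) = K (hel c) (hel (\<lambda>i. if i = j then 1 else 0))"
        by (simp only: H_hel[OF that])
      also have "\<dots> = (\<Sum>b\<in>B. (\<Sum>i<r. c i * of_rat (l b i)) *
          (\<Sum>i<r. (if i = j then 1 else 0) * of_rat (l b i)))"
        by (rule tform_hel[OF B])
      also have "\<dots> = (\<Sum>b\<in>B. (\<Sum>i<r. c i * of_rat (l b i)) * of_rat (l b j))"
        using that by (simp add: if_distrib[of "\<lambda>x. x * _"] cong: if_cong)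
      finally show ?thesis .
    qed
    have *: "(\<Sum>b\<in>B. (\<Sum>i<r. F (c i) * l b i) * l b j) = 0" if "j < r" for j
    proof -
      have "F (\<Sum>b\<in>B. (\<Sum>i<r. c i * of_rat (l b i)) * of_rat (l b j)) = 0"
        using H0[OF that] KH[OF that] F0 by simp
      then show ?thesis by (simp only: Fsum Fc Fl)
    qed
    have "(\<Sum>b\<in>B. (\<Sum>i<r. F (c i) * l b i)\<^sup>2) =
        (\<Sum>b\<in>B. \<Sum>j<r. F (c j) * ((\<Sum>i<r. F (c i) * l b i) * l b j))"
      by (intro sum.cong refl) (simp add: power2_eq_square sum_distrib_left mult_ac)
    also have "\<dots> = (\<Sum>j<r. F (c j) * (\<Sum>b\<in>B. (\<Sum>i<r. F (c i) * l b i) * l b j))"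
      by (subst sum.swap) (simp add: sum_distrib_left)
    also have "\<dots> = 0" using * by simp
    finally have "(\<Sum>i<r. F (c i) * l b i) = 0" using b B(1) by (simp add: sum_nonneg_eq_0_iff)
    then show False using F(3) Fl by simp
  qed
  have "lie (hel c) x = 0" if "x \<in> N" for x
    by (rule lie_kills_span[of B]) (use hel_weight[OF B(4)] ev that B(3) in auto)
  then show ?thesis unfolding ann_def using exp XS0 lie_add(1) by (metis add.left_neutral)
qed

lemma active_orth:
  assumes i: "i \<in> active" and u: "u \<in> L" "ann u"
  shows "\<Phi> u (e i) = 0" "\<Phi> u (e' i) = 0"
proof -
  have X: "\<Phi> u (X a) = 0 \<and> \<Phi> u (Y a) = 0" if a: "a < s" "\<not> ann (X a)" for a
    using form_X_eigen[OF K_inv a(1) u(1)] ann_K(1)[OF u(2,1) X_in[OF a(1)]] ann_K(1)[OF u(2,1) Y_in[OF a(1)]]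
      K_coroot_0[OF a(1)] a(2) ip_root_pos[OF a(1)] by auto
  have Hz: "\<Phi> u (H l) = 0" if l: "r1 \<le> l" "l < r" for l
  proof -
    let ?c = "\<lambda>i. \<Phi> u (H i) / of_rat (q i)"
    have exp: "u = hel ?c + (\<Sum>a<s. \<Phi> u (Y a) *\<^sub>M X a)" using expand[OF u(1)] by (simp add: hel_def)
    have "\<Phi> u (Y a) *\<^sub>M lie (X a) x = 0" if "a < s" "x \<in> N" for a x
      using X[of a] that by (cases "ann (X a)") (auto simp: ann_def)
    then have "lie (\<Sum>a<s. \<Phi> u (Y a) *\<^sub>M X a) x = 0" if "x \<in> N" for x
      unfolding lie_sum lie_scale using that by (intro sum.neutral) auto
    then have "lie (hel ?c) x = 0" if "x \<in> N" for x
      using u(2) exp that lie_add(1)[of "hel ?c"] unfolding ann_def by (metis add.right_neutral)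
    from torus_faithful[OF this l] q_pos[OF l(2)] show ?thesis by simp
  qed
  have "\<Phi> u (e i) = 0 \<and> \<Phi> u (e' i) = 0"
  proof (cases "i < r")
    case True
    then have "r1 \<le> i" using i by (auto simp: active_def)
    then show ?thesis using Hz True u(1) H_in by (simp add: e_simps form_scale(2)[OF inv subspace_L])
  next
    case False
    then obtain a where a: "i = r + a" "a < s" using i unfolding active_def
      by (metis (no_types, lifting) add_less_cancel_left le_Suc_ex mem_Collect_eq not_less)
    then have "\<not> ann (X a)" using i False by (auto simp: active_def)
    then show ?thesis using X[OF a(2)] a by (simp add: e_simps)
  qed
  then show "\<Phi> u (e i) = 0" "\<Phi> u (e' i) = 0" by auto
qed

end

lemma sum_swap4:
  "(\<Sum>a\<in>A. \<Sum>b\<in>B. \<Sum>j\<in>J. \<Sum>i\<in>I. F j i a b) = (\<Sum>j\<in>J. \<Sum>i\<in>I. \<Sum>a\<in>A. \<Sum>b\<in>B. F j i a b)"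
proof -
  have 1: "(\<Sum>b\<in>B. \<Sum>j\<in>J. \<Sum>i\<in>I. F j i a b) = (\<Sum>j\<in>J. \<Sum>i\<in>I. \<Sum>b\<in>B. F j i a b)" for a
    by (subst sum.swap, rule sum.cong[OF refl], rule sum.swap)
  show ?thesis unfolding 1 by (subst sum.swap, rule sum.cong[OF refl], rule sum.swap)
qed

lemma sum_of_squares_expand:
  fixes l k :: "'b \<Rightarrow> nat \<Rightarrow> rat" and q :: "nat \<Rightarrow> rat"
  shows "(\<Sum>i\<in>A. \<Sum>j\<in>A. (\<Sum>b\<in>B. l b i * l b j) * (\<Sum>d\<in>D. k d i * k d j) / (q i * q j)) =
    (\<Sum>b\<in>B. \<Sum>d\<in>D. (\<Sum>i\<in>A. l b i * k d i / q i)\<^sup>2)"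
proof -
  have "(\<Sum>i\<in>A. \<Sum>j\<in>A. (\<Sum>b\<in>B. l b i * l b j) * (\<Sum>d\<in>D. k d i * k d j) / (q i * q j)) =
      (\<Sum>i\<in>A. \<Sum>j\<in>A. \<Sum>b\<in>B. \<Sum>d\<in>D. (l b i * k d i / q i) * (l b j * k d j / q j))"
    unfolding sum_product sum_divide_distrib by (intro sum.cong refl) (simp add: mult_ac)
  also have "\<dots> = (\<Sum>b\<in>B. \<Sum>d\<in>D. \<Sum>i\<in>A. \<Sum>j\<in>A. (l b i * k d i / q i) * (l b j * k d j / q j))"
    by (rule sum_swap4)
  finally show ?thesis by (simp add: power2_eq_square sum_product)
qed

section \<open>Skew endomorphisms of the eigenspace\<close>

context casimir_half
begin

abbreviation fs :: "'k \<Rightarrow> ('k^'n^'n \<Rightarrow> 'k^'n^'n) \<Rightarrow> 'k^'n^'n \<Rightarrow> 'k^'n^'n" where "fs \<equiv> fscale mscale"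

interpretation fl: linear_space fs by (rule linear_space_fscale) unfold_locales

abbreviation EN where "EN \<equiv> endo mscale N"
abbreviation aN where "aN \<equiv> endo_act lie N"

lemma wmodN: "wmod mscale N lie"
  by (rule wmod_sub[OF wmod_g N])

lemmas repN = wmod_rep[OF wmodN]

lemma wmodEN: "wmod fs EN aN"
  by (rule wmod_endo[OF wmodN])

lemmas repEN = wmod_rep[OF wmodEN]

lemma half_swapped: "x \<in> N \<Longrightarrow> (\<Sum>i<r + s. lie (e i) (lie (e' i) x)) = (1 / 2) *\<^sub>M x"
  using cas_independent[OF repN lie_subalgebra inv dual_pair_swap[OF dual_e] dual_e, of x] half[of x]
  by (simp add: cas_def)

definition T :: "('k^'n^'n \<Rightarrow> 'k^'n^'n) \<Rightarrow> 'k^'n^'n \<Rightarrow> 'k^'n^'n" where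
  "T F = F - C aN F"

text \<open>\<open>C\<close> maps \<open>F\<close> to \<open>C F + F C - 2 \<Sum> e\<^sub>i F e'\<^sub>i\<close>, and the first two terms are both \<open>F / 2\<close>.\<close>

lemma T_apply:
  assumes F: "F \<in> EN" and x: "x \<in> N"
  shows "T F x = 2 *\<^sub>M (\<Sum>i<r + s. lie (e i) (F (lie (e' i) x)))"
proof -
  note FN = endoD(2)[OF F]
  let ?D = "\<Sum>i<r + s. lie (e i) (F (lie (e' i) x))"
  have "C aN F x = (\<Sum>i<r + s. aN (e' i) (aN (e i) F) x)"
    by (simp add: cas_def sum_fun_apply)
  also have "\<dots> = (\<Sum>i<r + s. lie (e' i) (lie (e i) (F x)) - lie (e' i) (F (lie (e i) x))
      - lie (e i) (F (lie (e' i) x)) + F (lie (e i) (lie (e' i) x)))"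
    using x eL by (intro sum.cong refl) (simp add: endo_act_def lie_diff N(3))
  also have "\<dots> = C lie (F x) - (\<Sum>i<r + s. lie (e' i) (F (lie (e i) x))) - ?D
      + (\<Sum>i<r + s. F (lie (e i) (lie (e' i) x)))"
    by (simp add: sum.distrib sum_subtractf cas_def)
  also have "C lie (F x) = (1 / 2) *\<^sub>M F x" by (rule half[OF FN[OF x]])
  also have "(\<Sum>i<r + s. lie (e' i) (F (lie (e i) x))) = ?D"
  proof (rule tensor_swap[where \<beta> = "\<lambda>u w. lie u (F (lie w x))", OF ml.linear_space_axioms, symmetric])
    fix u assume u: "u \<in> L"
    show "lin_on mscale L mscale (\<lambda>v. lie v (F (lie u x)))" by (simp add: lin_on_def lie_add lie_scale)
    show "lin_on mscale L mscale (\<lambda>w. lie u (F (lie w x)))"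
      using x N(3) lin_onD[OF endoD(1)[OF F]] by (simp add: lin_on_def lie_add lie_scale)
  qed
  also have "(\<Sum>i<r + s. F (lie (e i) (lie (e' i) x))) = F (\<Sum>i<r + s. lie (e i) (lie (e' i) x))"
    by (rule ml.lin_on_sum[OF N(1) endoD(1)[OF F], symmetric]) (use x eL N(3) in auto)
  also have "\<dots> = (1 / 2) *\<^sub>M F x"
    unfolding half_swapped[OF x] by (rule lin_onD(2)[OF endoD(1)[OF F] x])
  finally have "C aN F x = (1 / 2) *\<^sub>M F x - ?D - ?D + (1 / 2) *\<^sub>M F x" .
  moreover have "(1 / 2) *\<^sub>M F x + (1 / 2) *\<^sub>M F x = F x"
    by (simp add: mat_vs.scale_left_distrib[symmetric])
  moreover have "2 *\<^sub>M ?D = ?D + ?D"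
    using mat_vs.scale_left_distrib[of 1 1 ?D] by simp
  ultimately show ?thesis by (simp add: T_def algebra_simps)
qed

text \<open>The orthogonal Lie algebra of \<open>\<Phi>\<close> on \<open>N\<close>.\<close>

definition soN :: "('k^'n^'n \<Rightarrow> 'k^'n^'n) set" where
  "soN = {F \<in> EN. \<forall>x\<in>N. \<forall>y\<in>N. \<Phi> (F x) y = - \<Phi> x (F y)}"

lemma soN_D:
  assumes "F \<in> soN"
  shows "F \<in> EN" "x \<in> N \<Longrightarrow> y \<in> N \<Longrightarrow> \<Phi> (F x) y = - \<Phi> x (F y)" "x \<in> N \<Longrightarrow> F x \<in> N"
  using assms by (auto simp: soN_def intro: endoD(2))

lemma subspace_EN: "fl.subspace EN" by (rule rep_subspace[OF repEN])

lemma soN_sub: "fl.subspace soN"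
proof (rule fl.subspaceI)
  show "0 \<in> soN" unfolding soN_def using fl.subspace_0[OF subspace_EN] N
    by (auto simp: form_zero[OF form_g])
  fix F G assume FG: "F \<in> soN" "G \<in> soN"
  have "\<Phi> (F x + G x) y = - \<Phi> x (F y + G y)" if "x \<in> N" "y \<in> N" for x y
    using that soN_D[OF FG(1)] soN_D[OF FG(2)] by (simp add: form_add[OF form_g])
  then show "F + G \<in> soN" using FG fl.subspace_add[OF subspace_EN] by (auto simp: soN_def)
next
  fix c F assume F: "F \<in> soN"
  have "\<Phi> (c *\<^sub>M F x) y = - \<Phi> x (c *\<^sub>M F y)" if "x \<in> N" "y \<in> N" for x y
    using that soN_D[OF F] by (simp add: scale_g)
  then show "fs c F \<in> soN" using F fl.subspace_scale[OF subspace_EN, of F c] by (auto simp: soN_def fscale_def)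
qed

lemma soN_stable:
  assumes u: "u \<in> L" and F: "F \<in> soN"
  shows "aN u F \<in> soN"
proof -
  have "\<Phi> (lie u (F x) - F (lie u x)) y = - \<Phi> x (lie u (F y) - F (lie u y))" if x: "x \<in> N" and y: "y \<in> N" for x y
  proof -
    note N' = N(3)[OF u x] N(3)[OF u y] soN_D(3)[OF F x] soN_D(3)[OF F y]
    note g' = N'[THEN in_g(2)] in_g(1)[OF u] in_g(2)[OF x] in_g(2)[OF y]
      N(3)[OF u N'(3), THEN in_g(2)] N(3)[OF u N'(4), THEN in_g(2)]
      soN_D(3)[OF F N'(1), THEN in_g(2)] soN_D(3)[OF F N'(2), THEN in_g(2)]
    have "\<Phi> (lie u (F x)) y = - \<Phi> (F x) (lie u y)" by (rule skew) (use g' in auto)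
    also have "\<dots> = \<Phi> x (F (lie u y))" using soN_D(2)[OF F x N'(2)] by simp
    finally have 1: "\<Phi> (lie u (F x)) y = \<Phi> x (F (lie u y))" .
    have "\<Phi> (F (lie u x)) y = - \<Phi> (lie u x) (F y)" by (rule soN_D(2)[OF F N'(1) y])
    also have "\<dots> = \<Phi> x (lie u (F y))" using skew[of u x "F y"] g' by simp
    finally have 2: "\<Phi> (F (lie u x)) y = \<Phi> x (lie u (F y))" .
    show ?thesis using g' by (simp add: form_diff[OF form_g] 1 2)
  qed
  then show ?thesis
    using rep_in[OF repEN u soN_D(1)[OF F]] by (simp add: soN_def endo_act_def)
qed

lemma wmod_soN: "wmod fs soN aN"
  by (rule wmod_sub[OF wmodEN soN_sub _ soN_stable]) (auto simp: soN_def)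

lemmas rep_soN = wmod_rep[OF wmod_soN]

lemma T_in: "F \<in> soN \<Longrightarrow> T F \<in> soN"
  unfolding T_def by (intro fl.subspace_diff[OF soN_sub] C_lin(2)[OF rep_soN])

lemma T_lin: "lin_on fs soN fs T"
proof -
  have "lin_on fs soN fs (\<lambda>F. F)" by (simp add: lin_on_def)
  then show ?thesis
    using C_lin(1)[OF rep_soN] unfolding lin_on_def T_def
    by (simp add: fl.scale_right_diff_distrib)
qed

lemma TT_lin: "lin_on fs soN fs (\<lambda>F. T (T F))"
  using lin_on_comp[OF T_lin T_lin] T_in by blast

text \<open>Half of \<open>f\<^sub>a \<and> f'\<^sub>b\<close>; the factor compensates that each basis element occurs twice up to sign.\<close>

definition skew_frame :: "nat \<times> nat \<Rightarrow> 'k^'n^'n \<Rightarrow> 'k^'n^'n" where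
  "skew_frame p x = (if x \<in> N then (1 / 2) *\<^sub>M (\<Phi> x (f' (snd p)) *\<^sub>M f (fst p) - \<Phi> x (f (fst p)) *\<^sub>M f' (snd p)) else 0)"

lemma skew_frame_in:
  assumes "a < n" "b < n" shows "skew_frame (a, b) \<in> soN"
proof -
  note N' = fN(1)[OF assms(1)] fN(2)[OF assms(2)]
  have "skew_frame (a, b) \<in> EN"
    unfolding endo_def lin_on_def
  proof (intro CollectI conjI ballI allI impI)
    fix x y assume "x \<in> N" "y \<in> N"
    then show "skew_frame (a, b) (x + y) = skew_frame (a, b) x + skew_frame (a, b) y"
      using N' mat_vs.subspace_add[OF N(1)]
      by (simp add: skew_frame_def form_add[OF form_g] mat_vs.scale_left_distrib mat_vs.scale_right_distrib
          mat_vs.scale_right_diff_distrib)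
  next
    fix c x assume "x \<in> N"
    then show "skew_frame (a, b) (c *\<^sub>M x) = c *\<^sub>M skew_frame (a, b) x"
      using N' mat_vs.subspace_scale[OF N(1)]
      by (simp add: skew_frame_def scale_g mat_vs.scale_right_diff_distrib mult.left_commute)
  next
    show "skew_frame (a, b) ` N \<subseteq> N"
      using N' by (auto simp: skew_frame_def intro!: mat_vs.subspace_scale[OF N(1)] mat_vs.subspace_diff[OF N(1)])
  qed (simp add: skew_frame_def)
  moreover have "\<Phi> (skew_frame (a, b) x) y = - \<Phi> x (skew_frame (a, b) y)" if x: "x \<in> N" and y: "y \<in> N" for x y
  proof -
    note g' = in_g(2)[OF N'(1)] in_g(2)[OF N'(2)] in_g(2)[OF x] in_g(2)[OF y]
    have A: "\<Phi> (skew_frame (a, b) x) y = (1 / 2) * (\<Phi> x (f' b) * \<Phi> (f a) y - \<Phi> x (f a) * \<Phi> (f' b) y)"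
      using x g' sub_g diff_g by (simp add: skew_frame_def scale_g form_diff[OF form_g])
    have B: "\<Phi> x (skew_frame (a, b) y) = (1 / 2) * (\<Phi> y (f' b) * \<Phi> x (f a) - \<Phi> y (f a) * \<Phi> x (f' b))"
      using y g' sub_g diff_g by (simp add: skew_frame_def scale_g form_diff[OF form_g])
    show ?thesis
      unfolding A B sym[OF g'(1,4)] sym[OF g'(2,4)] by (simp add: algebra_simps)
  qed
  ultimately show ?thesis by (simp add: soN_def)
qed

lemma frame_soN:
  "fl.frame soN ({..<n} \<times> {..<n}) skew_frame (\<lambda>p F. \<Phi> (F (f (snd p))) (f' (fst p)))"
  unfolding fl.frame_def
proof (intro conjI ballI)
  fix p assume "p \<in> {..<n} \<times> {..<n}"
  then obtain a b where p: "p = (a, b)" "a < n" "b < n" by auto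
  then show "skew_frame p \<in> soN" using skew_frame_in by simp
  show "lin_on fs soN (*) (\<lambda>F. \<Phi> (F (f (snd p))) (f' (fst p)))"
    using p fN soN_D(3) by (simp add: lin_on_def fscale_def form_add[OF form_g] scale_g)
next
  fix F assume F: "F \<in> soN"
  let ?G = "\<Sum>p\<in>{..<n} \<times> {..<n}. fs (\<Phi> (F (f (snd p))) (f' (fst p))) (skew_frame p)"
  show "F = ?G"
  proof (rule endo_eqI)
    show "F \<in> EN" by (rule soN_D(1)[OF F])
    have "?G \<in> soN" using skew_frame_in by (intro fl.subspace_sum[OF soN_sub] fl.subspace_scale[OF soN_sub]) auto
    then show "?G \<in> EN" by (rule soN_D(1))
    fix x assume x: "x \<in> N"
    note Fg = soN_D(3)[OF F]
    have "?G x = (\<Sum>a<n. \<Sum>b<n. \<Phi> (F (f b)) (f' a) *\<^sub>M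
        ((1 / 2) *\<^sub>M (\<Phi> x (f' b) *\<^sub>M f a - \<Phi> x (f a) *\<^sub>M f' b)))"
      using x by (simp add: sum_fun_apply sum.cartesian_product case_prod_unfold fscale_def skew_frame_def)
    also have "\<dots> = (1 / 2) *\<^sub>M ((\<Sum>a<n. \<Sum>b<n. (\<Phi> (F (f b)) (f' a) * \<Phi> x (f' b)) *\<^sub>M f a)
        - (\<Sum>a<n. \<Sum>b<n. (\<Phi> (F (f b)) (f' a) * \<Phi> x (f a)) *\<^sub>M f' b))"
      by (simp add: mat_vs.scale_right_diff_distrib sum_subtractf mat_vs.scale_sum_right mult_ac)
    also have "(\<Sum>a<n. \<Sum>b<n. (\<Phi> (F (f b)) (f' a) * \<Phi> x (f' b)) *\<^sub>M f a) = F x"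
    proof -
      have "(\<Sum>a<n. \<Sum>b<n. (\<Phi> (F (f b)) (f' a) * \<Phi> x (f' b)) *\<^sub>M f a) =
          (\<Sum>b<n. \<Phi> x (f' b) *\<^sub>M (\<Sum>a<n. \<Phi> (F (f b)) (f' a) *\<^sub>M f a))"
        by (subst sum.swap) (simp add: mat_vs.scale_sum_right mult.commute)
      also have "\<dots> = (\<Sum>b<n. F (\<Phi> x (f' b) *\<^sub>M f b))"
        using fN Fg by (intro sum.cong refl) (simp add: expand_N lin_onD(2)[OF endoD(1)[OF soN_D(1)[OF F]]])
      also have "\<dots> = F (\<Sum>b<n. \<Phi> x (f' b) *\<^sub>M f b)"
        by (rule ml.lin_on_sum[OF N(1) endoD(1)[OF soN_D(1)[OF F]], symmetric])
           (use fN mat_vs.subspace_scale[OF N(1)] in auto)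
      finally show ?thesis using expand_N(1)[OF x] by simp
    qed
    also have "(\<Sum>a<n. \<Sum>b<n. (\<Phi> (F (f b)) (f' a) * \<Phi> x (f a)) *\<^sub>M f' b) = - F x"
    proof -
      have "(\<Sum>a<n. \<Sum>b<n. (\<Phi> (F (f b)) (f' a) * \<Phi> x (f a)) *\<^sub>M f' b) =
          (\<Sum>b<n. (\<Sum>a<n. \<Phi> x (f a) * \<Phi> (F (f b)) (f' a)) *\<^sub>M f' b)"
        by (subst sum.swap) (simp add: mat_vs.scale_sum_left mult.commute)
      also have "\<dots> = (\<Sum>b<n. - (\<Phi> (F x) (f b) *\<^sub>M f' b))"
      proof (intro sum.cong refl)
        fix b assume "b \<in> {..<n}"
        then have b: "f b \<in> N" using fN by simp
        have "(\<Sum>a<n. \<Phi> x (f a) * \<Phi> (F (f b)) (f' a)) = \<Phi> (F (f b)) x"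
          by (rule parseval_N[OF x in_g(2)[OF Fg[OF b]]])
        also have "\<dots> = - \<Phi> (f b) (F x)" by (rule soN_D(2)[OF F b x])
        also have "\<dots> = - \<Phi> (F x) (f b)" using sym[of "f b" "F x"] b Fg[OF x] by simp
        finally show "(\<Sum>a<n. \<Phi> x (f a) * \<Phi> (F (f b)) (f' a)) *\<^sub>M f' b = - (\<Phi> (F x) (f b) *\<^sub>M f' b)"
          by simp
      qed
      finally show ?thesis using expand_N(2)[OF Fg[OF x]] by (simp add: sum_negf)
    qed
    also have "(1 / 2) *\<^sub>M (F x - - F x) = F x"
      by (simp only: diff_minus_eq_add mat_vs.scale_right_distrib mat_vs.scale_left_distrib[symmetric]) simp
    finally show "F x = ?G x" ..
  qed
qed simp

section \<open>The trace of the square on skew endomorphisms\<close>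

definition tr3 :: "'k^'n^'n \<Rightarrow> 'k^'n^'n \<Rightarrow> 'k^'n^'n \<Rightarrow> 'k" where
  "tr3 u v w = ml.tr N (\<lambda>z. lie u (lie v (lie w z)))"

lemma lin3: "lin_on mscale V mscale (\<lambda>z. lie u (lie v (lie w z)))"
  by (simp add: lin_on_def lie_add lie_scale)

lemma tr3_cyclic: "u \<in> L \<Longrightarrow> v \<in> L \<Longrightarrow> w \<in> L \<Longrightarrow> tr3 u v w = tr3 w u v"
  unfolding tr3_def
  by (rule tr_commute[where f = "\<lambda>z. lie u (lie v z)" and g = "lie w",
        OF ml.linear_space_axioms ml.linear_space_axioms fdN fdN, symmetric])
     (use N(3) in \<open>auto intro: lin_on_lie lin_on_lie2\<close>)

lemma tr3_sum: "u \<in> L \<Longrightarrow> v \<in> L \<Longrightarrow> w \<in> L \<Longrightarrow> tr3 u v w = (\<Sum>a<n. \<Phi> (lie u (lie v (lie w (f a)))) (f' a))"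
  unfolding tr3_def by (rule tr_N[OF lin3]) (use N(3) in auto)

lemma tr3_lin:
  assumes "v \<in> L" "w \<in> L"
  shows "lin_on mscale L (*) (\<lambda>u. tr3 u v w)" "lin_on mscale L (*) (\<lambda>u. tr3 v u w)" "lin_on mscale L (*) (\<lambda>u. tr3 v w u)"
  unfolding lin_on_def
  using assms fN N(3) mat_vs.subspace_add[OF subspace_L] L_scale
  by (simp_all add: tr3_sum lie_add lie_scale form_add[OF form_g] scale_g sum.distrib sum_distrib_left)

lemma tr3_diff:
  assumes "u \<in> L" "v \<in> L" "w \<in> L"
  shows "tr3 u v w - tr3 u w v = K u (lie v w)"
  using assms fN N(3) L_closed
  by (simp add: tr3_sum K_sum sum_subtractf[symmetric] lie_lie lie_diff form_diff[OF form_g])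

text \<open>The trace of the product of the endomorphisms of \<open>L\<close> that represent \<open>F\<close> and \<open>G\<close>, when both are
  compressed to the span of the \<open>e j\<close> with \<open>j \<in> J\<close>.\<close>

definition trace_prod :: "nat set \<Rightarrow> ('k^'n^'n \<Rightarrow> 'k^'n^'n \<Rightarrow> 'k) \<Rightarrow> ('k^'n^'n \<Rightarrow> 'k^'n^'n \<Rightarrow> 'k) \<Rightarrow> 'k" where
  "trace_prod J F G = (\<Sum>i\<in>J. \<Sum>j\<in>J. F (e i) (e' j) * G (e j) (e' i))"

abbreviation all_idx :: "nat set" where "all_idx \<equiv> {..<r + s}"

lemma Cswap_L: "u \<in> L \<Longrightarrow> (\<Sum>i<r + s. lie (e i) (lie (e' i) u)) = C lie u"
  using cas_independent[OF repL lie_subalgebra inv dual_pair_swap[OF dual_e] dual_e, of u]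
  by (simp add: cas_def)

text \<open>Exchange \<open>e\<^sub>i\<close> and \<open>e'\<^sub>j\<close>.  The main term contains two Casimir operators of \<open>N\<close> and reduces to the trace
  of \<open>K\<close>.  The commutator term is antisymmetrised with the help of \<open>tensor_swap\<close>, which replaces the trace of
  three factors by \<open>K\<close> of a bracket; invariance of \<open>K\<close> turns this into the trace of \<open>K C\<close>, and
  \<open>form_decomposition\<close> eliminates \<open>C\<close>.\<close>

lemma trace_four:
  "(\<Sum>i<r + s. \<Sum>j<r + s. ml.tr N (\<lambda>z. lie (e j) (lie (e i) (lie (e' j) (lie (e' i) z))))) =
    (trace_prod all_idx K K + trace_prod all_idx K' K) / 2"
proof -
  let ?I = "{..<r + s}"
  let ?k1 = "\<Sum>j\<in>?I. K (e j) (e' j)"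
  have in4: "lin_on mscale N mscale (\<lambda>z. lie a (lie b (lie c (lie d z))))" for a b c d
    by (simp add: lin_on_def lie_add lie_scale)
  have sum4: "ml.tr N (\<lambda>z. lie a (lie b (lie c (lie d z)))) = (\<Sum>k<n. \<Phi> (lie a (lie b (lie c (lie d (f k))))) (f' k))"
    if "a \<in> L" "b \<in> L" "c \<in> L" "d \<in> L" for a b c d
    by (rule tr_N[OF in4]) (use that N(3) in auto)
  have step1: "ml.tr N (\<lambda>z. lie (e j) (lie (e i) (lie (e' j) (lie (e' i) z)))) =
      (\<Sum>k<n. \<Phi> (lie (e j) (lie (e' j) (lie (e i) (lie (e' i) (f k))))) (f' k)) + tr3 (e j) (lie (e i) (e' j)) (e' i)"
    if "i < r + s" "j < r + s" for i j
  proof -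
    have "lie (e i) (lie (e' j) z) = lie (e' j) (lie (e i) z) + lie (lie (e i) (e' j)) z" for z
      by (simp add: lie_lie)
    moreover have "ml.tr N (\<lambda>z. lie (e j) (lie (e i) (lie (e' j) (lie (e' i) z)))) =
        (\<Sum>k<n. \<Phi> (lie (e j) (lie (e i) (lie (e' j) (lie (e' i) (f k))))) (f' k))"
      using eL that by (intro sum4)
    ultimately show ?thesis
      using eL that N(3) fN L_closed
      by (simp add: tr3_sum sum.distrib[symmetric] lie_add form_add[OF form_g])
  qed
  have first: "(\<Sum>i\<in>?I. \<Sum>j\<in>?I. \<Sum>k<n. \<Phi> (lie (e j) (lie (e' j) (lie (e i) (lie (e' i) (f k))))) (f' k)) = ?k1 / 2"
  proof -
    have "(\<Sum>i\<in>?I. \<Sum>j\<in>?I. \<Sum>k<n. \<Phi> (lie (e j) (lie (e' j) (lie (e i) (lie (e' i) (f k))))) (f' k)) =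
        (\<Sum>j\<in>?I. \<Sum>k<n. \<Sum>i\<in>?I. \<Phi> (lie (e j) (lie (e' j) (lie (e i) (lie (e' i) (f k))))) (f' k))"
      by (subst sum.swap) (intro sum.cong refl sum.swap)
    also have "\<dots> = (\<Sum>j\<in>?I. \<Sum>k<n. \<Phi> (lie (e j) (lie (e' j) (\<Sum>i\<in>?I. lie (e i) (lie (e' i) (f k))))) (f' k))"
      using eL N(3) fN unfolding lie_sum
      by (intro sum.cong refl form_sum_g(1)[symmetric]) auto
    also have "\<dots> = (\<Sum>j\<in>?I. \<Sum>k<n. \<Phi> (lie (e j) (lie (e' j) (f k))) (f' k) / 2)"
      using eL N(3) fN by (intro sum.cong refl) (simp add: half_swapped lie_scale scale_g)
    also have "\<dots> = ?k1 / 2"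
      using eL by (simp add: K_sum sum_divide_distrib)
    finally show ?thesis .
  qed
  let ?S = "\<Sum>i\<in>?I. \<Sum>j\<in>?I. tr3 (e j) (lie (e i) (e' j)) (e' i)"
  (* three applications of tensor symmetry, in i, in j, and renaming i and j *)
  have swapped: "?S = (\<Sum>i\<in>?I. \<Sum>j\<in>?I. - tr3 (e' i) (lie (e i) (e' j)) (e j))"
  proof -
    have lin_lie_left: "lin_on mscale L mscale (\<lambda>u. lie u v)" for v by (simp add: lin_on_def lie_add lie_scale)
    have "?S = (\<Sum>j\<in>?I. \<Sum>i\<in>?I. tr3 (e j) (lie (e i) (e' j)) (e' i))" by (rule sum.swap)
    also have "\<dots> = (\<Sum>j\<in>?I. \<Sum>i\<in>?I. tr3 (e j) (lie (e' i) (e' j)) (e i))"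
    proof (rule sum.cong[OF refl])
      fix j assume "j \<in> ?I"
      then have j: "e j \<in> L" "e' j \<in> L" using eL by auto
      show "(\<Sum>i\<in>?I. tr3 (e j) (lie (e i) (e' j)) (e' i)) = (\<Sum>i\<in>?I. tr3 (e j) (lie (e' i) (e' j)) (e i))"
      proof (rule tensor_swap[where \<beta> = "\<lambda>u w. tr3 (e j) (lie u (e' j)) w", OF linear_space_mult])
        fix w assume w: "w \<in> L"
        show "lin_on mscale L (*) (\<lambda>u. tr3 (e j) (lie u (e' j)) w)"
          by (rule lin_on_comp[OF lin_lie_left tr3_lin(2)[OF j(1) w]]) (use j L_closed in auto)
        show "lin_on mscale L (*) (\<lambda>u. tr3 (e j) (lie w (e' j)) u)"
          by (rule tr3_lin(3)[OF j(1) L_closed[OF w j(2)]])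
      qed
    qed
    also have "\<dots> = (\<Sum>i\<in>?I. \<Sum>j\<in>?I. tr3 (e j) (lie (e' i) (e' j)) (e i))" by (rule sum.swap)
    also have "\<dots> = (\<Sum>i\<in>?I. \<Sum>j\<in>?I. tr3 (e' j) (lie (e' i) (e j)) (e i))"
    proof (rule sum.cong[OF refl])
      fix i assume "i \<in> ?I"
      then have i: "e i \<in> L" "e' i \<in> L" using eL by auto
      show "(\<Sum>j\<in>?I. tr3 (e j) (lie (e' i) (e' j)) (e i)) = (\<Sum>j\<in>?I. tr3 (e' j) (lie (e' i) (e j)) (e i))"
      proof (rule tensor_swap[where \<beta> = "\<lambda>u w. tr3 u (lie (e' i) w) (e i)", OF linear_space_mult])
        fix w assume w: "w \<in> L"
        show "lin_on mscale L (*) (\<lambda>u. tr3 u (lie (e' i) w) (e i))"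
          by (rule tr3_lin(1)[OF L_closed[OF i(2) w] i(1)])
        show "lin_on mscale L (*) (\<lambda>u. tr3 w (lie (e' i) u) (e i))"
          by (rule lin_on_comp[OF lin_on_lie tr3_lin(2)[OF w i(1)]]) (use i L_closed in auto)
      qed
    qed
    also have "\<dots> = (\<Sum>j\<in>?I. \<Sum>i\<in>?I. tr3 (e' j) (lie (e' i) (e j)) (e i))" by (rule sum.swap)
    also have "\<dots> = (\<Sum>j\<in>?I. \<Sum>i\<in>?I. - tr3 (e' j) (lie (e j) (e' i)) (e i))"
    proof (intro sum.cong refl)
      fix i j assume "j \<in> ?I" "i \<in> ?I"
      then have ij: "e i \<in> L" "e' i \<in> L" "e j \<in> L" "e' j \<in> L" using eL by auto
      have "lie (e' i) (e j) = (- 1) *\<^sub>M lie (e j) (e' i)" using lie_anti[of "e j" "e' i"] by simp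
      then show "tr3 (e' j) (lie (e' i) (e j)) (e i) = - tr3 (e' j) (lie (e j) (e' i)) (e i)"
        using lin_onD(2)[OF tr3_lin(2)[OF ij(4,1)] L_closed[OF ij(3,2)], of "- 1"] by simp
    qed
    finally show ?thesis .
  qed
  have "2 * ?S = (\<Sum>i\<in>?I. \<Sum>j\<in>?I. K (lie (e i) (e' j)) (lie (e' i) (e j)))"
  proof -
    have "2 * ?S = ?S + (\<Sum>i\<in>?I. \<Sum>j\<in>?I. - tr3 (e' i) (lie (e i) (e' j)) (e j))"
      using swapped by simp
    also have "\<dots> = (\<Sum>i\<in>?I. \<Sum>j\<in>?I. tr3 (e j) (lie (e i) (e' j)) (e' i) - tr3 (e' i) (lie (e i) (e' j)) (e j))"
      by (simp add: sum.distrib[symmetric])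
    also have "\<dots> = (\<Sum>i\<in>?I. \<Sum>j\<in>?I. K (lie (e i) (e' j)) (lie (e' i) (e j)))"
    proof (intro sum.cong refl)
      fix i j assume "i \<in> ?I" "j \<in> ?I"
      then have ij: "e i \<in> L" "e' i \<in> L" "e j \<in> L" "e' j \<in> L" using eL by auto
      note w = L_closed[OF ij(1,4)]
      have "tr3 (e j) (lie (e i) (e' j)) (e' i) = tr3 (lie (e i) (e' j)) (e' i) (e j)"
        using tr3_cyclic[OF w ij(2,3)] by simp
      moreover have "tr3 (e' i) (lie (e i) (e' j)) (e j) = tr3 (lie (e i) (e' j)) (e j) (e' i)"
        using tr3_cyclic[OF w ij(3,2)] by simp
      ultimately show "tr3 (e j) (lie (e i) (e' j)) (e' i) - tr3 (e' i) (lie (e i) (e' j)) (e j) =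
          K (lie (e i) (e' j)) (lie (e' i) (e j))"
        using tr3_diff[OF w ij(2,3)] by simp
    qed
    finally show ?thesis .
  qed
  also have "\<dots> = (\<Sum>j\<in>?I. \<Sum>i\<in>?I. - K (e' j) (lie (e i) (lie (e' i) (e j))))"
    using eL L_closed
    by (subst sum.swap) (intro sum.cong refl form_lie_swap[OF K_inv subspace_L], auto)
  also have "\<dots> = - (\<Sum>j\<in>?I. K (e' j) (C lie (e j)))"
  proof -
    have "(\<Sum>i\<in>?I. - K (e' j) (lie (e i) (lie (e' i) (e j)))) = - K (e' j) (C lie (e j))" if "j \<in> ?I" for j
    proof -
      have j: "e j \<in> L" "e' j \<in> L" using eL that by auto
      have "(\<Sum>i\<in>?I. K (e' j) (lie (e i) (lie (e' i) (e j)))) = K (e' j) (\<Sum>i\<in>?I. lie (e i) (lie (e' i) (e j)))"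
        by (rule form_sum(2)[OF K_inv subspace_L j(2), symmetric]) (use eL j L_closed in auto)
      then show ?thesis by (simp add: sum_negf Cswap_L[OF j(1)])
    qed
    then show ?thesis by (simp add: sum_negf)
  qed
  also have "(\<Sum>j\<in>?I. K (e' j) (C lie (e j))) = ?k1 - trace_prod ?I K K - trace_prod ?I K' K"
  proof -
    have "K (e' j) (C lie (e j)) = (\<Sum>i\<in>?I. (\<Phi> (e j) (e' i) - K (e j) (e' i) - K' (e j) (e' i)) * K (e' j) (e i))"
      if "j \<in> ?I" for j
    proof -
      have j: "e j \<in> L" "e' j \<in> L" using eL that by auto
      have "K (e' j) (C lie (e j)) = K (e' j) (\<Sum>i\<in>?I. \<Phi> (C lie (e j)) (e' i) *\<^sub>M e i)"
        by (simp only: expand_L(1)[OF CL_in[OF j(1)]])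
      also have "\<dots> = (\<Sum>i\<in>?I. K (e' j) (\<Phi> (C lie (e j)) (e' i) *\<^sub>M e i))"
        by (rule form_sum(2)[OF K_inv subspace_L j(2)]) (use eL L_scale in auto)
      also have "\<dots> = (\<Sum>i\<in>?I. (\<Phi> (e j) (e' i) - K (e j) (e' i) - K' (e j) (e' i)) * K (e' j) (e i))"
      proof (intro sum.cong refl)
        fix i assume "i \<in> ?I"
        then have i: "e i \<in> L" "e' i \<in> L" using eL by auto
        have "\<Phi> (C lie (e j)) (e' i) = \<Phi> (e j) (e' i) - K (e j) (e' i) - K' (e j) (e' i)"
          using form_decomposition[OF j(1) i(2)] by (simp add: algebra_simps)
        then show "K (e' j) (\<Phi> (C lie (e j)) (e' i) *\<^sub>M e i) =
            (\<Phi> (e j) (e' i) - K (e j) (e' i) - K' (e j) (e' i)) * K (e' j) (e i)"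
          using form_scale(2)[OF K_inv subspace_L i(1) j(2)] by simp
      qed
      finally show ?thesis .
    qed
    then have "(\<Sum>j\<in>?I. K (e' j) (C lie (e j))) =
        (\<Sum>j\<in>?I. \<Sum>i\<in>?I. \<Phi> (e j) (e' i) * K (e' j) (e i))
        - (\<Sum>j\<in>?I. \<Sum>i\<in>?I. K (e j) (e' i) * K (e' j) (e i))
        - (\<Sum>j\<in>?I. \<Sum>i\<in>?I. K' (e j) (e' i) * K (e' j) (e i))"
      by (simp add: left_diff_distrib sum_subtractf)
    also have "(\<Sum>j\<in>?I. \<Sum>i\<in>?I. \<Phi> (e j) (e' i) * K (e' j) (e i)) = ?k1"
    proof (intro sum.cong refl)
      fix j assume "j \<in> ?I"
      then have j: "e j \<in> L" "e' j \<in> L" using eL by auto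
      have "(\<Sum>i\<in>?I. \<Phi> (e j) (e' i) * K (e' j) (e i)) = (\<Sum>i\<in>?I. K (e' j) (\<Phi> (e j) (e' i) *\<^sub>M e i))"
        using eL j by (intro sum.cong refl) (simp add: form_scale(2)[OF K_inv subspace_L])
      also have "\<dots> = K (e' j) (\<Sum>i\<in>?I. \<Phi> (e j) (e' i) *\<^sub>M e i)"
        by (rule form_sum(2)[OF K_inv subspace_L j(2), symmetric]) (use eL L_scale in auto)
      also have "\<dots> = K (e j) (e' j)"
        using expand_L(1)[OF j(1)] invariant_formD(1)[OF K_inv j(2,1)] by simp
      finally show "(\<Sum>i\<in>?I. \<Phi> (e j) (e' i) * K (e' j) (e i)) = K (e j) (e' j)" .
    qed
    finally have "(\<Sum>j\<in>?I. K (e' j) (C lie (e j))) = ?k1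
        - (\<Sum>j\<in>?I. \<Sum>i\<in>?I. K (e j) (e' i) * K (e' j) (e i))
        - (\<Sum>j\<in>?I. \<Sum>i\<in>?I. K' (e j) (e' i) * K (e' j) (e i))" .
    moreover have "(\<Sum>j\<in>?I. \<Sum>i\<in>?I. F (e j) (e' i) * K (e' j) (e i)) = trace_prod ?I F K" for F
      unfolding trace_prod_def using eL invariant_formD(1)[OF K_inv] by (intro sum.cong refl) auto
    ultimately show ?thesis by simp
  qed
  finally have S: "2 * ?S = - (?k1 - trace_prod ?I K K - trace_prod ?I K' K)" .
  have "(\<Sum>i\<in>?I. \<Sum>j\<in>?I. ml.tr N (\<lambda>z. lie (e j) (lie (e i) (lie (e' j) (lie (e' i) z))))) = ?k1 / 2 + ?S"
    unfolding first[symmetric] sum.distrib[symmetric] by (intro sum.cong refl) (simp add: step1)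
  then show ?thesis using S by (simp add: field_simps)
qed

lemma fd_soN: "fl.fin_dim soN" by (rule wmod_fin_dim[OF wmod_soN])

lemma T_EN: "F \<in> soN \<Longrightarrow> T F \<in> EN" using T_in soN_D(1) by blast

lemma TT_apply:
  assumes F: "F \<in> soN" and x: "x \<in> N"
  shows "T (T F) x = 4 *\<^sub>M (\<Sum>j<r + s. \<Sum>i<r + s. lie (e j) (lie (e i) (F (lie (e' i) (lie (e' j) x)))))"
proof -
  have "T (T F) x = 2 *\<^sub>M (\<Sum>j<r + s. lie (e j) (T F (lie (e' j) x)))"
    by (rule T_apply[OF T_EN[OF F] x])
  also have "\<dots> = 2 *\<^sub>M (\<Sum>j<r + s. lie (e j) (2 *\<^sub>M (\<Sum>i<r + s. lie (e i) (F (lie (e' i) (lie (e' j) x))))))"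
    using eL N(3) x by (intro arg_cong[where f = "mscale 2"] sum.cong refl) (simp add: T_apply[OF soN_D(1)[OF F]])
  also have "\<dots> = 4 *\<^sub>M (\<Sum>j<r + s. \<Sum>i<r + s. lie (e j) (lie (e i) (F (lie (e' i) (lie (e' j) x)))))"
    by (simp add: lie_scale lie_sum mat_vs.scale_sum_right)
  finally show ?thesis .
qed

text \<open>In the frame \<open>skew_frame\<close>, the trace of \<open>F \<mapsto> 4 \<Sum> e\<^sub>j e\<^sub>i F e'\<^sub>i e'\<^sub>j\<close> splits into a product of two traces, which is
  the trace of \<open>K\<^sup>2\<close>, and one trace of four factors.\<close>

lemma trace_TT: "fl.tr soN (\<lambda>F. T (T F)) = trace_prod all_idx K K - trace_prod all_idx K' K"
proof -
  let ?I = "{..<r + s}"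
  have in_N: "lie u (lie v x) \<in> N" if "u \<in> L" "v \<in> L" "x \<in> N" for u v x
    using that N(3) by blast
  have one: "\<Phi> (T (T (skew_frame (a, b))) (f b)) (f' a) =
      2 * (\<Sum>j\<in>?I. \<Sum>i\<in>?I. \<Phi> (lie (e' i) (lie (e' j) (f b))) (f' b) * \<Phi> (lie (e j) (lie (e i) (f a))) (f' a)
        - \<Phi> (lie (e' i) (lie (e' j) (f b))) (f a) * \<Phi> (lie (e j) (lie (e i) (f' b))) (f' a))"
    if ab: "a < n" "b < n" for a b
  proof -
    note F = skew_frame_in[OF ab]
    have pt: "\<Phi> (lie (e j) (lie (e i) (skew_frame (a, b) (lie (e' i) (lie (e' j) (f b)))))) (f' a) =
        (\<Phi> (lie (e' i) (lie (e' j) (f b))) (f' b) * \<Phi> (lie (e j) (lie (e i) (f a))) (f' a)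
        - \<Phi> (lie (e' i) (lie (e' j) (f b))) (f a) * \<Phi> (lie (e j) (lie (e i) (f' b))) (f' a)) / 2"
      if "i \<in> ?I" "j \<in> ?I" for i j
    proof -
      have ij: "e i \<in> L" "e' i \<in> L" "e j \<in> L" "e' j \<in> L" using eL that by auto
      have y: "lie (e' i) (lie (e' j) (f b)) \<in> N" by (rule in_N[OF ij(2,4) fN(1)[OF ab(2)]])
      have z: "lie (e j) (lie (e i) (f a)) \<in> g" "lie (e j) (lie (e i) (f' b)) \<in> g"
        using in_N[OF ij(3,1) fN(1)[OF ab(1)]] in_N[OF ij(3,1) fN(2)[OF ab(2)]] by auto
      have w: "f' a \<in> g" using fN(2)[OF ab(1)] by simp
      show ?thesis
        using y z w sub_g diff_g
        by (simp add: skew_frame_def lie_scale lie_diff scale_g form_diff[OF form_g])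
    qed
    have in_g': "lie (e j) (lie (e i) (skew_frame (a, b) (lie (e' i) (lie (e' j) (f b))))) \<in> g" if "i \<in> ?I" "j \<in> ?I" for i j
      using that eL ab fN by (intro in_g(2) in_N soN_D(3)[OF F]) auto
    have in_g'': "(\<Sum>i\<in>?I. lie (e j) (lie (e i) (skew_frame (a, b) (lie (e' i) (lie (e' j) (f b)))))) \<in> g" if "j \<in> ?I" for j
      using in_g' that by (intro sum_g) auto
    have w: "f' a \<in> g" using fN(2)[OF ab(1)] by simp
    have "\<Phi> (T (T (skew_frame (a, b))) (f b)) (f' a) =
        4 * \<Phi> (\<Sum>j\<in>?I. \<Sum>i\<in>?I. lie (e j) (lie (e i) (skew_frame (a, b) (lie (e' i) (lie (e' j) (f b)))))) (f' a)"
      unfolding TT_apply[OF F fN(1)[OF ab(2)]]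
      by (rule scale_g(1)[OF mat_vs.subspace_sum[OF g_sub in_g''] w])
    also have "\<Phi> (\<Sum>j\<in>?I. \<Sum>i\<in>?I. lie (e j) (lie (e i) (skew_frame (a, b) (lie (e' i) (lie (e' j) (f b)))))) (f' a) =
        (\<Sum>j\<in>?I. \<Phi> (\<Sum>i\<in>?I. lie (e j) (lie (e i) (skew_frame (a, b) (lie (e' i) (lie (e' j) (f b)))))) (f' a))"
      by (rule form_sum_g(1)[OF w in_g''])
    also have "\<dots> = (\<Sum>j\<in>?I. \<Sum>i\<in>?I. \<Phi> (lie (e j) (lie (e i) (skew_frame (a, b) (lie (e' i) (lie (e' j) (f b)))))) (f' a))"
      by (rule sum.cong[OF refl], rule form_sum_g(1)[OF w in_g']) auto
    also have "\<dots> = (\<Sum>j\<in>?I. \<Sum>i\<in>?I. (\<Phi> (lie (e' i) (lie (e' j) (f b))) (f' b) * \<Phi> (lie (e j) (lie (e i) (f a))) (f' a)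
        - \<Phi> (lie (e' i) (lie (e' j) (f b))) (f a) * \<Phi> (lie (e j) (lie (e i) (f' b))) (f' a)) / 2)"
      by (rule sum.cong[OF refl], rule sum.cong[OF refl], rule pt)
    finally show ?thesis by (simp add: sum_divide_distrib[symmetric])
  qed
  (* the two halves of the wedge: P gives a product of traces, Q a single trace *)
  let ?P = "\<lambda>j i a b. \<Phi> (lie (e' i) (lie (e' j) (f b))) (f' b) * \<Phi> (lie (e j) (lie (e i) (f a))) (f' a)"
  let ?Q = "\<lambda>j i a b. \<Phi> (lie (e' i) (lie (e' j) (f b))) (f a) * \<Phi> (lie (e j) (lie (e i) (f' b))) (f' a)"
  have "fl.tr soN (\<lambda>F. T (T F)) = (\<Sum>p\<in>{..<n} \<times> {..<n}. \<Phi> (T (T (skew_frame p)) (f (snd p))) (f' (fst p)))"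
    by (rule fl.tr_frame[OF soN_sub frame_soN TT_lin]) (use T_in in auto)
  also have "\<dots> = (\<Sum>a<n. \<Sum>b<n. \<Phi> (T (T (skew_frame (a, b))) (f b)) (f' a))"
    by (simp add: sum.cartesian_product case_prod_unfold)
  also have "\<dots> = (\<Sum>a<n. \<Sum>b<n. 2 * (\<Sum>j\<in>?I. \<Sum>i\<in>?I. ?P j i a b - ?Q j i a b))"
    by (rule sum.cong[OF refl], rule sum.cong[OF refl], rule one) auto
  also have "\<dots> = 2 * (\<Sum>a<n. \<Sum>b<n. \<Sum>j\<in>?I. \<Sum>i\<in>?I. ?P j i a b - ?Q j i a b)"
    by (simp only: sum_distrib_left)
  also have "(\<Sum>a<n. \<Sum>b<n. \<Sum>j\<in>?I. \<Sum>i\<in>?I. ?P j i a b - ?Q j i a b) =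
      (\<Sum>j\<in>?I. \<Sum>i\<in>?I. \<Sum>a<n. \<Sum>b<n. ?P j i a b - ?Q j i a b)"
    by (rule sum_swap4)
  also have "\<dots> = (\<Sum>j\<in>?I. \<Sum>i\<in>?I. K (e' i) (e' j) * K (e j) (e i)
      - ml.tr N (\<lambda>z. lie (e i) (lie (e j) (lie (e' i) (lie (e' j) z)))))"
  proof (rule sum.cong[OF refl], rule sum.cong[OF refl])
    fix j i assume "j \<in> ?I" "i \<in> ?I"
    then have ij: "e i \<in> L" "e' i \<in> L" "e j \<in> L" "e' j \<in> L" using eL by auto
    have "(\<Sum>a<n. \<Sum>b<n. ?P j i a b - ?Q j i a b) = (\<Sum>a<n. \<Sum>b<n. ?P j i a b) - (\<Sum>a<n. \<Sum>b<n. ?Q j i a b)"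
      by (simp add: sum_subtractf)
    also have "(\<Sum>a<n. \<Sum>b<n. ?P j i a b) = K (e' i) (e' j) * K (e j) (e i)"
      using ij by (simp add: K_sum sum_product mult.commute)
    also have "(\<Sum>a<n. \<Sum>b<n. ?Q j i a b) = (\<Sum>b<n. \<Sum>a<n. ?Q j i a b)" by (rule sum.swap)
    also have "\<dots> = (\<Sum>b<n. \<Phi> (lie (e i) (lie (e j) (lie (e' i) (lie (e' j) (f b))))) (f' b))"
    proof (rule sum.cong[OF refl])
      fix b assume "b \<in> {..<n}"
      then have b: "f b \<in> N" "f' b \<in> N" using fN by auto
      have x: "lie (e' i) (lie (e' j) (f b)) \<in> N" by (rule in_N[OF ij(2,4) b(1)])
      have y: "lie (e i) (f' b) \<in> N" "lie (e j) (lie (e i) (f' b)) \<in> N" using N(3) ij b by auto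
      have x': "lie (e j) (lie (e' i) (lie (e' j) (f b))) \<in> N" "lie (e i) (lie (e j) (lie (e' i) (lie (e' j) (f b)))) \<in> N"
        using N(3) ij x by auto
      have "(\<Sum>a<n. ?Q j i a b) = \<Phi> (lie (e j) (lie (e i) (f' b))) (lie (e' i) (lie (e' j) (f b)))"
        by (rule parseval_N[OF x in_g(2)[OF y(2)]])
      also have "\<dots> = - \<Phi> (lie (e i) (f' b)) (lie (e j) (lie (e' i) (lie (e' j) (f b))))"
        using ij x y by (intro skew) auto
      also have "\<Phi> (lie (e i) (f' b)) (lie (e j) (lie (e' i) (lie (e' j) (f b)))) =
          - \<Phi> (f' b) (lie (e i) (lie (e j) (lie (e' i) (lie (e' j) (f b)))))"
        using ij x' b by (intro skew) auto
      also have "\<Phi> (f' b) (lie (e i) (lie (e j) (lie (e' i) (lie (e' j) (f b))))) =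
          \<Phi> (lie (e i) (lie (e j) (lie (e' i) (lie (e' j) (f b))))) (f' b)"
        using x' b by (intro sym) auto
      finally show "(\<Sum>a<n. ?Q j i a b) = \<Phi> (lie (e i) (lie (e j) (lie (e' i) (lie (e' j) (f b))))) (f' b)" by simp
    qed
    also have "\<dots> = ml.tr N (\<lambda>z. lie (e i) (lie (e j) (lie (e' i) (lie (e' j) z))))"
      by (rule tr_N[symmetric]) (use ij N(3) in \<open>auto simp: lin_on_def lie_add lie_scale\<close>)
    finally show "(\<Sum>a<n. \<Sum>b<n. ?P j i a b - ?Q j i a b) = K (e' i) (e' j) * K (e j) (e i)
      - ml.tr N (\<lambda>z. lie (e i) (lie (e j) (lie (e' i) (lie (e' j) z))))" .
  qed
  also have "\<dots> = (\<Sum>j\<in>?I. \<Sum>i\<in>?I. K (e' i) (e' j) * K (e j) (e i))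
      - (\<Sum>j\<in>?I. \<Sum>i\<in>?I. ml.tr N (\<lambda>z. lie (e i) (lie (e j) (lie (e' i) (lie (e' j) z)))))"
    by (simp add: sum_subtractf)
  also have "(\<Sum>j\<in>?I. \<Sum>i\<in>?I. ml.tr N (\<lambda>z. lie (e i) (lie (e j) (lie (e' i) (lie (e' j) z))))) =
      (trace_prod ?I K K + trace_prod ?I K' K) / 2"
    by (rule trace_four)
  also have "(\<Sum>j\<in>?I. \<Sum>i\<in>?I. K (e' i) (e' j) * K (e j) (e i)) = trace_prod ?I K K"
  proof -
    have "(\<Sum>j\<in>?I. \<Sum>i\<in>?I. K (e' i) (e' j) * K (e j) (e i)) = (\<Sum>j\<in>?I. \<Sum>i\<in>?I. K (e i) (e' j) * K (e j) (e' i))"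
    proof (rule sum.cong[OF refl])
      fix j assume "j \<in> ?I"
      then have j: "e j \<in> L" "e' j \<in> L" using eL by auto
      note lin = form_lin[OF K_inv subspace_L j(1)] form_lin[OF K_inv subspace_L j(2)]
      show "(\<Sum>i\<in>?I. K (e' i) (e' j) * K (e j) (e i)) = (\<Sum>i\<in>?I. K (e i) (e' j) * K (e j) (e' i))"
        by (rule tensor_swap[where \<beta> = "\<lambda>u w. K w (e' j) * K (e j) u", OF linear_space_mult])
           (use lin in \<open>auto simp: lin_on_def algebra_simps\<close>)
    qed
    then show ?thesis unfolding trace_prod_def by (subst sum.swap) simp
  qed
  also have "2 * (trace_prod ?I K K - (trace_prod ?I K K + trace_prod ?I K' K) / 2) = trace_prod ?I K K - trace_prod ?I K' K"
  proof -
    have "2 * (a - b / 2) = 2 * a - b" for a b :: 'k by (simp add: right_diff_distrib)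
    then show ?thesis by (simp only:) simp
  qed
  finally show ?thesis .
qed

section \<open>The moment map to the subalgebra and its kernel\<close>

text \<open>The trace of \<open>u F\<close> on \<open>N\<close>.\<close>

definition tr_with :: "'k^'n^'n \<Rightarrow> ('k^'n^'n \<Rightarrow> 'k^'n^'n) \<Rightarrow> 'k" where
  "tr_with u F = (\<Sum>a<n. \<Phi> (lie u (F (f a))) (f' a))"

text \<open>The element of \<open>L\<close> that represents \<open>u \<mapsto> tr (u F)\<close> with respect to \<open>\<Phi>\<close> (\<open>form_theta\<close>).\<close>

definition theta :: "('k^'n^'n \<Rightarrow> 'k^'n^'n) \<Rightarrow> 'k^'n^'n" where
  "theta F = (\<Sum>i<r + s. tr_with (e i) F *\<^sub>M e' i)"

text \<open>The image of \<open>theta\<close> (\<open>theta_L1\<close>, \<open>theta_iota_surj\<close>).\<close>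

definition L1 :: "('k^'n^'n) set" where
  "L1 = {u \<in> L. \<forall>w\<in>L. ann w \<longrightarrow> \<Phi> u w = 0}"

definition iota :: "'k^'n^'n \<Rightarrow> 'k^'n^'n \<Rightarrow> 'k^'n^'n" where
  "iota u = (\<lambda>x. if x \<in> N then lie u x else 0)"

lemma theta_L: "theta F \<in> L"
  unfolding theta_def using eL
  by (intro L_sum L_scale) auto

lemma tr_with_lin_left:
  assumes F: "F \<in> EN" shows "lin_on mscale L (*) (\<lambda>u. tr_with u F)"
  unfolding lin_on_def tr_with_def
  using fN N(3) endoD(2)[OF F]
  by (simp add: lie_add lie_scale form_add[OF form_g] scale_g sum.distrib sum_distrib_left)

lemma tr_with_lin:
  assumes u: "u \<in> L" shows "lin_on fs EN (*) (tr_with u)"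
  unfolding lin_on_def tr_with_def fscale_def
  using fN N(3)[OF u] endoD(2)[of _ mscale N]
  by (simp add: lie_add lie_scale form_add[OF form_g] scale_g sum.distrib sum_distrib_left)

lemma form_theta:
  assumes F: "F \<in> EN" and u: "u \<in> L"
  shows "\<Phi> u (theta F) = tr_with u F"
proof -
  have "\<Phi> u (theta F) = (\<Sum>i<r + s. \<Phi> u (tr_with (e i) F *\<^sub>M e' i))"
    unfolding theta_def by (rule form_sum_g(2)) (use u eL sub_g in auto)
  also have "\<dots> = (\<Sum>i<r + s. tr_with (\<Phi> u (e' i) *\<^sub>M e i) F)"
    using u eL by (intro sum.cong refl) (simp add: scale_g lin_onD(2)[OF tr_with_lin_left[OF F]])
  also have "\<dots> = tr_with (\<Sum>i<r + s. \<Phi> u (e' i) *\<^sub>M e i) F"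
    by (rule ml.lin_on_sum[OF subspace_L tr_with_lin_left[OF F], symmetric])
       (use eL L_scale in auto)
  finally show ?thesis by (simp only: expand_L(1)[OF u])
qed

lemma theta_lin: "lin_on fs EN mscale theta"
  unfolding lin_on_def theta_def
  using lin_onD[OF tr_with_lin[OF eL(1)]]
  by (simp add: sum.distrib mat_vs.scale_left_distrib mat_vs.scale_sum_right)

lemma theta_L1: "F \<in> EN \<Longrightarrow> theta F \<in> L1"
proof -
  assume F: "F \<in> EN"
  have "\<Phi> (theta F) w = 0" if w: "w \<in> L" "ann w" for w
  proof -
    have "\<Phi> (theta F) w = tr_with w F"
      using form_theta[OF F w(1)] sym[of w "theta F"] w theta_L by simp
    also have "\<dots> = 0" unfolding tr_with_def
      using w(2) fN endoD(2)[OF F] by (intro sum.neutral) (auto simp: ann_def form_zero[OF form_g])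
    finally show ?thesis .
  qed
  then show ?thesis using theta_L by (simp add: L1_def)
qed

lemma L1_sub: "mat_vs.subspace L1"
  unfolding L1_def
  using mat_vs.subspace_0[OF subspace_L] mat_vs.subspace_add[OF subspace_L] L_scale
  by (intro mat_vs.subspaceI) (auto simp: form_zero[OF form_g] form_add[OF form_g] scale_g)

lemma L1_L: "u \<in> L1 \<Longrightarrow> u \<in> L" by (simp add: L1_def)

lemma L1_stable:
  assumes "u \<in> L" "v \<in> L1" shows "lie u v \<in> L1"
proof -
  have "\<Phi> (lie u v) w = 0" if "w \<in> L" "ann w" for w
    using skew[of u v w] assms that ann_lie'[OF that(2) assms(1)] L_closed by (simp add: L1_def)
  then show ?thesis using assms L_closed by (simp add: L1_def)
qed

lemma fdL1: "ml.fin_dim L1" by (rule fin_dim_matrices[OF L1_sub])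

lemma frame_L1: "ml.frame L1 active e' (\<lambda>i v. \<Phi> v (e i))"
  unfolding ml.frame_def
proof (intro conjI ballI)
  fix i assume i: "i \<in> active"
  then have i': "i < r + s" using active_subset by auto
  show "e' i \<in> L1" unfolding L1_def using active_orth(2)[OF i] eL[OF i'] sym by simp
  show "lin_on mscale L1 (*) (\<lambda>v. \<Phi> v (e i))"
    by (rule lin_form_lie(1)) (use eL[OF i'] L1_L in auto)
next
  fix v assume v: "v \<in> L1"
  have "v = (\<Sum>i<r + s. \<Phi> v (e i) *\<^sub>M e' i)" using expand_L(2)[OF L1_L[OF v]] by simp
  also have "\<dots> = (\<Sum>i\<in>active. \<Phi> v (e i) *\<^sub>M e' i)"
    by (rule sum.mono_neutral_right)
       (use active_subset inactive_ann(1) v eL in \<open>auto simp: L1_def\<close>)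
  finally show "v = (\<Sum>i\<in>active. \<Phi> v (e i) *\<^sub>M e' i)" .
qed (rule active_finite)

lemma theta_act:
  assumes u: "u \<in> L" and F: "F \<in> EN"
  shows "theta (aN u F) = lie u (theta F)"
proof (rule eq_in_L[OF theta_L L_closed[OF u theta_L]])
  fix w assume w: "w \<in> L"
  have aF: "aN u F \<in> EN" by (rule rep_in[OF repEN u F])
  note FN = endoD(2)[OF F]
  have "tr_with w (aN u F) = (\<Sum>a<n. \<Phi> (lie w (lie u (F (f a)))) (f' a)) - (\<Sum>a<n. \<Phi> (lie w (F (lie u (f a)))) (f' a))"
    using u w fN N(3) FN by (simp add: tr_with_def endo_act_def lie_diff form_diff[OF form_g] sum_subtractf)
  also have "(\<Sum>a<n. \<Phi> (lie w (F (lie u (f a)))) (f' a)) = ml.tr N (\<lambda>z. lie w (F (lie u z)))"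
    by (rule tr_N[symmetric])
       (use u w N(3) FN lin_onD[OF endoD(1)[OF F]] in \<open>auto simp: lin_on_def lie_add lie_scale\<close>)
  also have "\<dots> = ml.tr N (\<lambda>z. lie u (lie w (F z)))"
    by (rule tr_commute[OF ml.linear_space_axioms ml.linear_space_axioms fdN fdN, where f = "lie u" and g = "\<lambda>z. lie w (F z)"])
       (use u w N(3) FN lin_onD[OF endoD(1)[OF F]] in \<open>auto simp: lin_on_def lie_add lie_scale\<close>)
  also have "\<dots> = (\<Sum>a<n. \<Phi> (lie u (lie w (F (f a)))) (f' a))"
    by (rule tr_N) (use u w N(3) FN lin_onD[OF endoD(1)[OF F]] in \<open>auto simp: lin_on_def lie_add lie_scale\<close>)
  also have "(\<Sum>a<n. \<Phi> (lie w (lie u (F (f a)))) (f' a)) - \<dots> = tr_with (lie w u) F"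
    unfolding tr_with_def sum_subtractf[symmetric]
    using u w fN N(3) FN by (intro sum.cong refl) (simp add: lie_lie form_diff[OF form_g])
  also have "\<dots> = \<Phi> (lie w u) (theta F)" by (rule form_theta[OF F L_closed[OF w u], symmetric])
  also have "\<dots> = \<Phi> w (lie u (theta F))" using assoc u w theta_L by simp
  finally have "\<Phi> w (theta (aN u F)) = \<Phi> w (lie u (theta F))" using form_theta[OF aF w] by simp
  then show "\<Phi> (theta (aN u F)) w = \<Phi> (lie u (theta F)) w"
    using sym[of w] w u theta_L L_closed by simp
qed

lemma theta_C:
  assumes F: "F \<in> EN" shows "theta (C aN F) = C lie (theta F)"
proof -
  have "theta (C aN F) = (\<Sum>i<r + s. theta (aN (e' i) (aN (e i) F)))"
    unfolding cas_def by (rule fl.lin_on_sum[OF subspace_EN theta_lin]) (use eL rep_in[OF repEN] F in auto)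
  also have "\<dots> = C lie (theta F)"
    unfolding cas_def using eL rep_in[OF repEN] F by (intro sum.cong refl) (simp add: theta_act)
  finally show ?thesis .
qed

lemma C_EN: "F \<in> EN \<Longrightarrow> C aN F \<in> EN" by (rule C_lin(2)[OF repEN])

lemma theta_T: "F \<in> soN \<Longrightarrow> theta (T F) = theta F - C lie (theta F)"
  unfolding T_def
  using fl.lin_on_diff[OF subspace_EN theta_lin soN_D(1) C_EN[OF soN_D(1)]] by (simp add: theta_C soN_D(1))

lemma iota_EN: "u \<in> L \<Longrightarrow> iota u \<in> EN"
  using N(3) mat_vs.subspace_add[OF N(1)] mat_vs.subspace_scale[OF N(1)]
  by (auto simp: endo_def iota_def lin_on_def lie_add lie_scale)

lemma iota_soN: "u \<in> L \<Longrightarrow> iota u \<in> soN"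
  using iota_EN skew N(3) by (auto simp: soN_def iota_def)

lemma iota_lin: "lin_on mscale L fs iota"
  by (auto simp: lin_on_def iota_def fscale_def fun_eq_iff lie_add lie_scale)

lemma iota_act: "u \<in> L \<Longrightarrow> v \<in> L \<Longrightarrow> aN u (iota v) = iota (lie u v)"
  using N(3) by (auto simp: endo_act_def iota_def fun_eq_iff lie_lie)

lemma iota_C:
  assumes u: "u \<in> L" shows "C aN (iota u) = iota (C lie u)"
proof -
  have "C aN (iota u) = (\<Sum>i<r + s. iota (lie (e' i) (lie (e i) u)))"
    unfolding cas_def using eL u L_closed by (intro sum.cong refl) (simp add: iota_act)
  also have "\<dots> = iota (C lie u)"
    unfolding cas_def by (rule ml.lin_on_sum[OF subspace_L iota_lin, symmetric]) (use eL u L_closed in auto)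
  finally show ?thesis .
qed

lemma form_theta_iota: "u \<in> L \<Longrightarrow> w \<in> L \<Longrightarrow> \<Phi> w (theta (iota u)) = K w u"
  using form_theta[OF iota_EN] fN by (simp add: tr_with_def iota_def K_sum)

lemma theta_iota_lin: "lin_on mscale L mscale (\<lambda>u. theta (iota u))"
  by (rule lin_on_comp[OF iota_lin theta_lin]) (use iota_EN in auto)

text \<open>\<open>theta \<circ> iota\<close> represents \<open>K\<close>, whose radical annihilates \<open>N\<close> and therefore meets \<open>L1\<close> only in
  \<open>0\<close>.\<close>

lemma theta_iota_inj:
  assumes u: "u \<in> L1" and z: "theta (iota u) = 0" shows "u = 0"
proof -
  have uL: "u \<in> L" by (rule L1_L[OF u])
  have "K u w = 0" if w: "w \<in> L" for w
    using form_theta_iota[OF uL w] w z invariant_formD(1)[OF K_inv uL w] by (simp add: form_zero[OF form_g])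
  then have a: "ann u" by (rule radical_ann[OF uL])
  have "u = (\<Sum>i\<in>active. \<Phi> u (e i) *\<^sub>M e' i)" using frame_L1 u unfolding ml.frame_def by blast
  also have "\<dots> = 0" using active_orth(1)[OF _ uL a] by simp
  finally show ?thesis .
qed

lemma theta_iota_surj:
  assumes "v \<in> L1" shows "\<exists>u\<in>L1. theta (iota u) = v"
  by (rule ml.injective_endo_surjective[OF fdL1 lin_on_subset[OF theta_iota_lin] _ theta_iota_inj assms])
     (use L1_L iota_EN theta_L1 in auto)

text \<open>A linear section of \<open>theta\<close> over \<open>L1\<close>; the element chosen is unique by \<open>theta_iota_inj\<close>.\<close>

definition sec :: "'k^'n^'n \<Rightarrow> 'k^'n^'n \<Rightarrow> 'k^'n^'n" where
  "sec v = iota (SOME u. u \<in> L1 \<and> theta (iota u) = v)"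

lemma sec_eq: "u \<in> L1 \<Longrightarrow> sec (theta (iota u)) = iota u"
proof -
  assume u: "u \<in> L1"
  have "u' = u" if "u' \<in> L1" "theta (iota u') = theta (iota u)" for u'
  proof -
    have "theta (iota (u' - u)) = 0"
      using ml.lin_on_diff[OF subspace_L theta_iota_lin L1_L[OF that(1)] L1_L[OF u]] that by simp
    then show ?thesis using theta_iota_inj[OF mat_vs.subspace_diff[OF L1_sub that(1) u]] by simp
  qed
  then have "(SOME u'. u' \<in> L1 \<and> theta (iota u') = theta (iota u)) = u" using u by (intro some_equality) auto
  then show ?thesis by (simp add: sec_def)
qed

lemma sec_soN: "v \<in> L1 \<Longrightarrow> sec v \<in> soN" and theta_sec: "v \<in> L1 \<Longrightarrow> theta (sec v) = v"
  using theta_iota_surj[of v] sec_eq iota_soN L1_L by auto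

lemma sec_lin: "lin_on mscale L1 fs sec"
  unfolding lin_on_def
proof (intro conjI ballI allI)
  fix v w assume "v \<in> L1" "w \<in> L1"
  then obtain a b where ab: "a \<in> L1" "theta (iota a) = v" "b \<in> L1" "theta (iota b) = w" using theta_iota_surj by meson
  then have "theta (iota (a + b)) = v + w" "iota (a + b) = iota a + iota b"
    using lin_onD(1)[OF theta_iota_lin] lin_onD(1)[OF iota_lin] L1_L by auto
  then show "sec (v + w) = sec v + sec w"
    using sec_eq ab mat_vs.subspace_add[OF L1_sub ab(1,3)] by metis
next
  fix c v assume "v \<in> L1"
  then obtain a where ab: "a \<in> L1" "theta (iota a) = v" using theta_iota_surj by meson
  then have "theta (iota (c *\<^sub>M a)) = c *\<^sub>M v" "iota (c *\<^sub>M a) = fs c (iota a)"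
    using lin_onD(2)[OF theta_iota_lin] lin_onD(2)[OF iota_lin] L1_L by auto
  then show "sec (c *\<^sub>M v) = fs c (sec v)"
    using sec_eq ab mat_vs.subspace_scale[OF L1_sub ab(1)] by metis
qed

definition Z :: "('k^'n^'n \<Rightarrow> 'k^'n^'n) set" where "Z = {F \<in> soN. theta F = 0}"

lemma Z_sub: "fl.subspace Z"
  unfolding Z_def using soN_D(1) lin_onD(1)[OF theta_lin] lin_onD(2)[OF theta_lin]
    fl.lin_on_zero[OF subspace_EN theta_lin] fl.subspace_0[OF soN_sub] fl.subspace_add[OF soN_sub] fl.subspace_scale[OF soN_sub]
  by (intro fl.subspaceI) auto

lemma Z_stable: "u \<in> L \<Longrightarrow> F \<in> Z \<Longrightarrow> aN u F \<in> Z"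
  using soN_stable theta_act soN_D(1) by (auto simp: Z_def)

lemma Z_soN: "Z \<subseteq> soN" by (auto simp: Z_def)

lemma wmodZ: "wmod fs Z aN"
  by (rule wmod_sub[OF wmod_soN Z_sub Z_soN Z_stable])

lemma T_Z: "F \<in> Z \<Longrightarrow> T F \<in> Z"
  using T_in theta_T CL_in by (auto simp: Z_def cas_def)

section \<open>All terms of the trace identity vanish\<close>

lemma theta_lin_soN: "lin_on fs soN mscale theta"
  by (rule lin_on_subset[OF theta_lin]) (auto simp: soN_def)

definition id_minus_C :: "'k^'n^'n \<Rightarrow> 'k^'n^'n" where "id_minus_C u = u - C lie u"

lemma id_minus_C_L: "u \<in> L \<Longrightarrow> id_minus_C u \<in> L"
  unfolding id_minus_C_def by (intro mat_vs.subspace_diff[OF subspace_L] CL_in)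

lemma id_minus_C_L1: "u \<in> L1 \<Longrightarrow> id_minus_C u \<in> L1"
  unfolding id_minus_C_def cas_def using eL L1_stable
  by (intro mat_vs.subspace_diff[OF L1_sub] mat_vs.subspace_sum[OF L1_sub]) auto

lemma id_minus_C_lin: "lin_on mscale L mscale id_minus_C"
  using C_lin(1)[OF repL] by (simp add: lin_on_def id_minus_C_def mat_vs.scale_right_diff_distrib)

lemma form_id_minus_C: "u \<in> L \<Longrightarrow> v \<in> L \<Longrightarrow> \<Phi> (id_minus_C u) v = K u v + K' u v"
  using form_decomposition[of u v] CL_in by (simp add: id_minus_C_def form_diff[OF form_g] algebra_simps)

text \<open>By \<open>form_decomposition\<close>, \<open>1 - C\<close> represents the form \<open>K + K'\<close>.  In products with \<open>K\<close> the inactive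
  basis vectors contribute nothing, so these traces may be taken over all of \<open>L\<close>.\<close>

lemma trace_id_minus_C: "ml.tr L1 (\<lambda>u. id_minus_C (id_minus_C u)) = trace_prod all_idx K K + 2 * trace_prod all_idx K' K + trace_prod active K' K'"
proof -
  have active_L: "e i \<in> L" "e' i \<in> L" if "i \<in> active" for i
    using that active_subset eL by auto
  have e'L1: "e' i \<in> L1" if "i \<in> active" for i using ml.frame_in[OF frame_L1 that] .
  have one: "\<Phi> (id_minus_C (id_minus_C (e' i))) (e i) = (\<Sum>j\<in>active. (K (e' i) (e j) + K' (e' i) (e j)) * (K (e' j) (e i) + K' (e' j) (e i)))"
    if i: "i \<in> active" for i
  proof -
    have c: "id_minus_C (e' i) \<in> L1" by (rule id_minus_C_L1[OF e'L1[OF i]])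
    have "id_minus_C (e' i) = (\<Sum>j\<in>active. \<Phi> (id_minus_C (e' i)) (e j) *\<^sub>M e' j)"
      using frame_L1 c unfolding ml.frame_def by blast
    then have "id_minus_C (id_minus_C (e' i)) = id_minus_C (\<Sum>j\<in>active. \<Phi> (id_minus_C (e' i)) (e j) *\<^sub>M e' j)" by simp
    also have "\<dots> = (\<Sum>j\<in>active. \<Phi> (id_minus_C (e' i)) (e j) *\<^sub>M id_minus_C (e' j))"
      using active_L L_scale
      by (subst ml.lin_on_sum[OF subspace_L id_minus_C_lin]) (auto simp: lin_onD(2)[OF id_minus_C_lin])
    finally have "\<Phi> (id_minus_C (id_minus_C (e' i))) (e i) = \<Phi> (\<Sum>j\<in>active. \<Phi> (id_minus_C (e' i)) (e j) *\<^sub>M id_minus_C (e' j)) (e i)" by simp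
    also have "\<dots> = (\<Sum>j\<in>active. \<Phi> (\<Phi> (id_minus_C (e' i)) (e j) *\<^sub>M id_minus_C (e' j)) (e i))"
      by (rule form_sum_g(1)) (use active_L i id_minus_C_L sub_g in auto)
    also have "\<dots> = (\<Sum>j\<in>active. \<Phi> (id_minus_C (e' i)) (e j) * \<Phi> (id_minus_C (e' j)) (e i))"
      using active_L i id_minus_C_L by (intro sum.cong refl) (simp add: scale_g)
    finally show ?thesis using active_L i by (simp add: form_id_minus_C)
  qed
  have "ml.tr L1 (\<lambda>u. id_minus_C (id_minus_C u)) = (\<Sum>i\<in>active. \<Phi> (id_minus_C (id_minus_C (e' i))) (e i))"
    by (rule ml.tr_frame[OF L1_sub frame_L1])
       (use id_minus_C_L1 in \<open>auto intro: lin_on_comp lin_on_subset[OF id_minus_C_lin L1_L[THEN subsetI]]\<close>)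
  also have "\<dots> = (\<Sum>i\<in>active. \<Sum>j\<in>active. (K (e' i) (e j) + K' (e' i) (e j)) * (K (e' j) (e i) + K' (e' j) (e i)))"
    by (rule sum.cong[OF refl], rule one)
  also have "\<dots> = (\<Sum>i\<in>active. \<Sum>j\<in>active. (K (e i) (e' j) + K' (e i) (e' j)) * (K (e j) (e' i) + K' (e j) (e' i)))"
  proof (rule sum.cong[OF refl], rule sum.cong[OF refl])
    fix i j assume "i \<in> active" "j \<in> active"
    then have ij: "e i \<in> L" "e' i \<in> L" "e j \<in> L" "e' j \<in> L" using active_L by auto
    note s = invariant_formD(1)[OF K_inv] invariant_formD(1)[OF K'_inv]
    show "(K (e' i) (e j) + K' (e' i) (e j)) * (K (e' j) (e i) + K' (e' j) (e i)) =
      (K (e i) (e' j) + K' (e i) (e' j)) * (K (e j) (e' i) + K' (e j) (e' i))"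
      unfolding s(1)[OF ij(2,3)] s(2)[OF ij(2,3)] s(1)[OF ij(4,1)] s(2)[OF ij(4,1)] by (rule mult.commute)
  qed
  also have "\<dots> = trace_prod active K K + trace_prod active K K' + trace_prod active K' K + trace_prod active K' K'"
    by (simp add: trace_prod_def sum.distrib algebra_simps)
  also have "trace_prod active K K' = trace_prod active K' K"
    unfolding trace_prod_def by (subst sum.swap) (simp add: mult.commute)
  finally have "ml.tr L1 (\<lambda>u. id_minus_C (id_minus_C u)) = trace_prod active K K + trace_prod active K' K + trace_prod active K' K + trace_prod active K' K'" .
  moreover have "trace_prod active F K = trace_prod all_idx F K" for F
  proof -
    have z: "F (e i) (e' j) * K (e j) (e' i) = 0" if "i < r + s" "j < r + s" "i \<notin> active \<or> j \<notin> active" for i j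
      using that ann_K(1)[OF inactive_ann(1)[OF that(2)] eL(1) eL(2)[OF that(1)]]
        ann_K(2)[OF inactive_ann(2)[OF that(1)] eL(2) eL(1)[OF that(2)]] by auto
    have "trace_prod active F K = (\<Sum>i\<in>active. \<Sum>j\<in>all_idx. F (e i) (e' j) * K (e j) (e' i))"
      unfolding trace_prod_def using active_subset z by (intro sum.cong[OF refl] sum.mono_neutral_left) auto
    also have "\<dots> = trace_prod all_idx F K"
      unfolding trace_prod_def using active_subset z by (intro sum.mono_neutral_left sum.neutral ballI) auto
    finally show ?thesis .
  qed
  ultimately show ?thesis by simp
qed

text \<open>\<open>soN\<close> is the sum of \<open>Z\<close> and the image of \<open>sec\<close>, with projections \<open>p\<close> and \<open>sec \<circ> theta\<close>.  Commuting factors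
  under the trace moves the first part to \<open>Z\<close> and the second to \<open>L1\<close>, where \<open>T\<close> becomes \<open>1 - C\<close> by
  \<open>theta_T\<close>.\<close>

lemma trace_TT_Z: "fl.tr Z (\<lambda>F. T (T F)) = - 3 * trace_prod all_idx K' K - trace_prod active K' K'"
proof -
  have Z_lin: "lin_on fs Z fs (\<lambda>F. T (T F))" by (rule lin_on_subset[OF TT_lin Z_soN])
  (* projection onto the kernel of theta *)
  define p where "p = (\<lambda>F. F - sec (theta F))"
  have fdZ: "fl.fin_dim Z" by (rule wmod_fin_dim[OF wmodZ])
  have st_lin: "lin_on fs soN fs (\<lambda>F. sec (theta F))"
    by (rule lin_on_comp[OF theta_lin_soN sec_lin]) (use theta_L1 soN_D(1) in auto)
  have st_in: "F \<in> soN \<Longrightarrow> sec (theta F) \<in> soN" for F using sec_soN theta_L1 soN_D(1) by blast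
  have p_lin: "lin_on fs soN fs p"
    using st_lin unfolding lin_on_def p_def by (simp add: fl.scale_right_diff_distrib)
  have p_Z: "p F \<in> Z" if F: "F \<in> soN" for F
  proof -
    have "theta (p F) = theta F - theta (sec (theta F))"
      unfolding p_def by (rule fl.lin_on_diff[OF soN_sub theta_lin_soN F st_in[OF F]])
    also have "\<dots> = 0" using theta_sec[OF theta_L1[OF soN_D(1)[OF F]]] by simp
    finally show ?thesis using fl.subspace_diff[OF soN_sub F st_in[OF F]] by (simp add: Z_def p_def)
  qed
  have p_Sk: "F \<in> soN \<Longrightarrow> p F \<in> soN" for F using p_Z Z_soN by blast
  have sec0: "sec 0 = 0" by (rule ml.lin_on_zero[OF L1_sub sec_lin])
  have p_id: "F \<in> Z \<Longrightarrow> p F = F" for F by (simp add: p_def Z_def sec0)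
  have TT_add: "T (T (F + G)) = T (T F) + T (T G)" if "F \<in> soN" "G \<in> soN" for F G
    by (rule lin_onD(1)[OF TT_lin that])
  have TTp: "lin_on fs soN fs (\<lambda>F. T (T (p F)))"
    by (rule lin_on_comp[OF p_lin TT_lin]) (use p_Z Z_soN in auto)
  have TTs: "lin_on fs soN fs (\<lambda>F. T (T (sec (theta F))))"
    by (rule lin_on_comp[OF st_lin TT_lin]) (use st_in in auto)
  have "fl.tr soN (\<lambda>F. T (T F)) = fl.tr soN (\<lambda>F. T (T (p F)) + T (T (sec (theta F))))"
  proof (rule fl.tr_cong[OF fd_soN TT_lin])
    fix F assume F: "F \<in> soN"
    have "T (T (p F)) + T (T (sec (theta F))) = T (T (p F + sec (theta F)))"
      using p_Z[OF F] Z_soN st_in[OF F] by (intro TT_add[symmetric]) auto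
    then show "T (T F) = T (T (p F)) + T (T (sec (theta F)))" by (simp add: p_def)
  qed (use T_in in auto)
  also have "\<dots> = fl.tr soN (\<lambda>F. T (T (p F))) + fl.tr soN (\<lambda>F. T (T (sec (theta F))))"
    by (rule fl.tr_add[OF fd_soN TTp _ TTs]) (use T_in p_Sk st_in in auto)
  also have "fl.tr soN (\<lambda>F. T (T (p F))) = fl.tr Z (\<lambda>F. p (T (T F)))"
    by (rule tr_commute[OF fl.linear_space_axioms fl.linear_space_axioms fd_soN fdZ p_lin _ Z_lin])
       (use p_Z T_in Z_soN in auto)
  also have "\<dots> = fl.tr Z (\<lambda>F. T (T F))"
    by (rule fl.tr_cong[OF fdZ Z_lin, symmetric]) (use T_Z p_id in auto)
  also have "fl.tr soN (\<lambda>F. T (T (sec (theta F)))) = ml.tr L1 (\<lambda>u. theta (T (T (sec u))))"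
    by (rule tr_commute[OF fl.linear_space_axioms ml.linear_space_axioms fd_soN fdL1 theta_lin_soN _ lin_on_comp[OF sec_lin TT_lin]])
       (use theta_L1 soN_D(1) sec_soN T_in in auto)
  also have "\<dots> = ml.tr L1 (\<lambda>u. id_minus_C (id_minus_C u))"
  proof (rule ml.tr_cong[OF fdL1, symmetric])
    show "lin_on mscale L1 mscale (\<lambda>u. id_minus_C (id_minus_C u))"
      by (rule lin_on_comp[OF lin_on_subset[OF id_minus_C_lin] id_minus_C_lin]) (use L1_L id_minus_C_L in auto)
    show "id_minus_C (id_minus_C u) = theta (T (T (sec u)))" if u: "u \<in> L1" for u
      using theta_T[OF T_in[OF sec_soN[OF u]]] theta_T[OF sec_soN[OF u]] theta_sec[OF u] by (simp add: id_minus_C_def)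
  qed (use id_minus_C_L1 in auto)
  finally have "fl.tr Z (\<lambda>F. T (T F)) = fl.tr soN (\<lambda>F. T (T F)) - ml.tr L1 (\<lambda>u. id_minus_C (id_minus_C u))" by simp
  then show ?thesis by (simp add: trace_TT trace_id_minus_C)
qed

text \<open>\<open>C\<close> is diagonalisable on \<open>Z\<close> with rational eigenvalues \<open>c\<close>, so the trace is the sum of the
  \<open>(1 - c)\<^sup>2\<close>.\<close>

lemma trace_TT_Z_rational:
  "\<exists>z\<ge>0. fl.tr Z (\<lambda>F. T (T F)) = of_rat z \<and> (z = 0 \<longrightarrow> (\<forall>F\<in>Z. T F = 0))"
proof -
  let ?E = "{F \<in> Z. \<exists>c. C aN F = fs (of_rat c) F}"
  have sp: "fl.span ?E = Z"
    using casimir_eigenvectors_span[OF wmodZ] fl.span_minimal[of ?E Z] Z_sub by auto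
  obtain B where B: "B \<subseteq> ?E" "finite B" "fl.independent B" "fl.span B = Z"
    using fl.basis_within[OF wmod_fin_dim[OF wmodZ] sp] by blast
  then have "\<forall>b\<in>B. \<exists>c. C aN b = fs (of_rat c) b" by auto
  then obtain c where c: "\<And>b. b \<in> B \<Longrightarrow> C aN b = fs (of_rat (c b)) b" by metis
  have bS: "b \<in> soN" if "b \<in> B" for b using B(1) that Z_soN by auto
  have Tb: "T b = fs (of_rat (1 - c b)) b" if "b \<in> B" for b
    unfolding T_def c[OF that] by (simp add: of_rat_diff fl.scale_left_diff_distrib)
  have TTb: "T (T b) = fs (of_rat ((1 - c b)\<^sup>2)) b" if "b \<in> B" for b
  proof -
    have "T (T b) = fs (of_rat (1 - c b)) (T b)"
      using lin_onD(2)[OF T_lin bS[OF that]] Tb[OF that] by metis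
    then show ?thesis using Tb[OF that] by (simp add: power2_eq_square of_rat_mult)
  qed
  have "fl.tr Z (\<lambda>F. T (T F)) = (\<Sum>b\<in>B. of_rat ((1 - c b)\<^sup>2))"
    by (rule fl.tr_eigenbasis[OF B(2-4) lin_on_subset[OF TT_lin Z_soN] TTb])
  moreover have "T F = 0" if z: "(\<Sum>b\<in>B. (1 - c b)\<^sup>2) = 0" and F: "F \<in> Z" for F
  proof -
    have c0: "1 - c b = 0" if "b \<in> B" for b
      using z B(2) that by (simp add: sum_nonneg_eq_0_iff)
    have "F \<in> fl.span B" using F B(4) by simp
    moreover have "fl.span B \<subseteq> {F \<in> Z. T F = 0}"
    proof (rule fl.span_minimal)
      show "B \<subseteq> {F \<in> Z. T F = 0}" using Tb c0 B by auto
      show "fl.subspace {F \<in> Z. T F = 0}"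
        using fl.subspace_eigen[OF Z_sub lin_on_subset[OF T_lin Z_soN], of 0] by simp
    qed
    ultimately show ?thesis by auto
  qed
  ultimately show ?thesis
    by (intro exI[of _ "\<Sum>b\<in>B. (1 - c b)\<^sup>2"]) (auto simp: of_rat_sum intro: sum_nonneg)
qed

text \<open>Invariant forms are block diagonal: torus and root vectors are orthogonal, and \<open>X a\<close> pairs only with
  \<open>Y a\<close>.\<close>

lemma trace_prod_split:
  assumes F: "invariant_form L F" and G: "invariant_form L G" and J: "J \<subseteq> all_idx"
  shows "trace_prod J F G = (\<Sum>i\<in>{i. i < r \<and> i \<in> J}. \<Sum>j\<in>{i. i < r \<and> i \<in> J}. F (H i) (H j) * G (H i) (H j) / of_rat (q i * q j))
    + (\<Sum>a\<in>{a. a < s \<and> r + a \<in> J}. F (X a) (Y a) * G (X a) (Y a))"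
proof -
  let ?A = "{i. i < r \<and> i \<in> J}" and ?B = "{a. a < s \<and> r + a \<in> J}"
  have sumJ: "(\<Sum>i\<in>J. f i) = (\<Sum>i\<in>?A. f i) + (\<Sum>a\<in>?B. f (r + a))" for f :: "nat \<Rightarrow> 'k"
  proof -
    have "J = ?A \<union> (+) r ` ?B"
    proof (intro equalityI subsetI)
      fix i assume i: "i \<in> J"
      then have "i < r + s" using J by auto
      then have "i < r \<or> (\<exists>a<s. i = r + a)" by presburger
      then show "i \<in> ?A \<union> (+) r ` ?B" using i by auto
    qed auto
    then have "(\<Sum>i\<in>J. f i) = (\<Sum>i\<in>?A \<union> (+) r ` ?B. f i)" by metis
    also have "\<dots> = (\<Sum>i\<in>?A. f i) + (\<Sum>i\<in>(+) r ` ?B. f i)"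
      by (rule sum.union_disjoint) auto
    finally show ?thesis by (simp add: sum.reindex)
  qed
  have HH': "P (H i) ((1 / of_rat (q j)) *\<^sub>M H j) = P (H i) (H j) / of_rat (q j)"
    if "invariant_form L P" "i < r" "j < r" for P i j
    using form_scale(2)[OF that(1) subspace_L H_in[OF that(3)] H_in[OF that(2)]] by simp
  have XH': "P (X a) ((1 / of_rat (q j)) *\<^sub>M H j) = 0" if "invariant_form L P" "a < s" "j < r" for P a j
    using form_scale(2)[OF that(1) subspace_L H_in[OF that(3)] X_in[OF that(2)]]
      invariant_formD(1)[OF that(1) X_in[OF that(2)] H_in[OF that(3)]] form_HX(1)[OF that(1,3,2)] by simp
  have row_H: "(\<Sum>j\<in>J. F (e i) (e' j) * G (e j) (e' i)) = (\<Sum>j\<in>?A. F (H i) (H j) * G (H i) (H j) / of_rat (q i * q j))"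
    if i: "i < r" for i
  proof -
    have "(\<Sum>j\<in>J. F (e i) (e' j) * G (e j) (e' i)) =
        (\<Sum>j\<in>?A. F (e i) (e' j) * G (e j) (e' i)) + (\<Sum>a\<in>?B. F (e i) (e' (r + a)) * G (e (r + a)) (e' i))"
      by (rule sumJ)
    also have "(\<Sum>a\<in>?B. F (e i) (e' (r + a)) * G (e (r + a)) (e' i)) = 0"
      using i by (intro sum.neutral) (auto simp: e_simps form_HX[OF F])
    also have "(\<Sum>j\<in>?A. F (e i) (e' j) * G (e j) (e' i)) = (\<Sum>j\<in>?A. F (H i) (H j) * G (H i) (H j) / of_rat (q i * q j))"
      using i by (intro sum.cong refl)
        (auto simp: e_simps HH'[OF F] HH'[OF G] of_rat_mult invariant_formD(1)[OF G H_in H_in])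
    finally show ?thesis by simp
  qed
  have row_X: "(\<Sum>j\<in>J. F (e (r + a)) (e' j) * G (e j) (e' (r + a))) = (\<Sum>b\<in>?B. F (X a) (Y b) * G (X b) (Y a))"
    if a: "a < s" for a
  proof -
    have "(\<Sum>j\<in>J. F (e (r + a)) (e' j) * G (e j) (e' (r + a))) =
        (\<Sum>j\<in>?A. F (e (r + a)) (e' j) * G (e j) (e' (r + a))) +
        (\<Sum>b\<in>?B. F (e (r + a)) (e' (r + b)) * G (e (r + b)) (e' (r + a)))"
      by (rule sumJ)
    also have "(\<Sum>j\<in>?A. F (e (r + a)) (e' j) * G (e j) (e' (r + a))) = 0"
      using a by (intro sum.neutral) (auto simp: e_simps XH'[OF F])
    finally show ?thesis by (simp add: e_simps)
  qed
  have "trace_prod J F G = (\<Sum>i\<in>?A. \<Sum>j\<in>?A. F (H i) (H j) * G (H i) (H j) / of_rat (q i * q j))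
    + (\<Sum>a\<in>?B. \<Sum>b\<in>?B. F (X a) (Y b) * G (X b) (Y a))"
    unfolding trace_prod_def sumJ[of "\<lambda>i. \<Sum>j\<in>J. F (e i) (e' j) * G (e j) (e' i)"]
    by (rule arg_cong2[where f = "(+)"]; rule sum.cong[OF refl]; simp only: mem_Collect_eq row_H row_X)
  also have "(\<Sum>a\<in>?B. \<Sum>b\<in>?B. F (X a) (Y b) * G (X b) (Y a)) = (\<Sum>a\<in>?B. F (X a) (Y a) * G (X a) (Y a))"
  proof (rule sum.cong[OF refl])
    fix a assume a: "a \<in> ?B"
    have "(\<Sum>b\<in>?B. F (X a) (Y b) * G (X b) (Y a)) = (\<Sum>b\<in>?B. if b = a then F (X a) (Y a) * G (X a) (Y a) else 0)"
      using a by (intro sum.cong refl) (auto simp: form_XY[OF F])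
    then show "(\<Sum>b\<in>?B. F (X a) (Y b) * G (X b) (Y a)) = F (X a) (Y a) * G (X a) (Y a)" using a by simp
  qed
  finally show ?thesis .
qed

lemma tform_XY_rational:
  assumes "invariant_form L (tform V)"
    and B: "finite B" "mat_vs.independent B" "mat_vs.span B = V" "\<And>b. b \<in> B \<Longrightarrow> b \<in> wsp mscale V lie (l b)"
    and a: "a < s"
  shows "tform V (X a) (Y a) = of_rat ((\<Sum>b\<in>B. (ip (\<alpha> a) (l b))\<^sup>2) / ip (\<alpha> a) (\<alpha> a))"
  using form_XY[OF assms(1) a a] tform_coroot[OF B, of a] by (simp add: of_rat_divide)

text \<open>On the torus, with weights \<open>l\<close> of \<open>M\<close> and \<open>k\<close> of \<open>N\<close>, the trace is the sum of all \<open>(ip l k)\<^sup>2\<close>; root vectors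
  contribute products of nonnegative numbers.\<close>

lemma trace_prod_K'K_rational: "\<exists>x\<ge>0. trace_prod all_idx K' K = of_rat x"
proof -
  obtain B l where B: "finite B" "mat_vs.independent B" "mat_vs.span B = M" "\<And>b. b \<in> B \<Longrightarrow> b \<in> wsp mscale M lie (l b)"
    using weight_basis_M by blast
  obtain D k where D: "finite D" "mat_vs.independent D" "mat_vs.span D = N" "\<And>b. b \<in> D \<Longrightarrow> b \<in> wsp mscale N lie (k b)"
    using weight_basis_N by blast
  let ?A = "{i. i < r \<and> i \<in> all_idx}" and ?S = "{a. a < s \<and> r + a \<in> all_idx}"
  let ?m = "\<lambda>a. (\<Sum>b\<in>B. (ip (\<alpha> a) (l b))\<^sup>2) / ip (\<alpha> a) (\<alpha> a)" and ?m' = "\<lambda>a. (\<Sum>b\<in>D. (ip (\<alpha> a) (k b))\<^sup>2) / ip (\<alpha> a) (\<alpha> a)"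
  let ?x = "(\<Sum>i\<in>?A. \<Sum>j\<in>?A. (\<Sum>b\<in>B. l b i * l b j) * (\<Sum>d\<in>D. k d i * k d j) / (q i * q j)) + (\<Sum>a\<in>?S. ?m a * ?m' a)"
  have "trace_prod all_idx K' K = (\<Sum>i\<in>?A. \<Sum>j\<in>?A. of_rat ((\<Sum>b\<in>B. l b i * l b j) * (\<Sum>d\<in>D. k d i * k d j) / (q i * q j)))
      + (\<Sum>a\<in>?S. of_rat (?m a * ?m' a))"
    unfolding trace_prod_split[OF K'_inv K_inv order_refl]
    using tform_H[OF B] tform_H[OF D] tform_XY_rational[OF K'_inv B] tform_XY_rational[OF K_inv D]
    by (simp add: of_rat_mult of_rat_divide)
  then have "trace_prod all_idx K' K = of_rat ?x" by (simp only: of_rat_sum of_rat_add)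
  moreover have "?x \<ge> 0"
    unfolding sum_of_squares_expand
    using ip_root_pos by (intro add_nonneg_nonneg sum_nonneg mult_nonneg_nonneg divide_nonneg_nonneg) (auto intro: less_imp_le)
  ultimately show ?thesis by blast
qed

lemma trace_prod_active_rational:
  "\<exists>x\<ge>0. trace_prod active K' K' = of_rat x \<and> (x = 0 \<longrightarrow> (\<forall>i\<in>active. \<forall>y\<in>M. lie (e i) y = 0 \<and> lie (e' i) y = 0))"
proof -
  obtain B l where B: "finite B" "mat_vs.independent B" "mat_vs.span B = M" "\<And>b. b \<in> B \<Longrightarrow> b \<in> wsp mscale M lie (l b)"
    using weight_basis_M by blast
  let ?A = "{i. i < r \<and> i \<in> active}" and ?S = "{a. a < s \<and> r + a \<in> active}"
  let ?m = "\<lambda>a. (\<Sum>b\<in>B. (ip (\<alpha> a) (l b))\<^sup>2) / ip (\<alpha> a) (\<alpha> a)"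
  let ?k = "\<lambda>i j. \<Sum>b\<in>B. l b i * l b j"
  let ?x = "(\<Sum>i\<in>?A. \<Sum>j\<in>?A. ?k i j * ?k i j / (q i * q j)) + (\<Sum>a\<in>?S. ?m a * ?m a)"
  have "trace_prod active K' K' = (\<Sum>i\<in>?A. \<Sum>j\<in>?A. of_rat (?k i j * ?k i j / (q i * q j))) + (\<Sum>a\<in>?S. of_rat (?m a * ?m a))"
    unfolding trace_prod_split[OF K'_inv K'_inv active_subset]
    using tform_H[OF B] tform_XY_rational[OF K'_inv B]
    by (simp add: of_rat_mult of_rat_divide)
  then have "trace_prod active K' K' = of_rat ?x" by (simp only: of_rat_sum of_rat_add)
  moreover have nn: "?k i j * ?k i j / (q i * q j) \<ge> 0" if "i \<in> ?A" "j \<in> ?A" for i j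
    using that q_pos[of i] q_pos[of j] by (intro divide_nonneg_nonneg zero_le_square) auto
  have nn1: "(\<Sum>i\<in>?A. \<Sum>j\<in>?A. ?k i j * ?k i j / (q i * q j)) \<ge> 0" by (intro sum_nonneg nn)
  have nn2: "(\<Sum>a\<in>?S. ?m a * ?m a) \<ge> 0" by (intro sum_nonneg zero_le_square)
  moreover have "?x \<ge> 0" using nn1 nn2 by simp
  moreover have "lie (e i) y = 0 \<and> lie (e' i) y = 0" if z: "?x = 0" and i: "i \<in> active" and y: "y \<in> M" for i y
  proof -
    have z1: "(\<Sum>i\<in>?A. \<Sum>j\<in>?A. ?k i j * ?k i j / (q i * q j)) = 0" and z2: "(\<Sum>a\<in>?S. ?m a * ?m a) = 0"
      using nn1 nn2 z by linarith+
    show ?thesis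
    proof (cases "i < r")
      case True
      then have iA: "i \<in> ?A" using i by simp
      have "(\<Sum>j\<in>?A. ?k i j * ?k i j / (q i * q j)) = 0"
        using z1 iA by (subst (asm) sum_nonneg_eq_0_iff) (auto intro!: sum_nonneg nn)
      then have "?k i i * ?k i i / (q i * q i) = 0"
        using iA by (subst (asm) sum_nonneg_eq_0_iff) (use iA in \<open>auto intro!: nn\<close>)
      then have "(\<Sum>b\<in>B. (l b i)\<^sup>2) = 0" using q_pos[OF True] by (simp add: power2_eq_square)
      then have "l b i = 0" if "b \<in> B" for b using that B(1) by (simp add: sum_nonneg_eq_0_iff)
      then have "lie (H i) b = 0" if "b \<in> B" for b using B(4)[OF that] that True by (simp add: wsp_def)
      then have "lie (H i) y = 0" using lie_kills_span[of B] y B(3) by blast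
      then show ?thesis using True by (simp add: e_simps lie_scale)
    next
      case False
      then obtain a where a: "i = r + a" "a < s" using i active_subset
        by (metis add_less_cancel_left le_Suc_ex lessThan_iff not_less subsetD)
      then have "?m a * ?m a = 0" using z2 i by (subst (asm) sum_nonneg_eq_0_iff) auto
      then have "(\<Sum>b\<in>B. (ip (\<alpha> a) (l b))\<^sup>2) = 0" using ip_root_pos[OF a(2)] by simp
      then have "K' (coroot a) (coroot a) = 0" using tform_coroot[OF B, of a] by simp
      from tform_coroot_0[OF a(2) this M y] show ?thesis using a by (simp add: e_simps)
    qed
  qed
  ultimately show ?thesis by blast
qed

text \<open>The identity \<open>trace_TT_Z\<close> reads \<open>z = - 3 x - y\<close> with nonnegative rational numbers \<open>x\<close>, \<open>y\<close>, \<open>z\<close>.\<close>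

lemma shows T_vanishes: "F \<in> Z \<Longrightarrow> T F = 0"
    and active_kills_M: "i \<in> active \<Longrightarrow> y \<in> M \<Longrightarrow> lie (e i) y = 0" "i \<in> active \<Longrightarrow> y \<in> M \<Longrightarrow> lie (e' i) y = 0"
proof -
  obtain z where z: "z \<ge> 0" "fl.tr Z (\<lambda>F. T (T F)) = of_rat z" "z = 0 \<longrightarrow> (\<forall>F\<in>Z. T F = 0)"
    using trace_TT_Z_rational by blast
  obtain x where x: "x \<ge> 0" "trace_prod all_idx K' K = of_rat x" using trace_prod_K'K_rational by blast
  obtain y where y: "y \<ge> 0" "trace_prod active K' K' = of_rat y"
    "y = 0 \<longrightarrow> (\<forall>i\<in>active. \<forall>y\<in>M. lie (e i) y = 0 \<and> lie (e' i) y = 0)"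
    using trace_prod_active_rational by blast
  have "(of_rat z :: 'k) = of_rat (- 3 * x - y)" if "fl.tr Z (\<lambda>F. T (T F)) = of_rat z"
    using trace_TT_Z that unfolding x(2) y(2) by (simp add: of_rat_diff of_rat_mult of_rat_minus)
  from this[OF z(2)] have "z = - 3 * x - y" by (simp only: of_rat_eq_iff)
  then have "z = 0" "y = 0" using z(1) x(1) y(1) by linarith+
  then show "F \<in> Z \<Longrightarrow> T F = 0" "i \<in> active \<Longrightarrow> y \<in> M \<Longrightarrow> lie (e i) y = 0" "i \<in> active \<Longrightarrow> y \<in> M \<Longrightarrow> lie (e' i) y = 0" for F i y
    using z(3) y(3) by auto
qed

lemma L1_kills_M:
  assumes u: "u \<in> L1" and y: "y \<in> M"
  shows "lie u y = 0"
proof -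
  have "lie u y = lie (\<Sum>i\<in>active. \<Phi> u (e i) *\<^sub>M e' i) y"
    using frame_L1 u unfolding ml.frame_def by metis
  also have "\<dots> = 0" using active_kills_M(2)[OF _ y] by (simp add: lie_sum lie_scale)
  finally show ?thesis .
qed

lemma T_iota:
  assumes v: "v \<in> L1" shows "T (iota v) = iota (theta (iota v))"
proof -
  have vL: "v \<in> L" by (rule L1_L[OF v])
  have "id_minus_C v = theta (iota v)"
  proof (rule eq_in_L[OF id_minus_C_L[OF vL] theta_L])
    fix w assume w: "w \<in> L"
    have "K' v w = 0"
      unfolding K'_sum[OF vL w] using L1_kills_M[OF v] hM w M(3) by (intro sum.neutral) (simp add: form_zero[OF form_g])
    then have "\<Phi> (id_minus_C v) w = K v w" using form_id_minus_C[OF vL w] by simp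
    then show "\<Phi> (id_minus_C v) w = \<Phi> (theta (iota v)) w"
      using form_theta_iota[OF vL w] sym[of w "theta (iota v)"] theta_L w invariant_formD(1)[OF K_inv vL w] by simp
  qed
  moreover have "T (iota v) = iota (id_minus_C v)"
    unfolding T_def id_minus_C_def iota_C[OF vL] using ml.lin_on_diff[OF subspace_L iota_lin vL CL_in[OF vL]] by simp
  ultimately show ?thesis by simp
qed

text \<open>\<open>F\<close> differs from some \<open>iota v\<close> by an element of \<open>Z\<close>, which \<open>T\<close> kills.  On \<open>iota v\<close> the claim is
  \<open>T_iota\<close>, where \<open>K'\<close> no longer contributes to \<open>1 - C\<close> since \<open>L1\<close> kills \<open>M\<close>.\<close>

lemma T_eq_iota_theta:
  assumes F: "F \<in> soN" shows "T F = iota (theta F)"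
proof -
  obtain v where v: "v \<in> L1" "theta (iota v) = theta F"
    using theta_iota_surj[OF theta_L1[OF soN_D(1)[OF F]]] by blast
  have iv: "iota v \<in> soN" by (rule iota_soN[OF L1_L[OF v(1)]])
  have "theta (F - iota v) = 0"
    using fl.lin_on_diff[OF soN_sub theta_lin_soN F iv] v(2) by simp
  then have "F - iota v \<in> Z" using fl.subspace_diff[OF soN_sub F iv] by (simp add: Z_def)
  then have "T (F - iota v) = 0" by (rule T_vanishes)
  then have "T F = T (iota v)" using fl.lin_on_diff[OF soN_sub T_lin F iv] by simp
  then show ?thesis using T_iota[OF v(1)] v(2) by simp
qed

section \<open>The Bianchi identity\<close>

text \<open>The orthogonal projection of \<open>g\<close> onto \<open>L\<close>.\<close>

definition lp :: "'k^'n^'n \<Rightarrow> 'k^'n^'n" where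
  "lp z = (\<Sum>i<r + s. \<Phi> z (e' i) *\<^sub>M e i)"

lemma lp_L: "lp z \<in> L"
  unfolding lp_def using eL by (intro L_sum L_scale) auto

lemma form_lp:
  assumes "z \<in> g" "u \<in> L" shows "\<Phi> (lp z) u = \<Phi> z u"
proof -
  have "\<Phi> z u = \<Phi> z (\<Sum>i<r + s. \<Phi> u (e i) *\<^sub>M e' i)" by (simp only: expand_L(2)[OF assms(2)])
  also have "\<dots> = (\<Sum>i<r + s. \<Phi> u (e i) * \<Phi> z (e' i))"
    using assms eL sub_g by (subst form_sum_g(2)) (auto simp: scale_g)
  also have "\<dots> = (\<Sum>i<r + s. \<Phi> (\<Phi> z (e' i) *\<^sub>M e i) u)"
    using assms eL by (intro sum.cong refl) (simp add: scale_g sym[of u])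
  also have "\<dots> = \<Phi> (lp z) u"
    unfolding lp_def using assms eL sub_g by (intro form_sum_g(1)[symmetric]) auto
  finally show ?thesis ..
qed

lemma lp_eqI: "z \<in> g \<Longrightarrow> u \<in> L \<Longrightarrow> (\<And>w. w \<in> L \<Longrightarrow> \<Phi> z w = \<Phi> u w) \<Longrightarrow> lp z = u"
  by (rule eq_in_L[OF lp_L]) (auto simp: form_lp)

lemma lp_add: "x \<in> g \<Longrightarrow> y \<in> g \<Longrightarrow> lp (x + y) = lp x + lp y"
  using eL by (simp add: lp_def form_add[OF form_g] mat_vs.scale_left_distrib sum.distrib)

lemma lp_scale: "x \<in> g \<Longrightarrow> lp (c *\<^sub>M x) = c *\<^sub>M lp x"
  using eL by (simp add: lp_def scale_g mat_vs.scale_sum_right)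

lemma lp_lin: "lin_on mscale g mscale lp"
  by (simp add: lin_on_def lp_add lp_scale)

lemma lp_neg: "x \<in> g \<Longrightarrow> lp (- x) = - lp x"
  using lp_scale[of x "- 1"] by simp

lemma lp_0: "z \<in> g \<Longrightarrow> (\<And>w. w \<in> L \<Longrightarrow> \<Phi> z w = 0) \<Longrightarrow> lp z = 0"
  by (rule lp_eqI) (auto simp: form_zero[OF form_g] mat_vs.subspace_0[OF subspace_L])

lemma nondeg_N:
  assumes "x \<in> N" "\<And>x'. x' \<in> N \<Longrightarrow> \<Phi> x x' = 0" shows "x = 0"
proof -
  have "x = (\<Sum>i<n. \<Phi> x (f' i) *\<^sub>M f i)" using expand_N(1)[OF assms(1)] by simp
  also have "\<dots> = 0" using assms(2) fN by simp
  finally show ?thesis .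
qed

lemma nondeg_M:
  assumes "x \<in> M" "\<And>x'. x' \<in> M \<Longrightarrow> \<Phi> x x' = 0" shows "x = 0"
proof -
  have "x = (\<Sum>i<m. \<Phi> x (h' i) *\<^sub>M h i)" using expand_M(1)[OF assms(1)] by simp
  also have "\<dots> = 0" using assms(2) hM by simp
  finally show ?thesis .
qed

text \<open>This is \<open>T_eq_iota_theta\<close> for \<open>W = x \<and> y\<close>: here \<open>theta W\<close> is twice the projection of \<open>[x, y]\<close>, and
  \<open>T_apply\<close> produces the other two terms.\<close>

lemma bianchi_N:
  assumes x: "x \<in> N" and y: "y \<in> N" and z: "z \<in> N"
  shows "lie (lp (lie x y)) z + lie (lp (lie y z)) x + lie (lp (lie z x)) y = 0"
proof -
  define W where "W = (\<lambda>z. if z \<in> N then \<Phi> y z *\<^sub>M x - \<Phi> x z *\<^sub>M y else 0)"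
  note g' = in_g(2)[OF x] in_g(2)[OF y] in_g(2)[OF z]
  have W: "W \<in> soN"
  proof -
    have "W \<in> EN"
      unfolding endo_def lin_on_def W_def
      using x y mat_vs.subspace_add[OF N(1)] mat_vs.subspace_scale[OF N(1)] mat_vs.subspace_diff[OF N(1)]
      by (auto simp: form_add[OF form_g] scale_g mat_vs.scale_left_distrib mat_vs.scale_right_diff_distrib mult.commute)
    moreover have "\<Phi> (W a) b = - \<Phi> a (W b)" if a: "a \<in> N" and b: "b \<in> N" for a b
    proof -
      note g'' = g' in_g(2)[OF a] in_g(2)[OF b]
      have A: "\<Phi> (W a) b = \<Phi> y a * \<Phi> x b - \<Phi> x a * \<Phi> y b"
        using g'' sub_g a by (simp add: W_def form_diff[OF form_g] scale_g)
      have B: "\<Phi> a (W b) = \<Phi> y b * \<Phi> a x - \<Phi> x b * \<Phi> a y"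
        using g'' sub_g b by (simp add: W_def form_diff[OF form_g] scale_g)
      show ?thesis unfolding A B sym[OF g''(4,1)] sym[OF g''(4,2)] by (simp add: algebra_simps)
    qed
    ultimately show ?thesis by (simp add: soN_def)
  qed
  have shift: "(\<Sum>i<r + s. \<Phi> v (lie (e' i) z) *\<^sub>M lie (e i) w) = - lie (lp (lie v z)) w" if v: "v \<in> N" for v w
  proof -
    have "\<Phi> v (lie (e' i) z) = - \<Phi> (lie v z) (e' i)" if i: "i < r + s" for i
    proof -
      have ei: "e' i \<in> g" using eL(2)[OF i] by simp
      have "\<Phi> (lie v z) (e' i) = \<Phi> v (lie z (e' i))" using assoc v g' ei by simp
      also have "lie z (e' i) = (- 1) *\<^sub>M lie (e' i) z" using lie_anti[of "e' i" z] by simp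
      also have "\<Phi> v \<dots> = - \<Phi> v (lie (e' i) z)" using v g' ei g_closed scale_g(2)[of "lie (e' i) z" v "- 1"] by simp
      finally show ?thesis by simp
    qed
    then show ?thesis by (simp add: lp_def lie_sum lie_scale sum_negf)
  qed
  have "T W z = 2 *\<^sub>M (\<Sum>i<r + s. lie (e i) (W (lie (e' i) z)))"
    by (rule T_apply[OF soN_D(1)[OF W] z])
  also have "(\<Sum>i<r + s. lie (e i) (W (lie (e' i) z))) =
      (\<Sum>i<r + s. \<Phi> y (lie (e' i) z) *\<^sub>M lie (e i) x) - (\<Sum>i<r + s. \<Phi> x (lie (e' i) z) *\<^sub>M lie (e i) y)"
    using eL N(3)[OF _ z] by (simp add: W_def lie_diff lie_scale sum_subtractf)
  also have "\<dots> = lie (lp (lie x z)) y - lie (lp (lie y z)) x"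
    by (simp add: shift[OF x] shift[OF y])
  finally have TW: "T W z = 2 *\<^sub>M (lie (lp (lie x z)) y - lie (lp (lie y z)) x)" .
  have "theta W = 2 *\<^sub>M lp (lie x y)"
  proof (rule eq_in_L[OF theta_L L_scale[OF lp_L]])
    fix u assume u: "u \<in> L"
    note ug = in_g(1)[OF u]
    have ux: "lie u x \<in> N" "lie u y \<in> N" using N(3)[OF u] x y by auto
    have "tr_with u W = (\<Sum>a<n. \<Phi> y (f a) * \<Phi> (lie u x) (f' a)) - (\<Sum>a<n. \<Phi> x (f a) * \<Phi> (lie u y) (f' a))"
      using fN ux sub_g by (simp add: tr_with_def W_def lie_diff lie_scale form_diff[OF form_g] scale_g sum_subtractf)
    also have "\<dots> = \<Phi> (lie u x) y - \<Phi> (lie u y) x"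
      using parseval_N[OF y in_g(2)[OF ux(1)]] parseval_N[OF x in_g(2)[OF ux(2)]] by simp
    also have "\<dots> = \<Phi> u (lie x y) - \<Phi> u (lie y x)" using assoc ug g' by simp
    also have "\<Phi> u (lie y x) = - \<Phi> u (lie x y)"
      using scale_g(2)[of "lie x y" u "- 1"] lie_anti[of y x] g_closed g' ug by simp
    also have "\<Phi> u (lie x y) - - \<Phi> u (lie x y) = 2 * \<Phi> (lp (lie x y)) u"
      using form_lp[OF g_closed[OF g'(1,2)] u] sym[OF ug g_closed[OF g'(1,2)]] by simp
    finally show "\<Phi> (theta W) u = \<Phi> (2 *\<^sub>M lp (lie x y)) u"
      using form_theta[OF soN_D(1)[OF W] u] sym[OF in_g(1)[OF theta_L] ug] scale_g(1)[OF in_g(1)[OF lp_L] ug] by simp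
  qed
  then have "T W z = 2 *\<^sub>M lie (lp (lie x y)) z"
    using T_eq_iota_theta[OF W] z by (simp add: iota_def lie_scale)
  then have "lie (lp (lie x y)) z = lie (lp (lie x z)) y - lie (lp (lie y z)) x"
    using TW by simp
  moreover have "lie (lp (lie x z)) y = - lie (lp (lie z x)) y"
    using lie_anti[of x z] lp_neg[OF g_closed[OF g'(3,1)]] by (simp add: lie_neg)
  ultimately show ?thesis by simp
qed

lemma lp_NM: "x \<in> N \<Longrightarrow> y \<in> M \<Longrightarrow> lp (lie x y) = 0"
proof (rule lp_0)
  assume xy: "x \<in> N" "y \<in> M"
  show "lie x y \<in> g" using xy by (simp add: g_closed)
  fix w assume w: "w \<in> L"
  have "\<Phi> (lie x y) w = \<Phi> x (lie y w)" using assoc xy w by simp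
  also have "\<dots> = \<Phi> x ((- 1) *\<^sub>M lie w y)" using lie_anti[of y w] by simp
  also have "\<dots> = - \<Phi> x (lie w y)" using xy w M(3)[OF w xy(2)] by (simp only: scale_g in_g) simp
  also have "\<Phi> x (lie w y) = 0" using orth_NM[OF xy(1) M(3)[OF w xy(2)]] .
  finally show "\<Phi> (lie x y) w = 0" by simp
qed

lemma lp_MN: "x \<in> N \<Longrightarrow> y \<in> M \<Longrightarrow> lp (lie y x) = 0"
  using lp_NM[of x y] lp_neg[of "lie x y"] lie_anti[of y x] by (simp add: g_closed)

lemma lp_NN: "x \<in> N \<Longrightarrow> y \<in> N \<Longrightarrow> lp (lie x y) \<in> L1"
proof -
  assume xy: "x \<in> N" "y \<in> N"
  have "\<Phi> (lp (lie x y)) w = 0" if w: "w \<in> L" "ann w" for w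
  proof -
    have "\<Phi> (lp (lie x y)) w = \<Phi> (lie x y) w" using form_lp w xy g_closed by simp
    also have "\<dots> = \<Phi> w (lie x y)" using sym w xy g_closed by simp
    also have "\<dots> = \<Phi> (lie w x) y" using assoc w xy by simp
    also have "\<dots> = 0" using w xy by (simp add: ann_def form_zero[OF form_g])
    finally show ?thesis .
  qed
  then show ?thesis using lp_L by (simp add: L1_def)
qed

text \<open>The projection of \<open>[y, y']\<close> is orthogonal to \<open>L1\<close>, which contains the projections of all brackets
  of \<open>N\<close>.\<close>

lemma lp_MM_ann:
  assumes y: "y \<in> M" "y' \<in> M" and x: "x \<in> N"
  shows "lie (lp (lie y y')) x = 0"
proof (rule nondeg_N[OF N(3)[OF lp_L x]])
  fix x' assume x': "x' \<in> N"
  let ?u = "lp (lie x x')"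
  note u = lp_NN[OF x x']
  have "\<Phi> (lie (lp (lie y y')) x) x' = \<Phi> (lp (lie y y')) (lie x x')" using assoc lp_L x x' by simp
  also have "\<dots> = \<Phi> (lie x x') (lp (lie y y'))" using sym lp_L x x' g_closed by simp
  also have "\<dots> = \<Phi> ?u (lp (lie y y'))" using form_lp[OF _ lp_L] x x' g_closed by simp
  also have "\<dots> = \<Phi> (lp (lie y y')) ?u" using sym lp_L by simp
  also have "\<dots> = \<Phi> (lie y y') ?u" using form_lp[OF _ lp_L] y g_closed by simp
  also have "\<dots> = \<Phi> ?u (lie y y')" using sym lp_L y g_closed by simp
  also have "\<dots> = \<Phi> (lie ?u y) y'" using assoc lp_L y by simp
  also have "\<dots> = 0" using L1_kills_M[OF u y(1)] y by (simp add: form_zero[OF form_g])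
  finally show "\<Phi> (lie (lp (lie y y')) x) x' = 0" .
qed

text \<open>The complement \<open>\<mm> = N + M\<close> of \<open>L\<close>.\<close>

definition mm :: "('k^'n^'n) set" where "mm = {z \<in> g. \<forall>u\<in>L. \<Phi> u z = 0}"

lemma mm_sub: "mat_vs.subspace mm"
  unfolding mm_def using mat_vs.subspace_0[OF g_sub] add_g sub_g
  by (intro mat_vs.subspaceI) (auto simp: form_zero[OF form_g] form_add[OF form_g] scale_g)

lemma mm_g: "z \<in> mm \<Longrightarrow> z \<in> g" by (simp add: mm_def)

lemma N_mm: "x \<in> N \<Longrightarrow> x \<in> mm" and M_mm: "y \<in> M \<Longrightarrow> y \<in> mm"
  using orth_LN orth_LM by (auto simp: mm_def)

lemma mm_stable: "u \<in> L \<Longrightarrow> z \<in> mm \<Longrightarrow> lie u z \<in> mm"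
  using skew L_closed g_closed by (auto simp: mm_def) (metis in_g(1) neg_0_equal_iff_equal skew)

lemma mm_decomp:
  assumes "z \<in> mm" shows "\<exists>x\<in>N. \<exists>y\<in>M. z = x + y"
proof -
  obtain u x y where z: "u \<in> L" "x \<in> N" "y \<in> M" "z = u + x + y" using decomp[OF mm_g[OF assms]] by blast
  have "x + y \<in> mm" using mat_vs.subspace_add[OF mm_sub] N_mm M_mm z by blast
  moreover have "u = z - (x + y)" using z(4) by simp
  ultimately have "u \<in> mm" using mat_vs.subspace_diff[OF mm_sub assms] by metis
  then have "u = 0"
    using z(1) sym by (intro eq_in_L[OF z(1) mat_vs.subspace_0[OF subspace_L]]) (auto simp: mm_def form_zero[OF form_g])
  then show ?thesis using z by auto
qed

definition bianchi_sum :: "'k^'n^'n \<Rightarrow> 'k^'n^'n \<Rightarrow> 'k^'n^'n \<Rightarrow> 'k^'n^'n" where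
  "bianchi_sum x y z = lie (lp (lie x y)) z + lie (lp (lie y z)) x + lie (lp (lie z x)) y"

lemma bianchi_sum_rotate: "bianchi_sum x y z = bianchi_sum y z x"
  by (simp add: bianchi_sum_def algebra_simps)

lemma bianchi_sum_add:
  assumes "x \<in> g" "y \<in> g" "z \<in> g" "z' \<in> g"
  shows "bianchi_sum x y (z + z') = bianchi_sum x y z + bianchi_sum x y z'" "bianchi_sum x (z + z') y = bianchi_sum x z y + bianchi_sum x z' y"
  using assms g_closed by (simp_all add: bianchi_sum_def lie_add lp_add algebra_simps)

text \<open>For arguments in \<open>N\<close> this is \<open>bianchi_N\<close>; as soon as one of them is in \<open>M\<close>, each of the three terms
  vanishes separately.\<close>

lemma bianchi:
  assumes x: "x \<in> N" and y: "y \<in> mm" and z: "z \<in> mm"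
  shows "bianchi_sum x y z = 0"
proof -
  obtain y1 y2 where y': "y1 \<in> N" "y2 \<in> M" "y = y1 + y2" using mm_decomp[OF y] by blast
  obtain z1 z2 where z': "z1 \<in> N" "z2 \<in> M" "z = z1 + z2" using mm_decomp[OF z] by blast
  have 1: "bianchi_sum x y1 z1 = 0" unfolding bianchi_sum_def by (rule bianchi_N[OF x y'(1) z'(1)])
  have 2: "bianchi_sum x a b = 0" if "a \<in> N" "b \<in> M" for a b
    unfolding bianchi_sum_def using lp_NM[OF that] lp_MN[OF x that(2)] L1_kills_M[OF lp_NN[OF x that(1)] that(2)] by simp
  have 3: "bianchi_sum x a b = 0" if "a \<in> M" "b \<in> N" for a b
    unfolding bianchi_sum_def using lp_NM[OF x that(1)] lp_MN[OF that(2,1)] L1_kills_M[OF lp_NN[OF that(2) x] that(1)] by simp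
  have 4: "bianchi_sum x a b = 0" if "a \<in> M" "b \<in> M" for a b
    unfolding bianchi_sum_def using lp_NM[OF x that(1)] lp_MN[OF x that(2)] lp_MM_ann[OF that x] by simp
  have in_g': "x \<in> g" "y1 \<in> g" "y2 \<in> g" "z1 \<in> g" "z2 \<in> g" "z1 + z2 \<in> g"
    using x y' z' add_g by auto
  show ?thesis
    unfolding y'(3) z'(3) bianchi_sum_add(2)[OF in_g'(1,6,2,3)] bianchi_sum_add(1)[OF in_g'(1,2,4,5)] bianchi_sum_add(1)[OF in_g'(1,3,4,5)]
    using 1 2[OF y'(1) z'(2)] 3[OF y'(2) z'(1)] 4[OF y'(2) z'(2)] by simp
qed

section \<open>The homotopy for the Casimir operator\<close>

text \<open>The \<open>\<mm>\<close>-component of the bracket.\<close>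

definition om :: "'k^'n^'n \<Rightarrow> 'k^'n^'n \<Rightarrow> 'k^'n^'n" where
  "om x y = lie x y - lp (lie x y)"

text \<open>The union of the dual pairs of \<open>N\<close> and \<open>M\<close>, a dual pair of \<open>mm\<close>.\<close>

definition kk :: "nat \<Rightarrow> 'k^'n^'n" where "kk j = (if j < n then f j else h (j - n))"
definition kk' :: "nat \<Rightarrow> 'k^'n^'n" where "kk' j = (if j < n then f' j else h' (j - n))"

lemma sum_kk: "(\<Sum>j<n + m. G j) = (\<Sum>j<n. G j) + (\<Sum>j<m. G (n + j))" for G :: "nat \<Rightarrow> 'b::comm_monoid_add"
proof -
  have "(\<Sum>j<n + m. G j) = (\<Sum>j\<in>{0..<n} \<union> {n..<n + m}. G j)" by (rule sum.cong) auto
  also have "\<dots> = (\<Sum>j\<in>{0..<n}. G j) + (\<Sum>j\<in>{n..<n + m}. G j)" by (rule sum.union_disjoint) auto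
  also have "(\<Sum>j\<in>{n..<n + m}. G j) = (\<Sum>j\<in>{0..<m}. G (j + n))"
    using sum.shift_bounds_nat_ivl[of G 0 n m] by (simp add: add.commute)
  finally show ?thesis by (simp add: atLeast0LessThan add.commute)
qed

lemma kk_simps: "j < n \<Longrightarrow> kk j = f j" "j < n \<Longrightarrow> kk' j = f' j" "kk (n + j) = h j" "kk' (n + j) = h' j"
  by (simp_all add: kk_def kk'_def)

lemma kk_cases: "j < n + m \<Longrightarrow> (kk j \<in> N \<and> kk' j \<in> N) \<or> (kk j \<in> M \<and> kk' j \<in> M)"
  using fN hM by (auto simp: kk_def kk'_def)

lemma kk_mm: "j < n + m \<Longrightarrow> kk j \<in> mm" "j < n + m \<Longrightarrow> kk' j \<in> mm"
  using kk_cases[of j] N_mm M_mm by auto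

lemma expand_mm:
  assumes "z \<in> mm"
  shows "(\<Sum>j<n + m. \<Phi> z (kk' j) *\<^sub>M kk j) = z" "(\<Sum>j<n + m. \<Phi> z (kk j) *\<^sub>M kk' j) = z"
proof -
  obtain x y where z: "x \<in> N" "y \<in> M" "z = x + y" using mm_decomp[OF assms] by blast
  have N': "\<Phi> z a = \<Phi> x a" if "a \<in> N" for a
    using z that orth_NM[OF that z(2)] sym[of y a] by (simp add: form_add[OF form_g])
  have M': "\<Phi> z a = \<Phi> y a" if "a \<in> M" for a
    using z that orth_NM[OF z(1) that] by (simp add: form_add[OF form_g])
  show "(\<Sum>j<n + m. \<Phi> z (kk' j) *\<^sub>M kk j) = z" "(\<Sum>j<n + m. \<Phi> z (kk j) *\<^sub>M kk' j) = z"
    unfolding sum_kk using expand_N[OF z(1)] expand_M[OF z(2)] fN hM z(3)[symmetric] by (simp_all add: kk_simps N' M')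
qed

lemma lp_mm: "z \<in> mm \<Longrightarrow> lp z = 0"
  by (rule lp_0[OF mm_g]) (auto simp: mm_def sym[of z])

lemma om_mm: "x \<in> g \<Longrightarrow> y \<in> g \<Longrightarrow> om x y \<in> mm"
  unfolding mm_def om_def
  using g_closed form_lp lp_L sym diff_g by (auto simp: form_diff[OF form_g])

lemma form_om: "x \<in> g \<Longrightarrow> y \<in> g \<Longrightarrow> z \<in> mm \<Longrightarrow> \<Phi> (om x y) z = \<Phi> (lie x y) z"
  using lp_L[of "lie x y"] g_closed by (simp add: om_def form_diff[OF form_g] mm_g) (simp add: mm_def)

lemma om_swap: "x \<in> g \<Longrightarrow> y \<in> g \<Longrightarrow> om y x = - om x y"
  using lie_anti[of y x] lp_neg[of "lie x y"] g_closed by (simp add: om_def)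

lemma lp_equivariant: "u \<in> L \<Longrightarrow> z \<in> g \<Longrightarrow> lp (lie u z) = lie u (lp z)"
proof (rule lp_eqI)
  assume uz: "u \<in> L" "z \<in> g"
  show "lie u z \<in> g" "lie u (lp z) \<in> L" using uz g_closed L_closed lp_L by auto
  fix w assume w: "w \<in> L"
  have "\<Phi> (lie u z) w = - \<Phi> z (lie u w)" using skew uz w by simp
  also have "\<dots> = - \<Phi> (lp z) (lie u w)" using form_lp[OF uz(2) L_closed[OF uz(1) w]] by simp
  also have "\<dots> = \<Phi> (lie u (lp z)) w" using skew uz w lp_L by simp
  finally show "\<Phi> (lie u z) w = \<Phi> (lie u (lp z)) w" .
qed

lemma om_equivariant:
  assumes "u \<in> L" "x \<in> g" "y \<in> g"
  shows "lie u (om x y) = om (lie u x) y + om x (lie u y)"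
proof -
  have j: "lie u (lie x y) = lie (lie u x) y + lie x (lie u y)" by (simp add: lie_lie)
  have "lie u (om x y) = lie u (lie x y) - lp (lie u (lie x y))"
    using assms g_closed by (simp add: om_def lie_diff lp_equivariant)
  then show ?thesis unfolding j using assms g_closed by (simp add: om_def lp_add)
qed

text \<open>Expand \<open>[e\<^sub>i, z]\<close> in the dual pair of \<open>mm\<close> and move the form to \<open>[z, kk']\<close>; the sum over \<open>i\<close> then
  assembles the projection to \<open>L\<close>.\<close>

lemma C_via_mm:
  assumes z: "z \<in> mm"
  shows "(\<Sum>j<n + m. lie (lp (lie z (kk' j))) (kk j)) = C lie z"
proof -
  have "C lie z = (\<Sum>i<r + s. \<Sum>j<n + m. \<Phi> (lie z (kk' j)) (e i) *\<^sub>M lie (e' i) (kk j))"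
    unfolding cas_def
  proof (rule sum.cong[OF refl])
    fix i assume "i \<in> {..<r + s}"
    then have i: "e i \<in> L" "e' i \<in> L" using eL by auto
    have "lie (e' i) (lie (e i) z) = lie (e' i) (\<Sum>j<n + m. \<Phi> (lie (e i) z) (kk' j) *\<^sub>M kk j)"
      by (simp only: expand_mm(1)[OF mm_stable[OF i(1) z]])
    also have "\<dots> = (\<Sum>j<n + m. \<Phi> (lie z (kk' j)) (e i) *\<^sub>M lie (e' i) (kk j))"
    proof -
      have "\<Phi> (lie (e i) z) (kk' j) = \<Phi> (lie z (kk' j)) (e i)" if "j < n + m" for j
        using assoc[of "e i" z "kk' j"] sym[of "e i" "lie z (kk' j)"] i kk_mm(2)[OF that] mm_g z g_closed by simp
      then show ?thesis by (simp add: lie_sum lie_scale)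
    qed
    finally show "lie (e' i) (lie (e i) z) = (\<Sum>j<n + m. \<Phi> (lie z (kk' j)) (e i) *\<^sub>M lie (e' i) (kk j))" .
  qed
  also have "\<dots> = (\<Sum>j<n + m. lie (\<Sum>i<r + s. \<Phi> (lie z (kk' j)) (e i) *\<^sub>M e' i) (kk j))"
    by (subst sum.swap) (simp add: lie_sum lie_scale)
  also have "\<dots> = (\<Sum>j<n + m. lie (lp (lie z (kk' j))) (kk j))"
  proof (rule sum.cong[OF refl])
    fix j assume "j \<in> {..<n + m}"
    then have j: "lie z (kk' j) \<in> g" using z kk_mm mm_g g_closed by simp
    have "(\<Sum>i<r + s. \<Phi> (lie z (kk' j)) (e i) *\<^sub>M e' i) = (\<Sum>i<r + s. \<Phi> (lp (lie z (kk' j))) (e i) *\<^sub>M e' i)"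
      using form_lp[OF j] eL by simp
    also have "\<dots> = lp (lie z (kk' j))" by (rule expand_L(2)[OF lp_L])
    finally show "lie (\<Sum>i<r + s. \<Phi> (lie z (kk' j)) (e i) *\<^sub>M e' i) (kk j) = lie (lp (lie z (kk' j))) (kk j)" by simp
  qed
  finally show ?thesis ..
qed

text \<open>The value \<open>\<Phi> y u = 0\<close> of the Killing form is this trace plus the trace on \<open>L\<close>, and the latter vanishes
  because \<open>y\<close> maps \<open>L\<close> into \<open>mm\<close>.\<close>

lemma trace_mm_0:
  assumes y: "y \<in> mm" and u: "u \<in> L"
  shows "(\<Sum>j<n + m. \<Phi> (lie y (lie u (kk j))) (kk' j)) = 0"
proof -
  have yg: "y \<in> g" by (rule mm_g[OF y])
  have "0 = \<Phi> y u" using y u yg sym[of y u] by (simp add: mm_def)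
  also have "\<dots> = ml.tr g (\<lambda>z. lie y (lie u z))" using \<Phi>_trace[OF yg] u by (simp add: tform_def)
  also have "\<dots> = (\<Sum>i<r + s. \<Phi> (lie y (lie u (e i))) (e' i)) + (\<Sum>a<n. \<Phi> (lie y (lie u (f a))) (f' a)) + (\<Sum>b<m. \<Phi> (lie y (lie u (h b))) (h' b))"
    by (rule tr_g[OF lin_on_lie2]) (use yg u g_closed in auto)
  also have "(\<Sum>i<r + s. \<Phi> (lie y (lie u (e i))) (e' i)) = 0"
  proof (rule sum.neutral, rule ballI)
    fix i assume "i \<in> {..<r + s}"
    then have i: "e i \<in> L" "e' i \<in> L" using eL by auto
    have "\<Phi> (lie y (lie u (e i))) (e' i) = \<Phi> y (lie (lie u (e i)) (e' i))" using assoc yg u i g_closed by simp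
    also have "\<dots> = 0" using y sym[of y] yg L_closed[OF L_closed[OF u i(1)] i(2)] by (simp add: mm_def)
    finally show "\<Phi> (lie y (lie u (e i))) (e' i) = 0" .
  qed
  finally show ?thesis by (simp add: sum_kk kk_simps)
qed

text \<open>Paired with \<open>u \<in> L\<close>, the sum is the negative of the trace of \<open>trace_mm_0\<close>.\<close>

lemma sum_lp_om_0:
  assumes y: "y \<in> mm" shows "(\<Sum>j<n + m. lp (lie (kk j) (om y (kk' j)))) = 0"
proof (rule eq_in_L[OF _ mat_vs.subspace_0[OF subspace_L]])
  show "(\<Sum>j<n + m. lp (lie (kk j) (om y (kk' j)))) \<in> L" by (intro L_sum lp_L)
  fix u assume u: "u \<in> L"
  have yg: "y \<in> g" by (rule mm_g[OF y])
  have "\<Phi> (\<Sum>j<n + m. lp (lie (kk j) (om y (kk' j)))) u = (\<Sum>j<n + m. \<Phi> (lp (lie (kk j) (om y (kk' j)))) u)"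
    by (rule form_sum_g(1)) (use u lp_L in auto)
  also have "\<dots> = (\<Sum>j<n + m. - \<Phi> (lie y (lie u (kk j))) (kk' j))"
  proof (rule sum.cong[OF refl])
    fix j assume "j \<in> {..<n + m}"
    then have j: "kk j \<in> mm" "kk' j \<in> mm" "kk j \<in> g" "kk' j \<in> g" using kk_mm mm_g by auto
    have o: "om y (kk' j) \<in> g" using om_mm[OF yg j(4)] mm_g by simp
    have k: "lie u (kk j) \<in> mm" "lie u (kk j) \<in> g" using mm_stable[OF u j(1)] mm_g by auto
    have "\<Phi> (lp (lie (kk j) (om y (kk' j)))) u = \<Phi> (lie (kk j) (om y (kk' j))) u"
      using form_lp u j o g_closed by simp
    also have "\<dots> = \<Phi> (lie u (kk j)) (om y (kk' j))" using sym[of "lie (kk j) (om y (kk' j))" u] assoc[of u "kk j" "om y (kk' j)"] u j o g_closed by simp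
    also have "\<dots> = \<Phi> (om y (kk' j)) (lie u (kk j))" using sym k o by simp
    also have "\<dots> = \<Phi> (lie y (kk' j)) (lie u (kk j))" by (rule form_om[OF yg j(4) k(1)])
    also have "\<dots> = \<Phi> (lie u (kk j)) (lie y (kk' j))" using sym k yg j g_closed by simp
    also have "\<dots> = - \<Phi> (lie y (lie u (kk j))) (kk' j)" using skew[OF yg k(2) j(4)] by simp
    finally show "\<Phi> (lp (lie (kk j) (om y (kk' j)))) u = - \<Phi> (lie y (lie u (kk j))) (kk' j)" .
  qed
  also have "\<dots> = 0" using trace_mm_0[OF y u] by (simp add: sum_negf)
  also have "\<dots> = \<Phi> 0 u" using u by (simp add: form_zero[OF form_g])
  finally show "\<Phi> (\<Sum>j<n + m. lp (lie (kk j) (om y (kk' j)))) u = \<Phi> 0 u" .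
qed

text \<open>Two sums in the computation of \<open>C (om x y)\<close> reduce to this one: \<open>DD_via_mm\<close> and
  \<open>sum_lie_om_bianchi\<close>.\<close>

definition DD where "DD x y = (\<Sum>i<r + s. lie (e i) (om y (lie (e' i) x)))"

lemma om_lin: "y \<in> g \<Longrightarrow> lin_on mscale g mscale (om y)"
  using g_closed by (auto simp: lin_on_def om_def lie_add lie_scale lp_add lp_scale mat_vs.scale_right_diff_distrib)

lemma DD_via_mm:
  assumes x: "x \<in> mm" and y: "y \<in> mm"
  shows "(\<Sum>j<n + m. lie (lp (lie x (kk j))) (om y (kk' j))) = DD x y"
proof -
  note xy = mm_g[OF x] mm_g[OF y]
  have 1: "\<Phi> (lie x (kk j)) (e' i) = \<Phi> (lie (e' i) x) (kk j)" if "i < r + s" "j < n + m" for i j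
    using assoc[of "e' i" x "kk j"] sym eL that kk_mm mm_g xy g_closed by simp
  have "(\<Sum>j<n + m. lie (lp (lie x (kk j))) (om y (kk' j))) =
      (\<Sum>j<n + m. \<Sum>i<r + s. lie (e i) (\<Phi> (lie (e' i) x) (kk j) *\<^sub>M om y (kk' j)))"
    unfolding lp_def by (intro sum.cong[OF refl]) (simp add: lie_sum lie_scale 1)
  also have "\<dots> = (\<Sum>i<r + s. lie (e i) (\<Sum>j<n + m. \<Phi> (lie (e' i) x) (kk j) *\<^sub>M om y (kk' j)))"
    by (subst sum.swap) (simp add: lie_sum)
  also have "\<dots> = (\<Sum>i<r + s. lie (e i) (om y (lie (e' i) x)))"
  proof (rule sum.cong[OF refl])
    fix i assume "i \<in> {..<r + s}"
    then have i: "lie (e' i) x \<in> mm" using mm_stable[OF _ x] eL by simp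
    have "om y (lie (e' i) x) = om y (\<Sum>j<n + m. \<Phi> (lie (e' i) x) (kk j) *\<^sub>M kk' j)"
      by (simp only: expand_mm(2)[OF i])
    also have "\<dots> = (\<Sum>j<n + m. om y (\<Phi> (lie (e' i) x) (kk j) *\<^sub>M kk' j))"
      by (rule ml.lin_on_sum[OF g_sub om_lin[OF xy(2)]]) (use kk_mm mm_g sub_g in auto)
    also have "\<dots> = (\<Sum>j<n + m. \<Phi> (lie (e' i) x) (kk j) *\<^sub>M om y (kk' j))"
      using kk_mm mm_g by (intro sum.cong refl) (simp add: lin_onD(2)[OF om_lin[OF xy(2)]])
    finally show "lie (e i) (\<Sum>j<n + m. \<Phi> (lie (e' i) x) (kk j) *\<^sub>M om y (kk' j)) = lie (e i) (om y (lie (e' i) x))" by simp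
  qed
  finally show ?thesis by (simp add: DD_def)
qed

lemma sum_lie_om_bianchi:
  assumes x: "x \<in> mm" and y: "y \<in> mm" and b: "\<And>j. j < n + m \<Longrightarrow> bianchi_sum (om y (kk' j)) x (kk j) = 0"
  shows "(\<Sum>j<n + m. lie (lp (lie (om y (kk' j)) x)) (kk j)) = - DD x y"
proof -
  have "(\<Sum>j<n + m. lie (lp (lie (om y (kk' j)) x)) (kk j)) =
     (\<Sum>j<n + m. - lie (lp (lie x (kk j))) (om y (kk' j)) - lie (lp (lie (kk j) (om y (kk' j)))) x)"
    using b by (intro sum.cong refl) (simp add: bianchi_sum_def eq_neg_iff_add_eq_0 algebra_simps)
  also have "\<dots> = - (\<Sum>j<n + m. lie (lp (lie x (kk j))) (om y (kk' j))) - lie (\<Sum>j<n + m. lp (lie (kk j) (om y (kk' j)))) x"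
    by (simp add: sum_subtractf sum_negf lie_sum)
  finally show ?thesis by (simp add: DD_via_mm[OF x y] sum_lp_om_0[OF y])
qed

lemma rep_g: "lie_rep L mscale g lie"
  by (rule lie_rep_adjoint[OF g_sub]) (auto intro: g_closed)

text \<open>Write \<open>C (om x y)\<close> as in \<open>C_via_mm\<close>.  The \<open>L\<close>-part of the Jacobi identity and the Bianchi identity give
  \<open>DD x y - DD y x\<close>, whereas the derivation property of \<open>L\<close> gives \<open>DD y x - DD x y\<close>.\<close>

lemma C_om_0:
  assumes x: "x \<in> mm" and y: "y \<in> mm"
    and b: "\<And>j. j < n + m \<Longrightarrow> bianchi_sum (om y (kk' j)) x (kk j) = 0" "\<And>j. j < n + m \<Longrightarrow> bianchi_sum (om x (kk' j)) y (kk j) = 0"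
  shows "C lie (om x y) = 0"
proof -
  note xy = mm_g[OF x] mm_g[OF y]
  have om: "om x y \<in> mm" by (rule om_mm[OF xy])
  (* the component in L of the Jacobi identity of x, y, k *)
  have jac: "lp (lie (om x y) k) = lp (lie (om x k) y) - lp (lie (om y k) x)" if k: "k \<in> mm" for k
  proof -
    note kg = mm_g[OF k]
    have in_mm: "lie (lp z) w \<in> mm" if "w \<in> mm" for z w by (rule mm_stable[OF lp_L that])
    have l: "lp (lie (om a b) c) = lp (lie (lie a b) c)" if "a \<in> mm" "b \<in> mm" "c \<in> mm" for a b c
    proof -
      have "lie (lie a b) c = lie (om a b) c + lie (lp (lie a b)) c" by (simp add: om_def lie_diff)
      moreover have "lp (lie (lp (lie a b)) c) = 0" by (rule lp_mm[OF in_mm[OF that(3)]])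
      moreover have "lie (om a b) c \<in> g" "lie (lp (lie a b)) c \<in> g"
        using om_mm that mm_g g_closed in_mm by auto
      ultimately show ?thesis by (simp add: lp_add)
    qed
    have "lie (lie x y) k = lie (lie x k) y - lie (lie y k) x"
      using lie_anti[of x "lie y k"] lie_anti[of "lie x k" y] by (simp add: lie_lie lie_anti[of y k] lie_neg algebra_simps)
    then have "lp (lie (lie x y) k) = lp (lie (lie x k) y) - lp (lie (lie y k) x)"
      using ml.lin_on_diff[OF g_sub lp_lin] xy kg g_closed by simp
    then show ?thesis by (simp add: l x y k)
  qed
  have "C lie (om x y) = (\<Sum>j<n + m. lie (lp (lie (om x y) (kk' j))) (kk j))" by (rule C_via_mm[OF om, symmetric])
  also have "\<dots> = (\<Sum>j<n + m. lie (lp (lie (om x (kk' j)) y)) (kk j)) - (\<Sum>j<n + m. lie (lp (lie (om y (kk' j)) x)) (kk j))"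
    using kk_mm by (simp add: jac lie_diff sum_subtractf)
  also have "\<dots> = DD x y - DD y x"
    by (simp add: sum_lie_om_bianchi[OF x y b(1)] sum_lie_om_bianchi[OF y x b(2)])
  also have "\<dots> = - (\<Sum>i<r + s. lie (e i) (lie (e' i) (om x y)))"
    unfolding DD_def sum_subtractf[symmetric] sum_negf[symmetric]
  proof (rule sum.cong[OF refl])
    fix i assume "i \<in> {..<r + s}"
    then have i: "e' i \<in> L" using eL by simp
    have "om y (lie (e' i) x) = - om (lie (e' i) x) y" using om_swap[of "lie (e' i) x" y] i xy g_closed by simp
    then show "lie (e i) (om y (lie (e' i) x)) - lie (e i) (om x (lie (e' i) y)) = - lie (e i) (lie (e' i) (om x y))"
      by (simp add: om_equivariant[OF i xy] lie_add lie_neg)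
  qed
  also have "(\<Sum>i<r + s. lie (e i) (lie (e' i) (om x y))) = C lie (om x y)"
    using cas_independent[OF rep_g lie_subalgebra inv dual_pair_swap[OF dual_e] dual_e mm_g[OF om]] by (simp add: cas_def)
  finally have "C lie (om x y) = - C lie (om x y)" .
  then have "2 *\<^sub>M C lie (om x y) = 0"
    using mat_vs.scale_left_distrib[of 1 1 "C lie (om x y)"] by (simp add: eq_neg_iff_add_eq_0)
  then show ?thesis by simp
qed

lemma C_form_0:
  assumes z: "z \<in> g" "C lie z = 0" and x: "x \<in> N" shows "\<Phi> z x = 0"
proof -
  have "(1 / 2) * \<Phi> z x = \<Phi> z (\<Sum>i<r + s. lie (e i) (lie (e' i) x))"
    using half_swapped[OF x] z x by (simp add: scale_g)
  also have "\<dots> = (\<Sum>i<r + s. \<Phi> z (lie (e i) (lie (e' i) x)))"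
    by (rule form_sum_g(2)) (use z x eL g_closed in auto)
  also have "\<dots> = (\<Sum>i<r + s. \<Phi> (lie (e' i) (lie (e i) z)) x)"
  proof (rule sum.cong[OF refl])
    fix i assume "i \<in> {..<r + s}"
    then have i: "e i \<in> g" "e' i \<in> g" using eL by auto
    show "\<Phi> z (lie (e i) (lie (e' i) x)) = \<Phi> (lie (e' i) (lie (e i) z)) x"
      using skew[of "e' i" "lie (e i) z" x] skew[of "e i" z "lie (e' i) x"] i x z g_closed by simp
  qed
  also have "\<dots> = \<Phi> (C lie z) x"
    unfolding cas_def by (rule form_sum_g(1)[symmetric]) (use z x eL g_closed in auto)
  finally show ?thesis using z x by (simp add: form_zero[OF form_g])
qed

section \<open>An ideal\<close>

text \<open>\<open>C\<close> is self-adjoint and acts by \<open>1/2\<close> on \<open>N\<close>, so its kernel is orthogonal to \<open>N\<close>.\<close>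

lemma om_NN_M:
  assumes x: "x \<in> N" and y: "y \<in> N" shows "om x y \<in> M"
proof -
  have C0: "C lie (om x y) = 0"
    by (rule C_om_0[OF N_mm[OF x] N_mm[OF y]])
       (use bianchi bianchi_sum_rotate om_mm kk_mm mm_g x y N_mm in metis)+
  obtain a b where ab: "a \<in> N" "b \<in> M" "om x y = a + b" using mm_decomp[OF om_mm] x y by (metis in_g(2))
  have "\<Phi> a x' = 0" if x': "x' \<in> N" for x'
    using C_form_0[OF mm_g[OF om_mm] C0 x'] ab x y x' orth_NM[OF x' ab(2)] sym[of b x']
    by (simp add: form_add[OF form_g])
  then have "a = 0" by (rule nondeg_N[OF ab(1)])
  then show ?thesis using ab by simp
qed

lemma active_sum_N:
  assumes x: "x \<in> N" shows "x = 2 *\<^sub>M (\<Sum>i\<in>active. lie (e' i) (lie (e i) x))"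
proof -
  have "(\<Sum>i\<in>active. lie (e' i) (lie (e i) x)) = C lie x"
    unfolding cas_def using active_subset inactive_ann(1) x
    by (intro sum.mono_neutral_left) (auto simp: ann_def)
  then show ?thesis using half[OF x] by simp
qed

text \<open>\<open>N\<close> is spanned by values of the active vectors, which kill \<open>M\<close>; hence \<open>om x y\<close> is orthogonal to \<open>M\<close> and
  lies in \<open>N\<close>.  This also makes the Bianchi identity available for \<open>C_om_0\<close>, and \<open>C\<close> is invertible on \<open>N\<close>.\<close>

lemma NM_commute:
  assumes x: "x \<in> N" and y: "y \<in> M" shows "lie x y = 0"
proof -
  have om_N: "om x y \<in> N" if x: "x \<in> N" and y: "y \<in> M" for x y
  proof -
    note xy = in_g(2)[OF x] in_g(3)[OF y]
    obtain a b where ab: "a \<in> N" "b \<in> M" "om x y = a + b" using mm_decomp[OF om_mm[OF xy]] by blast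
    have "\<Phi> b y' = 0" if y': "y' \<in> M" for y'
    proof -
      note y'g = in_g(3)[OF y']
      have act0: "\<Phi> (lie (e' i) v) (lie y y') = 0" if i: "i \<in> active" and v: "v \<in> N" for i v
      proof -
        have ei: "e' i \<in> g" using i active_subset eL by auto
        have "\<Phi> (lie (e' i) v) (lie y y') = - \<Phi> v (lie (e' i) (lie y y'))"
          by (rule skew[OF ei]) (use v y y' g_closed in auto)
        also have "lie (e' i) (lie y y') = lie (lie (e' i) y) y' + lie y (lie (e' i) y')" by (simp add: lie_lie)
        also have "\<dots> = 0" using active_kills_M(2)[OF i] y y' by simp
        finally show ?thesis using v by (simp add: form_zero[OF form_g])
      qed
      have in_N: "lie (e' i) (lie (e i) x) \<in> N" if "i \<in> active" for i
        using that active_subset eL N(3) x by auto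
      have S_N: "(\<Sum>i\<in>active. lie (e' i) (lie (e i) x)) \<in> N" by (rule mat_vs.subspace_sum[OF N(1) in_N])
      have "\<Phi> b y' = \<Phi> (om x y) y'"
        using ab orth_NM[OF ab(1) y'] y' by (simp add: form_add[OF form_g])
      also have "\<dots> = \<Phi> x (lie y y')" using form_om[OF xy M_mm[OF y']] assoc xy y' by simp
      also have "\<dots> = \<Phi> (2 *\<^sub>M (\<Sum>i\<in>active. lie (e' i) (lie (e i) x))) (lie y y')"
        using active_sum_N[OF x] by simp
      also have "\<dots> = 2 * \<Phi> (\<Sum>i\<in>active. lie (e' i) (lie (e i) x)) (lie y y')"
        using S_N y y' g_closed by (intro scale_g) auto
      also have "\<Phi> (\<Sum>i\<in>active. lie (e' i) (lie (e i) x)) (lie y y') = (\<Sum>i\<in>active. \<Phi> (lie (e' i) (lie (e i) x)) (lie y y'))"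
        by (rule form_sum_g(1)) (use in_N y y' g_closed in auto)
      also have "\<dots> = 0" using act0 N(3) eL active_subset x by (intro sum.neutral) auto
      finally show ?thesis by simp
    qed
    then have "b = 0" by (rule nondeg_M[OF ab(2)])
    then show ?thesis using ab by simp
  qed
  (* k is in N, or k and its dual vector are both in M and then om x k lies in N *)
  have b2: "bianchi_sum (om x (kk' j)) y (kk j) = 0" if j: "j < n + m" for j
  proof (cases "kk j \<in> N")
    case True
    then have "bianchi_sum (kk j) (om x (kk' j)) y = 0"
      using bianchi om_mm kk_mm[OF j] mm_g x M_mm[OF y] by simp
    then show ?thesis using bianchi_sum_rotate[of "kk j"] by simp
  next
    case False
    then have "kk' j \<in> M" using kk_cases[OF j] by blast
    then show ?thesis using bianchi[OF om_N[OF x] M_mm[OF y] kk_mm(1)[OF j]] by simp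
  qed
  have b1: "bianchi_sum (om y (kk' j)) x (kk j) = 0" if j: "j < n + m" for j
    using bianchi[OF x kk_mm(1)[OF j] om_mm[OF in_g(3)[OF y] mm_g[OF kk_mm(2)[OF j]]]]
      bianchi_sum_rotate[of "om y (kk' j)" x "kk j"] by simp
  have "C lie (om x y) = 0" by (rule C_om_0[OF N_mm[OF x] M_mm[OF y] b1 b2])
  then have "(1 / 2) *\<^sub>M om x y = 0" using half[OF om_N[OF x y]] by simp
  then have "om x y = 0" by simp
  then show ?thesis using lp_NM[OF x y] by (simp add: om_def)
qed

lemma NN_L1:
  assumes x: "x \<in> N" and y: "y \<in> N" shows "lie x y \<in> L1"
proof -
  have "om x y = 0"
  proof (rule nondeg_M[OF om_NN_M[OF x y]])
    fix z assume z: "z \<in> M"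
    have "\<Phi> (om x y) z = \<Phi> x (lie y z)" using form_om[OF _ _ M_mm[OF z]] assoc x y z by simp
    then show "\<Phi> (om x y) z = 0" using NM_commute[OF y z] x by (simp add: form_zero[OF form_g])
  qed
  then show ?thesis using lp_NN[OF x y] by (simp add: om_def)
qed

theorem half_exhausts:
  assumes simple: "simple_lie_algebra g" and N0: "N \<noteq> {0}"
  shows "M = {0}"
proof -
  define I where "I = {u + x | u x. u \<in> L1 \<and> x \<in> N}"
  have I_sub: "mat_vs.subspace I" unfolding I_def by (rule mat_vs.subspace_sums[OF L1_sub N(1)])
  have in_I: "u \<in> L1 \<Longrightarrow> u \<in> I" "x \<in> N \<Longrightarrow> x \<in> I" for u x
    using mat_vs.subspace_0[OF L1_sub] mat_vs.subspace_0[OF N(1)] by (auto simp: I_def) (metis add.right_neutral, metis add.left_neutral)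
  have "lie_ideal I g"
    unfolding lie_ideal_def
  proof (intro conjI ballI I_sub)
    show "I \<subseteq> g" unfolding I_def using L1_L add_g by auto
    fix z w assume "z \<in> g" "w \<in> I"
    then obtain u x y where z: "u \<in> L" "x \<in> N" "y \<in> M" "z = u + x + y" using decomp by blast
    obtain v a where w: "v \<in> L1" "a \<in> N" "w = v + a" using \<open>w \<in> I\<close> by (auto simp: I_def)
    have "lie x v = - lie v x" "lie y v = - lie v y" "lie y a = - lie a y"
      using lie_anti by auto
    then have "lie z w = (lie u v + lie x a) + (lie u a + - lie v x)"
      unfolding z(4) w(3) using L1_kills_M[OF w(1) z(3)] NM_commute[OF w(2) z(3)] by (simp add: lie_add)
    moreover have "lie u v + lie x a \<in> L1"
      using L1_stable z w NN_L1 mat_vs.subspace_add[OF L1_sub] by simp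
    moreover have "lie u a + - lie v x \<in> N"
      using N(3) z w L1_L mat_vs.subspace_diff[OF N(1)] by simp
    ultimately show "lie z w \<in> I" unfolding I_def by blast
  qed
  then have "I = {0} \<or> I = g" using simple by (simp add: simple_lie_algebra_def)
  moreover have "I \<noteq> {0}" using N0 in_I(2) mat_vs.subspace_0[OF N(1)] by blast
  ultimately have I: "I = g" by simp
  have "y = 0" if y: "y \<in> M" for y
  proof (rule nondeg_M[OF y])
    fix y' assume y': "y' \<in> M"
    obtain u x where ux: "u \<in> L1" "x \<in> N" "y = u + x"
    proof -
      have "y \<in> I" unfolding I using y by simp
      then show ?thesis unfolding I_def using that by blast
    qed
    then show "\<Phi> y y' = 0"
      using orth_LM[OF L1_L[OF ux(1)] y'] orth_NM[OF ux(2) y'] L1_L[OF ux(1)] y' by (simp add: form_add[OF form_g])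
  qed
  then show ?thesis using mat_vs.subspace_0[OF M(1)] by auto
qed

end

section \<open>Maximal rational tori\<close>

text \<open>The situation of the theorem: \<open>L\<close> is the Lie algebra of the matrix group \<open>A\<close> and has dual bases for the
  Killing form, and \<open>N\<close> is the eigenspace.\<close>

locale half_eigenspace =
  fixes g L A N :: "('k::{alg_closed_field, field_char_0}^'n^'n) set" and d :: nat and p p' :: "nat \<Rightarrow> 'k^'n^'n"
  assumes simple: "simple_lie_algebra g"
    and L: "lie_subalgebra L" "L \<subseteq> g" "L = Lie_of A"
    and A: "mat 1 \<in> A" "\<And>a b. a \<in> A \<Longrightarrow> b \<in> A \<Longrightarrow> a ** b \<in> A"
    and dual_L: "dual_pair (tform g) L d p p'"
    and N_def: "N = {x \<in> g. (\<forall>u\<in>L. tform g u x = 0) \<and> cas d p p' lie x = (1 / 2) *\<^sub>M x}"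
    and N_nonzero: "N \<noteq> {0}"
begin

abbreviation \<Phi> where "\<Phi> \<equiv> tform g"

lemma g_lie: "lie_subalgebra g" using simple by (simp add: simple_lie_algebra_def)

lemmas g_sub = lie_subalgebraD(1)[OF g_lie]
lemmas g_closed = lie_subalgebraD(2)[OF g_lie]
lemmas L_sub = lie_subalgebraD(1)[OF L(1)]
lemmas L_closed = lie_subalgebraD(2)[OF L(1)]
lemmas fdg = fin_dim_matrices[OF g_sub]
lemmas g_0 = mat_vs.subspace_0[OF g_sub] and g_add = mat_vs.subspace_add[OF g_sub]
  and g_diff = mat_vs.subspace_diff[OF g_sub]
  and g_scale = mat_vs.subspace_scale[OF g_sub] and g_sum = mat_vs.subspace_sum[OF g_sub]
lemmas L_scale = mat_vs.subspace_scale[OF L_sub] and L_sum = mat_vs.subspace_sum[OF L_sub]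

lemma L_g: "u \<in> L \<Longrightarrow> u \<in> g" using L(2) by auto

lemma form: "invariant_form g \<Phi>" by (rule tform_invariant[OF g_sub g_closed])

lemmas form_g = form g_sub

lemma inv: "invariant_form L \<Phi>"
  using form L(2) unfolding invariant_form_def by (meson subsetD)

lemma sym: "x \<in> g \<Longrightarrow> y \<in> g \<Longrightarrow> \<Phi> x y = \<Phi> y x" by (rule invariant_formD(1)[OF form])
lemma assoc: "x \<in> g \<Longrightarrow> y \<in> g \<Longrightarrow> z \<in> g \<Longrightarrow> \<Phi> (lie x y) z = \<Phi> x (lie y z)"
  by (rule invariant_formD(4)[OF form])
lemma skew: "x \<in> g \<Longrightarrow> y \<in> g \<Longrightarrow> z \<in> g \<Longrightarrow> \<Phi> (lie x y) z = - \<Phi> y (lie x z)"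
  by (rule form_lie_swap[OF form_g]) (auto intro: g_closed)

lemma p_in: "i < d \<Longrightarrow> p i \<in> L" "i < d \<Longrightarrow> p' i \<in> L"
  using dual_pairD(1,2)[OF dual_L] by auto

lemma nondeg_L:
  assumes "u \<in> L" "\<And>w. w \<in> L \<Longrightarrow> \<Phi> u w = 0" shows "u = 0"
proof -
  have "u = (\<Sum>i<d. \<Phi> u (p' i) *\<^sub>M p i)" using dual_pairD(3)[OF dual_L assms(1)] by simp
  then show ?thesis using assms(2) p_in by simp
qed

text \<open>The radical is an ideal.  If it were \<open>g\<close>, the dual bases of \<open>L\<close> would be empty, \<open>C\<close> would be \<open>0\<close> and \<open>N\<close>
  too.\<close>

lemma nondeg:
  assumes "x \<in> g" "\<And>y. y \<in> g \<Longrightarrow> \<Phi> x y = 0" shows "x = 0"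
proof -
  let ?R = "{x \<in> g. \<forall>y\<in>g. \<Phi> x y = 0}"
  have "lie_ideal ?R g"
    unfolding lie_ideal_def
  proof (intro conjI ballI)
    show "mat_vs.subspace ?R"
      using g_0 g_add g_scale
      by (intro mat_vs.subspaceI) (auto simp: form_zero[OF form_g] form_add[OF form_g] form_scale[OF form_g])
    fix u x assume "u \<in> g" "x \<in> ?R"
    then show "lie u x \<in> ?R" using skew g_closed by simp
  qed auto
  then have "?R = {0} \<or> ?R = g" using simple by (simp add: simple_lie_algebra_def)
  moreover have "?R \<noteq> g"
  proof
    assume R: "?R = g"
    have "p i = 0" if "i < d" for i
      using R p_in(1)[OF that] L_g by (intro nondeg_L) auto
    then have "cas d p p' lie x = 0" for x by (simp add: cas_def)
    then have "N \<subseteq> {0}" by (auto simp: N_def)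
    moreover have "0 \<in> N" using R L_g g_0 by (auto simp: N_def cas_def)
    ultimately show False using N_nonzero by auto
  qed
  ultimately have "?R = {0}" by simp
  then show ?thesis using assms by auto
qed

text \<open>On such elements the Killing form is a sum of squares of rational numbers (\<open>rat_diag_form\<close>), which
  replaces the positivity of a real form.\<close>

definition rat_diag :: "'k^'n^'n \<Rightarrow> bool" where
  "rat_diag x \<longleftrightarrow> g \<subseteq> mat_vs.span {z \<in> g. \<exists>c\<in>range of_rat. lie x z = c *\<^sub>M z}"

lemma rat_diag_form:
  assumes x: "x \<in> g" "rat_diag x"
  obtains q where "q \<ge> 0" "\<Phi> x x = of_rat q" "q = 0 \<Longrightarrow> x = 0"
proof -
  let ?E = "{z \<in> g. \<exists>c\<in>range of_rat. lie x z = c *\<^sub>M z}"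
  have sp: "mat_vs.span ?E = g" using x(2) mat_vs.span_minimal[of ?E g] g_sub by (auto simp: rat_diag_def)
  obtain B where B: "B \<subseteq> ?E" "finite B" "mat_vs.independent B" "mat_vs.span B = g"
    using ml.basis_within[OF fdg sp] by blast
  then have "\<forall>b\<in>B. \<exists>c. lie x b = of_rat c *\<^sub>M b" by auto
  then obtain c where c: "\<And>b. b \<in> B \<Longrightarrow> lie x b = of_rat (c b) *\<^sub>M b" by metis
  have "\<Phi> x x = (\<Sum>b\<in>B. of_rat ((c b)\<^sup>2))"
    unfolding tform_def
    by (rule ml.tr_eigenbasis[OF B(2-4) lin_on_lie2]) (simp add: c lie_scale of_rat_mult power2_eq_square)
  then have 1: "\<Phi> x x = of_rat (\<Sum>b\<in>B. (c b)\<^sup>2)" by (simp add: of_rat_sum)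
  have 2: "x = 0" if z: "(\<Sum>b\<in>B. (c b)\<^sup>2) = 0"
  proof -
    have "c b = 0" if "b \<in> B" for b using z that B(2) by (simp add: sum_nonneg_eq_0_iff)
    then have kill: "lie x b = 0" if "b \<in> B" for b using c[OF that] that by simp
    have k: "lie x z = 0" if "z \<in> g" for z
      by (rule lie_kills_span[of B]) (use kill that B(4) in auto)
    show ?thesis
    proof (rule nondeg[OF x(1)])
      fix y assume y: "y \<in> g"
      have "\<Phi> x y = ml.tr g (\<lambda>z. 0 *\<^sub>M z)"
        unfolding tform_def by (rule ml.tr_cong[OF fdg lin_on_lie2]) (use x y k g_closed g_0 in auto)
      also have "\<dots> = 0 * ml.tr g (\<lambda>z. z)" by (rule ml.tr_scale[OF fdg]) (auto simp: lin_on_def)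
      finally show "\<Phi> x y = 0" by simp
    qed
  qed
  show thesis by (rule that[of "\<Sum>b\<in>B. (c b)\<^sup>2"]) (use 1 2 in \<open>auto intro: sum_nonneg\<close>)
qed

text \<open>Orthogonality is kept apart from this notion, because the orthogonalisation in
  \<open>torus_maximal_contains\<close> starts with commuting elements that are not yet orthogonal.\<close>

definition commuting :: "nat \<Rightarrow> (nat \<Rightarrow> 'k^'n^'n) \<Rightarrow> bool" where
  "commuting r H \<longleftrightarrow> (\<forall>i<r. H i \<in> g \<and> rat_diag (H i)) \<and> (\<forall>i<r. \<forall>j<r. lie (H i) (H j) = 0)"

abbreviation weight_vectors :: "nat \<Rightarrow> (nat \<Rightarrow> 'k^'n^'n) \<Rightarrow> ('k^'n^'n) set \<Rightarrow> ('k^'n^'n) set" where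
  "weight_vectors r H V \<equiv> {z \<in> V. \<exists>\<mu>. \<forall>i<r. lie (H i) z = of_rat (\<mu> i) *\<^sub>M z}"

lemma form_orth_subspace: "x \<in> g \<Longrightarrow> mat_vs.subspace {y \<in> g. \<Phi> x y = 0}"
  using g_0 g_add g_scale
  by (intro mat_vs.subspaceI) (auto simp: form_zero[OF form_g] form_add[OF form_g] form_scale[OF form_g])

lemma commuting_weights:
  assumes H: "commuting r H" and W: "mat_vs.subspace W" "W \<subseteq> g" "\<And>i z. i < r \<Longrightarrow> z \<in> W \<Longrightarrow> lie (H i) z \<in> W"
  shows "W \<subseteq> mat_vs.span (weight_vectors r H W)"
proof -
  have "W \<subseteq> mat_vs.span {z \<in> W. \<exists>\<mu>. \<forall>i<r. \<mu> i \<in> range of_rat \<and> lie (H i) z = \<mu> i *\<^sub>M z}"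
  proof (rule ml.joint_eigenvectors_span[OF W(1) lin_on_lie])
    fix i j z assume ij: "i < r" "j < r"
    have "lie (lie (H i) (H j)) z = 0" using H ij by (simp add: commuting_def)
    then show "lie (H i) (lie (H j) z) = lie (H j) (lie (H i) z)" by (simp add: lie_lie)
  next
    fix i assume i: "i < r"
    then have Hi: "H i \<in> g" "rat_diag (H i)" using H by (auto simp: commuting_def)
    show "lie (H i) ` W \<subseteq> W" using W(3)[OF i] by auto
    show "W \<subseteq> mat_vs.span {v \<in> W. \<exists>c\<in>range of_rat. lie (H i) v = c *\<^sub>M v}"
      by (rule ml.eigenvectors_span_subspace[OF g_sub lin_on_lie _ _ W(1,2)])
         (use Hi g_closed W(3)[OF i] in \<open>auto simp: rat_diag_def\<close>)
  qed
  also have "\<dots> \<subseteq> mat_vs.span (weight_vectors r H W)"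
  proof (rule mat_vs.span_mono, rule subsetI)
    fix z assume "z \<in> {z \<in> W. \<exists>\<mu>. \<forall>i<r. \<mu> i \<in> range of_rat \<and> lie (H i) z = \<mu> i *\<^sub>M z}"
    then obtain \<mu> where z: "z \<in> W" "\<And>i. i < r \<Longrightarrow> \<mu> i \<in> range of_rat \<and> lie (H i) z = \<mu> i *\<^sub>M z" by blast
    then have "\<forall>i. \<exists>q. i < r \<longrightarrow> \<mu> i = of_rat q" by blast
    then obtain q where "\<And>i. i < r \<Longrightarrow> \<mu> i = of_rat (q i)" by metis
    then show "z \<in> weight_vectors r H W" using z by auto
  qed
  finally show ?thesis .
qed

lemma commuting_weights_g:
  assumes "commuting r H"
  shows "g \<subseteq> mat_vs.span (weight_vectors r H g)"
  by (rule commuting_weights[OF assms g_sub order_refl]) (use assms g_closed in \<open>auto simp: commuting_def\<close>)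

lemma commuting_combination:
  assumes H: "commuting r H" shows "rat_diag (\<Sum>i<r. of_rat (c i) *\<^sub>M H i)"
proof -
  have "weight_vectors r H g \<subseteq>
      {z \<in> g. \<exists>a\<in>range of_rat. lie (\<Sum>i<r. of_rat (c i) *\<^sub>M H i) z = a *\<^sub>M z}"
  proof
    fix z assume "z \<in> weight_vectors r H g"
    then obtain \<mu> where z: "z \<in> g" "\<And>i. i < r \<Longrightarrow> lie (H i) z = of_rat (\<mu> i) *\<^sub>M z" by blast
    have "lie (\<Sum>i<r. of_rat (c i) *\<^sub>M H i) z = (\<Sum>i<r. of_rat (c i * \<mu> i) *\<^sub>M z)"
      unfolding lie_sum by (intro sum.cong refl) (simp add: lie_scale z of_rat_mult)
    also have "\<dots> = of_rat (\<Sum>i<r. c i * \<mu> i) *\<^sub>M z"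
      by (simp add: of_rat_sum mat_vs.scale_sum_left)
    finally show "z \<in> {z \<in> g. \<exists>a\<in>range of_rat. lie (\<Sum>i<r. of_rat (c i) *\<^sub>M H i) z = a *\<^sub>M z}"
      using z(1) by blast
  qed
  from mat_vs.span_mono[OF this] show ?thesis using commuting_weights_g[OF H] unfolding rat_diag_def by blast
qed

lemma commuting_form:
  assumes H: "commuting r H" and ij: "i < r" "j < r" shows "\<exists>a. \<Phi> (H i) (H j) = of_rat a"
proof -
  let ?E = "weight_vectors r H g"
  have sp: "mat_vs.span ?E = g" using commuting_weights_g[OF H] mat_vs.span_minimal[of ?E g] g_sub by auto
  obtain B where B: "B \<subseteq> ?E" "finite B" "mat_vs.independent B" "mat_vs.span B = g"
    using ml.basis_within[OF fdg sp] by blast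
  then have "\<forall>b\<in>B. \<exists>\<mu>. \<forall>i<r. lie (H i) b = of_rat (\<mu> i) *\<^sub>M b" by auto
  then obtain \<mu> where \<mu>: "\<And>b i. b \<in> B \<Longrightarrow> i < r \<Longrightarrow> lie (H i) b = of_rat (\<mu> b i) *\<^sub>M b" by metis
  have "\<Phi> (H i) (H j) = (\<Sum>b\<in>B. of_rat (\<mu> b i * \<mu> b j))"
    unfolding tform_def
    by (rule ml.tr_eigenbasis[OF B(2-4) lin_on_lie2]) (simp add: \<mu> ij lie_scale of_rat_mult mult.commute)
  then show ?thesis by (metis of_rat_sum)
qed

definition torus :: "('k^'n^'n) set \<Rightarrow> nat \<Rightarrow> (nat \<Rightarrow> 'k^'n^'n) \<Rightarrow> bool" where
  "torus V r H \<longleftrightarrow> commuting r H \<and> orth_family \<Phi> V r H"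

lemma torus_q:
  assumes "torus V r H" "V \<subseteq> g"
  shows "\<exists>q. (\<forall>i<r. q i > 0) \<and> (\<forall>i<r. \<forall>j<r. \<Phi> (H i) (H j) = (if i = j then of_rat (q i) else 0))"
proof -
  have "\<exists>q>0. \<Phi> (H i) (H i) = of_rat q" if i: "i < r" for i
  proof -
    have "H i \<in> g" "rat_diag (H i)" "\<Phi> (H i) (H i) \<noteq> 0"
      using assms i by (auto simp: torus_def commuting_def orth_family_def)
    then show ?thesis by (metis rat_diag_form of_rat_0 order_le_less)
  qed
  then obtain q where "\<And>i. i < r \<Longrightarrow> q i > 0 \<and> \<Phi> (H i) (H i) = of_rat (q i)" by metis
  then show ?thesis using assms by (intro exI[of _ q]) (auto simp: torus_def orth_family_def)
qed

text \<open>Subtract from \<open>y\<close> its projection to the torus.  The coefficients are rational, so the difference \<open>z\<close> is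
  again diagonalisable with rational eigenvalues and would extend the torus unless \<open>\<Phi> z z = 0\<close>; but \<open>\<Phi> z z\<close> is a sum
  of squares of rational numbers.\<close>

lemma torus_maximal_contains:
  assumes H: "torus V r H" "mat_vs.subspace V" "V \<subseteq> g" and max: "\<And>H'. (\<forall>i<r. H' i = H i) \<Longrightarrow> \<not> torus V (Suc r) H'"
    and q: "\<And>i j. i < r \<Longrightarrow> j < r \<Longrightarrow> \<Phi> (H i) (H j) = (if i = j then of_rat (q i) else 0)" "\<And>i. i < r \<Longrightarrow> q i > 0"
    and y: "y \<in> V" "rat_diag y" "\<And>i. i < r \<Longrightarrow> lie (H i) y = 0"
  shows "y = (\<Sum>i<r. (\<Phi> y (H i) / of_rat (q i)) *\<^sub>M H i)"
proof -
  have Hc: "commuting r H" and Ho: "orth_family \<Phi> V r H" using H(1) by (auto simp: torus_def)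
  have Hg: "H i \<in> g" "H i \<in> V" if "i < r" for i using Hc Ho that by (auto simp: commuting_def orth_family_def)
  have yg: "y \<in> g" using y(1) H(3) by auto
  have yH: "lie y (H i) = 0" if "i < r" for i using lie_anti[of y "H i"] y(3)[OF that] by simp
  define H1 where "H1 = (\<lambda>i. if i < r then H i else y)"
  have H1c: "commuting (Suc r) H1"
    using Hc y(2,3) yg yH unfolding commuting_def H1_def by (auto simp: less_Suc_eq)
  have "\<exists>a. \<Phi> y (H i) = of_rat a" if "i < r" for i
    using commuting_form[OF H1c, of r i] that by (simp add: H1_def)
  then obtain a where a: "\<And>i. i < r \<Longrightarrow> \<Phi> y (H i) = of_rat (a i)" by metis
  define S where "S = (\<Sum>i<r. of_rat (a i / q i) *\<^sub>M H i)"
  have S_V: "S \<in> V" unfolding S_def using Hg by (intro mat_vs.subspace_sum[OF H(2)] mat_vs.subspace_scale[OF H(2)]) auto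
  have S_g: "S \<in> g" using S_V H(3) by auto
  define z where "z = y - S"
  have zV: "z \<in> V" unfolding z_def using y(1) S_V by (rule mat_vs.subspace_diff[OF H(2)])
  have zg: "z \<in> g" using zV H(3) by auto
  have S_H: "\<Phi> S (H j) = of_rat (a j)" if j: "j < r" for j
  proof -
    have "\<Phi> S (H j) = (\<Sum>i<r. \<Phi> (of_rat (a i / q i) *\<^sub>M H i) (H j))"
      unfolding S_def by (rule form_sum[OF form_g Hg(1)[OF j]]) (use Hg g_scale in auto)
    also have "\<dots> = (\<Sum>i<r. if i = j then of_rat (a j) else 0)"
      using j Hg q(1) q(2)[OF j] by (intro sum.cong refl) (auto simp: form_scale[OF form_g] of_rat_divide)
    finally show ?thesis using j by simp
  qed
  have z_H: "\<Phi> z (H j) = 0" if "j < r" for j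
    unfolding z_def using form_diff(1)[OF form_g Hg(1)[OF that] yg S_g] S_H[OF that] a[OF that] by simp
  have z_comm: "lie (H i) z = 0" if "i < r" for i
  proof -
    have "lie (H i) S = 0" unfolding S_def lie_sum
      using Hc that by (intro sum.neutral) (auto simp: commuting_def lie_scale)
    then show ?thesis using y(3)[OF that] by (simp add: z_def lie_diff)
  qed
  have z_comb: "z = (\<Sum>i<Suc r. of_rat (if i < r then - (a i / q i) else 1) *\<^sub>M H1 i)"
    by (simp add: z_def S_def H1_def of_rat_minus sum_negf)
  have z_diag: "rat_diag z" unfolding z_comb by (rule commuting_combination[OF H1c])
  have "\<Phi> z z = 0"
  proof (rule ccontr)
    assume nz: "\<Phi> z z \<noteq> 0"
    define H2 where "H2 = (\<lambda>i. if i < r then H i else z)"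
    have "lie z (H i) = 0" if "i < r" for i using lie_anti[of z "H i"] z_comm[OF that] by simp
    then have "commuting (Suc r) H2"
      using Hc z_diag z_comm zg unfolding commuting_def H2_def by (auto simp: less_Suc_eq)
    moreover have "orth_family \<Phi> V (Suc r) H2"
      using Ho nz z_H zV sym[OF zg Hg(1)] unfolding orth_family_def H2_def by (auto simp: less_Suc_eq)
    ultimately show False using max[of H2] by (simp add: torus_def H2_def)
  qed
  then have "z = 0" using rat_diag_form[OF zg z_diag] by (metis of_rat_eq_0_iff)
  then have "y = S" by (simp add: z_def)
  also have "S = (\<Sum>i<r. (\<Phi> y (H i) / of_rat (q i)) *\<^sub>M H i)"
    unfolding S_def by (intro sum.cong refl) (simp add: a of_rat_divide)
  finally show ?thesis .
qed

definition ratfun :: "('k \<Rightarrow> rat) \<Rightarrow> bool" where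
  "ratfun f \<longleftrightarrow> (\<forall>x y. f (x + y) = f x + f y) \<and> (\<forall>q x. f (of_rat q * x) = q * f x)"

lemma ratfunD:
  assumes "ratfun f"
  shows "f (x + y) = f x + f y" "f (of_rat q * x) = q * f x" "f (x * of_rat q) = f x * q" "f 0 = 0"
    "f (\<Sum>i\<in>I. t i) = (\<Sum>i\<in>I. f (t i))"
proof -
  show a: "f (x + y) = f x + f y" and s: "f (of_rat q * x) = q * f x" for x y q
    using assms by (auto simp: ratfun_def)
  show "f (x * of_rat q) = f x * q" using s[of q x] by (simp add: mult.commute)
  show z: "f 0 = 0" using s[of 0 0] by simp
  show "f (\<Sum>i\<in>I. t i) = (\<Sum>i\<in>I. f (t i))"
    by (induction I rule: infinite_finite_induct) (auto simp: a z)
qed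

lemma ratfun_separate: "(\<And>f. ratfun f \<Longrightarrow> f \<delta> = 0) \<Longrightarrow> \<delta> = 0"
  using exists_rational_functional[of \<delta>] unfolding ratfun_def by metis

lemma replica:
  assumes x: "x \<in> L" and f: "ratfun f"
  obtains y where "y \<in> L" "rat_diag y" "\<And>\<delta> z. ml.geig (lie x) \<delta> z \<Longrightarrow> lie y z = of_rat (f \<delta>) *\<^sub>M z"
proof -
  have add: "of_rat (f (a + b)) = of_rat (f a) + (of_rat (f b) :: 'k)" for a b
    by (simp add: ratfunD(1)[OF f] of_rat_add)
  obtain y where y: "\<And>H. x \<in> Lie_of H \<Longrightarrow> mat 1 \<in> H \<Longrightarrow> (\<And>A B. A \<in> H \<Longrightarrow> B \<in> H \<Longrightarrow> A ** B \<in> H) \<Longrightarrow> y \<in> Lie_of H"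
    "\<And>\<delta> z. ml.geig (lie x) \<delta> z \<Longrightarrow> lie y z = of_rat (f \<delta>) *\<^sub>M z"
    using replica_exists[where X = x and f = "\<lambda>c. of_rat (f c)", OF add] by metis
  have yL: "y \<in> L" using y(1)[of A] x A L(3) by simp
  have "g \<subseteq> mat_vs.span {z \<in> g. \<exists>c. ml.geig (lie x) c z}"
    by (rule geig_span_alg_closed[OF ml.linear_space_axioms fdg lin_on_lie]) (use g_closed L_g x in auto)
  also have "\<dots> \<subseteq> mat_vs.span {z \<in> g. \<exists>c\<in>range of_rat. lie y z = c *\<^sub>M z}"
    by (rule mat_vs.span_mono) (use y(2) in blast)
  finally show thesis using that[OF yL] y(2) by (simp add: rat_diag_def)
qed

lemma geig_span: "x \<in> g \<Longrightarrow> g \<subseteq> mat_vs.span {z \<in> g. \<exists>c. ml.geig (lie x) c z}"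
  by (rule geig_span_alg_closed[OF ml.linear_space_axioms fdg lin_on_lie]) (use g_closed in auto)

lemma geig_everywhere:
  assumes x: "x \<in> g" and B: "mat_vs.span B = g" "\<And>b. b \<in> B \<Longrightarrow> ml.geig (lie x) 0 b" and z: "z \<in> g"
  shows "ml.geig (lie x) 0 z"
proof -
  have "mat_vs.subspace {v \<in> g. ml.geig (lie x) 0 v}"
    by (rule ml.subspace_geig[OF g_sub lin_on_lie]) (use x g_closed in auto)
  then have "mat_vs.span B \<subseteq> {v \<in> g. ml.geig (lie x) 0 v}"
    using B mat_vs.span_base[of _ B] by (intro mat_vs.span_minimal) auto
  then show ?thesis using B(1) z by auto
qed

text \<open>Let \<open>f \<delta>\<close> be the eigenvalue of the replica \<open>y\<close> where \<open>x\<close> has generalised eigenvalue \<open>\<delta>\<close>.  Up to the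
  nilpotent \<open>S\<close>, the product of \<open>x\<close> and \<open>y\<close> in the adjoint representation is the diagonalisable \<open>D\<close>, so
  \<open>\<Sum> \<delta> f(\<delta>) = 0\<close>.  Applying \<open>f\<close> gives \<open>\<Sum> f(\<delta>)\<^sup>2 = 0\<close>, hence \<open>f(\<delta>) = 0\<close> for every functional \<open>f\<close>.\<close>

lemma nilpotent_of_replicas_orthogonal:
  assumes x: "x \<in> L"
    and orth: "\<And>f y. ratfun f \<Longrightarrow> y \<in> L \<Longrightarrow> rat_diag y \<Longrightarrow>
      (\<And>\<delta> z. ml.geig (lie x) \<delta> z \<Longrightarrow> lie y z = of_rat (f \<delta>) *\<^sub>M z) \<Longrightarrow> \<Phi> x y = 0"
    and z: "z \<in> g"
  shows "ml.geig (lie x) 0 z"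
proof -
  have xg: "x \<in> g" by (rule L_g[OF x])
  let ?E = "{z \<in> g. \<exists>c. ml.geig (lie x) c z}"
  have sp: "mat_vs.span ?E = g" using geig_span[OF xg] mat_vs.span_minimal[of ?E g] g_sub by auto
  obtain B where B: "B \<subseteq> ?E" "finite B" "mat_vs.independent B" "mat_vs.span B = g"
    using ml.basis_within[OF fdg sp] by blast
  then have "\<forall>b\<in>B. \<exists>c. ml.geig (lie x) c b" by auto
  then obtain \<delta> where \<delta>: "\<And>b. b \<in> B \<Longrightarrow> ml.geig (lie x) (\<delta> b) b" by metis
  have Bg: "b \<in> g" if "b \<in> B" for b using B(1) that by auto
  have x_in: "lie x ` g \<subseteq> g" using xg g_closed by auto
  have zero: "f (\<delta> b) = 0" if f: "ratfun f" and b: "b \<in> B" for f b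
  proof -
    obtain y where y: "y \<in> L" "rat_diag y" "\<And>\<delta> z. ml.geig (lie x) \<delta> z \<Longrightarrow> lie y z = of_rat (f \<delta>) *\<^sub>M z"
      using replica[OF x f] by blast
    have yg: "y \<in> g" by (rule L_g[OF y(1)])
    obtain D where D: "lin_on mscale g mscale D" "D ` g \<subseteq> g"
      "\<And>c v. v \<in> g \<Longrightarrow> ml.geig (lie x) c v \<Longrightarrow> D v = (c * of_rat (f c)) *\<^sub>M v"
      using ml.geig_functional_calculus[OF fdg lin_on_lie x_in geig_span[OF xg], where h = "\<lambda>c. c * of_rat (f c)"] by blast
    define S where "S = (\<lambda>z. lie x (lie y z) + (- 1) *\<^sub>M D z)"
    have D': "lin_on mscale g mscale (\<lambda>z. (- 1) *\<^sub>M D z)" "(\<lambda>z. (- 1) *\<^sub>M D z) ` g \<subseteq> g"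
      using D(1,2) mat_vs.subspace_neg[OF g_sub] by (auto simp: lin_on_def mat_vs.scale_right_distrib)
    have xy_in: "(\<lambda>z. lie x (lie y z)) ` g \<subseteq> g" using xg yg g_closed by auto
    have S_lin: "lin_on mscale g mscale S" "S ` g \<subseteq> g"
      using D(1,2) lin_on_lie2[of g x y] xy_in g_diff
      by (auto simp: S_def lin_on_def mat_vs.scale_right_diff_distrib image_subset_iff)
    (* S is a multiple of the nilpotent x - c on the generalised eigenspace of c *)
    have S_geig: "S v = of_rat (f c) *\<^sub>M (lie x v - c *\<^sub>M v)" if "v \<in> g" "ml.geig (lie x) c v" for c v
      using that by (simp add: S_def D(3) y(3) lie_scale mat_vs.scale_right_diff_distrib mult.commute)
    have S_pow: "(S ^^ k) v = of_rat (f c) ^ k *\<^sub>M (ml.shift (lie x) c ^^ k) v"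
      if "v \<in> g" "ml.geig (lie x) c v" for c v k
    proof (induction k)
      case (Suc k)
      let ?w = "(ml.shift (lie x) c ^^ k) v"
      have "?w \<in> g \<and> ml.geig (lie x) c ?w"
      proof (induction k)
        case (Suc k)
        then show ?case
          using ml.geig_funpow_shift[OF g_sub lin_on_lie x_in, where d = c and c = c] ml.shift_lin(2)[OF g_sub lin_on_lie x_in, of c]
          by auto
      qed (use that in auto)
      then have w: "?w \<in> g" "ml.geig (lie x) c ?w" by auto
      have "(S ^^ Suc k) v = S (of_rat (f c) ^ k *\<^sub>M ?w)" using Suc by simp
      also have "\<dots> = of_rat (f c) ^ k *\<^sub>M S ?w" by (rule lin_onD(2)[OF S_lin(1) w(1)])
      also have "\<dots> = of_rat (f c) ^ Suc k *\<^sub>M (ml.shift (lie x) c ^^ Suc k) v"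
        by (simp add: S_geig[OF w] mult.commute)
      finally show ?case .
    qed simp
    have S_nil: "\<exists>k. (S ^^ k) v = 0" if v: "v \<in> g" for v
    proof -
      have "mat_vs.subspace {v \<in> g. ml.geig S 0 v}" by (rule ml.subspace_geig[OF g_sub S_lin])
      moreover have "B \<subseteq> {v \<in> g. ml.geig S 0 v}"
      proof
        fix b assume b: "b \<in> B"
        obtain k where "(ml.shift (lie x) (\<delta> b) ^^ k) b = 0" using \<delta>[OF b] by (auto simp: ml.geig_def)
        then have "(S ^^ k) b = 0" using S_pow[OF Bg[OF b] \<delta>[OF b]] by simp
        then show "b \<in> {v \<in> g. ml.geig S 0 v}" using Bg[OF b] by (auto simp: ml.geig_def)
      qed
      ultimately have "mat_vs.span B \<subseteq> {v \<in> g. ml.geig S 0 v}" by (intro mat_vs.span_minimal) auto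
      then have "ml.geig S 0 v" using B(4) v by auto
      then show ?thesis by (simp add: ml.geig_def)
    qed
    have trD: "ml.tr g D = (\<Sum>b\<in>B. \<delta> b * of_rat (f (\<delta> b)))"
      by (rule ml.tr_eigenbasis[OF B(2-4) D(1)]) (use D(3) Bg \<delta> in auto)
    have "0 = ml.tr g S" using ml.tr_nilpotent[OF fdg S_lin S_nil] by simp
    also have "\<dots> = ml.tr g (\<lambda>z. lie x (lie y z)) + ml.tr g (\<lambda>z. (- 1) *\<^sub>M D z)"
      unfolding S_def by (rule ml.tr_add[OF fdg lin_on_lie2 xy_in D'])
    also have "ml.tr g (\<lambda>z. lie x (lie y z)) = 0"
      using orth[OF f y] by (simp add: tform_def)
    also have "ml.tr g (\<lambda>z. (- 1) *\<^sub>M D z) = (- 1) * ml.tr g D" by (rule ml.tr_scale[OF fdg D(1,2)])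
    finally have "(\<Sum>b\<in>B. \<delta> b * of_rat (f (\<delta> b))) = 0" by (simp add: trD)
    then have "f (\<Sum>b\<in>B. \<delta> b * of_rat (f (\<delta> b))) = 0" using ratfunD(4)[OF f] by simp
    then have "(\<Sum>b\<in>B. (f (\<delta> b))\<^sup>2) = 0" by (simp add: ratfunD(3,5)[OF f] power2_eq_square)
    then show "f (\<delta> b) = 0" using B(2) b by (simp add: sum_nonneg_eq_0_iff)
  qed
  have "\<delta> b = 0" if "b \<in> B" for b by (rule ratfun_separate) (rule zero[OF _ that])
  then have "ml.geig (lie x) 0 b" if "b \<in> B" for b using \<delta>[OF that] that by simp
  then show ?thesis by (rule geig_everywhere[OF xg B(4) _ z])
qed

text \<open>The square of the adjoint action of \<open>x\<close> is nilpotent, so its trace is \<open>0\<close> by \<open>tr_nilpotent\<close>.\<close>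

lemma nilpotent_form_0:
  assumes x: "x \<in> g" "\<And>z. z \<in> g \<Longrightarrow> ml.geig (lie x) 0 z"
  shows "\<Phi> x x = 0"
  unfolding tform_def
proof (rule ml.tr_nilpotent[OF fdg lin_on_lie2])
  fix z assume "z \<in> g"
  then obtain k where k: "(lie x ^^ k) z = 0" using x(2)[of z] by (auto simp: ml.geig_def)
  have pow: "((\<lambda>z. lie x (lie x z)) ^^ k) z = (lie x ^^ (k + k)) z"
  proof (induction k)
    case (Suc k)
    then show ?case by (simp add: funpow_swap1)
  qed simp
  have "(lie x ^^ (k + k)) z = (lie x ^^ k) ((lie x ^^ k) z)" by (simp add: funpow_add)
  also have "\<dots> = 0" unfolding k by (induction k) auto
  finally show "\<exists>k. ((\<lambda>z. lie x (lie x z)) ^^ k) z = 0" using pow by auto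
qed (use x g_closed in auto)

definition maximal_torus :: "('k^'n^'n) set \<Rightarrow> nat \<Rightarrow> (nat \<Rightarrow> 'k^'n^'n) \<Rightarrow> bool" where
  "maximal_torus V r H \<longleftrightarrow> torus V r H \<and> (\<forall>H'. (\<forall>i<r. H' i = H i) \<longrightarrow> \<not> torus V (Suc r) H')"

lemma maximal_torus_exists:
  assumes V: "V \<subseteq> g" and H0: "torus V r0 H0"
  obtains r H where "maximal_torus V r H" "r0 \<le> r" "\<And>i. i < r0 \<Longrightarrow> H i = H0 i"
proof -
  obtain b where b: "\<And>V k v. V \<subseteq> g \<Longrightarrow> orth_family \<Phi> V k v \<Longrightarrow> k \<le> b"
    using orth_family_bound[OF form_g] by metis
  let ?P = "\<lambda>(r, H). r0 \<le> r \<and> (\<forall>i<r0. H i = H0 i) \<and> torus V r H"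
  have bound: "fst x \<le> b" if "?P x" for x using that b[OF V] by (auto simp: torus_def)
  have bound': "\<forall>x. ?P x \<longrightarrow> fst x < Suc b" using bound by (simp add: le_imp_less_Suc)
  obtain x where x: "?P x" "\<And>y. ?P y \<Longrightarrow> fst y \<le> fst x"
    using ex_has_greatest_nat[of ?P "(r0, H0)" fst "Suc b", OF _ bound'] H0 by blast
  obtain r H where rH: "x = (r, H)" by (cases x)
  have "\<not> torus V (Suc r) H'" if "\<forall>i<r. H' i = H i" for H'
    using x(2)[of "(Suc r, H')"] x(1) that by (auto simp: rH)
  then have "maximal_torus V r H" using x(1) by (simp add: maximal_torus_def rH)
  then show thesis using that x(1) by (simp add: rH)
qed

lemma dual_vector:
  assumes \<phi>: "lin_on mscale L (*) \<phi>"
  obtains y where "y \<in> L" "\<And>u. u \<in> L \<Longrightarrow> \<Phi> u y = \<phi> u"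
proof
  let ?y = "\<Sum>i<d. \<phi> (p i) *\<^sub>M p' i"
  show "?y \<in> L" using p_in by (intro L_sum L_scale) auto
  fix u assume u: "u \<in> L"
  have "\<Phi> u ?y = (\<Sum>i<d. \<Phi> u (\<phi> (p i) *\<^sub>M p' i))"
    by (rule form_sum(2)[OF form_g L_g[OF u]]) (use p_in L_g g_scale in auto)
  also have "\<dots> = (\<Sum>i<d. \<phi> (\<Phi> u (p' i) *\<^sub>M p i))"
    using p_in L_g u by (intro sum.cong refl) (simp add: form_scale[OF form_g] lin_onD(2)[OF \<phi>])
  also have "\<dots> = \<phi> (\<Sum>i<d. \<Phi> u (p' i) *\<^sub>M p i)"
    by (rule ml.lin_on_sum[OF L_sub \<phi>, symmetric]) (use p_in L_scale in auto)
  finally show "\<Phi> u ?y = \<phi> u" by (simp only: dual_pairD(3)[OF dual_L u])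
qed

lemma eq_in_L:
  assumes "u \<in> L" "v \<in> L" "\<And>w. w \<in> L \<Longrightarrow> \<Phi> w u = \<Phi> w v" shows "u = v"
proof -
  have "u - v = 0"
  proof (rule nondeg_L[OF mat_vs.subspace_diff[OF L_sub assms(1,2)]])
    fix w assume w: "w \<in> L"
    show "\<Phi> (u - v) w = 0"
      using form_diff(1)[OF form_g L_g[OF w] L_g[OF assms(1)] L_g[OF assms(2)]] assms(3)[OF w] sym[OF L_g[OF w]] L_g assms(1,2) by simp
  qed
  then show ?thesis by simp
qed

context
  fixes r H q
  assumes H: "maximal_torus L r H"
    and q: "\<And>i j. i < r \<Longrightarrow> j < r \<Longrightarrow> \<Phi> (H i) (H j) = (if i = j then of_rat (q i) else 0)" "\<And>i. i < r \<Longrightarrow> q i > 0"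
begin

lemma H_torus: "torus L r H" and H_commuting: "commuting r H" and H_L: "i < r \<Longrightarrow> H i \<in> L"
  and H_comm: "i < r \<Longrightarrow> j < r \<Longrightarrow> lie (H i) (H j) = 0"
  using H by (auto simp: maximal_torus_def torus_def commuting_def orth_family_def)

lemma H_g: "i < r \<Longrightarrow> H i \<in> g" using H_L L_g by blast

text \<open>The part of the centraliser of the torus that is orthogonal to it; it turns out to be \<open>0\<close>
  (\<open>cent0_trivial\<close>).\<close>

definition cent0 :: "('k^'n^'n) set" where
  "cent0 = {x \<in> L. \<forall>i<r. lie (H i) x = 0 \<and> \<Phi> x (H i) = 0}"

lemma cent0_sub: "mat_vs.subspace cent0"
  unfolding cent0_def
  using mat_vs.subspace_0[OF L_sub] mat_vs.subspace_add[OF L_sub] L_scale H_g L_g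
  by (intro mat_vs.subspaceI)
     (auto simp: form_zero[OF form_g] form_add[OF form_g] form_scale[OF form_g] lie_add lie_scale)

lemma form_H_combination:
  assumes "x \<in> g" "\<And>i. i < r \<Longrightarrow> \<Phi> x (H i) = 0" shows "\<Phi> x (\<Sum>i<r. c i *\<^sub>M H i) = 0"
proof -
  have "\<Phi> x (\<Sum>i<r. c i *\<^sub>M H i) = (\<Sum>i<r. \<Phi> x (c i *\<^sub>M H i))"
    by (rule form_sum(2)[OF form_g assms(1)]) (use H_g g_scale in auto)
  also have "\<dots> = 0" using assms H_g by (intro sum.neutral) (simp add: form_scale[OF form_g])
  finally show ?thesis .
qed

text \<open>A replica of \<open>x\<close> commutes with everything that \<open>x\<close> commutes with, hence lies in the torus by maximality,
  and is orthogonal to \<open>x\<close>.\<close>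

lemma cent0_nilpotent:
  assumes x: "x \<in> cent0" and z: "z \<in> g" shows "ml.geig (lie x) 0 z"
proof (rule nilpotent_of_replicas_orthogonal[OF _ _ z])
  show xL: "x \<in> L" using x by (simp add: cent0_def)
  fix f y assume f: "ratfun f" and y: "y \<in> L" "rat_diag y" "\<And>\<delta> z. ml.geig (lie x) \<delta> z \<Longrightarrow> lie y z = of_rat (f \<delta>) *\<^sub>M z"
  have "lie (H i) y = 0" if i: "i < r" for i
  proof -
    have "lie x (H i) = 0 *\<^sub>M H i" using x i lie_anti[of x "H i"] by (simp add: cent0_def)
    then have "lie y (H i) = of_rat (f 0) *\<^sub>M H i" by (intro y(3) ml.geig_eigenvector)
    then show ?thesis using ratfunD(4)[OF f] lie_anti[of "H i" y] by simp
  qed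
  then have "y = (\<Sum>i<r. (\<Phi> y (H i) / of_rat (q i)) *\<^sub>M H i)"
    using H torus_maximal_contains[OF H_torus L_sub L(2) _ q y(1,2)] by (auto simp: maximal_torus_def)
  moreover have "\<Phi> x (\<Sum>i<r. (\<Phi> y (H i) / of_rat (q i)) *\<^sub>M H i) = 0"
    by (rule form_H_combination) (use x L_g in \<open>auto simp: cent0_def\<close>)
  ultimately show "\<Phi> x y = 0" by simp
qed

text \<open>Polarisation of \<open>nilpotent_form_0\<close>: all elements of \<open>cent0\<close>, sums included, are nilpotent.\<close>

lemma cent0_isotropic:
  assumes x: "x \<in> cent0" and y: "y \<in> cent0" shows "\<Phi> x y = 0"
proof -
  have g': "x \<in> g" "y \<in> g" "x + y \<in> g" using x y L_g g_add by (auto simp: cent0_def)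
  have xy: "x + y \<in> cent0" by (rule mat_vs.subspace_add[OF cent0_sub x y])
  have "\<Phi> (x + y) (x + y) = \<Phi> x x + 2 * \<Phi> x y + \<Phi> y y"
    using g' sym[of y x] by (simp add: form_add[OF form_g])
  then show ?thesis
    using nilpotent_form_0[OF g'(1) cent0_nilpotent[OF x]] nilpotent_form_0[OF g'(2) cent0_nilpotent[OF y]]
      nilpotent_form_0[OF g'(3) cent0_nilpotent[OF xy]] by simp
qed

lemma cent_split:
  assumes x: "x \<in> L" "\<And>i. i < r \<Longrightarrow> lie (H i) x = 0"
  shows "x - (\<Sum>i<r. (\<Phi> x (H i) / of_rat (q i)) *\<^sub>M H i) \<in> cent0"
proof -
  let ?S = "\<Sum>i<r. (\<Phi> x (H i) / of_rat (q i)) *\<^sub>M H i"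
  have S: "?S \<in> L" using H_L by (intro L_sum L_scale) auto
  have "\<Phi> ?S (H j) = \<Phi> x (H j)" if j: "j < r" for j
  proof -
    have "\<Phi> ?S (H j) = (\<Sum>i<r. \<Phi> ((\<Phi> x (H i) / of_rat (q i)) *\<^sub>M H i) (H j))"
      by (rule form_sum[OF form_g H_g[OF j]]) (use H_g g_scale in auto)
    also have "\<dots> = (\<Sum>i<r. if i = j then \<Phi> x (H j) else 0)"
      using j q H_g by (intro sum.cong refl) (auto simp: form_scale[OF form_g] dest: q(2))
    finally show ?thesis using j by simp
  qed
  then have "\<Phi> (x - ?S) (H j) = 0" if "j < r" for j
    using form_diff(1)[OF form_g H_g[OF that] L_g[OF x(1)] L_g[OF S]] that by simp
  moreover have "lie (H j) (x - ?S) = 0" if "j < r" for j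
    unfolding lie_diff lie_sum lie_scale using x(2)[OF that] H_comm[OF that] by (simp add: sum.neutral)
  ultimately show ?thesis using mat_vs.subspace_diff[OF L_sub x(1) S] by (simp add: cent0_def)
qed

lemma form_different_weights:
  assumes x: "x \<in> g" "lie (H i) x = 0" and z: "z \<in> g" "lie (H i) z = c *\<^sub>M z" "c \<noteq> 0" and i: "i < r"
  shows "\<Phi> x z = 0"
proof -
  have "c * \<Phi> x z = \<Phi> x (lie (H i) z)" using x z by (simp add: form_scale[OF form_g])
  also have "\<dots> = - \<Phi> (lie (H i) x) z" using skew[OF H_g[OF i] x(1) z(1)] by simp
  also have "\<dots> = 0" using x z by (simp add: form_zero[OF form_g])
  finally show ?thesis using z(3) by simp
qed

lemma L_weights: "L \<subseteq> mat_vs.span (weight_vectors r H L)"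
  by (rule commuting_weights[OF H_commuting L_sub L(2)]) (use H_L L_closed in auto)

text \<open>\<open>x\<close> is orthogonal to nonzero weights by \<open>form_different_weights\<close>, and a vector of weight \<open>0\<close> is the sum of
  an element of the torus and one of \<open>cent0\<close>.\<close>

lemma cent0_trivial:
  assumes x: "x \<in> cent0" shows "x = 0"
proof (rule nondeg_L)
  show xL: "x \<in> L" using x by (simp add: cent0_def)
  have xg: "x \<in> g" by (rule L_g[OF xL])
  fix w assume "w \<in> L"
  then have "w \<in> mat_vs.span (weight_vectors r H L)" using L_weights by auto
  moreover have "mat_vs.span (weight_vectors r H L) \<subseteq> {z \<in> g. \<Phi> x z = 0}"
  proof (rule mat_vs.span_minimal)
    show "mat_vs.subspace {z \<in> g. \<Phi> x z = 0}" by (rule form_orth_subspace[OF xg])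
    show "weight_vectors r H L \<subseteq> {z \<in> g. \<Phi> x z = 0}"
    proof
      fix z assume "z \<in> weight_vectors r H L"
      then obtain \<mu> where z: "z \<in> L" "\<And>i. i < r \<Longrightarrow> lie (H i) z = of_rat (\<mu> i) *\<^sub>M z" by blast
      have "\<Phi> x z = 0"
      proof (cases "\<exists>i<r. \<mu> i \<noteq> 0")
        case True
        then obtain i where i: "i < r" "\<mu> i \<noteq> 0" by blast
        show ?thesis
          by (rule form_different_weights[OF xg _ L_g[OF z(1)] z(2)[OF i(1)] _ i(1)]) (use i x in \<open>auto simp: cent0_def\<close>)
      next
        case False
        then have z0: "lie (H i) z = 0" if "i < r" for i using z(2)[OF that] that by simp
        let ?S = "\<Sum>i<r. (\<Phi> z (H i) / of_rat (q i)) *\<^sub>M H i"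
        have S: "?S \<in> g" using H_g by (intro g_sum g_scale) auto
        have "\<Phi> x (z - ?S) = 0" by (rule cent0_isotropic[OF x cent_split[OF z(1) z0]])
        moreover have "\<Phi> x ?S = 0" by (rule form_H_combination[OF xg]) (use x in \<open>auto simp: cent0_def\<close>)
        ultimately show ?thesis using form_diff(2)[OF form_g xg L_g[OF z(1)] S] by simp
      qed
      then show "z \<in> {z \<in> g. \<Phi> x z = 0}" using L_g[OF z(1)] by simp
    qed
  qed
  ultimately show "\<Phi> x w = 0" by auto
qed

lemma centralizer:
  assumes x: "x \<in> L" "\<And>i. i < r \<Longrightarrow> lie (H i) x = 0"
  shows "x = (\<Sum>i<r. (\<Phi> x (H i) / of_rat (q i)) *\<^sub>M H i)"
  using cent0_trivial[OF cent_split[OF x]] by simp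

section \<open>Existence of the root decomposition\<close>

definition roots :: "('k^'n^'n) set" where
  "roots = {z \<in> L. \<exists>\<mu>. (\<forall>i<r. lie (H i) z = of_rat (\<mu> i) *\<^sub>M z) \<and> (\<exists>i<r. \<mu> i \<noteq> 0)}"

lemma L_span_roots: "L = mat_vs.span (H ` {..<r} \<union> roots)"
proof (rule equalityI)
  show "mat_vs.span (H ` {..<r} \<union> roots) \<subseteq> L"
    by (rule mat_vs.span_minimal[OF _ L_sub]) (use H_L in \<open>auto simp: roots_def\<close>)
  have "weight_vectors r H L \<subseteq> mat_vs.span (H ` {..<r} \<union> roots)"
  proof
    fix z assume "z \<in> weight_vectors r H L"
    then obtain \<mu> where z: "z \<in> L" "\<And>i. i < r \<Longrightarrow> lie (H i) z = of_rat (\<mu> i) *\<^sub>M z" by blast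
    show "z \<in> mat_vs.span (H ` {..<r} \<union> roots)"
    proof (cases "\<exists>i<r. \<mu> i \<noteq> 0")
      case True
      then show ?thesis using z by (intro mat_vs.span_base) (auto simp: roots_def)
    next
      case False
      then have z0: "lie (H i) z = 0" if "i < r" for i using z(2)[OF that] that by simp
      have "(\<Sum>i<r. (\<Phi> z (H i) / of_rat (q i)) *\<^sub>M H i) \<in> mat_vs.span (H ` {..<r} \<union> roots)"
        by (intro mat_vs.span_sum mat_vs.span_scale mat_vs.span_base) auto
      then show ?thesis using centralizer[OF z(1) z0] by simp
    qed
  qed
  then have "mat_vs.span (weight_vectors r H L) \<subseteq> mat_vs.span (H ` {..<r} \<union> roots)"
    by (rule mat_vs.span_minimal) simp
  then show "L \<subseteq> mat_vs.span (H ` {..<r} \<union> roots)" using L_weights by blast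
qed

text \<open>Extend the orthogonal basis of the torus by root vectors to a basis of \<open>L\<close> and take dual vectors.\<close>

lemma torus_data_exists: "\<exists>s X Y \<alpha>. torus_data L \<Phi> r s H X Y q \<alpha>"
proof -
  have orth: "orth_family \<Phi> L r H" using H_torus by (simp add: torus_def)
  note indep = orth_family_span_independent[OF form_g L(2) orth]
  obtain B where B: "H ` {..<r} \<subseteq> B" "B \<subseteq> H ` {..<r} \<union> roots" "mat_vs.independent B" "H ` {..<r} \<union> roots \<subseteq> mat_vs.span B"
    by (rule mat_vs.maximal_independent_subset_extend[OF Un_upper1 indep(2)])
  have span_B: "mat_vs.span B = L"
  proof (rule equalityI)
    show "mat_vs.span B \<subseteq> L" using mat_vs.span_mono[OF B(2)] L_span_roots by blast
    show "L \<subseteq> mat_vs.span B" using mat_vs.span_minimal[OF B(4)] L_span_roots by simp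
  qed
  have fin: "finite B"
  proof -
    obtain C where C: "finite C" "mat_vs.span C = L" using fin_dim_matrices[OF L_sub] by (auto simp: ml.fin_dim_def)
    show ?thesis using mat_vs.independent_span_bound[OF C(1) B(3)] mat_vs.span_superset[of B] span_B C(2) by auto
  qed
  define s where "s = card (B - H ` {..<r})"
  obtain X where X: "bij_betw X {..<s} (B - H ` {..<r})"
    using fin ex_bij_betw_nat_finite[of "B - H ` {..<r}"] by (auto simp: s_def atLeast0LessThan)
  have X_root: "X a \<in> roots" "X a \<in> B" if "a < s" for a
    using bij_betwE[OF X] that B(2) by auto
  have X_L: "X a \<in> L" if "a < s" for a using X_root(1)[OF that] by (simp add: roots_def)
  obtain \<alpha> where \<alpha>: "\<And>a i. a < s \<Longrightarrow> i < r \<Longrightarrow> lie (H i) (X a) = of_rat (\<alpha> a i) *\<^sub>M X a" "\<And>a. a < s \<Longrightarrow> \<exists>i<r. \<alpha> a i \<noteq> 0"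
  proof -
    have "\<forall>a. \<exists>\<mu>. a < s \<longrightarrow> (\<forall>i<r. lie (H i) (X a) = of_rat (\<mu> i) *\<^sub>M X a) \<and> (\<exists>i<r. \<mu> i \<noteq> 0)"
      using X_root(1) by (auto simp: roots_def)
    then show thesis using that by metis
  qed
  let ?c = "\<lambda>a u. mat_vs.representation B u (X a)"
  have c_lin: "lin_on mscale L (*) (?c a)" for a
    unfolding lin_on_def using mat_vs.representation_add[OF B(3)] mat_vs.representation_scale[OF B(3)] span_B by auto
  have "\<forall>a. \<exists>y. y \<in> L \<and> (\<forall>u\<in>L. \<Phi> u y = ?c a u)" using dual_vector[OF c_lin] by metis
  then obtain Y where Y: "\<And>a. Y a \<in> L" "\<And>a u. u \<in> L \<Longrightarrow> \<Phi> u (Y a) = ?c a u" by metis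
  have XH: "X a \<noteq> H i" if "a < s" "i < r" for a i using bij_betwE[OF X] that by auto
  have XX: "X a = X b \<longleftrightarrow> a = b" if "a < s" "b < s" for a b using X that by (auto simp: bij_betw_def inj_on_def)
  have HY0: "\<Phi> (H i) (Y a) = 0" if "i < r" "a < s" for i a
    using Y(2)[OF H_L[OF that(1)]] mat_vs.representation_basis[OF B(3), of "H i"] B(1) that XH[OF that(2,1)] by auto
  have XY1: "\<Phi> (X a) (Y b) = (if a = b then 1 else 0)" if "a < s" "b < s" for a b
    using Y(2)[OF X_L[OF that(1)]] mat_vs.representation_basis[OF B(3) X_root(2)[OF that(1)]] XX[OF that] by auto
  have HX0: "\<Phi> (H i) (X a) = 0" if ia: "i < r" "a < s" for i a
  proof -
    obtain j where j: "j < r" "\<alpha> a j \<noteq> 0" using \<alpha>(2)[OF ia(2)] by blast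
    show ?thesis
      by (rule form_different_weights[OF H_g[OF ia(1)] H_comm[OF j(1) ia(1)] L_g[OF X_L[OF ia(2)]] \<alpha>(1)[OF ia(2) j(1)] _ j(1)])
         (use j in auto)
  qed
  have expand: "u = (\<Sum>i<r. (\<Phi> u (H i) / of_rat (q i)) *\<^sub>M H i) + (\<Sum>a<s. \<Phi> u (Y a) *\<^sub>M X a)" if u: "u \<in> L" for u
  proof -
    have "u = (\<Sum>b\<in>B. mat_vs.representation B u b *\<^sub>M b)"
      using ml.frame_basis[OF fin B(3) span_B] u by (simp add: ml.frame_def)
    also have "\<dots> = (\<Sum>b\<in>H ` {..<r}. mat_vs.representation B u b *\<^sub>M b) + (\<Sum>b\<in>B - H ` {..<r}. mat_vs.representation B u b *\<^sub>M b)"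
      by (rule sum.subset_diff[OF B(1) fin, unfolded add.commute[of "sum _ (B - _)"]])
    also have "(\<Sum>b\<in>B - H ` {..<r}. mat_vs.representation B u b *\<^sub>M b) = (\<Sum>a<s. \<Phi> u (Y a) *\<^sub>M X a)"
      using sum.reindex_bij_betw[OF X, of "\<lambda>b. mat_vs.representation B u b *\<^sub>M b"] Y(2)[OF u] by simp
    also have "(\<Sum>b\<in>H ` {..<r}. mat_vs.representation B u b *\<^sub>M b) = (\<Sum>i<r. mat_vs.representation B u (H i) *\<^sub>M H i)"
      by (rule sum.reindex[OF indep(1), unfolded comp_def])
    finally have e: "u = (\<Sum>i<r. mat_vs.representation B u (H i) *\<^sub>M H i) + (\<Sum>a<s. \<Phi> u (Y a) *\<^sub>M X a)" .
    have "mat_vs.representation B u (H j) = \<Phi> u (H j) / of_rat (q j)" if j: "j < r" for j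
    proof -
      let ?S = "\<Sum>i<r. mat_vs.representation B u (H i) *\<^sub>M H i" and ?R = "\<Sum>a<s. \<Phi> u (Y a) *\<^sub>M X a"
      have S: "?S \<in> g" using H_g by (intro g_sum g_scale) auto
      have R: "?R \<in> g" using X_L L_g by (intro g_sum g_scale) auto
      have "\<Phi> u (H j) = \<Phi> (?S + ?R) (H j)" using e by simp
      also have "\<dots> = \<Phi> ?S (H j) + \<Phi> ?R (H j)" by (rule form_add(1)[OF form_g H_g[OF j] S R])
      also have "\<Phi> ?R (H j) = (\<Sum>a<s. \<Phi> (\<Phi> u (Y a) *\<^sub>M X a) (H j))"
        by (rule form_sum[OF form_g H_g[OF j]]) (use X_L L_g g_scale in auto)
      also have "\<dots> = 0" using HX0[OF j] X_L L_g H_g[OF j] sym[OF H_g[OF j]]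
        by (intro sum.neutral) (auto simp: form_scale[OF form_g])
      also have "\<Phi> ?S (H j) = (\<Sum>i<r. \<Phi> (mat_vs.representation B u (H i) *\<^sub>M H i) (H j))"
        by (rule form_sum[OF form_g H_g[OF j]]) (use H_g g_scale in auto)
      also have "\<dots> = (\<Sum>i<r. if i = j then mat_vs.representation B u (H j) * of_rat (q j) else 0)"
        using H_g j q(1) by (intro sum.cong refl) (auto simp: form_scale[OF form_g])
      finally show ?thesis using j q(2)[OF j] by simp
    qed
    then have "(\<Sum>i<r. mat_vs.representation B u (H i) *\<^sub>M H i) = (\<Sum>i<r. (\<Phi> u (H i) / of_rat (q i)) *\<^sub>M H i)"
      by simp
    then show ?thesis using e by (rule subst)
  qed
  have expand': "u = (\<Sum>i<r. (\<Phi> u (H i) / of_rat (q i)) *\<^sub>M H i) + (\<Sum>a<s. \<Phi> u (X a) *\<^sub>M Y a)" if u: "u \<in> L" for u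
  proof -
    let ?S = "\<lambda>u. \<Sum>i<r. (\<Phi> u (H i) / of_rat (q i)) *\<^sub>M H i" and ?R = "\<Sum>a<s. \<Phi> u (X a) *\<^sub>M Y a"
      and ?R' = "\<lambda>w. \<Sum>a<s. \<Phi> w (Y a) *\<^sub>M X a"
    have S: "?S u \<in> L" for u using H_L by (intro L_sum L_scale) auto
    have R: "?R \<in> L" using Y by (intro L_sum L_scale) auto
    have R': "?R' w \<in> L" for w using X_L by (intro L_sum L_scale) auto
    show ?thesis
    proof (rule eq_in_L[OF u mat_vs.subspace_add[OF L_sub S R]])
      fix w assume w: "w \<in> L"
      have wg: "w \<in> g" "u \<in> g" using w u L_g by auto
      have 1: "\<Phi> w (?S u) = (\<Sum>i<r. \<Phi> u (H i) * \<Phi> w (H i) / of_rat (q i))"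
        using H_g wg g_scale by (subst form_sum(2)[OF form_g]) (auto simp: form_scale[OF form_g])
      have 2: "\<Phi> w ?R = (\<Sum>a<s. \<Phi> u (X a) * \<Phi> w (Y a))"
        using Y L_g wg g_scale by (subst form_sum(2)[OF form_g]) (auto simp: form_scale[OF form_g])
      have 3: "\<Phi> (?S w) u = (\<Sum>i<r. \<Phi> u (H i) * \<Phi> w (H i) / of_rat (q i))"
        using H_g wg g_scale sym[OF wg(2)]
        by (subst form_sum(1)[OF form_g]) (auto simp: form_scale[OF form_g] mult.commute)
      have 4: "\<Phi> (?R' w) u = (\<Sum>a<s. \<Phi> u (X a) * \<Phi> w (Y a))"
        using X_L L_g wg g_scale sym[OF wg(2)]
        by (subst form_sum(1)[OF form_g]) (auto simp: form_scale[OF form_g] mult.commute)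
      have "\<Phi> w u = \<Phi> (?S w + ?R' w) u" using expand[OF w] by simp
      also have "\<dots> = \<Phi> (?S w) u + \<Phi> (?R' w) u" by (rule form_add(1)[OF form_g wg(2) L_g[OF S] L_g[OF R']])
      also have "\<dots> = \<Phi> w (?S u) + \<Phi> w ?R" unfolding 1 2 3 4 ..
      also have "\<dots> = \<Phi> w (?S u + ?R)" by (rule form_add(2)[OF form_g wg(1) L_g[OF S] L_g[OF R], symmetric])
      finally show "\<Phi> w u = \<Phi> w (?S u + ?R)" .
    qed
  qed
  have HY: "lie (H i) (Y a) = of_rat (- \<alpha> a i) *\<^sub>M Y a" if ia: "i < r" "a < s" for i a
  proof (rule eq_in_L[OF L_closed[OF H_L[OF ia(1)] Y(1)] mat_vs.subspace_scale[OF L_sub Y(1)]])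
    fix w assume w: "w \<in> L"
    let ?S = "\<Sum>j<r. (\<Phi> w (H j) / of_rat (q j)) *\<^sub>M H j"
    have "lie (H i) w = lie (H i) (?S + (\<Sum>b<s. \<Phi> w (Y b) *\<^sub>M X b))" using expand[OF w] by simp
    also have "\<dots> = (\<Sum>b<s. (\<Phi> w (Y b) * of_rat (\<alpha> b i)) *\<^sub>M X b)"
      using H_comm[OF ia(1)] by (simp add: lie_add lie_sum lie_scale \<alpha>(1)[OF _ ia(1)])
    finally have Hw: "lie (H i) w = (\<Sum>b<s. (\<Phi> w (Y b) * of_rat (\<alpha> b i)) *\<^sub>M X b)" .
    have "\<Phi> w (lie (H i) (Y a)) = - \<Phi> (lie (H i) w) (Y a)"
      using skew[OF H_g[OF ia(1)] L_g[OF w] L_g[OF Y(1)]] by simp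
    also have "\<Phi> (lie (H i) w) (Y a) = (\<Sum>b<s. \<Phi> ((\<Phi> w (Y b) * of_rat (\<alpha> b i)) *\<^sub>M X b) (Y a))"
      unfolding Hw by (rule form_sum[OF form_g L_g[OF Y(1)]]) (use X_L L_g g_scale in auto)
    also have "\<dots> = (\<Sum>b<s. if b = a then \<Phi> w (Y a) * of_rat (\<alpha> a i) else 0)"
      using X_L L_g Y(1) ia XY1[OF _ ia(2)] by (intro sum.cong refl) (auto simp: form_scale[OF form_g])
    also have "\<dots> = \<Phi> w (Y a) * of_rat (\<alpha> a i)" using ia by simp
    also have "- (\<Phi> w (Y a) * of_rat (\<alpha> a i)) = \<Phi> w (of_rat (- \<alpha> a i) *\<^sub>M Y a)"
      unfolding form_scale(2)[OF form_g L_g[OF Y(1)] L_g[OF w]] by (simp add: of_rat_minus)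
    finally show "\<Phi> w (lie (H i) (Y a)) = \<Phi> w (of_rat (- \<alpha> a i) *\<^sub>M Y a)" .
  qed
  have "torus_data L \<Phi> r s H X Y q \<alpha>"
    by (rule torus_data.intro) (fact L(1) inv H_L X_L expand expand' q(2) H_comm \<alpha>(1) HY HX0 HY0 XY1 q(1) \<alpha>(2) | rule Y(1) | (rule \<alpha>(1); assumption))+
  then show ?thesis by blast
qed

end

lemma rep_g: "lie_rep L mscale g lie"
  by (rule lie_rep_adjoint[OF g_sub]) (auto intro: g_closed L_g)

definition mm :: "('k^'n^'n) set" where "mm = {x \<in> g. \<forall>u\<in>L. \<Phi> u x = 0}"

lemma mm_sub: "mat_vs.subspace mm"
  unfolding mm_def using g_0 g_add g_scale L_g
  by (intro mat_vs.subspaceI) (auto simp: form_zero[OF form_g] form_add[OF form_g] form_scale[OF form_g])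

lemma mm_stable: "u \<in> L \<Longrightarrow> z \<in> mm \<Longrightarrow> lie u z \<in> mm"
proof -
  assume u: "u \<in> L" and z: "z \<in> mm"
  have "\<Phi> w (lie u z) = 0" if w: "w \<in> L" for w
    using skew[OF L_g[OF u] L_g[OF w], of z] z L_closed[OF u w] by (simp add: mm_def)
  then show ?thesis using u z g_closed L_g by (simp add: mm_def)
qed

lemma N_mm: "N = {x \<in> mm. cas d p p' lie x = (1 / 2) *\<^sub>M x}"
  by (auto simp: N_def mm_def)

lemma rep_mm: "lie_rep L mscale mm lie"
  by (rule lie_rep_adjoint[OF mm_sub mm_stable])

lemma cas_lin_mm: "lin_on mscale mm mscale (cas d p p' lie)"
  by (rule cas_lin(1)[OF rep_mm L(1)]) (use p_in in auto)

lemma N_sub: "mat_vs.subspace N"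
  unfolding N_mm by (rule ml.subspace_eigen[OF mm_sub cas_lin_mm])

lemma N_stable: "u \<in> L \<Longrightarrow> x \<in> N \<Longrightarrow> lie u x \<in> N"
  using mm_stable cas_commutes[OF rep_mm L(1) inv dual_L, of u x] by (auto simp: N_mm lie_scale)

lemma decomp_g:
  assumes "z \<in> g" shows "\<exists>u\<in>L. z - u \<in> mm"
proof -
  have \<phi>: "lin_on mscale L (*) (\<Phi> z)" by (rule lin_on_subset[OF form_lin(2)[OF form_g assms] L(2)])
  obtain u where u: "u \<in> L" "\<And>w. w \<in> L \<Longrightarrow> \<Phi> w u = \<Phi> z w" using dual_vector[OF \<phi>] by blast
  have "\<Phi> w (z - u) = 0" if w: "w \<in> L" for w
    using form_diff(2)[OF form_g L_g[OF w] assms L_g[OF u(1)]] u(2)[OF w] sym[OF assms L_g[OF w]] by simp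
  then have "z - u \<in> mm" using mat_vs.subspace_diff[OF g_sub assms L_g[OF u(1)]] by (simp add: mm_def)
  then show ?thesis using u(1) by blast
qed

lemma nondeg_mm:
  assumes x: "x \<in> mm" "\<And>y. y \<in> mm \<Longrightarrow> \<Phi> x y = 0" shows "x = 0"
proof (rule nondeg)
  show xg: "x \<in> g" using x(1) by (simp add: mm_def)
  fix z assume z: "z \<in> g"
  then obtain u where u: "u \<in> L" "z - u \<in> mm" using decomp_g by blast
  have "\<Phi> x (u + (z - u)) = \<Phi> x u + \<Phi> x (z - u)"
    by (rule form_add(2)[OF form_g xg L_g[OF u(1)]]) (use u in \<open>simp add: mm_def\<close>)
  then show "\<Phi> x z = 0" using x u sym[OF xg L_g[OF u(1)]] by (simp add: mm_def)
qed

definition annL :: "('k^'n^'n) set" where "annL = {u \<in> L. \<forall>x\<in>N. lie u x = 0}"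

lemma annL_sub: "mat_vs.subspace annL"
  unfolding annL_def
  using mat_vs.subspace_0[OF L_sub] mat_vs.subspace_add[OF L_sub] L_scale
  by (intro mat_vs.subspaceI) (auto simp: lie_add lie_scale)

lemma torus_mono: "torus V r H \<Longrightarrow> V \<subseteq> W \<Longrightarrow> torus W r H"
  by (auto simp: torus_def orth_family_def)

text \<open>The torus is chosen in two steps, so that it is adapted to \<open>N\<close>: first maximal in the annihilator of \<open>N\<close>, then
  extended to a maximal one of \<open>L\<close>.  Diagonalisability of \<open>C\<close> makes eigenspaces of \<open>C\<close> orthogonal
  summands, so that \<open>N\<close> and its complement \<open>M\<close> are nondegenerate.\<close>

lemma exists_casimir_half:
  "\<exists>r s H X Y q \<alpha> M r1 n m f f' h h'. casimir_half L \<Phi> r s H X Y q \<alpha> g N M r1 n m f f' h h'"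
proof -
  have annL_L: "annL \<subseteq> L" by (auto simp: annL_def)
  have t0: "torus annL 0 H" for H by (simp add: torus_def commuting_def orth_family_def)
  obtain r1 H1 where H1: "maximal_torus annL r1 H1"
    by (rule maximal_torus_exists[OF order_trans[OF annL_L L(2)] t0[of "\<lambda>_. 0"]]) (rule that)
  have t1: "torus L r1 H1" using H1 torus_mono[OF _ annL_L] by (simp add: maximal_torus_def)
  obtain r H where H: "maximal_torus L r H" "r1 \<le> r" "\<And>i. i < r1 \<Longrightarrow> H i = H1 i"
    by (rule maximal_torus_exists[OF L(2) t1]) (rule that)
  obtain q where q: "\<And>i j. i < r \<Longrightarrow> j < r \<Longrightarrow> \<Phi> (H i) (H j) = (if i = j then of_rat (q i) else 0)" "\<And>i. i < r \<Longrightarrow> q i > 0"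
    using torus_q[of L r H] H(1) L(2) unfolding maximal_torus_def by blast
  obtain s X Y \<alpha> where td: "torus_data L \<Phi> r s H X Y q \<alpha>" using torus_data_exists[OF H(1) q] by blast
  interpret T: torus_data L \<Phi> r s H X Y q \<alpha> by (rule td)
  have Hc: "commuting r H" using H(1) by (simp add: maximal_torus_def torus_def)
  note HL = T.H_in
  have wmod_g: "T.wmod mscale g lie"
    unfolding T.wmod_def
  proof (intro conjI rep_g)
    let ?E = "weight_vectors r H g"
    have sp: "mat_vs.span ?E = g" using commuting_weights_g[OF Hc] mat_vs.span_minimal[of ?E g] g_sub by auto
    obtain B where B: "B \<subseteq> ?E" "finite B" "mat_vs.independent B" "mat_vs.span B = g"
      using ml.basis_within[OF fdg sp] by blast
    moreover have "B \<subseteq> (\<Union>l. T.wsp mscale g lie l)" using B(1) by (auto simp: T.wsp_def)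
    ultimately show "\<exists>P. finite P \<and> P \<subseteq> (\<Union>l. T.wsp mscale g lie l) \<and> mat_vs.span P = g" by blast
  qed
  have wmod_mm: "T.wmod mscale mm lie"
    by (rule T.wmod_sub[OF wmod_g mm_sub _ mm_stable]) (auto simp: mm_def)
  have C_eq: "T.C lie x = cas d p p' lie x" if "x \<in> g" for x
    by (rule cas_independent[OF rep_g L(1) inv T.dual_e dual_L that])
  have mm_g: "x \<in> mm \<Longrightarrow> x \<in> g" for x by (simp add: mm_def)
  have N_g: "N \<subseteq> g" and N_in_mm: "N \<subseteq> mm" using N_def N_mm by auto
  have half: "T.C lie x = (1 / 2) *\<^sub>M x" if "x \<in> N" for x using that C_eq[of x] by (simp add: N_def)
  have C_sym: "\<Phi> (T.C lie x) z = \<Phi> x (T.C lie z)" if "x \<in> g" "z \<in> g" for x z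
  proof -
    have "\<Phi> (T.C lie x) z = (\<Sum>i<r + s. \<Phi> (lie (T.e' i) (lie (T.e i) x)) z)"
      unfolding cas_def using dual_pairD(1,2)[OF T.dual_e] L_g g_closed that
      by (intro form_sum(1)[OF form_g]) auto
    also have "\<dots> = (\<Sum>i<r + s. \<Phi> x (lie (T.e i) (lie (T.e' i) z)))"
    proof (rule sum.cong[OF refl])
      fix i assume "i \<in> {..<r + s}"
      then have i: "T.e i \<in> g" "T.e' i \<in> g" using dual_pairD(1,2)[OF T.dual_e] L_g by auto
      show "\<Phi> (lie (T.e' i) (lie (T.e i) x)) z = \<Phi> x (lie (T.e i) (lie (T.e' i) z))"
        using skew[OF i(2) g_closed[OF i(1) that(1)] that(2)] skew[OF i(1) that(1) g_closed[OF i(2) that(2)]] by simp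
    qed
    also have "\<dots> = \<Phi> x (\<Sum>i<r + s. lie (T.e i) (lie (T.e' i) z))"
      using dual_pairD(1,2)[OF T.dual_e] L_g g_closed that by (intro form_sum(2)[OF form_g, symmetric]) auto
    also have "(\<Sum>i<r + s. lie (T.e i) (lie (T.e' i) z)) = T.C lie z"
      using cas_independent[OF rep_g L(1) inv dual_pair_swap[OF T.dual_e] T.dual_e that(2)] by (simp add: cas_def)
    finally show ?thesis .
  qed
  have nondeg_N: "x = 0" if x: "x \<in> N" "\<And>y. y \<in> N \<Longrightarrow> \<Phi> x y = 0" for x
  proof (rule nondeg_mm)
    show xm: "x \<in> mm" using x(1) N_in_mm by auto
    fix y assume "y \<in> mm"
    then have "y \<in> mat_vs.span {v \<in> mm. \<exists>c. T.C lie v = of_rat c *\<^sub>M v}"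
      using T.casimir_eigenvectors_span[OF wmod_mm] by auto
    moreover have "mat_vs.span {v \<in> mm. \<exists>c. T.C lie v = of_rat c *\<^sub>M v} \<subseteq> {y \<in> g. \<Phi> x y = 0}"
    proof (rule mat_vs.span_minimal)
      show "mat_vs.subspace {y \<in> g. \<Phi> x y = 0}" by (rule form_orth_subspace[OF mm_g[OF xm]])
      show "{v \<in> mm. \<exists>c. T.C lie v = of_rat c *\<^sub>M v} \<subseteq> {y \<in> g. \<Phi> x y = 0}"
      proof
        fix v assume "v \<in> {v \<in> mm. \<exists>c. T.C lie v = of_rat c *\<^sub>M v}"
        then obtain c where v: "v \<in> mm" "T.C lie v = of_rat c *\<^sub>M v" by blast
        have eq: "(1 / 2) * \<Phi> x v = of_rat c * \<Phi> x v"
          using C_sym[OF mm_g[OF xm] mm_g[OF v(1)]] half[OF x(1)] v(2) mm_g[OF xm] mm_g[OF v(1)]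
          by (simp add: form_scale[OF form_g])
        have "\<Phi> x v = 0"
        proof (cases "of_rat c = (1 / 2 :: 'k)")
          case True
          then have "v \<in> N" using v C_eq[OF mm_g[OF v(1)]] by (simp add: N_mm)
          then show ?thesis by (rule x(2))
        next
          case False
          then show ?thesis using eq by auto
        qed
        then show "v \<in> {y \<in> g. \<Phi> x y = 0}" using mm_g[OF v(1)] by simp
      qed
    qed
    ultimately show "\<Phi> x y = 0" by auto
  qed
  obtain n f f' where dual_N: "dual_pair \<Phi> N n f f'"
    using dual_pair_exists[OF form_g N_sub N_g] nondeg_N by metis
  note f_N = dual_pairD(1,2)[OF dual_N]
  define M where "M = {y \<in> mm. \<forall>x\<in>N. \<Phi> x y = 0}"
  have M_mm: "y \<in> M \<Longrightarrow> y \<in> mm" for y by (simp add: M_def)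
  have M_sub: "mat_vs.subspace M"
    unfolding M_def using mat_vs.subspace_0[OF mm_sub] mat_vs.subspace_add[OF mm_sub] mat_vs.subspace_scale[OF mm_sub] mm_g N_g
    by (intro mat_vs.subspaceI) (auto simp: form_zero[OF form_g] form_add[OF form_g] form_scale[OF form_g] subset_iff)
  have M_stable: "lie u y \<in> M" if u: "u \<in> L" and y: "y \<in> M" for u y
  proof -
    have "\<Phi> x (lie u y) = 0" if x: "x \<in> N" for x
      using skew[OF L_g[OF u], of x y] x N_g y N_stable[OF u x] mm_g M_mm[OF y] by (auto simp: M_def)
    then show ?thesis using mm_stable[OF u M_mm[OF y]] by (simp add: M_def)
  qed
  have mm_split: "\<exists>x\<in>N. z - x \<in> M" if z: "z \<in> mm" for z
  proof -
    let ?x = "\<Sum>i<n. \<Phi> z (f' i) *\<^sub>M f i"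
    have x: "?x \<in> N" using f_N by (intro mat_vs.subspace_sum[OF N_sub] mat_vs.subspace_scale[OF N_sub]) auto
    have "\<Phi> w (z - ?x) = 0" if w: "w \<in> N" for w
    proof -
      have wg: "w \<in> g" using w N_g by auto
      have fg: "f i \<in> g" "f' i \<in> g" if "i < n" for i using f_N that N_g by auto
      have "\<Phi> w ?x = (\<Sum>i<n. \<Phi> z (f' i) * \<Phi> w (f i))"
        using fg wg g_scale by (subst form_sum(2)[OF form_g]) (auto simp: form_scale[OF form_g])
      also have "\<dots> = \<Phi> z (\<Sum>i<n. \<Phi> w (f i) *\<^sub>M f' i)"
        using fg mm_g[OF z] g_scale
        by (subst form_sum(2)[OF form_g]) (auto simp: form_scale[OF form_g] mult.commute)
      also have "\<dots> = \<Phi> w z" using dual_pairD(4)[OF dual_N w] sym wg mm_g[OF z] by simp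
      finally show ?thesis using form_diff(2)[OF form_g wg mm_g[OF z]] x N_g by auto
    qed
    then have "z - ?x \<in> M" using mat_vs.subspace_diff[OF mm_sub z] x N_in_mm by (auto simp: M_def)
    then show ?thesis using x by blast
  qed
  have nondeg_M: "y = 0" if y: "y \<in> M" "\<And>y'. y' \<in> M \<Longrightarrow> \<Phi> y y' = 0" for y
  proof (rule nondeg_mm[OF M_mm[OF y(1)]])
    have yg: "y \<in> g" using M_mm[OF y(1)] mm_g by simp
    fix z assume z: "z \<in> mm"
    obtain x where x: "x \<in> N" "z - x \<in> M" using mm_split[OF z] by blast
    have "\<Phi> y (x + (z - x)) = \<Phi> y x + \<Phi> y (z - x)"
      by (rule form_add(2)[OF form_g yg]) (use x N_g M_mm mm_g in auto)
    then show "\<Phi> y z = 0" using y x sym[OF yg] N_g by (auto simp: M_def)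
  qed
  have M_g: "M \<subseteq> g" using M_mm mm_g by auto
  obtain m h h' where dual_M: "dual_pair \<Phi> M m h h'"
    using dual_pair_exists[OF form_g M_sub M_g] nondeg_M by metis
  (* replace c by rational coefficients; the resulting element lies in the first torus by maximality *)
  have faithful: "c i = 0" if kill: "\<And>x. x \<in> N \<Longrightarrow> lie (T.hel c) x = 0" and i: "r1 \<le> i" "i < r" for c i
  proof (rule ratfun_separate)
    fix F assume F: "ratfun F"
    define u where "u = (\<Sum>i<r. of_rat (F (c i)) *\<^sub>M H i)"
    have uL: "u \<in> L" unfolding u_def using HL by (intro L_sum L_scale) auto
    have u_diag: "rat_diag u" unfolding u_def by (rule commuting_combination[OF Hc])
    have u_comm: "lie (H i) u = 0" if "i < r" for i
      unfolding u_def lie_sum lie_scale using T.HH[OF that] by (simp add: sum.neutral)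
    have u_kill: "lie u x = 0" if x: "x \<in> N" for x
    proof (rule lie_kills_span)
      have "N \<subseteq> mat_vs.span (weight_vectors r H N)"
        by (rule commuting_weights[OF Hc N_sub N_g]) (use N_stable HL in auto)
      then show "x \<in> mat_vs.span (weight_vectors r H N)" using x by auto
      fix b assume "b \<in> weight_vectors r H N"
      then obtain \<mu> where b: "b \<in> N" "\<And>i. i < r \<Longrightarrow> lie (H i) b = of_rat (\<mu> i) *\<^sub>M b" by blast
      have act: "lie (\<Sum>i<r. t i *\<^sub>M H i) b = (\<Sum>i<r. t i * of_rat (\<mu> i)) *\<^sub>M b" for t
        unfolding lie_sum mat_vs.scale_sum_left by (intro sum.cong refl) (simp add: lie_scale b(2))
      show "lie u b = 0"
      proof (cases "b = 0")
        case False
        have "(\<Sum>i<r. c i * of_rat (\<mu> i)) *\<^sub>M b = 0" using kill[OF b(1)] act[of c] by (simp add: T.hel_def)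
        then have "(\<Sum>i<r. c i * of_rat (\<mu> i)) = 0" using False by simp
        then have "F (\<Sum>i<r. c i * of_rat (\<mu> i)) = 0" using ratfunD(4)[OF F] by simp
        then have "(\<Sum>i<r. F (c i) * \<mu> i) = 0" by (simp add: ratfunD(3,5)[OF F])
        then have "(\<Sum>i<r. of_rat (F (c i)) * of_rat (\<mu> i)) = (0 :: 'k)"
          by (simp only: of_rat_mult[symmetric] of_rat_sum[symmetric] of_rat_0)
        then show ?thesis unfolding u_def act by simp
      qed simp
    qed
    have u_ann: "u \<in> annL" using uL u_kill by (simp add: annL_def)
    have "u = (\<Sum>i<r1. (\<Phi> u (H1 i) / of_rat (q i)) *\<^sub>M H1 i)"
    proof (rule torus_maximal_contains[OF _ annL_sub _ _ _ _ u_ann u_diag])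
      show "torus annL r1 H1" "annL \<subseteq> g" "\<And>H'. \<forall>i<r1. H' i = H1 i \<Longrightarrow> \<not> torus annL (Suc r1) H'"
        using H1 annL_L L(2) by (auto simp: maximal_torus_def)
      show "\<Phi> (H1 i) (H1 j) = (if i = j then of_rat (q i) else 0)" if "i < r1" "j < r1" for i j
        using q(1)[of i j] H(2) H(3)[OF that(1)] H(3)[OF that(2)] that by simp
      show "lie (H1 i) u = 0" "0 < q i" if "i < r1" for i
        using u_comm[of i] q(2)[of i] H(2) H(3)[OF that] that by simp_all
    qed
    then have u1: "u = (\<Sum>i<r1. (\<Phi> u (H i) / of_rat (q i)) *\<^sub>M H i)" using H(3) by simp
    have Hg: "H i \<in> g" if "i < r" for i using HL[OF that] L_g by simp
    have "\<Phi> (\<Sum>j<r1. (\<Phi> u (H j) / of_rat (q j)) *\<^sub>M H j) (H i) = (\<Sum>j<r1. \<Phi> ((\<Phi> u (H j) / of_rat (q j)) *\<^sub>M H j) (H i))"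
      by (rule form_sum[OF form_g Hg[OF i(2)]]) (use Hg H(2) g_scale in auto)
    also have "\<dots> = 0" using i H(2) Hg q(1) by (intro sum.neutral) (auto simp: form_scale[OF form_g])
    finally have "\<Phi> u (H i) = 0" using u1 by simp
    moreover have "\<Phi> u (H i) = (\<Sum>j<r. \<Phi> (of_rat (F (c j)) *\<^sub>M H j) (H i))"
      unfolding u_def by (rule form_sum[OF form_g Hg[OF i(2)]]) (use Hg g_scale in auto)
    moreover have "\<dots> = (\<Sum>j<r. if j = i then of_rat (F (c i)) * of_rat (q i) else 0)"
      using i Hg q(1) by (intro sum.cong refl) (auto simp: form_scale[OF form_g])
    ultimately have "of_rat (F (c i)) * of_rat (q i) = (0 :: 'k)" using i(2) by simp
    then show "F (c i) = 0" using q(2)[OF i(2)] by simp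
  qed
  have "casimir_half L \<Phi> r s H X Y q \<alpha> g N M r1 n m f f' h h'"
  proof unfold_locales
    show "lie (H i) x = 0" if "i < r1" "i < r" "x \<in> N" for i x
      using that H(3)[OF that(1)] H1 by (auto simp: maximal_torus_def torus_def orth_family_def annL_def)
    show "\<exists>u\<in>L. \<exists>x\<in>N. \<exists>y\<in>M. z = u + x + y" if z: "z \<in> g" for z
    proof -
      obtain u where u: "u \<in> L" "z - u \<in> mm" using decomp_g[OF z] by blast
      obtain x where x: "x \<in> N" "z - u - x \<in> M" using mm_split[OF u(2)] by blast
      have "z = u + x + (z - u - x)" by simp
      then show ?thesis using u x by blast
    qed
    show "\<Phi> u x = 0" if "u \<in> L" "x \<in> N" for u x using that N_in_mm by (auto simp: mm_def)
    show "\<Phi> u y = 0" if "u \<in> L" "y \<in> M" for u y using that M_mm by (auto simp: mm_def)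
    show "\<Phi> x y = 0" if "x \<in> N" "y \<in> M" for x y using that by (simp add: M_def)
    show "T.wmod mscale g lie" by (rule wmod_g)
    show "T.C lie x = (1 / 2) *\<^sub>M x" if "x \<in> N" for x by (rule half[OF that])
    show "c i = 0" if "\<And>x. x \<in> N \<Longrightarrow> lie (T.hel c) x = 0" "r1 \<le> i" "i < r" for c i by (rule faithful[OF that])
  qed (rule refl | fact g_lie L(2) form N_sub N_g N_stable M_sub M_g M_stable dual_N dual_M)+
  then show ?thesis by blast
qed

theorem half_eigenspace_is_complement:
  shows "mm = N" "\<And>x y. x \<in> N \<Longrightarrow> y \<in> N \<Longrightarrow> lie x y \<in> L"
proof -
  obtain r s H X Y q \<alpha> M r1 n m f f' h h' where ch: "casimir_half L \<Phi> r s H X Y q \<alpha> g N M r1 n m f f' h h'"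
    using exists_casimir_half by blast
  interpret K: casimir_half L \<Phi> r s H X Y q \<alpha> g N M r1 n m f f' h h' by (rule ch)
  have M0: "M = {0}" by (rule K.half_exhausts[OF simple N_nonzero])
  have "K.mm = mm" by (simp add: K.mm_def mm_def)
  then have "z \<in> N" if z: "z \<in> mm" for z
    using K.mm_decomp[of z] z M0 by auto
  then show "mm = N" by (auto simp: N_mm)
  show "lie x y \<in> L" if "x \<in> N" "y \<in> N" for x y using K.NN_L1[OF that] by (simp add: K.L1_def)
qed

end

section \<open>The theorem\<close>

lemma basis_of_in: "basis_of V d e \<Longrightarrow> i < d \<Longrightarrow> e i \<in> V"
  using mat_vs.span_base[of "e i" "e ` {..<d}"] by (auto simp: basis_of_def)

lemma basis_of_expand:
  assumes \<Phi>: "invariant_form L \<Phi>" "mat_vs.subspace L" "V \<subseteq> L"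
    and b: "basis_of V d e" "basis_of V d e'"
    and dual: "\<And>i j. i < d \<Longrightarrow> j < d \<Longrightarrow> \<Phi> (e i) (e' j) = (if i = j then 1 else 0)" and u: "u \<in> V"
  shows "u = (\<Sum>i<d. \<Phi> u (e' i) *\<^sub>M e i)"
proof -
  let ?B = "e ` {..<d}"
  let ?c = "\<lambda>i. mat_vs.representation ?B u (e i)"
  have inj: "inj_on e {..<d}" and ind: "mat_vs.independent ?B" and sp: "mat_vs.span ?B = V"
    using b by (auto simp: basis_of_def)
  have eL: "e i \<in> L" "e' i \<in> L" if "i < d" for i
    using basis_of_in[OF b(1) that] basis_of_in[OF b(2) that] \<Phi>(3) by auto
  have "u = (\<Sum>v\<in>?B. mat_vs.representation ?B u v *\<^sub>M v)"
    using ml.frame_basis[OF _ ind sp] u by (simp add: ml.frame_def)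
  also have "\<dots> = (\<Sum>i<d. ?c i *\<^sub>M e i)" by (rule sum.reindex[OF inj, unfolded comp_def])
  finally have exp: "u = (\<Sum>i<d. ?c i *\<^sub>M e i)" .
  have "\<Phi> u (e' j) = ?c j" if j: "j < d" for j
  proof -
    have "\<Phi> u (e' j) = \<Phi> (\<Sum>i<d. ?c i *\<^sub>M e i) (e' j)" using exp by simp
    also have "\<dots> = (\<Sum>i<d. \<Phi> (?c i *\<^sub>M e i) (e' j))"
      by (rule form_sum(1)[OF \<Phi>(1,2) eL(2)[OF j]]) (use eL mat_vs.subspace_scale[OF \<Phi>(2)] in auto)
    also have "\<dots> = (\<Sum>i<d. if i = j then ?c j else 0)"
      using eL j dual by (intro sum.cong refl) (auto simp: form_scale[OF \<Phi>(1,2)])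
    finally show ?thesis using j by simp
  qed
  then have "(\<Sum>i<d. ?c i *\<^sub>M e i) = (\<Sum>i<d. \<Phi> u (e' i) *\<^sub>M e i)" by simp
  then show ?thesis using exp by (rule subst)
qed

lemma dual_bases_dual_pair:
  fixes \<Phi> :: "'k::field^'n^'n \<Rightarrow> 'k^'n^'n \<Rightarrow> 'k"
  assumes \<Phi>: "invariant_form L \<Phi>" "mat_vs.subspace L" "V \<subseteq> L" and e: "dual_bases \<Phi> V d e e'"
  shows "dual_pair \<Phi> V d e e'"
proof -
  have b: "basis_of V d e" "basis_of V d e'" and d: "\<And>i j. i < d \<Longrightarrow> j < d \<Longrightarrow> \<Phi> (e i) (e' j) = (if i = j then 1 else 0)"
    using e by (auto simp: dual_bases_def)
  have "\<Phi> (e' i) (e j) = (if i = j then 1 else 0)" if "i < d" "j < d" for i j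
  proof -
    have "e' i \<in> L" "e j \<in> L" using basis_of_in[OF b(1) that(2)] basis_of_in[OF b(2) that(1)] \<Phi>(3) by auto
    then show ?thesis using d[OF that(2,1)] invariant_formD(1)[OF \<Phi>(1), of "e' i" "e j"] by auto
  qed
  then show ?thesis
    unfolding dual_pair_def
    using basis_of_expand[OF \<Phi> b d] basis_of_expand[OF \<Phi> b(2,1)] basis_of_in[OF b(1)] basis_of_in[OF b(2)] by blast
qed

theorem proposition1p2:
  fixes G \<gg> \<hh> \<mm> \<mm>_half :: "('k::{alg_closed_field, field_char_0}^'n^'n) set"
    and e e' :: "nat \<Rightarrow> 'k^'n^'n" and d :: nat
  assumes "simple_algebraic_group G"
    and "\<gg> = Lie_of G"
    and "simple_lie_algebra \<gg>"
    and "reductive_algebraic_subalgebra G \<hh>"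
    and "\<mm> = killing_complement \<gg> \<hh>"
    and "dual_bases (killing \<gg>) \<hh> d e e'"
    and "\<mm>_half = eigenspace_on \<mm> (env_act (casimir \<hh> d e e')) (1/2)"
    and "\<mm>_half \<noteq> {0}"
  shows "\<mm>_half = \<mm> \<and> Z2_grading \<gg> \<hh> \<mm>"
proof -
  have kil: "killing \<gg> = tform \<gg>" by (intro ext) (rule killing_tform)
  have g: "lie_subalgebra \<gg>" using assms(3) by (simp add: simple_lie_algebra_def)
  note g_sub = lie_subalgebraD(1)[OF g] and g_closed = lie_subalgebraD(2)[OF g]
  have form: "invariant_form \<gg> (tform \<gg>)" by (rule tform_invariant[OF g_sub g_closed])
  have h: "lie_subalgebra \<hh>" "\<hh> \<subseteq> \<gg>" using assms(2,4) by (auto simp: reductive_algebraic_subalgebra_def)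
  obtain A where A: "reductive_group A" "\<hh> = Lie_of A" using assms(4) by (auto simp: reductive_algebraic_subalgebra_def)
  then have "subgroup A GL_mat" by (simp add: reductive_group_def algebraic_group_def)
  then have A': "mat 1 \<in> A" "\<And>a b. a \<in> A \<Longrightarrow> b \<in> A \<Longrightarrow> a ** b \<in> A"
    using subgroup.one_closed[of A GL_mat] subgroup.m_closed[of A GL_mat] by (auto simp: GL_mat_def)
  have dual: "dual_pair (tform \<gg>) \<hh> d e e'"
    using dual_bases_dual_pair[OF form g_sub h(2)] assms(6) by (simp add: kil)
  have e: "i < d \<Longrightarrow> e i \<in> \<hh>" "i < d \<Longrightarrow> e' i \<in> \<hh>" for i
    using dual_pairD(1,2)[OF dual] by auto
  have env: "env_act (casimir \<hh> d e e') = cas d e e' lie"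
    using casimir_act[OF h(1) e] by (auto simp: cas_def)
  have sym: "tform \<gg> x y = tform \<gg> y x" if "x \<in> \<gg>" "y \<in> \<hh>" for x y
    using invariant_formD(1)[OF form that(1)] that h(2) by auto
  have m: "\<mm> = {x \<in> \<gg>. \<forall>u\<in>\<hh>. tform \<gg> u x = 0}"
    unfolding assms(5) killing_complement_def kil by (intro Collect_cong) (metis sym)
  have half: "\<mm>_half = {x \<in> \<gg>. (\<forall>u\<in>\<hh>. tform \<gg> u x = 0) \<and> cas d e e' lie x = (1 / 2) *\<^sub>M x}"
    unfolding assms(7) eigenspace_on_def env m by auto
  interpret E: half_eigenspace \<gg> \<hh> A \<mm>_half d e e'
    by unfold_locales (fact assms(3) h A(2) A' dual half assms(8))+
  have mm: "E.mm = \<mm>" by (simp add: E.mm_def m)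
  have eq: "\<mm>_half = \<mm>" using E.half_eigenspace_is_complement(1) mm by simp
  have "Z2_grading \<gg> \<hh> \<mm>"
    unfolding Z2_grading_def
  proof (intro conjI ballI)
    show "mat_vs.subspace \<hh>" by (rule lie_subalgebraD(1)[OF h(1)])
    show m_sub: "mat_vs.subspace \<mm>" using E.mm_sub mm by simp
    show "\<gg> = {x + y |x y. x \<in> \<hh> \<and> y \<in> \<mm>}"
    proof (intro equalityI subsetI)
      fix z assume "z \<in> \<gg>"
      then obtain u where u: "u \<in> \<hh>" "z - u \<in> \<mm>" using E.decomp_g mm by blast
      then have "z = u + (z - u)" by simp
      then show "z \<in> {x + y |x y. x \<in> \<hh> \<and> y \<in> \<mm>}" using u by blast
    next
      fix z assume "z \<in> {x + y |x y. x \<in> \<hh> \<and> y \<in> \<mm>}"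
      then show "z \<in> \<gg>" using h(2) m mat_vs.subspace_add[OF g_sub] by auto
    qed
    show "\<hh> \<inter> \<mm> = {0}"
    proof
      show "\<hh> \<inter> \<mm> \<subseteq> {0}"
      proof
        fix x assume x: "x \<in> \<hh> \<inter> \<mm>"
        then have "tform \<gg> x w = 0" if "w \<in> \<hh>" for w using that sym[of x w] h(2) by (auto simp: m)
        then show "x \<in> {0}" using E.nondeg_L x by simp
      qed
      show "{0} \<subseteq> \<hh> \<inter> \<mm>" using mat_vs.subspace_0[OF m_sub] mat_vs.subspace_0[OF lie_subalgebraD(1)[OF h(1)]] by simp
    qed
    show "lie x y \<in> \<hh>" if "x \<in> \<hh>" "y \<in> \<hh>" for x y by (rule lie_subalgebraD(2)[OF h(1) that])
    show "lie x y \<in> \<mm>" if "x \<in> \<hh>" "y \<in> \<mm>" for x y using E.mm_stable[OF that(1)] that(2) mm by simp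
    show "lie x y \<in> \<hh>" if "x \<in> \<mm>" "y \<in> \<mm>" for x y
      using E.half_eigenspace_is_complement(2) that eq by simp
  qed
  then show ?thesis using eq by simp
qed

end
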